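(* Fix an $\mathcal F_0$-measurable random variable $\xi$ with $\xi>0$ $\mathbb P$-a.s. and $0<\mathbb E[\xi]<+\infty$. Consider the mean-field game with finite time horizon $T<+\infty$. Then: (i) If there exists an equilibrium $(\widehat{\mathbf u},\widehat q)$ such that $\widehat q\in\mathcal Q_T$, then $\widehat q$ is a solution to the integral equation $$y_s=e^{-\delta s}\,\mathbb E[\xi]+\int_0^se^{-\delta(s-r)}\int_r^Te^{-(\rho+\delta)(u-r)}y_u^{-\beta}\,\mathrm du\,\mathrm dr,\quad s\in[0,T].\qquad(1)$$ (ii) Vice versa, if there exists a unique solution $\widehat q\in\mathcal Q_T$ to (1), then there exists a unique equilibrium $(\widehat{\mathbf u},\widehat q)=(z^{(T,\widehat q)},\widehat q)$ of the mean-field game among all equilibria $(\widetilde{\mathbf u},\widetilde q)\in\mathcal U_T\times\mathcal Q_T$. Consider, instead, the mean-field game with infinite time horizon $T=+\infty$. Then: (iii) If there exists an equilibrium $(\widehat{\mathbf u},\widehat q)$ such that $\widehat q\in\mathcal Q_\infty$, then $\widehat q$ is a solution to the integral equation $$y_s=e^{-\delta s}\,\mathbb E[\xi]+\int_0^se^{-\delta(s-r)}\int_r^{+\infty}e^{-(\rho+\delta)(u-r)}y_u^{-\beta}\,\mathrm du\,\mathrm dr,\quad s\ge0.\qquad(2)$$ (iv) Vice versa, if there exists a unique solution $\widehat q\in\mathcal Q_\infty$ to (2), then there exists a unique equilibrium $(\widehat{\mathbf u},\widehat q)=(z^{(\infty,\widehat q)},\widehat q)$ of the mean-field game among all equilibria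 $(\widetilde{\mathbf u},\widetilde q)\in\mathcal U_\infty\times\mathcal Q_\infty$.
   Context: Fixed constants $\delta,\sigma,\rho,\beta>0$; $T\in(0,+\infty]$, and $[0,T]$ means $[0,+\infty)$ if $T=+\infty$. $(\Omega,\mathcal F,\mathbb F=(\mathcal F_s)_{s\ge0},\mathbb P)$ is a complete filtered probability space satisfying the usual assumptions and supporting a standard Brownian motion $B$ with respect to $\mathbb F$; the initial condition $\xi$ is independent of $B$. Admissible controls: for $T<+\infty$, $\mathcal U_T$ is the set of $(\mathcal F_s)_{s\in[0,T]}$-progressively measurable $\mathbf u:\Omega\times[0,T]\to[0,+\infty)$ with $\mathbb E\big[\int_0^Tu_s^2\,\mathrm ds\big]<+\infty$; $\mathcal U_\infty$ is the set of $\mathbb F$-progressively measurable $\mathbf u:\Omega\times[0,\infty)\to[0,+\infty)$ with $\mathbb E\big[\int_0^tu_s\,\mathrm ds\big]<+\infty$ for all $t\ge0$ and $\mathbb E\big[\int_0^{+\infty}e^{-\rho s}u_s^2\,\mathrm ds\big]<+\infty$. Controls equal $\mathbb P\otimes\mathrm{Leb}$-a.e. are identified. State: $X^{\xi,\mathbf u}$ is the unique strong solution of $\mathrm dX_s=-\delta X_s\,\mathrm ds+\sigma X_s\,\mathrm dB_s+u_s\,\mathrm ds$, $X_0=\xi$, on $[0,T]$. Functional: for a deterministic measurable $q:[0,T]\to(0,+\infty)$, $J_{T,q}(\xi,\mathbf u)=\mathbb E\big[\int_0^Te^{-\rho s}\{X_s^{\xi,\mathbf u}q_s^{-\beta}-\tfrac12u_s^2\}\,\mathrm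 ds\big]$. Equilibrium: a pair $(\widehat{\mathbf u},\widehat q)$ with $\widehat{\mathbf u}\in\mathcal U_T$ and $\widehat q:[0,T]\to(0,+\infty)$ measurable such that (a) $J_{T,\widehat q}(\xi,\widehat{\mathbf u})\ge J_{T,\widehat q}(\xi,\mathbf u)$ for all $\mathbf u\in\mathcal U_T$; (b) $\widehat q_s=\mathbb E[X_s^{\xi,\widehat{\mathbf u}}]$ for all $s\in[0,T]$. For $T\in(0,+\infty]$ and measurable $q:[0,T]\to(0,+\infty)$, $z^{(T,q)}_s=\int_s^Te^{-(\rho+\delta)(r-s)}q_r^{-\beta}\,\mathrm dr$, $s\in[0,T]$ (for $T=+\infty$ this is denoted $z^{(\infty,q)}_s$, $s\ge0$, with the integral over $(s,+\infty)$). For $T<+\infty$, $\mathcal Q_T$ is the set of measurable $q:[0,T]\to(0,+\infty)$ such that $q^{-\beta}\in L^1((0,T];(0,+\infty))$, i.e. $q^{-\beta}$ is Lebesgue integrable on $(0,T]$. $\mathcal Q_\infty$ is the set of measurable $q:[0,+\infty)\to(0,+\infty)$ such that $q^{-\beta}\in L^1((0,+\infty);(0,+\infty))$, i.e. $q^{-\beta}$ is Lebesgue integrable on $(0,+\infty)$, and $z^{(\infty,q)}$ is bounded. *)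

theory Defs
  imports "HOL-Probability.Probability"
begin

text \<open>
  Processes are maps from times to random variables: \<open>X s \<omega>\<close>. Horizons are extended reals, so that
  the finite and the infinite horizon share all definitions; values of a process (or of a function
  of time) outside \<open>horizon T\<close> are irrelevant.
\<close>

definition horizon :: "ereal \<Rightarrow> real set" where
  "horizon T = {s. 0 \<le> s \<and> ereal s \<le> T}"

lemma horizon_ereal [simp]: "horizon (ereal T) = {0..T}"
  by (auto simp: horizon_def)

lemma horizon_infty [simp]: "horizon \<infinity> = {0..}"
  by (auto simp: horizon_def)


section \<open>Stochastic basis\<close>

text \<open>
  Only the values \<open>F s\<close> with \<open>s \<ge> 0\<close> matter; \<open>max 0\<close> adapts them to the library locale, whose
  index set is a whole type.
\<close>

definition usual_conditions :: "'a measure \<Rightarrow> (real \<Rightarrow> 'a measure) \<Rightarrow> bool" where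
  "usual_conditions M F \<longleftrightarrow>
     prob_space M \<and> complete_measure M \<and>
     filtration (space M) (\<lambda>s. F (max 0 s)) \<and>
     (\<forall>s\<ge>0. sets (F s) \<subseteq> sets M) \<and>
     null_sets M \<subseteq> sets (F 0) \<and>
     (\<forall>s\<ge>0. (\<Inter>t\<in>{s<..}. sets (F t)) = sets (F s))"

definition brownian_motion ::
  "'a measure \<Rightarrow> (real \<Rightarrow> 'a measure) \<Rightarrow> (real \<Rightarrow> 'a \<Rightarrow> real) \<Rightarrow> bool" where
  "brownian_motion M F B \<longleftrightarrow>
     (\<forall>s\<ge>0. B s \<in> borel_measurable (F s)) \<and>
     (AE \<omega> in M. B 0 \<omega> = 0) \<and>
     (AE \<omega> in M. continuous_on {0..} (\<lambda>s. B s \<omega>)) \<and>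
     (\<forall>s\<ge>0. \<forall>t>s.
        distributed M lborel (\<lambda>\<omega>. B t \<omega> - B s \<omega>) (normal_density 0 (sqrt (t - s))) \<and>
        prob_space.indep_set M (sets (F s))
          {(\<lambda>\<omega>. B t \<omega> - B s \<omega>) -` A \<inter> space M | A. A \<in> sets borel})"

text \<open>Independence of the sigma-algebras generated by \<open>\<xi>\<close> and by the whole process \<open>(B s)\<close>, \<open>s \<ge> 0\<close>.\<close>

definition independent_of_process ::
  "'a measure \<Rightarrow> ('a \<Rightarrow> real) \<Rightarrow> (real \<Rightarrow> 'a \<Rightarrow> real) \<Rightarrow> bool" where
  "independent_of_process M \<xi> B \<longleftrightarrow>
     prob_space.indep_set M
       {\<xi> -` A \<inter> space M | A. A \<in> sets borel}
       {(\<lambda>\<omega>. \<lambda>s\<in>{0..}. B s \<omega>) -` A \<inter> space M | A. A \<in> sets (Pi\<^sub>M {0..} (\<lambda>_. borel))}"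

definition progressively_measurable ::
  "(real \<Rightarrow> 'a measure) \<Rightarrow> ereal \<Rightarrow> (real \<Rightarrow> 'a \<Rightarrow> real) \<Rightarrow> bool" where
  "progressively_measurable F T u \<longleftrightarrow>
     (\<forall>t\<in>horizon T. (\<lambda>(\<omega>, s). u s \<omega>) \<in> borel_measurable (F t \<Otimes>\<^sub>M restrict_space borel {0..t}))"

definition continuous_adapted ::
  "'a measure \<Rightarrow> (real \<Rightarrow> 'a measure) \<Rightarrow> ereal \<Rightarrow> (real \<Rightarrow> 'a \<Rightarrow> real) \<Rightarrow> bool" where
  "continuous_adapted M F T X \<longleftrightarrow>
     (\<forall>s\<in>horizon T. X s \<in> borel_measurable (F s)) \<and>
     (\<forall>\<omega>\<in>space M. continuous_on (horizon T) (\<lambda>s. X s \<omega>))"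


section \<open>Stochastic integral with respect to \<open>B\<close>\<close>

text \<open>
  A triple \<open>(n, \<tau>, \<eta>)\<close> stands for the simple process
  \<open>\<eta>\<^sub>0 1\<^bsub>(\<tau>\<^sub>0, \<tau>\<^sub>1]\<^esub> + \<dots> + \<eta>\<^bsub>n-1\<^esub> 1\<^bsub>(\<tau>\<^bsub>n-1\<^esub>, \<tau>\<^sub>n]\<^esub>\<close>.
\<close>

type_synonym 'a simple_process = "nat \<times> (nat \<Rightarrow> real) \<times> (nat \<Rightarrow> 'a \<Rightarrow> real)"

definition simple_process :: "'a measure \<Rightarrow> (real \<Rightarrow> 'a measure) \<Rightarrow> 'a simple_process \<Rightarrow> bool" where
  "simple_process M F = (\<lambda>(n, \<tau>, \<eta>).
     0 \<le> \<tau> 0 \<and> (\<forall>i<n. \<tau> i \<le> \<tau> (Suc i)) \<and>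
     (\<forall>i<n. \<eta> i \<in> borel_measurable (F (\<tau> i))) \<and>
     (\<exists>C. \<forall>i<n. \<forall>\<omega>\<in>space M. \<bar>\<eta> i \<omega>\<bar> \<le> C))"

definition simple_value :: "'a simple_process \<Rightarrow> real \<Rightarrow> 'a \<Rightarrow> real" where
  "simple_value = (\<lambda>(n, \<tau>, \<eta>) s \<omega>. \<Sum>i<n. \<eta> i \<omega> * indicator {\<tau> i<..\<tau> (Suc i)} s)"

definition simple_integral_wrt ::
  "(real \<Rightarrow> 'a \<Rightarrow> real) \<Rightarrow> 'a simple_process \<Rightarrow> real \<Rightarrow> 'a \<Rightarrow> real" where
  "simple_integral_wrt B =
     (\<lambda>(n, \<tau>, \<eta>) t \<omega>. \<Sum>i<n. \<eta> i \<omega> * (B (min t (\<tau> (Suc i))) \<omega> - B (min t (\<tau> i)) \<omega>))"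

definition vanishes_in_probability :: "'a measure \<Rightarrow> (nat \<Rightarrow> 'a \<Rightarrow> ennreal) \<Rightarrow> bool" where
  "vanishes_in_probability M Z \<longleftrightarrow>
     (\<forall>n. Z n \<in> borel_measurable M) \<and>
     (\<forall>\<epsilon>>0. (\<lambda>n. measure M {\<omega> \<in> space M. ennreal \<epsilon> < Z n \<omega>}) \<longlonglongrightarrow> 0)"

text \<open>
  \<open>I\<close> is (a continuous version of) the Ito integral of a progressively measurable integrand \<open>H\<close>
  with almost surely locally square-integrable paths: the limit in probability of the integrals of
  simple processes approximating \<open>H\<close>.
\<close>

definition ito_integral ::
  "'a measure \<Rightarrow> (real \<Rightarrow> 'a measure) \<Rightarrow> (real \<Rightarrow> 'a \<Rightarrow> real) \<Rightarrow> ereal \<Rightarrow>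
   (real \<Rightarrow> 'a \<Rightarrow> real) \<Rightarrow> (real \<Rightarrow> 'a \<Rightarrow> real) \<Rightarrow> bool" where
  "ito_integral M F B T H I \<longleftrightarrow>
     progressively_measurable F T H \<and>
     (\<forall>t\<in>horizon T. AE \<omega> in M. (\<integral>\<^sup>+s\<in>{0..t}. ennreal ((H s \<omega>)\<^sup>2) \<partial>lborel) < \<infinity>) \<and>
     continuous_adapted M F T I \<and>
     (\<exists>S. (\<forall>n. simple_process M F (S n)) \<and>
        (\<forall>t\<in>horizon T.
           vanishes_in_probability M
             (\<lambda>n \<omega>. \<integral>\<^sup>+s\<in>{0..t}. ennreal ((simple_value (S n) s \<omega> - H s \<omega>)\<^sup>2) \<partial>lborel) \<and>
           vanishes_in_probability M
             (\<lambda>n \<omega>. ennreal \<bar>simple_integral_wrt B (S n) t \<omega> - I t \<omega>\<bar>)))"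


section \<open>State equation, controls and functional\<close>

definition strong_solution ::
  "'a measure \<Rightarrow> (real \<Rightarrow> 'a measure) \<Rightarrow> (real \<Rightarrow> 'a \<Rightarrow> real) \<Rightarrow> real \<Rightarrow> real \<Rightarrow> ereal \<Rightarrow>
   ('a \<Rightarrow> real) \<Rightarrow> (real \<Rightarrow> 'a \<Rightarrow> real) \<Rightarrow> (real \<Rightarrow> 'a \<Rightarrow> real) \<Rightarrow> bool" where
  "strong_solution M F B \<delta> \<sigma> T \<xi> u X \<longleftrightarrow>
     continuous_adapted M F T X \<and>
     (\<exists>I. ito_integral M F B T (\<lambda>s \<omega>. \<sigma> * X s \<omega>) I \<and>
        (AE \<omega> in M. \<forall>t\<in>horizon T.
           set_integrable lborel {0..t} (\<lambda>s. - \<delta> * X s \<omega> + u s \<omega>) \<and>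
           X t \<omega> = \<xi> \<omega> + (LINT s:{0..t}|lborel. - \<delta> * X s \<omega> + u s \<omega>) + I t \<omega>))"

text \<open>
  Strong solutions are unique up to indistinguishability, and nothing below distinguishes
  indistinguishable processes, so the choice made here is immaterial.
\<close>

definition state ::
  "'a measure \<Rightarrow> (real \<Rightarrow> 'a measure) \<Rightarrow> (real \<Rightarrow> 'a \<Rightarrow> real) \<Rightarrow> real \<Rightarrow> real \<Rightarrow> ereal \<Rightarrow>
   ('a \<Rightarrow> real) \<Rightarrow> (real \<Rightarrow> 'a \<Rightarrow> real) \<Rightarrow> real \<Rightarrow> 'a \<Rightarrow> real" where
  "state M F B \<delta> \<sigma> T \<xi> u = (SOME X. strong_solution M F B \<delta> \<sigma> T \<xi> u X)"

definition controls ::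
  "'a measure \<Rightarrow> (real \<Rightarrow> 'a measure) \<Rightarrow> real \<Rightarrow> ereal \<Rightarrow> (real \<Rightarrow> 'a \<Rightarrow> real) set" where
  "controls M F \<rho> T = {u.
     progressively_measurable F T u \<and>
     (\<forall>s\<in>horizon T. \<forall>\<omega>\<in>space M. 0 \<le> u s \<omega>) \<and>
     (if T = \<infinity> then
        (\<forall>t\<ge>0. (\<integral>\<^sup>+\<omega>. (\<integral>\<^sup>+s\<in>{0..t}. ennreal (u s \<omega>) \<partial>lborel) \<partial>M) < \<infinity>) \<and>
        (\<integral>\<^sup>+\<omega>. (\<integral>\<^sup>+s\<in>{0..}. ennreal (exp (- \<rho> * s) * (u s \<omega>)\<^sup>2) \<partial>lborel) \<partial>M) < \<infinity>
      else
        (\<integral>\<^sup>+\<omega>. (\<integral>\<^sup>+s\<in>horizon T. ennreal ((u s \<omega>)\<^sup>2) \<partial>lborel) \<partial>M) < \<infinity>)}"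

definition same_control ::
  "'a measure \<Rightarrow> ereal \<Rightarrow> (real \<Rightarrow> 'a \<Rightarrow> real) \<Rightarrow> (real \<Rightarrow> 'a \<Rightarrow> real) \<Rightarrow> bool" where
  "same_control M T u v \<longleftrightarrow>
     (AE (\<omega>, s) in M \<Otimes>\<^sub>M restrict_space lborel (horizon T). u s \<omega> = v s \<omega>)"

text \<open>
  The functional may take the value \<open>\<infinity>\<close>, hence an extended-valued integral. The convention
  \<open>\<infinity> - \<infinity> = \<infinity>\<close> plays no role: states are almost surely nonnegative, so the negative part of the
  payoff is dominated by the discounted square of the control, which is integrable for admissible
  controls.
\<close>

definition ext_integral :: "'a measure \<Rightarrow> ('a \<Rightarrow> ereal) \<Rightarrow> ereal" where
  "ext_integral M f =
     enn2ereal (\<integral>\<^sup>+x. e2ennreal (f x) \<partial>M) - enn2ereal (\<integral>\<^sup>+x. e2ennreal (- f x) \<partial>M)"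

definition payoff ::
  "'a measure \<Rightarrow> (real \<Rightarrow> 'a measure) \<Rightarrow> (real \<Rightarrow> 'a \<Rightarrow> real) \<Rightarrow> real \<Rightarrow> real \<Rightarrow> real \<Rightarrow> real \<Rightarrow> ereal \<Rightarrow>
   (real \<Rightarrow> real) \<Rightarrow> ('a \<Rightarrow> real) \<Rightarrow> (real \<Rightarrow> 'a \<Rightarrow> real) \<Rightarrow> ereal" where
  "payoff M F B \<delta> \<sigma> \<rho> \<beta> T q \<xi> u =
     ext_integral M (\<lambda>\<omega>. ext_integral (restrict_space lborel (horizon T)) (\<lambda>s.
       ereal (exp (- \<rho> * s) *
         (state M F B \<delta> \<sigma> T \<xi> u s \<omega> * q s powr (- \<beta>) - 1 / 2 * (u s \<omega>)\<^sup>2))))"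


section \<open>Equilibria and the integral equation\<close>

definition positive_measurable :: "ereal \<Rightarrow> (real \<Rightarrow> real) set" where
  "positive_measurable T =
     {q. q \<in> borel_measurable (restrict_space borel (horizon T)) \<and> (\<forall>s\<in>horizon T. 0 < q s)}"

text \<open>
  In the last condition, positivity of \<open>q s\<close> rules out the default value \<open>0\<close> of the Bochner
  integral of a nonintegrable state.
\<close>

definition equilibrium ::
  "'a measure \<Rightarrow> (real \<Rightarrow> 'a measure) \<Rightarrow> (real \<Rightarrow> 'a \<Rightarrow> real) \<Rightarrow> real \<Rightarrow> real \<Rightarrow> real \<Rightarrow> real \<Rightarrow> ereal \<Rightarrow>
   ('a \<Rightarrow> real) \<Rightarrow> (real \<Rightarrow> 'a \<Rightarrow> real) \<Rightarrow> (real \<Rightarrow> real) \<Rightarrow> bool" where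
  "equilibrium M F B \<delta> \<sigma> \<rho> \<beta> T \<xi> u q \<longleftrightarrow>
     u \<in> controls M F \<rho> T \<and> q \<in> positive_measurable T \<and>
     (\<forall>v\<in>controls M F \<rho> T.
        payoff M F B \<delta> \<sigma> \<rho> \<beta> T q \<xi> v \<le> payoff M F B \<delta> \<sigma> \<rho> \<beta> T q \<xi> u) \<and>
     (\<forall>s\<in>horizon T. q s = prob_space.expectation M (state M F B \<delta> \<sigma> T \<xi> u s))"

definition zfun :: "real \<Rightarrow> real \<Rightarrow> real \<Rightarrow> ereal \<Rightarrow> (real \<Rightarrow> real) \<Rightarrow> real \<Rightarrow> real" where
  "zfun \<delta> \<rho> \<beta> T q s =
     (LINT r:(horizon T \<inter> {s<..})|lborel. exp (- (\<rho> + \<delta>) * (r - s)) * q r powr (- \<beta>))"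

definition Qclass :: "real \<Rightarrow> real \<Rightarrow> real \<Rightarrow> ereal \<Rightarrow> (real \<Rightarrow> real) set" where
  "Qclass \<delta> \<rho> \<beta> T = {q \<in> positive_measurable T.
     set_integrable lborel (horizon T \<inter> {0<..}) (\<lambda>s. q s powr (- \<beta>)) \<and>
     (T = \<infinity> \<longrightarrow> bounded (zfun \<delta> \<rho> \<beta> T q ` horizon T))}"

definition solves_integral_eq ::
  "real \<Rightarrow> real \<Rightarrow> real \<Rightarrow> ereal \<Rightarrow> real \<Rightarrow> (real \<Rightarrow> real) \<Rightarrow> bool" where
  "solves_integral_eq \<delta> \<rho> \<beta> T m y \<longleftrightarrow>
     (\<forall>s\<in>horizon T. y s = exp (- \<delta> * s) * m +
        (LINT r:{0..s}|lborel. exp (- \<delta> * (s - r)) *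
           (LINT u:(horizon T \<inter> {r<..})|lborel. exp (- (\<rho> + \<delta>) * (u - r)) * y u powr (- \<beta>))))"

text \<open>Functions of time are identified when they agree on \<open>horizon T\<close>.\<close>

definition unique_Q_solution ::
  "real \<Rightarrow> real \<Rightarrow> real \<Rightarrow> ereal \<Rightarrow> real \<Rightarrow> (real \<Rightarrow> real) \<Rightarrow> bool" where
  "unique_Q_solution \<delta> \<rho> \<beta> T m q \<longleftrightarrow>
     q \<in> Qclass \<delta> \<rho> \<beta> T \<and> solves_integral_eq \<delta> \<rho> \<beta> T m q \<and>
     (\<forall>y\<in>Qclass \<delta> \<rho> \<beta> T. solves_integral_eq \<delta> \<rho> \<beta> T m y \<longrightarrow> (\<forall>s\<in>horizon T. y s = q s))"

definition unique_Q_equilibrium ::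
  "'a measure \<Rightarrow> (real \<Rightarrow> 'a measure) \<Rightarrow> (real \<Rightarrow> 'a \<Rightarrow> real) \<Rightarrow> real \<Rightarrow> real \<Rightarrow> real \<Rightarrow> real \<Rightarrow> ereal \<Rightarrow>
   ('a \<Rightarrow> real) \<Rightarrow> (real \<Rightarrow> 'a \<Rightarrow> real) \<Rightarrow> (real \<Rightarrow> real) \<Rightarrow> bool" where
  "unique_Q_equilibrium M F B \<delta> \<sigma> \<rho> \<beta> T \<xi> u q \<longleftrightarrow>
     equilibrium M F B \<delta> \<sigma> \<rho> \<beta> T \<xi> u q \<and> q \<in> Qclass \<delta> \<rho> \<beta> T \<and>
     (\<forall>v\<in>controls M F \<rho> T. \<forall>y\<in>Qclass \<delta> \<rho> \<beta> T. equilibrium M F B \<delta> \<sigma> \<rho> \<beta> T \<xi> v y \<longrightarrow>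
        same_control M T v u \<and> (\<forall>s\<in>horizon T. y s = q s))"

end

theory Submission
  imports Defs
begin

text \<open>
  The state equation is linear, so the mean of the state is an affine functional of the control,
  \<open>E X\<^sub>t = exp (- \<delta> t) E \<xi> + \<integral>\<^sub>0\<^sup>t exp (- \<delta> (t - r)) E u\<^sub>r dr\<close>. For a fixed \<open>q\<close> with integrable
  \<open>q powr - \<beta>\<close>, exchanging the order of integration turns the benefit
  \<open>E \<integral> exp (- \<rho> s) X\<^sub>s q\<^sub>s powr (- \<beta>) ds\<close> into a constant plus \<open>E \<integral> exp (- \<rho> s) z\<^sub>s u\<^sub>s ds\<close>, where
  \<open>z\<close> is the function \<open>zfun\<close>. Completing the square,
  the payoff of \<open>u\<close> falls short of the payoff of the deterministic control \<open>z\<close> by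
  \<open>1/2 E \<integral> exp (- \<rho> s) (u\<^sub>s - z\<^sub>s)\<^sup>2 ds\<close> (\<open>gain_gap\<close>). Hence \<open>z\<close> is the optimal control, unique
  almost everywhere, and the consistency condition \<open>q\<^sub>s = E X\<^sub>s\<close> for \<open>u = z\<close> is exactly the integral
  equation. All four claims follow from this equivalence, on either horizon.

  The bulk of the work is the formula for the mean, because the state is an arbitrarily chosen
  strong solution, defined through limits in probability of integrals of simple processes. Two facts
  make it accessible.

  Uniqueness (\<open>strong_solution_unique\<close>). A truncation argument shows that a sum of adapted
  coefficients times Brownian increments is small in probability as soon as the quadratic sum of
  the coefficients is (\<open>increment_sum_tail\<close>). It follows that the integral of a continuous adapted process is the limit of
  its Riemann sums along partitions that refine the jump times of the approximating
  simple processes (\<open>riemann_sums_null\<close>). The difference of two solutions is therefore a limit of Euler sums; stopped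
  when it exceeds a level \<open>N\<close>, its second moment satisfies a Gronwall inequality and vanishes
  (\<open>homogeneous_sde_zero\<close>).

  Existence (\<open>explicit_strong_solution\<close>). The candidate is the variation of constants formula
  \<open>X\<^sub>t = Z\<^sub>t (\<xi> + \<integral>\<^sub>0\<^sup>t u\<^sub>r / Z\<^sub>r dr)\<close> with the geometric Brownian motion \<open>Z\<close>. Instead of invoking Ito's
  formula, the increments of \<open>X\<close> over a partition are compared with \<open>\<sigma> X dB\<close> directly: the
  discrepancy is a pathwise Riemann error plus centred noise of the increments, whose variance is
  quadratic in the mesh (\<open>noise_moments\<close>).

  By uniqueness the chosen state equals this formula almost surely, and the mean follows from
  Tonelli's theorem and the independence of \<open>Z\<^sub>t / Z\<^sub>r\<close> from the past up to time \<open>r\<close>.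
\<close>


section \<open>Convergence in probability\<close>

context prob_space
begin

text \<open>
  The expectation of the truncated absolute value metrizes convergence in probability; with it,
  sums, domination and almost sure limits reduce to elementary properties of the integral.
\<close>

definition null_in_prob :: "(nat \<Rightarrow> 'a \<Rightarrow> real) \<Rightarrow> bool" where
  "null_in_prob Z \<longleftrightarrow> (\<forall>n. Z n \<in> borel_measurable M) \<and>
     (\<lambda>n. expectation (\<lambda>\<omega>. min 1 \<bar>Z n \<omega>\<bar>)) \<longlonglongrightarrow> 0"

lemma integrable_min_1_abs [simp]:
  fixes f :: "'a \<Rightarrow> real"
  assumes [measurable]: "f \<in> borel_measurable M"
  shows "integrable M (\<lambda>\<omega>. min 1 \<bar>f \<omega>\<bar>)"
  by (rule integrable_const_bound[where B=1]) auto

lemma null_in_prob_measurable: "null_in_prob Z \<Longrightarrow> Z n \<in> borel_measurable M"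
  by (auto simp: null_in_prob_def)

lemma null_in_prob_dominated:
  assumes "null_in_prob Z" "\<And>n. Y n \<in> borel_measurable M"
    and "\<And>n. AE \<omega> in M. \<bar>Y n \<omega>\<bar> \<le> \<bar>Z n \<omega>\<bar>"
  shows "null_in_prob Y"
  unfolding null_in_prob_def
proof (intro conjI allI)
  have [measurable]: "Z n \<in> borel_measurable M" for n
    using assms(1) by (rule null_in_prob_measurable)
  note assms(2)[measurable]
  show "(\<lambda>n. expectation (\<lambda>\<omega>. min 1 \<bar>Y n \<omega>\<bar>)) \<longlonglongrightarrow> 0"
  proof (rule tendsto_sandwich[OF _ _ tendsto_const])
    show "(\<lambda>n. expectation (\<lambda>\<omega>. min 1 \<bar>Z n \<omega>\<bar>)) \<longlonglongrightarrow> 0"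
      using assms(1) by (simp add: null_in_prob_def)
    show "\<forall>\<^sub>F n in sequentially. 0 \<le> expectation (\<lambda>\<omega>. min 1 \<bar>Y n \<omega>\<bar>)"
      by (auto intro!: always_eventually Bochner_Integration.integral_nonneg)
    have "expectation (\<lambda>\<omega>. min 1 \<bar>Y n \<omega>\<bar>) \<le> expectation (\<lambda>\<omega>. min 1 \<bar>Z n \<omega>\<bar>)" for n
      using assms(3)[of n] by (intro integral_mono_AE) auto
    then show "\<forall>\<^sub>F n in sequentially. expectation (\<lambda>\<omega>. min 1 \<bar>Y n \<omega>\<bar>) \<le> expectation (\<lambda>\<omega>. min 1 \<bar>Z n \<omega>\<bar>)"
      by simp
  qed
qed (use assms in auto)

lemma null_in_prob_min_1:
  assumes "\<And>n. Z n \<in> borel_measurable M" "null_in_prob Y" "\<And>n \<omega>. \<omega> \<in> space M \<Longrightarrow> min 1 \<bar>Z n \<omega>\<bar> \<le> \<bar>Y n \<omega>\<bar>"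
  shows "null_in_prob Z"
proof -
  have "null_in_prob (\<lambda>n \<omega>. min 1 \<bar>Z n \<omega>\<bar>)"
    using assms by (intro null_in_prob_dominated[OF assms(2)]) auto
  moreover have "min 1 \<bar>min 1 \<bar>Z n \<omega>\<bar>\<bar> = min 1 \<bar>Z n \<omega>\<bar>" for n \<omega> by simp
  ultimately show ?thesis using assms(1) by (simp only: null_in_prob_def simp_thms)
qed

lemma null_in_prob_cong_AE:
  assumes "null_in_prob Z" "\<And>n. Y n \<in> borel_measurable M" "\<And>n. AE \<omega> in M. Y n \<omega> = Z n \<omega>"
  shows "null_in_prob Y"
proof (rule null_in_prob_dominated[OF assms(1,2)])
  show "AE \<omega> in M. \<bar>Y n \<omega>\<bar> \<le> \<bar>Z n \<omega>\<bar>" for n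
    using assms(3)[of n] by auto
qed

lemma null_in_prob_add:
  assumes "null_in_prob Y" "null_in_prob Z"
  shows "null_in_prob (\<lambda>n \<omega>. Y n \<omega> + Z n \<omega>)"
  unfolding null_in_prob_def
proof (intro conjI allI)
  have [measurable]: "Y n \<in> borel_measurable M" "Z n \<in> borel_measurable M" for n
    using assms by (auto intro: null_in_prob_measurable)
  show "(\<lambda>\<omega>. Y n \<omega> + Z n \<omega>) \<in> borel_measurable M" for n by measurable
  show "(\<lambda>n. expectation (\<lambda>\<omega>. min 1 \<bar>Y n \<omega> + Z n \<omega>\<bar>)) \<longlonglongrightarrow> 0"
  proof (rule tendsto_sandwich[OF _ _ tendsto_const])
    show "(\<lambda>n. expectation (\<lambda>\<omega>. min 1 \<bar>Y n \<omega>\<bar>) + expectation (\<lambda>\<omega>. min 1 \<bar>Z n \<omega>\<bar>)) \<longlonglongrightarrow> 0"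
      using assms by (auto simp: null_in_prob_def intro!: tendsto_add_zero)
    show "\<forall>\<^sub>F n in sequentially. 0 \<le> expectation (\<lambda>\<omega>. min 1 \<bar>Y n \<omega> + Z n \<omega>\<bar>)"
      by (auto intro!: always_eventually Bochner_Integration.integral_nonneg)
    have "expectation (\<lambda>\<omega>. min 1 \<bar>Y n \<omega> + Z n \<omega>\<bar>)
        \<le> expectation (\<lambda>\<omega>. min 1 \<bar>Y n \<omega>\<bar> + min 1 \<bar>Z n \<omega>\<bar>)" for n
      by (intro integral_mono Bochner_Integration.integrable_add integrable_min_1_abs) auto
    then show "\<forall>\<^sub>F n in sequentially. expectation (\<lambda>\<omega>. min 1 \<bar>Y n \<omega> + Z n \<omega>\<bar>) \<le>
        expectation (\<lambda>\<omega>. min 1 \<bar>Y n \<omega>\<bar>) + expectation (\<lambda>\<omega>. min 1 \<bar>Z n \<omega>\<bar>)"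
      by (simp add: Bochner_Integration.integral_add)
  qed
qed

lemma null_in_prob_uminus: "null_in_prob Z \<Longrightarrow> null_in_prob (\<lambda>n \<omega>. - Z n \<omega>)"
  by (rule null_in_prob_dominated) (auto dest: null_in_prob_measurable)

lemma null_in_prob_diff:
  "null_in_prob Y \<Longrightarrow> null_in_prob Z \<Longrightarrow> null_in_prob (\<lambda>n \<omega>. Y n \<omega> - Z n \<omega>)"
  using null_in_prob_add[OF _ null_in_prob_uminus] by simp

lemma null_in_prob_AE:
  assumes [measurable]: "\<And>n. Z n \<in> borel_measurable M"
    and "AE \<omega> in M. (\<lambda>n. Z n \<omega>) \<longlonglongrightarrow> 0"
  shows "null_in_prob Z"
  unfolding null_in_prob_def
proof (intro conjI allI)
  have "(\<lambda>n. expectation (\<lambda>\<omega>. min 1 \<bar>Z n \<omega>\<bar>)) \<longlonglongrightarrow> expectation (\<lambda>\<omega>. 0)"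
  proof (rule integral_dominated_convergence[where w="\<lambda>_. 1"])
    show "AE \<omega> in M. (\<lambda>n. min 1 \<bar>Z n \<omega>\<bar>) \<longlonglongrightarrow> 0"
      using assms(2)
    proof eventually_elim
      case (elim \<omega>)
      have "(\<lambda>n. min 1 \<bar>Z n \<omega>\<bar>) \<longlonglongrightarrow> min 1 \<bar>0\<bar>"
        by (intro tendsto_intros elim)
      then show ?case by simp
    qed
  qed auto
  then show "(\<lambda>n. expectation (\<lambda>\<omega>. min 1 \<bar>Z n \<omega>\<bar>)) \<longlonglongrightarrow> 0" by simp
qed measurable

lemma null_in_probI_prob:
  assumes [measurable]: "\<And>n. Z n \<in> borel_measurable M"
    and "\<And>\<epsilon>. 0 < \<epsilon> \<Longrightarrow> (\<lambda>n. prob {\<omega> \<in> space M. \<epsilon> < \<bar>Z n \<omega>\<bar>}) \<longlonglongrightarrow> 0"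
  shows "null_in_prob Z"
  unfolding null_in_prob_def
proof (intro conjI allI)
  show "(\<lambda>n. expectation (\<lambda>\<omega>. min 1 \<bar>Z n \<omega>\<bar>)) \<longlonglongrightarrow> 0"
  proof (rule LIMSEQ_I)
    fix r :: real assume r: "0 < r"
    have le: "expectation (\<lambda>\<omega>. min 1 \<bar>Z n \<omega>\<bar>) \<le> r/2 + prob {\<omega> \<in> space M. r/2 < \<bar>Z n \<omega>\<bar>}" for n
    proof -
      have "expectation (\<lambda>\<omega>. min 1 \<bar>Z n \<omega>\<bar>)
          \<le> expectation (\<lambda>\<omega>. r/2 + indicator {\<omega> \<in> space M. r/2 < \<bar>Z n \<omega>\<bar>} \<omega>)"
      proof (rule integral_mono)
        show "integrable M (\<lambda>\<omega>. r/2 + indicator {\<omega> \<in> space M. r/2 < \<bar>Z n \<omega>\<bar>} \<omega>)"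
        proof (rule integrable_const_bound[where B="r/2 + 1"])
          show "(\<lambda>\<omega>. r/2 + indicator {\<omega> \<in> space M. r/2 < \<bar>Z n \<omega>\<bar>} \<omega>) \<in> borel_measurable M"
            by measurable
        qed (use r in \<open>simp add: indicator_def\<close>)
      qed (use r in \<open>auto simp: indicator_def\<close>)
      also have "\<dots> = r/2 + prob {\<omega> \<in> space M. r/2 < \<bar>Z n \<omega>\<bar>}"
      proof (subst Bochner_Integration.integral_add)
        show "integrable M (indicator {\<omega> \<in> space M. r/2 < \<bar>Z n \<omega>\<bar>} :: 'a \<Rightarrow> real)"
          by (rule integrable_const_bound[where B=1]) (simp_all add: indicator_def)
      qed (simp_all add: prob_space)
      finally show ?thesis .
    qed
    obtain no where no: "\<And>n. n \<ge> no \<Longrightarrow> norm (prob {\<omega> \<in> space M. r/2 < \<bar>Z n \<omega>\<bar>} - 0) < r/2"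
      using LIMSEQ_D[OF assms(2)[of "r/2"], of "r/2"] r by auto
    show "\<exists>no. \<forall>n\<ge>no. norm (expectation (\<lambda>\<omega>. min 1 \<bar>Z n \<omega>\<bar>) - 0) < r"
    proof (intro exI[of _ no] allI impI)
      fix n assume "n \<ge> no"
      moreover have "0 \<le> expectation (\<lambda>\<omega>. min 1 \<bar>Z n \<omega>\<bar>)"
        by (intro Bochner_Integration.integral_nonneg) auto
      ultimately show "norm (expectation (\<lambda>\<omega>. min 1 \<bar>Z n \<omega>\<bar>) - 0) < r"
        using le[of n] no[of n] by auto
    qed
  qed
qed measurable

lemma null_in_prob_prob:
  assumes "null_in_prob Z" "0 < \<epsilon>"
  shows "(\<lambda>n. prob {\<omega> \<in> space M. \<epsilon> < \<bar>Z n \<omega>\<bar>}) \<longlonglongrightarrow> 0"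
proof (rule tendsto_sandwich[OF _ _ tendsto_const])
  have [measurable]: "Z n \<in> borel_measurable M" for n
    using assms(1) by (rule null_in_prob_measurable)
  define c where "c = min 1 \<epsilon>"
  have c: "0 < c" using assms(2) by (simp add: c_def)
  show "(\<lambda>n. expectation (\<lambda>\<omega>. min 1 \<bar>Z n \<omega>\<bar>) / c) \<longlonglongrightarrow> 0"
    using assms(1) by (auto simp: null_in_prob_def intro!: tendsto_divide_zero)
  have "prob {\<omega> \<in> space M. \<epsilon> < \<bar>Z n \<omega>\<bar>} \<le> expectation (\<lambda>\<omega>. min 1 \<bar>Z n \<omega>\<bar>) / c" for n
  proof -
    have "prob {\<omega> \<in> space M. \<epsilon> < \<bar>Z n \<omega>\<bar>} \<le> prob {\<omega> \<in> space M. c \<le> min 1 \<bar>Z n \<omega>\<bar>}"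
      by (intro finite_measure_mono) (auto simp: c_def)
    also have "\<dots> \<le> expectation (\<lambda>\<omega>. min 1 \<bar>Z n \<omega>\<bar>) / c"
      using c by (intro integral_Markov_inequality_measure[where A="{}"]) auto
    finally show ?thesis .
  qed
  then show "\<forall>\<^sub>F n in sequentially. prob {\<omega> \<in> space M. \<epsilon> < \<bar>Z n \<omega>\<bar>} \<le> expectation (\<lambda>\<omega>. min 1 \<bar>Z n \<omega>\<bar>) / c"
    by simp
qed (auto intro: always_eventually)

lemma vanishes_in_probability_iff:
  "vanishes_in_probability M (\<lambda>n \<omega>. ennreal \<bar>Z n \<omega>\<bar>) \<longleftrightarrow>
     (\<forall>n. (\<lambda>\<omega>. \<bar>Z n \<omega>\<bar>) \<in> borel_measurable M) \<and> null_in_prob (\<lambda>n \<omega>. \<bar>Z n \<omega>\<bar>)"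
proof
  assume L: "vanishes_in_probability M (\<lambda>n \<omega>. ennreal \<bar>Z n \<omega>\<bar>)"
  have [measurable]: "(\<lambda>\<omega>. \<bar>Z n \<omega>\<bar>) \<in> borel_measurable M" for n
  proof -
    have "(\<lambda>\<omega>. enn2real (ennreal \<bar>Z n \<omega>\<bar>)) \<in> borel_measurable M"
      using L by (auto simp: vanishes_in_probability_def intro!: borel_measurable_enn2real)
    then show ?thesis by simp
  qed
  show "(\<forall>n. (\<lambda>\<omega>. \<bar>Z n \<omega>\<bar>) \<in> borel_measurable M) \<and> null_in_prob (\<lambda>n \<omega>. \<bar>Z n \<omega>\<bar>)"
  proof (intro conjI allI null_in_probI_prob)
    fix \<epsilon> :: real assume "0 < \<epsilon>"
    then have "(\<lambda>n. prob {\<omega> \<in> space M. ennreal \<epsilon> < ennreal \<bar>Z n \<omega>\<bar>}) \<longlonglongrightarrow> 0"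
      using L by (auto simp: vanishes_in_probability_def)
    then show "(\<lambda>n. prob {\<omega> \<in> space M. \<epsilon> < \<bar>\<bar>Z n \<omega>\<bar>\<bar>}) \<longlonglongrightarrow> 0"
      using \<open>0 < \<epsilon>\<close> by (simp add: ennreal_less_iff)
  qed measurable
next
  assume R: "(\<forall>n. (\<lambda>\<omega>. \<bar>Z n \<omega>\<bar>) \<in> borel_measurable M) \<and> null_in_prob (\<lambda>n \<omega>. \<bar>Z n \<omega>\<bar>)"
  then show "vanishes_in_probability M (\<lambda>n \<omega>. ennreal \<bar>Z n \<omega>\<bar>)"
    unfolding vanishes_in_probability_def
    using null_in_prob_prob[of "\<lambda>n \<omega>. \<bar>Z n \<omega>\<bar>"]
    by (auto simp: ennreal_less_iff)
qed

lemma vanishes_in_probability_enn2real: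
  assumes "vanishes_in_probability M Z"
  shows "null_in_prob (\<lambda>n \<omega>. enn2real (min 1 (Z n \<omega>)))"
proof (rule null_in_probI_prob)
  have [measurable]: "Z n \<in> borel_measurable M" for n
    using assms by (simp add: vanishes_in_probability_def)
  show "(\<lambda>\<omega>. enn2real (min 1 (Z n \<omega>))) \<in> borel_measurable M" for n by measurable
  fix \<epsilon> :: real assume \<epsilon>: "0 < \<epsilon>"
  have lim: "(\<lambda>n. prob {\<omega> \<in> space M. ennreal \<epsilon> < Z n \<omega>}) \<longlonglongrightarrow> 0"
    using assms \<epsilon> by (simp add: vanishes_in_probability_def)
  have sub: "ennreal \<epsilon> < z" if "\<epsilon> < enn2real (min 1 z)" for z :: ennreal
  proof (cases z)
    case (real r)
    have "min 1 (ennreal r) = ennreal (min 1 r)"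
      using real by (auto simp: min_def)
    then show ?thesis using that real \<epsilon> by (auto simp: ennreal_less_iff)
  qed auto
  show "(\<lambda>n. prob {\<omega> \<in> space M. \<epsilon> < \<bar>enn2real (min 1 (Z n \<omega>))\<bar>}) \<longlonglongrightarrow> 0"
  proof (rule tendsto_sandwich[OF _ _ tendsto_const lim])
    show "\<forall>\<^sub>F n in sequentially. prob {\<omega> \<in> space M. \<epsilon> < \<bar>enn2real (min 1 (Z n \<omega>))\<bar>} \<le> prob {\<omega> \<in> space M. ennreal \<epsilon> < Z n \<omega>}"
      by (intro always_eventually allI finite_measure_mono) (auto intro: sub)
  qed (auto intro: always_eventually)
qed

lemma vanishes_in_probability_AE:
  assumes [measurable]: "\<And>n. Z n \<in> borel_measurable M"
    and "AE \<omega> in M. (\<lambda>n. Z n \<omega>) \<longlonglongrightarrow> 0"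
  shows "vanishes_in_probability M Z"
  unfolding vanishes_in_probability_def
proof (intro conjI allI impI)
  fix \<epsilon> :: real assume \<epsilon>: "0 < \<epsilon>"
  have "(\<lambda>n. expectation (indicator {\<omega> \<in> space M. ennreal \<epsilon> < Z n \<omega>})) \<longlonglongrightarrow> expectation (\<lambda>\<omega>. 0 :: real)"
  proof (rule integral_dominated_convergence[where w="\<lambda>_. 1"])
    show "AE \<omega> in M. (\<lambda>n. indicator {\<omega> \<in> space M. ennreal \<epsilon> < Z n \<omega>} \<omega> :: real) \<longlonglongrightarrow> 0"
      using assms(2)
    proof eventually_elim
      case (elim \<omega>)
      have "\<forall>\<^sub>F n in sequentially. Z n \<omega> < ennreal \<epsilon>"
        using order_tendstoD(2)[OF elim] \<epsilon> by auto
      then have "\<forall>\<^sub>F n in sequentially. (indicator {\<omega> \<in> space M. ennreal \<epsilon> < Z n \<omega>} \<omega> :: real) = 0"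
        by eventually_elim (auto simp: indicator_def)
      then show ?case by (rule tendsto_eventually)
    qed
  qed auto
  then show "(\<lambda>n. prob {\<omega> \<in> space M. ennreal \<epsilon> < Z n \<omega>}) \<longlonglongrightarrow> 0" by simp
qed measurable

lemma null_in_prob_L2:
  assumes [measurable]: "\<And>n. Z n \<in> borel_measurable M"
    and int: "\<And>n. integrable M (\<lambda>\<omega>. (Z n \<omega>)\<^sup>2)"
    and lim: "(\<lambda>n. expectation (\<lambda>\<omega>. (Z n \<omega>)\<^sup>2)) \<longlonglongrightarrow> 0"
  shows "null_in_prob Z"
proof (rule null_in_probI_prob)
  fix \<epsilon> :: real assume \<epsilon>: "0 < \<epsilon>"
  show "(\<lambda>n. prob {\<omega> \<in> space M. \<epsilon> < \<bar>Z n \<omega>\<bar>}) \<longlonglongrightarrow> 0"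
  proof (rule tendsto_sandwich[OF _ _ tendsto_const])
    show "(\<lambda>n. expectation (\<lambda>\<omega>. (Z n \<omega>)\<^sup>2) / \<epsilon>\<^sup>2) \<longlonglongrightarrow> 0"
      by (intro tendsto_divide_zero lim)
    have "prob {\<omega> \<in> space M. \<epsilon> < \<bar>Z n \<omega>\<bar>} \<le> expectation (\<lambda>\<omega>. (Z n \<omega>)\<^sup>2) / \<epsilon>\<^sup>2" for n
    proof -
      have "prob {\<omega> \<in> space M. \<epsilon> < \<bar>Z n \<omega>\<bar>} \<le> prob {\<omega> \<in> space M. \<epsilon>\<^sup>2 \<le> (Z n \<omega>)\<^sup>2}"
        using \<epsilon> by (intro finite_measure_mono) (auto simp: abs_le_square_iff[symmetric])
      also have "\<dots> \<le> expectation (\<lambda>\<omega>. (Z n \<omega>)\<^sup>2) / \<epsilon>\<^sup>2"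
        using \<epsilon> int by (intro integral_Markov_inequality_measure[where A="{}"]) auto
      finally show ?thesis .
    qed
    then show "\<forall>\<^sub>F n in sequentially. prob {\<omega> \<in> space M. \<epsilon> < \<bar>Z n \<omega>\<bar>} \<le> expectation (\<lambda>\<omega>. (Z n \<omega>)\<^sup>2) / \<epsilon>\<^sup>2"
      by simp
  qed (auto intro: always_eventually)
qed measurable

lemma null_in_prob_AE_subseq:
  assumes "null_in_prob Z"
  shows "\<exists>r. strict_mono r \<and> (AE \<omega> in M. (\<lambda>n. Z (r n) \<omega>) \<longlonglongrightarrow> 0)"
proof -
  have [measurable]: "Z n \<in> borel_measurable M" for n
    using assms by (rule null_in_prob_measurable)
  have "\<exists>r. strict_mono r \<and> (AE \<omega> in M. (\<lambda>n. min 1 \<bar>Z (r n) \<omega>\<bar>) \<longlonglongrightarrow> 0)"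
    using assms by (intro tendsto_L1_AE_subseq) (auto simp: null_in_prob_def)
  then obtain r where r: "strict_mono r" "AE \<omega> in M. (\<lambda>n. min 1 \<bar>Z (r n) \<omega>\<bar>) \<longlonglongrightarrow> 0"
    by auto
  have "AE \<omega> in M. (\<lambda>n. Z (r n) \<omega>) \<longlonglongrightarrow> 0"
    using r(2)
  proof eventually_elim
    case (elim \<omega>)
    have "\<forall>\<^sub>F n in sequentially. min 1 \<bar>Z (r n) \<omega>\<bar> < 1"
      using order_tendstoD(2)[OF elim, of 1] by auto
    then have "\<forall>\<^sub>F n in sequentially. min 1 \<bar>Z (r n) \<omega>\<bar> = \<bar>Z (r n) \<omega>\<bar>"
      by eventually_elim auto
    then have "(\<lambda>n. \<bar>Z (r n) \<omega>\<bar>) \<longlonglongrightarrow> 0"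
      using elim by (simp add: tendsto_cong)
    then show ?case by (rule tendsto_rabs_zero_cancel)
  qed
  with r(1) show ?thesis by auto
qed

end

section \<open>Increments of Brownian motion\<close>

lemma abs_mult_le_sum_squares: "\<bar>x\<bar> * \<bar>y\<bar> \<le> x\<^sup>2 + (y::real)\<^sup>2"
proof -
  have "2 * \<bar>x\<bar> * \<bar>y\<bar> \<le> \<bar>x\<bar>\<^sup>2 + \<bar>y\<bar>\<^sup>2" by (rule sum_squares_bound)
  moreover have "0 \<le> \<bar>x\<bar> * \<bar>y\<bar>" by simp
  ultimately show ?thesis unfolding power2_abs by linarith
qed

lemma Int_stable_vimage_sets: "Int_stable {f -` A \<inter> C |A. A \<in> sets N}"
  unfolding Int_stable_def
proof (intro ballI)
  fix a b assume "a \<in> {f -` A \<inter> C |A. A \<in> sets N}" "b \<in> {f -` A \<inter> C |A. A \<in> sets N}"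
  then obtain A A' where "a = f -` A \<inter> C" "A \<in> sets N" "b = f -` A' \<inter> C" "A' \<in> sets N" by auto
  then have "a \<inter> b = f -` (A \<inter> A') \<inter> C" "A \<inter> A' \<in> sets N" by auto
  then show "a \<inter> b \<in> {f -` A \<inter> C |A. A \<in> sets N}" by blast
qed

locale brownian_basis = prob_space M for M :: "'a measure" +
  fixes F :: "real \<Rightarrow> 'a measure" and B :: "real \<Rightarrow> 'a \<Rightarrow> real"
  assumes usual: "usual_conditions M F" and brownian: "brownian_motion M F B"
begin

lemma space_F: "0 \<le> s \<Longrightarrow> space (F s) = space M"
  using usual filtration.space_F[of "space M" "\<lambda>s. F (max 0 s)" s]
  by (auto simp: usual_conditions_def)

lemma sets_F_mono: "0 \<le> s \<Longrightarrow> s \<le> t \<Longrightarrow> sets (F s) \<subseteq> sets (F t)"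
  using usual filtration.sets_F_mono[of "space M" "\<lambda>s. F (max 0 s)" s t]
  by (auto simp: usual_conditions_def)

lemma sets_F_M: "0 \<le> s \<Longrightarrow> sets (F s) \<subseteq> sets M"
  using usual by (auto simp: usual_conditions_def)

lemma measurable_F_mono:
  "f \<in> measurable (F s) N \<Longrightarrow> 0 \<le> s \<Longrightarrow> s \<le> t \<Longrightarrow> f \<in> measurable (F t) N"
  using measurable_mono[of N N "F s" "F t"] sets_F_mono[of s t] space_F[of s] space_F[of t]
  by auto

lemma measurable_F_M: "f \<in> measurable (F s) N \<Longrightarrow> 0 \<le> s \<Longrightarrow> f \<in> measurable M N"
  using measurable_mono[of N N "F s" M] sets_F_M[of s] space_F[of s] by auto

text \<open>
  Null sets belong to the initial sigma-algebra, so an almost sure property can be enforced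
  everywhere by modifying a process off an event known at time zero, without losing adaptedness.
\<close>

lemma AE_good_event:
  assumes "AE \<omega> in M. P \<omega>"
  obtains G where "G \<in> sets (F 0)" "AE \<omega> in M. \<omega> \<in> G" "\<And>\<omega>. \<omega> \<in> G \<Longrightarrow> P \<omega>" "G \<subseteq> space M"
proof -
  obtain N where N: "{\<omega> \<in> space M. \<not> P \<omega>} \<subseteq> N" "N \<in> null_sets M"
    using assms by (auto elim!: AE_E simp: null_sets_def)
  have NF: "N \<in> sets (F 0)"
    using usual N(2) by (auto simp: usual_conditions_def)
  show thesis
  proof
    show "space M - N \<in> sets (F 0)"
      using NF space_F[of 0] sets.compl_sets[of N "F 0"] by simp
    show "AE \<omega> in M. \<omega> \<in> space M - N"
      using AE_not_in[OF N(2)] by auto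
  qed (use N in auto)
qed

lemma B_adapted: "0 \<le> s \<Longrightarrow> B s \<in> borel_measurable (F s)"
  using brownian by (auto simp: brownian_motion_def)

lemma B_measurable: "0 \<le> s \<Longrightarrow> B s \<in> borel_measurable M"
  using B_adapted measurable_F_M by blast

lemma increment_distributed:
  "0 \<le> s \<Longrightarrow> s < t \<Longrightarrow>
    distributed M lborel (\<lambda>\<omega>. B t \<omega> - B s \<omega>) (normal_density 0 (sqrt (t - s)))"
  using brownian by (auto simp: brownian_motion_def)

text \<open>
  The case \<open>s = t\<close> is included for the sake of partitions with repeated points; there the increment is
  the constant zero.
\<close>

lemma indep_increment:
  assumes st: "0 \<le> s" "s \<le> t" and f: "f \<in> measurable (F s) N" and h: "h \<in> measurable borel N'"
  shows "indep_var N f N' (\<lambda>\<omega>. h (B t \<omega> - B s \<omega>))"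
proof (cases "s = t")
  case True
  have f': "f \<in> measurable M N" using f st by (auto intro: measurable_F_M)
  show ?thesis
    unfolding indep_var_eq
  proof (intro conjI)
    show "indep_set (sigma_sets (space M) {f -` A \<inter> space M |A. A \<in> sets N})
     (sigma_sets (space M) {(\<lambda>\<omega>. h (B t \<omega> - B s \<omega>)) -` A \<inter> space M |A. A \<in> sets N'})"
    proof (rule indep_set_sigma_sets[OF indep_setI])
      fix a b assume a: "a \<in> {f -` A \<inter> space M |A. A \<in> sets N}"
        and "b \<in> {(\<lambda>\<omega>. h (B t \<omega> - B s \<omega>)) -` A \<inter> space M |A. A \<in> sets N'}"
      then obtain A where "b = (\<lambda>\<omega>. h (B t \<omega> - B s \<omega>)) -` A \<inter> space M" by auto
      then have "b = (if h 0 \<in> A then space M else {})"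
        using True by auto
      moreover have "a \<subseteq> space M" using a by auto
      ultimately show "prob (a \<inter> b) = prob a * prob b"
        by (simp add: Int_absorb2 prob_space)
    next
      show "Int_stable {f -` A \<inter> space M |A. A \<in> sets N}"
        "Int_stable {(\<lambda>\<omega>. h (B t \<omega> - B s \<omega>)) -` A \<inter> space M |A. A \<in> sets N'}"
        by (rule Int_stable_vimage_sets)+
    next
      show "{f -` A \<inter> space M |A. A \<in> sets N} \<subseteq> events"
        using f' by (auto intro: measurable_sets)
      show "{(\<lambda>\<omega>. h (B t \<omega> - B s \<omega>)) -` A \<inter> space M |A. A \<in> sets N'} \<subseteq> events"
        using True by auto
    qed
  qed (use True f' measurable_space[OF h, of 0] in auto)
next
  case False
  then have st': "s < t" using st by simp
  have Bst[measurable]: "(\<lambda>\<omega>. B t \<omega> - B s \<omega>) \<in> borel_measurable M"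
    using B_measurable[of s] B_measurable[of t] st by auto
  show ?thesis
    unfolding indep_var_eq
  proof (intro conjI)
    have ind: "indep_set (sets (F s)) {(\<lambda>\<omega>. B t \<omega> - B s \<omega>) -` A \<inter> space M |A. A \<in> sets borel}"
      using brownian st st' by (auto simp: brownian_motion_def)
    have f1: "f -` A \<inter> space M \<in> sets (F s)" if "A \<in> sets N" for A
      using measurable_sets[OF f that] space_F[OF st(1)] by simp
    have h1: "(\<lambda>\<omega>. h (B t \<omega> - B s \<omega>)) -` A \<inter> space M \<in> {(\<lambda>\<omega>. B t \<omega> - B s \<omega>) -` A \<inter> space M |A. A \<in> sets borel}"
      if "A \<in> sets N'" for A
      using measurable_sets[OF h that] by (auto simp: vimage_def)
    show "indep_set (sigma_sets (space M) {f -` A \<inter> space M |A. A \<in> sets N})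
     (sigma_sets (space M) {(\<lambda>\<omega>. h (B t \<omega> - B s \<omega>)) -` A \<inter> space M |A. A \<in> sets N'})"
    proof (rule indep_set_sigma_sets[OF indep_setI])
      fix a b assume "a \<in> {f -` A \<inter> space M |A. A \<in> sets N}"
        "b \<in> {(\<lambda>\<omega>. h (B t \<omega> - B s \<omega>)) -` A \<inter> space M |A. A \<in> sets N'}"
      then show "prob (a \<inter> b) = prob a * prob b"
        using f1 h1 by (intro indep_setD[OF ind]) auto
    next
      show "{f -` A \<inter> space M |A. A \<in> sets N} \<subseteq> events"
        using f1 indep_setD_ev1[OF ind] by auto
      show "{(\<lambda>\<omega>. h (B t \<omega> - B s \<omega>)) -` A \<inter> space M |A. A \<in> sets N'} \<subseteq> events"
        using h1 indep_setD_ev2[OF ind] by blast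
    qed (rule Int_stable_vimage_sets)+
    show "random_variable N f" using f st by (auto intro: measurable_F_M)
    show "random_variable N' (\<lambda>\<omega>. h (B t \<omega> - B s \<omega>))" by (rule measurable_compose[OF Bst h])
  qed
qed

lemma integrable_mult_increment:
  fixes f :: "'a \<Rightarrow> real" and h :: "real \<Rightarrow> real"
  assumes "0 \<le> s" "s \<le> t" "f \<in> borel_measurable (F s)" "h \<in> borel_measurable borel"
    and "integrable M f" "integrable M (\<lambda>\<omega>. h (B t \<omega> - B s \<omega>))"
  shows "integrable M (\<lambda>\<omega>. f \<omega> * h (B t \<omega> - B s \<omega>))"
    and "expectation (\<lambda>\<omega>. f \<omega> * h (B t \<omega> - B s \<omega>)) =
      expectation f * expectation (\<lambda>\<omega>. h (B t \<omega> - B s \<omega>))"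
  using indep_var_integrable[OF indep_increment[OF assms(1-4)] assms(5,6)]
    indep_var_lebesgue_integral[OF indep_increment[OF assms(1-4)] assms(5,6)] by auto

lemma nn_integral_mult_increment:
  fixes f :: "'a \<Rightarrow> ennreal" and h :: "real \<Rightarrow> ennreal"
  assumes st: "0 \<le> s" "s \<le> t" and f: "f \<in> borel_measurable (F s)" and h: "h \<in> borel_measurable borel"
  shows "(\<integral>\<^sup>+\<omega>. f \<omega> * h (B t \<omega> - B s \<omega>) \<partial>M) = (\<integral>\<^sup>+\<omega>. f \<omega> \<partial>M) * (\<integral>\<^sup>+\<omega>. h (B t \<omega> - B s \<omega>) \<partial>M)"
proof -
  have "indep_var borel f borel (\<lambda>\<omega>. h (B t \<omega> - B s \<omega>))"
    by (rule indep_increment[OF st f h])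
  then have iv: "indep_vars (case_bool borel borel) (case_bool f (\<lambda>\<omega>. h (B t \<omega> - B s \<omega>))) UNIV"
    by (simp add: indep_var_def)
  have cb: "case_bool borel borel = (\<lambda>_. borel)" by (auto simp: fun_eq_iff split: bool.split)
  show ?thesis
    using indep_vars_nn_integral[OF _ iv[unfolded cb]] by (simp add: UNIV_bool mult.commute)
qed

text \<open>
  Sums of centred functions of successive increments, with adapted coefficients, have orthogonal
  terms: each new term is a product of something known at the left end of its interval with a
  centred variable independent of it.
\<close>

lemma orthogonal_increments:
  fixes p :: "nat \<Rightarrow> real" and a :: "nat \<Rightarrow> 'a \<Rightarrow> real" and h :: "nat \<Rightarrow> real \<Rightarrow> real"
  defines "m \<equiv> \<lambda>i \<omega>. h i (B (p (Suc i)) \<omega> - B (p i) \<omega>)"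
  assumes p: "\<And>i. i < n \<Longrightarrow> 0 \<le> p i" "\<And>i. i < n \<Longrightarrow> p i \<le> p (Suc i)"
    and a: "\<And>i. i < n \<Longrightarrow> a i \<in> borel_measurable (F (p i))" "\<And>i. i < n \<Longrightarrow> integrable M (\<lambda>\<omega>. (a i \<omega>)\<^sup>2)"
    and h: "\<And>i. i < n \<Longrightarrow> h i \<in> borel_measurable borel" "\<And>i. i < n \<Longrightarrow> integrable M (\<lambda>\<omega>. (m i \<omega>)\<^sup>2)"
      "\<And>i. i < n \<Longrightarrow> expectation (m i) = 0"
  shows "integrable M (\<lambda>\<omega>. (\<Sum>i<n. a i \<omega> * m i \<omega>)\<^sup>2)"
    and "expectation (\<lambda>\<omega>. (\<Sum>i<n. a i \<omega> * m i \<omega>)\<^sup>2) =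
      (\<Sum>i<n. expectation (\<lambda>\<omega>. (a i \<omega>)\<^sup>2) * expectation (\<lambda>\<omega>. (m i \<omega>)\<^sup>2))"
proof -
  let ?S = "\<lambda>n \<omega>. \<Sum>i<n. a i \<omega> * m i \<omega>"
  have L1: "integrable M f" if "integrable M (\<lambda>\<omega>. (f \<omega>)\<^sup>2)" "f \<in> borel_measurable M" for f :: "'a \<Rightarrow> real"
    using that by (rule square_integrable_imp_integrable[rotated])
  have mM: "m i \<in> borel_measurable M" if "i < n" for i
    unfolding m_def using h(1)[OF that] B_measurable[of "p i"] B_measurable[of "p (Suc i)"] p[OF that]
    by (intro measurable_compose[OF _ h(1)[OF that]]) auto
  have "k \<le> n \<Longrightarrow> (0 < k \<longrightarrow> ?S k \<in> borel_measurable (F (p k))) \<and> integrable M (\<lambda>\<omega>. (?S k \<omega>)\<^sup>2) \<and>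
      expectation (\<lambda>\<omega>. (?S k \<omega>)\<^sup>2) = (\<Sum>i<k. expectation (\<lambda>\<omega>. (a i \<omega>)\<^sup>2) * expectation (\<lambda>\<omega>. (m i \<omega>)\<^sup>2))" for k
  proof (induction k)
    case (Suc k)
    then have k: "k < n" and IH: "integrable M (\<lambda>\<omega>. (?S k \<omega>)\<^sup>2)" "0 < k \<longrightarrow> ?S k \<in> borel_measurable (F (p k))"
      "expectation (\<lambda>\<omega>. (?S k \<omega>)\<^sup>2) = (\<Sum>i<k. expectation (\<lambda>\<omega>. (a i \<omega>)\<^sup>2) * expectation (\<lambda>\<omega>. (m i \<omega>)\<^sup>2))"
      by auto
    note pk = p[OF k]
    have pk': "0 \<le> p (Suc k)" using pk by simp
    have SF: "?S k \<in> borel_measurable (F (p k))"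
      using IH(2) by (cases "k = 0") auto
    have SM: "?S k \<in> borel_measurable M" using SF pk(1) by (rule measurable_F_M)
    have aM: "a k \<in> borel_measurable M" using a(1)[OF k] pk(1) by (rule measurable_F_M)
    have mF: "m k \<in> borel_measurable (F (p (Suc k)))"
      unfolding m_def using B_adapted[OF pk'] measurable_F_mono[OF B_adapted[OF pk(1)] pk]
      by (intro measurable_compose[OF _ h(1)[OF k]]) auto
    have im: "integrable M (m k)" by (rule L1[OF h(2)[OF k] mM[OF k]])
    have iSa: "integrable M (\<lambda>\<omega>. ?S k \<omega> * a k \<omega>)"
      by (rule Bochner_Integration.integrable_bound[of _ "\<lambda>\<omega>. (?S k \<omega>)\<^sup>2 + (a k \<omega>)\<^sup>2"])
        (use IH(1) a(2)[OF k] SM aM in \<open>simp_all add: abs_mult abs_mult_le_sum_squares\<close>)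
    \<comment> \<open>The cross term vanishes: its first factor is known at time \<open>p k\<close>, and \<open>m k\<close> is centred.\<close>
    have 1: "integrable M (\<lambda>\<omega>. (?S k \<omega> * a k \<omega>) * m k \<omega>)" "expectation (\<lambda>\<omega>. (?S k \<omega> * a k \<omega>) * m k \<omega>) = 0"
      using integrable_mult_increment[OF pk _ h(1)[OF k] iSa] SF a(1)[OF k] im h(3)[OF k]
      unfolding m_def by (auto simp: m_def)
    have 2: "integrable M (\<lambda>\<omega>. (a k \<omega>)\<^sup>2 * (m k \<omega>)\<^sup>2)"
      "expectation (\<lambda>\<omega>. (a k \<omega>)\<^sup>2 * (m k \<omega>)\<^sup>2) = expectation (\<lambda>\<omega>. (a k \<omega>)\<^sup>2) * expectation (\<lambda>\<omega>. (m k \<omega>)\<^sup>2)"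
      using integrable_mult_increment[OF pk _ _ a(2)[OF k], of "\<lambda>x. (h k x)\<^sup>2"] a(1)[OF k] h(1,2)[OF k]
      unfolding m_def by auto
    have eq: "(?S (Suc k) \<omega>)\<^sup>2 = (?S k \<omega>)\<^sup>2 + 2 * ((?S k \<omega> * a k \<omega>) * m k \<omega>) + (a k \<omega>)\<^sup>2 * (m k \<omega>)\<^sup>2" for \<omega>
      by (simp add: power2_eq_square algebra_simps)
    have "?S (Suc k) \<in> borel_measurable (F (p (Suc k)))"
      using measurable_F_mono[OF SF pk] measurable_F_mono[OF a(1)[OF k] pk] mF by auto
    moreover have "integrable M (\<lambda>\<omega>. (?S (Suc k) \<omega>)\<^sup>2)"
      unfolding eq using IH(1) 1 2 by auto
    moreover have "expectation (\<lambda>\<omega>. (?S (Suc k) \<omega>)\<^sup>2) =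
        (\<Sum>i<Suc k. expectation (\<lambda>\<omega>. (a i \<omega>)\<^sup>2) * expectation (\<lambda>\<omega>. (m i \<omega>)\<^sup>2))"
      unfolding eq using IH(1,3) 1 2 by simp
    ultimately show ?case by blast
  qed simp
  from this[of n] show "integrable M (\<lambda>\<omega>. (?S n \<omega>)\<^sup>2)"
    "expectation (\<lambda>\<omega>. (?S n \<omega>)\<^sup>2) = (\<Sum>i<n. expectation (\<lambda>\<omega>. (a i \<omega>)\<^sup>2) * expectation (\<lambda>\<omega>. (m i \<omega>)\<^sup>2))"
    by auto
qed

subsection \<open>Gaussian moments\<close>

text \<open>
  Completing the square: an exponential weight shifts a centred Gaussian density, so all moments
  with an exponential factor reduce to those of a shifted Gaussian.
\<close>

lemma normal_density_mult_exp:
  assumes "0 < \<tau>"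
  shows "normal_density 0 \<tau> x * exp (c * x) = exp (c\<^sup>2 * \<tau>\<^sup>2 / 2) * normal_density (c * \<tau>\<^sup>2) \<tau> x"
proof -
  have "- (x - 0)\<^sup>2 / (2 * \<tau>\<^sup>2) + c * x = c\<^sup>2 * \<tau>\<^sup>2 / 2 + - (x - c * \<tau>\<^sup>2)\<^sup>2 / (2 * \<tau>\<^sup>2)"
    using assms by (simp add: field_simps power2_eq_square)
  then have "exp (- (x - 0)\<^sup>2 / (2 * \<tau>\<^sup>2)) * exp (c * x) = exp (c\<^sup>2 * \<tau>\<^sup>2 / 2) * exp (- (x - c * \<tau>\<^sup>2)\<^sup>2 / (2 * \<tau>\<^sup>2))"
    by (simp only: exp_add[symmetric])
  then show ?thesis unfolding normal_density_def by simp
qed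

lemma increment_exp:
  assumes "0 \<le> s" "s \<le> t"
  shows "integrable M (\<lambda>\<omega>. exp (c * (B t \<omega> - B s \<omega>)))"
    and "expectation (\<lambda>\<omega>. exp (c * (B t \<omega> - B s \<omega>))) = exp (c\<^sup>2 * (t - s) / 2)"
    and "integrable M (\<lambda>\<omega>. (B t \<omega> - B s \<omega>) * exp (c * (B t \<omega> - B s \<omega>)))"
    and "expectation (\<lambda>\<omega>. (B t \<omega> - B s \<omega>) * exp (c * (B t \<omega> - B s \<omega>))) = c * (t - s) * exp (c\<^sup>2 * (t - s) / 2)"
proof -
  have "integrable M (\<lambda>\<omega>. exp (c * (B t \<omega> - B s \<omega>))) \<and>
    expectation (\<lambda>\<omega>. exp (c * (B t \<omega> - B s \<omega>))) = exp (c\<^sup>2 * (t - s) / 2) \<and>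
    integrable M (\<lambda>\<omega>. (B t \<omega> - B s \<omega>) * exp (c * (B t \<omega> - B s \<omega>))) \<and>
    expectation (\<lambda>\<omega>. (B t \<omega> - B s \<omega>) * exp (c * (B t \<omega> - B s \<omega>))) = c * (t - s) * exp (c\<^sup>2 * (t - s) / 2)"
  proof (cases "s = t")
    case False
    then have st: "s < t" using assms by simp
    define \<tau> where "\<tau> = sqrt (t - s)"
    have \<tau>: "0 < \<tau>" "\<tau>\<^sup>2 = t - s" using st by (auto simp: \<tau>_def)
    have D: "distributed M lborel (\<lambda>\<omega>. B t \<omega> - B s \<omega>) (normal_density 0 \<tau>)"
      unfolding \<tau>_def using increment_distributed[OF assms(1) st] .
    have eq: "normal_density 0 \<tau> x * exp (c * x) = exp (c\<^sup>2 * (t - s) / 2) * normal_density (c * (t - s)) \<tau> x" for x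
      using normal_density_mult_exp[OF \<tau>(1), of x c] by (simp add: \<tau>)
    have eq': "normal_density 0 \<tau> x * (x * exp (c * x)) =
        exp (c\<^sup>2 * (t - s) / 2) * (normal_density (c * (t - s)) \<tau> x * x)" for x
      using eq[of x] by (simp add: mult_ac)
    have i1: "integrable lborel (normal_density (c * (t - s)) \<tau>)" "(\<integral>x. normal_density (c * (t - s)) \<tau> x \<partial>lborel) = 1"
      using \<tau> by (auto intro: integrable_normal_density integral_normal_density)
    have i2: "integrable lborel (\<lambda>x. normal_density (c * (t - s)) \<tau> x * x)"
       "(\<integral>x. normal_density (c * (t - s)) \<tau> x * x \<partial>lborel) = c * (t - s)"
      using integrable_normal_moment_nz_1[OF \<tau>(1)] integral_normal_moment_nz_1[OF \<tau>(1)] by auto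
    have "integrable lborel (\<lambda>x. normal_density 0 \<tau> x * exp (c * x))"
      "(\<integral>x. normal_density 0 \<tau> x * exp (c * x) \<partial>lborel) = exp (c\<^sup>2 * (t - s) / 2)"
      unfolding eq using i1 by auto
    moreover have "integrable lborel (\<lambda>x. normal_density 0 \<tau> x * (x * exp (c * x)))"
      "(\<integral>x. normal_density 0 \<tau> x * (x * exp (c * x)) \<partial>lborel) = c * (t - s) * exp (c\<^sup>2 * (t - s) / 2)"
      unfolding eq' using i2 by auto
    ultimately show ?thesis
      using distributed_integrable[OF D, of "\<lambda>x. exp (c * x)"] distributed_integral[OF D, of "\<lambda>x. exp (c * x)"]
        distributed_integrable[OF D, of "\<lambda>x. x * exp (c * x)"] distributed_integral[OF D, of "\<lambda>x. x * exp (c * x)"]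
      by auto
  qed (simp add: prob_space)
  then show "integrable M (\<lambda>\<omega>. exp (c * (B t \<omega> - B s \<omega>)))"
    "expectation (\<lambda>\<omega>. exp (c * (B t \<omega> - B s \<omega>))) = exp (c\<^sup>2 * (t - s) / 2)"
    "integrable M (\<lambda>\<omega>. (B t \<omega> - B s \<omega>) * exp (c * (B t \<omega> - B s \<omega>)))"
    "expectation (\<lambda>\<omega>. (B t \<omega> - B s \<omega>) * exp (c * (B t \<omega> - B s \<omega>))) = c * (t - s) * exp (c\<^sup>2 * (t - s) / 2)"
    by blast+
qed

lemma increment_moments:
  assumes "0 \<le> s" "s \<le> t"
  shows "integrable M (\<lambda>\<omega>. B t \<omega> - B s \<omega>)" "expectation (\<lambda>\<omega>. B t \<omega> - B s \<omega>) = 0"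
    and "integrable M (\<lambda>\<omega>. (B t \<omega> - B s \<omega>)\<^sup>2)" "expectation (\<lambda>\<omega>. (B t \<omega> - B s \<omega>)\<^sup>2) = t - s"
proof -
  show "integrable M (\<lambda>\<omega>. B t \<omega> - B s \<omega>)" "expectation (\<lambda>\<omega>. B t \<omega> - B s \<omega>) = 0"
    using increment_exp(3,4)[OF assms, of 0] by auto
  have "integrable M (\<lambda>\<omega>. (B t \<omega> - B s \<omega>)\<^sup>2) \<and> expectation (\<lambda>\<omega>. (B t \<omega> - B s \<omega>)\<^sup>2) = t - s"
  proof (cases "s = t")
    case False
    then have st: "s < t" using assms by simp
    define \<tau> where "\<tau> = sqrt (t - s)"
    have \<tau>: "0 < \<tau>" "\<tau>\<^sup>2 = t - s" using st by (auto simp: \<tau>_def)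
    have D: "distributed M lborel (\<lambda>\<omega>. B t \<omega> - B s \<omega>) (normal_density 0 \<tau>)"
      unfolding \<tau>_def using increment_distributed[OF assms(1) st] .
    have "has_bochner_integral lborel (\<lambda>x. normal_density 0 \<tau> x * x\<^sup>2) (t - s)"
      using normal_moment_even[OF \<tau>(1), of 0 1] \<tau> by (simp add: diff_divide_distrib)
    then show ?thesis
      using distributed_integrable[OF D, of "\<lambda>x. x\<^sup>2"] distributed_integral[OF D, of "\<lambda>x. x\<^sup>2"]
      by (auto simp: has_bochner_integral_iff)
  qed simp
  then show "integrable M (\<lambda>\<omega>. (B t \<omega> - B s \<omega>)\<^sup>2)" "expectation (\<lambda>\<omega>. (B t \<omega> - B s \<omega>)\<^sup>2) = t - s"
    by auto
qed

end

section \<open>Measurability of processes\<close>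

lemma floor_grid:
  assumes "0 \<le> s"
  shows "0 \<le> real (nat \<lfloor>s * real (Suc n)\<rfloor>) / real (Suc n)"
    and "real (nat \<lfloor>s * real (Suc n)\<rfloor>) / real (Suc n) \<le> s"
    and "(\<lambda>n. real (nat \<lfloor>s * real (Suc n)\<rfloor>) / real (Suc n)) \<longlonglongrightarrow> s"
proof -
  let ?s = "\<lambda>n. real (nat \<lfloor>s * real (Suc n)\<rfloor>) / real (Suc n)"
  have b: "s - 1 / real (Suc n) \<le> ?s n \<and> ?s n \<le> s" for n
  proof -
    have r: "real (nat \<lfloor>s * real (Suc n)\<rfloor>) = of_int \<lfloor>s * real (Suc n)\<rfloor>"
      using assms by simp
    have "s * real (Suc n) - 1 \<le> of_int \<lfloor>s * real (Suc n)\<rfloor>" "of_int \<lfloor>s * real (Suc n)\<rfloor> \<le> s * real (Suc n)"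
      by linarith+
    then show ?thesis
      unfolding r by (simp only: diff_le_eq add_divide_distrib[symmetric] pos_le_divide_eq
            pos_divide_le_eq of_nat_0_less_iff zero_less_Suc simp_thms)
  qed
  show "0 \<le> ?s n" by simp
  show "?s n \<le> s" using b by blast
  show "?s \<longlonglongrightarrow> s"
  proof (rule tendsto_sandwich[of "\<lambda>n. s - 1 / real (Suc n)" _ _ "\<lambda>_. s"])
    have "(\<lambda>n. s - 1 / real (Suc n)) \<longlonglongrightarrow> s - 0"
      by (intro tendsto_intros LIMSEQ_Suc[OF lim_1_over_n])
    then show "(\<lambda>n. s - 1 / real (Suc n)) \<longlonglongrightarrow> s" by simp
  qed (use b in auto)
qed

text \<open>
  Clamping time to \<open>[0, t]\<close> makes the process jointly measurable on the whole line while using its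
  values up to time \<open>t\<close> alone. Time is approximated by grid points from the left, which never lie
  beyond \<open>t\<close>; countably many sections then suffice.
\<close>

lemma continuous_process_measurable:
  fixes X :: "real \<Rightarrow> 'a \<Rightarrow> real"
  assumes t: "0 \<le> t" and X: "\<And>s. 0 \<le> s \<Longrightarrow> s \<le> t \<Longrightarrow> X s \<in> borel_measurable N"
    and cont: "\<And>\<omega>. \<omega> \<in> space N \<Longrightarrow> continuous_on {0..t} (\<lambda>s. X s \<omega>)"
  shows "(\<lambda>(\<omega>, s). X (max 0 (min t s)) \<omega>) \<in> borel_measurable (N \<Otimes>\<^sub>M borel)"
proof (rule borel_measurable_LIMSEQ_metric[where f="\<lambda>n z. X (min t (real (nat \<lfloor>max 0 (min t (snd z)) * real (Suc n)\<rfloor>) / real (Suc n))) (fst z)"])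
  fix n :: nat
  let ?g = "\<lambda>z::'a \<times> real. nat \<lfloor>max 0 (min t (snd z)) * real (Suc n)\<rfloor>"
  have "(\<lambda>z. (\<lambda>i z. X (min t (real i / real (Suc n))) (fst z)) (?g z) z) \<in> borel_measurable (N \<Otimes>\<^sub>M borel)"
  proof (rule measurable_compose_countable[where f="\<lambda>i z. X (min t (real i / real (Suc n))) (fst z)" and g="?g"])
    fix i :: nat
    have [measurable]: "X (min t (real i / real (Suc n))) \<in> borel_measurable N"
      using t by (intro X) auto
    show "(\<lambda>z. X (min t (real i / real (Suc n))) (fst z)) \<in> borel_measurable (N \<Otimes>\<^sub>M borel)"
      by measurable
  qed measurable
  then show "(\<lambda>z. X (min t (real (?g z) / real (Suc n))) (fst z)) \<in> borel_measurable (N \<Otimes>\<^sub>M borel)"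
    by simp
next
  fix z assume z: "z \<in> space (N \<Otimes>\<^sub>M (borel :: real measure))"
  define s where "s = max 0 (min t (snd z))"
  have s: "s \<in> {0..t}" using t by (auto simp: s_def)
  let ?s = "\<lambda>n. min t (real (nat \<lfloor>s * real (Suc n)\<rfloor>) / real (Suc n))"
  have "real (nat \<lfloor>s * real (Suc n)\<rfloor>) / real (Suc n) \<le> t" for n
    using floor_grid(2)[of s n] s by auto
  then have "?s n = real (nat \<lfloor>s * real (Suc n)\<rfloor>) / real (Suc n)" for n
    by (intro min_absorb2)
  then have "?s \<longlonglongrightarrow> s"
    using floor_grid(3)[of s] s by simp
  moreover have "?s n \<in> {0..t}" for n using t by auto
  ultimately have "(\<lambda>n. X (?s n) (fst z)) \<longlonglongrightarrow> X s (fst z)"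
    using continuous_on_tendsto_compose[OF cont[of "fst z"], of ?s s sequentially] z s
    by (auto simp: space_pair_measure)
  then show "(\<lambda>n. X (min t (real (nat \<lfloor>max 0 (min t (snd z)) * real (Suc n)\<rfloor>) / real (Suc n))) (fst z))
      \<longlonglongrightarrow> (case z of (\<omega>, s) \<Rightarrow> X (max 0 (min t s)) \<omega>)"
    by (simp add: s_def case_prod_beta)
qed

lemma continuous_process_measurable_restrict:
  fixes X :: "real \<Rightarrow> 'a \<Rightarrow> real"
  assumes t: "0 \<le> t" and X: "\<And>s. 0 \<le> s \<Longrightarrow> s \<le> t \<Longrightarrow> X s \<in> borel_measurable N"
    and cont: "\<And>\<omega>. \<omega> \<in> space N \<Longrightarrow> continuous_on {0..t} (\<lambda>s. X s \<omega>)"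
  shows "(\<lambda>(\<omega>, s). X s \<omega>) \<in> borel_measurable (N \<Otimes>\<^sub>M restrict_space borel {0..t})"
proof -
  have "(\<lambda>z. (fst z, snd z)) \<in> measurable (N \<Otimes>\<^sub>M restrict_space borel {0..t}) (N \<Otimes>\<^sub>M borel)"
    by (intro measurable_Pair measurable_fst measurable_compose[OF measurable_snd] measurable_restrict_space1) auto
  from measurable_compose[OF this continuous_process_measurable[OF assms]]
  have "(\<lambda>z. X (max 0 (min t (snd z))) (fst z)) \<in> borel_measurable (N \<Otimes>\<^sub>M restrict_space borel {0..t})"
    by simp
  then show ?thesis
    by (rule measurable_cong[THEN iffD1, rotated])
      (auto simp: space_pair_measure space_restrict_space)
qed

text \<open>
  Progressive measurability speaks of time restricted to \<open>[0, t]\<close>; integration theory is simplest on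
  the whole line. Extension by zero passes from the first to the second.
\<close>

lemma measurable_indicator_times_restrict:
  fixes f :: "'a \<times> real \<Rightarrow> real"
  assumes f: "f \<in> borel_measurable (N \<Otimes>\<^sub>M restrict_space borel A)" and A[measurable]: "A \<in> sets borel"
  shows "(\<lambda>z. f z * indicator A (snd z)) \<in> borel_measurable (N \<Otimes>\<^sub>M borel)"
proof -
  let ?R = "restrict_space (N \<Otimes>\<^sub>M borel) (space N \<times> A)"
  have "(\<lambda>z. (fst z, snd z)) \<in> measurable ?R (N \<Otimes>\<^sub>M restrict_space borel A)"
  proof (rule measurable_Pair)
    show "fst \<in> measurable ?R N" by (intro measurable_restrict_space1) simp
    show "snd \<in> measurable ?R (restrict_space borel A)"
      by (intro measurable_restrict_space2 measurable_restrict_space1)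
        (auto simp: space_restrict_space space_pair_measure)
  qed
  from measurable_compose[OF this f] have "f \<in> borel_measurable ?R" by simp
  moreover have "space N \<times> A \<inter> space (N \<Otimes>\<^sub>M borel) \<in> sets (N \<Otimes>\<^sub>M borel)"
    by (auto simp: space_pair_measure Int_absorb2 intro!: pair_measureI)
  ultimately have "(\<lambda>z. f z * indicator (space N \<times> A) z) \<in> borel_measurable (N \<Otimes>\<^sub>M borel)"
    by (simp add: borel_measurable_restrict_space_iff mult.commute)
  then show ?thesis
    by (rule measurable_cong[THEN iffD1, rotated])
      (auto simp: space_pair_measure indicator_def)
qed

section \<open>Time horizons and time integrals\<close>

lemma integrable_indicator_Ioc: "integrable lborel (\<lambda>r. C * indicator {a<..b} r :: real)" for a b C :: real
proof -
  have "set_integrable lborel {a..b} (\<lambda>_. C)" by (rule borel_integrable_atLeastAtMost') simp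
  then have "set_integrable lborel {a<..b} (\<lambda>_. C)" by (rule set_integrable_subset) auto
  then show ?thesis by (simp add: set_integrable_def mult.commute)
qed

lemma set_integral_Ioc_Icc:
  fixes f :: "real \<Rightarrow> real"
  assumes "set_borel_measurable lborel {a..b} f"
  shows "(LINT r:{a<..b}|lborel. f r) = (LINT r:{a..b}|lborel. f r)"
proof (rule set_integral_cong_set)
  show "set_borel_measurable lborel {a<..b} f"
    by (rule set_borel_measurable_subset[OF assms]) auto
  show "AE x in lborel. (x \<in> {a..b}) = (x \<in> {a<..b})"
    by (rule AE_I[of _ _ "{a}"]) auto
qed (rule assms)

lemma continuous_on_Icc_bound:
  fixes f :: "real \<Rightarrow> real"
  assumes "continuous_on {a..b} f"
  obtains C where "0 \<le> C" "\<And>r. r \<in> {a..b} \<Longrightarrow> \<bar>f r\<bar> \<le> C"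
proof -
  have "bounded (f ` {a..b})"
    using compact_continuous_image[OF assms compact_Icc] by (rule compact_imp_bounded)
  then obtain C where "0 < C" "\<forall>x\<in>f ` {a..b}. norm x \<le> C" unfolding bounded_pos by auto
  then show thesis by (intro that[of C]) auto
qed

lemma horizonD: "t \<in> horizon T \<Longrightarrow> 0 \<le> t"
  by (simp add: horizon_def)

lemma horizon_down: "t \<in> horizon T \<Longrightarrow> 0 \<le> s \<Longrightarrow> s \<le> t \<Longrightarrow> s \<in> horizon T"
  by (auto simp: horizon_def intro: order_trans[of "ereal s" "ereal t"])

lemma horizon_cases:
  assumes "t \<in> horizon T"
  obtains a where "T = ereal a" "0 \<le> a" "horizon T = {0..a}" | "T = \<infinity>" "horizon T = {0..}"
proof (cases T)
  case (real r)
  then show ?thesis using assms that(1)[of r] by simp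
next
  case PInf
  then show ?thesis using that(2) by simp
qed (use assms in \<open>simp add: horizon_def\<close>)

lemma horizon_borel [measurable]: "horizon T \<in> sets borel"
  by (cases T) (auto simp: horizon_def)

lemma ex_cofinal_in_horizon:
  assumes "0 \<le> T"
  obtains c :: "nat \<Rightarrow> real" where "\<And>n. c n \<in> horizon T" "\<And>t. t \<in> horizon T \<Longrightarrow> \<forall>\<^sub>F n in sequentially. t \<le> c n"
proof (cases T)
  case (real a)
  then show ?thesis using assms by (intro that[of "\<lambda>_. a"]) auto
next
  case PInf
  show ?thesis
  proof (rule that)
    show "real n \<in> horizon T" for n using PInf by simp
    fix t show "\<forall>\<^sub>F n in sequentially. t \<le> real n"
      using filterlim_real_sequentially by (simp add: filterlim_at_top)
  qed
qed (use assms in auto)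

lemma continuous_on_horizonI:
  fixes f :: "real \<Rightarrow> real"
  assumes "\<And>t. t \<in> horizon T \<Longrightarrow> continuous_on {0..t} f"
  shows "continuous_on (horizon T) f"
proof (cases "horizon T = {}")
  case False
  then obtain t where "t \<in> horizon T" by auto
  then show ?thesis
  proof (cases rule: horizon_cases)
    case (1 a)
    then show ?thesis using assms[of a] by simp
  next
    case 2
    have "continuous_on {0..} f"
      unfolding continuous_on_eq_continuous_within
    proof
      fix x :: real assume x: "x \<in> {0..}"
      have "continuous (at x within {0..x+1}) f"
        using assms[of "x + 1"] x 2 by (auto simp: continuous_on_eq_continuous_within)
      moreover have "at x within {0..x+1} = at x within {0..}"
        by (rule at_within_nhd[of _ "{..<x+1}"]) auto
      ultimately show "continuous (at x within {0..}) f" by (simp add: continuous_within)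
    qed
    then show ?thesis using 2 by simp
  qed
qed simp

lemma continuous_on_horizonD:
  "continuous_on (horizon T) f \<Longrightarrow> t \<in> horizon T \<Longrightarrow> continuous_on {0..t} f"
  by (erule continuous_on_subset) (auto intro: horizon_down)

lemma continuous_on_indefinite_integral:
  fixes f :: "real \<Rightarrow> real"
  assumes "\<And>t. t \<in> horizon T \<Longrightarrow> set_integrable lborel {0..t} f"
  shows "continuous_on (horizon T) (\<lambda>s. LINT r:{0..s}|lborel. f r)"
proof (rule continuous_on_horizonI)
  fix t assume t: "t \<in> horizon T"
  have "f integrable_on {0..t}" by (rule set_borel_integral_eq_integral(1)[OF assms[OF t]])
  then have "continuous_on {0..t} (\<lambda>s. integral {0..s} f)" by (rule indefinite_integral_continuous_1)
  then show "continuous_on {0..t} (\<lambda>s. LINT r:{0..s}|lborel. f r)"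
    by (rule continuous_on_cong[THEN iffD1, rotated -1])
      (auto intro!: set_borel_integral_eq_integral(2)[symmetric] assms horizon_down[OF t])
qed

lemma progressive_integral_measurable:
  fixes f :: "real \<Rightarrow> 'a \<Rightarrow> real"
  assumes "(\<lambda>(\<omega>, s). f s \<omega>) \<in> borel_measurable (N \<Otimes>\<^sub>M restrict_space borel {0..t})"
  shows "(\<lambda>\<omega>. LINT s:{0..t}|lborel. f s \<omega>) \<in> borel_measurable N"
proof -
  have "(\<lambda>z. (\<lambda>(\<omega>, s). f s \<omega>) z * indicator {0..t} (snd z)) \<in> borel_measurable (N \<Otimes>\<^sub>M borel)"
    by (rule measurable_indicator_times_restrict[OF assms]) simp
  then have "(\<lambda>(\<omega>, s). indicator {0..t} s *\<^sub>R f s \<omega>) \<in> borel_measurable (N \<Otimes>\<^sub>M lborel)"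
    by (simp add: case_prod_beta mult.commute)
  then show ?thesis
    unfolding set_lebesgue_integral_def
    by (rule sigma_finite_measure.borel_measurable_lebesgue_integral[OF sigma_finite_lborel])
qed

lemma progressive_nn_integral_measurable:
  fixes f :: "real \<Rightarrow> 'a \<Rightarrow> real"
  assumes "(\<lambda>(\<omega>, s). f s \<omega>) \<in> borel_measurable (N \<Otimes>\<^sub>M restrict_space borel {0..t})"
  shows "(\<lambda>\<omega>. \<integral>\<^sup>+s\<in>{0..t}. ennreal (f s \<omega>) \<partial>lborel) \<in> borel_measurable N"
proof -
  have "(\<lambda>z. (\<lambda>(\<omega>, s). f s \<omega>) z * indicator {0..t} (snd z)) \<in> borel_measurable (N \<Otimes>\<^sub>M borel)"
    by (rule measurable_indicator_times_restrict[OF assms]) simp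
  then have "(\<lambda>(\<omega>, s). ennreal (f s \<omega> * indicator {0..t} s)) \<in> borel_measurable (N \<Otimes>\<^sub>M lborel)"
    by (simp add: case_prod_beta)
  then have "(\<lambda>\<omega>. \<integral>\<^sup>+s. ennreal (f s \<omega> * indicator {0..t} s) \<partial>lborel) \<in> borel_measurable N"
    by (rule sigma_finite_measure.borel_measurable_nn_integral[OF sigma_finite_lborel])
  also have "(\<lambda>\<omega>. \<integral>\<^sup>+s. ennreal (f s \<omega> * indicator {0..t} s) \<partial>lborel) = (\<lambda>\<omega>. \<integral>\<^sup>+s\<in>{0..t}. ennreal (f s \<omega>) \<partial>lborel)"
    by (intro ext nn_integral_cong) (auto simp: indicator_def)
  finally show ?thesis .
qed

section \<open>Partitions\<close>

definition partition :: "real \<Rightarrow> nat \<Rightarrow> (nat \<Rightarrow> real) \<Rightarrow> bool" where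
  "partition t m p \<longleftrightarrow> p 0 = 0 \<and> p m = t \<and> (\<forall>i<m. p i \<le> p (Suc i))"

text \<open>
  The step function with value \<open>f i\<close> on the cell \<open>(p\<^sub>i, p\<^bsub>i+1\<^esub>]\<close>. With \<open>f = p\<close> it maps a time to the left end
  of its cell, with \<open>f i = p (Suc i)\<close> to the right end; every Riemann sum is the integral of such a function.
\<close>

definition step :: "nat \<Rightarrow> (nat \<Rightarrow> real) \<Rightarrow> (nat \<Rightarrow> real) \<Rightarrow> real \<Rightarrow> real" where
  "step m p f r = (\<Sum>i<m. f i * indicator {p i<..p (Suc i)} r)"

lemma steps_mono:
  fixes p :: "nat \<Rightarrow> real"
  assumes "\<And>i. i < m \<Longrightarrow> p i \<le> p (Suc i)" "i \<le> j" "j \<le> m"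
  shows "p i \<le> p j"
  using assms(2,3)
proof (induction j rule: dec_induct)
  case (step k)
  then show ?case using assms(1)[of k] by auto
qed simp

lemma partition_mono: "partition t m p \<Longrightarrow> i \<le> j \<Longrightarrow> j \<le> m \<Longrightarrow> p i \<le> p j"
  using steps_mono[of m p] by (auto simp: partition_def)

lemma partition_bounds: "partition t m p \<Longrightarrow> i \<le> m \<Longrightarrow> 0 \<le> p i \<and> p i \<le> t"
  using partition_mono[of t m p 0 i] partition_mono[of t m p i m] by (auto simp: partition_def)

lemma partition_cell:
  assumes "partition t m p" "0 < r" "r \<le> t"
  obtains i where "i < m" "p i < r" "r \<le> p (Suc i)"
proof -
  let ?i = "LEAST i. r \<le> p i"
  have "r \<le> p m" using assms by (simp add: partition_def)
  then have le: "r \<le> p ?i" "?i \<le> m" by (auto intro: LeastI Least_le)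
  have "?i \<noteq> 0" using le assms by (metis partition_def not_le)
  then obtain j where j: "?i = Suc j" by (metis not0_implies_Suc)
  have "\<not> r \<le> p j" by (rule not_less_Least) (simp add: j)
  then show thesis using that[of j] le j by auto
qed

lemma step_cell:
  assumes "partition t m p" "i < m" "p i < r" "r \<le> p (Suc i)"
  shows "step m p f r = f i"
proof -
  have "f j * indicator {p j<..p (Suc j)} r = (if j = i then f i else 0)" if "j < m" for j
  proof (cases j i rule: linorder_cases)
    case less
    then have "p (Suc j) \<le> p i" using partition_mono[OF assms(1), of "Suc j" i] assms(2) by auto
    then show ?thesis using assms less by (auto simp: indicator_def)
  next
    case greater
    then have "p (Suc i) \<le> p j" using partition_mono[OF assms(1), of "Suc i" j] that by auto
    then show ?thesis using assms greater by (auto simp: indicator_def)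
  qed (use assms in auto)
  then have "step m p f r = (\<Sum>j<m. if j = i then f i else 0)"
    unfolding step_def by (intro sum.cong) auto
  also have "\<dots> = f i" using assms(2) by (simp add: sum.delta)
  finally show ?thesis .
qed

lemma step_compose:
  assumes "partition t m p" "0 < r" "r \<le> t"
  shows "step m p (\<lambda>i. g (f i)) r = g (step m p f r)"
proof -
  obtain i where "i < m" "p i < r" "r \<le> p (Suc i)" using partition_cell[OF assms] .
  then show ?thesis using step_cell[OF assms(1)] by simp
qed

lemma step_measurable [measurable]: "step m p f \<in> borel_measurable borel"
  unfolding step_def[abs_def] by measurable

lemma step_times_integral:
  assumes p: "partition t m p" and g: "set_integrable lborel {0..t} g"
  shows "set_integrable lborel {0..t} (\<lambda>r. step m p f r * g r)"
    and "(LINT r:{0..t}|lborel. step m p f r * g r) = (\<Sum>i<m. f i * (LINT r:{p i<..p (Suc i)}|lborel. g r))"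
proof -
  have sub: "{p i<..p (Suc i)} \<subseteq> {0..t}" if "i < m" for i
    using partition_bounds[OF p, of i] partition_bounds[OF p, of "Suc i"] that by auto
  have int: "set_integrable lborel {p i<..p (Suc i)} g" if "i < m" for i
    using set_integrable_subset[OF g _ sub[OF that]] by simp
  have eq: "indicator {0..t} r *\<^sub>R (step m p f r * g r) =
      (\<Sum>i<m. f i * (indicator {p i<..p (Suc i)} r *\<^sub>R g r))" for r
  proof -
    have "indicator {0..t} r *\<^sub>R (step m p f r * g r) =
        (\<Sum>i<m. indicator {0..t} r * (f i * indicator {p i<..p (Suc i)} r * g r))"
      by (simp only: step_def sum_distrib_right sum_distrib_left real_scaleR_def)
    also have "\<dots> = (\<Sum>i<m. f i * (indicator {p i<..p (Suc i)} r *\<^sub>R g r))"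
    proof (intro sum.cong refl)
      fix i assume "i \<in> {..<m}"
      then have "r \<in> {p i<..p (Suc i)} \<Longrightarrow> r \<in> {0..t}" using sub[of i] by (auto simp del: greaterThanAtMost_iff)
      then show "indicator {0..t} r * (f i * indicator {p i<..p (Suc i)} r * g r) =
          f i * (indicator {p i<..p (Suc i)} r *\<^sub>R g r)"
        by (cases "r \<in> {p i<..p (Suc i)}") (simp_all add: indicator_def del: greaterThanAtMost_iff atLeastAtMost_iff)
    qed
    finally show ?thesis .
  qed
  show "set_integrable lborel {0..t} (\<lambda>r. step m p f r * g r)"
    unfolding set_integrable_def eq
    by (intro Bochner_Integration.integrable_sum integrable_mult_right)
      (use int in \<open>auto simp: set_integrable_def\<close>)
  show "(LINT r:{0..t}|lborel. step m p f r * g r) = (\<Sum>i<m. f i * (LINT r:{p i<..p (Suc i)}|lborel. g r))"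
    unfolding set_lebesgue_integral_def eq
    by (subst Bochner_Integration.integral_sum)
      (use int in \<open>auto simp: set_integrable_def intro!: integrable_mult_right\<close>)
qed

lemma step_integral:
  assumes p: "partition t m p"
  shows "set_integrable lborel {0..t} (step m p f)"
    and "(LINT r:{0..t}|lborel. step m p f r) = (\<Sum>i<m. f i * (p (Suc i) - p i))"
proof -
  have 1: "set_integrable lborel {0..t} (\<lambda>_. 1::real)"
    by (rule borel_integrable_atLeastAtMost') simp
  show "set_integrable lborel {0..t} (step m p f)"
    using step_times_integral(1)[OF p 1, of f] by simp
  have "(LINT r:{p i<..p (Suc i)}|lborel. 1::real) = p (Suc i) - p i" if "i < m" for i
    using p that by (simp add: set_lebesgue_integral_def partition_def)
  then show "(LINT r:{0..t}|lborel. step m p f r) = (\<Sum>i<m. f i * (p (Suc i) - p i))"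
    using step_times_integral(2)[OF p 1, of f] by simp
qed

definition fine_partitions :: "real \<Rightarrow> (nat \<Rightarrow> nat) \<Rightarrow> (nat \<Rightarrow> nat \<Rightarrow> real) \<Rightarrow> bool" where
  "fine_partitions t m p \<longleftrightarrow> (\<forall>n. partition t (m n) (p n)) \<and>
     (\<exists>h. h \<longlonglongrightarrow> 0 \<and> (\<forall>n. \<forall>i<m n. p n (Suc i) - p n i \<le> h n))"

lemma fine_partitionsD: "fine_partitions t m p \<Longrightarrow> partition t (m n) (p n)"
  by (simp add: fine_partitions_def)

lemma step_left_endpoint:
  assumes "partition t m p" "0 < r" "r \<le> t"
  shows "0 \<le> step m p p r \<and> step m p p r < r \<and> r \<le> step m p (\<lambda>i. p (Suc i)) r \<and> step m p (\<lambda>i. p (Suc i)) r \<le> t"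
proof -
  obtain i where i: "i < m" "p i < r" "r \<le> p (Suc i)" using partition_cell[OF assms] .
  then show ?thesis
    using step_cell[OF assms(1) i, of p] step_cell[OF assms(1) i, of "\<lambda>i. p (Suc i)"]
      partition_bounds[OF assms(1), of i] partition_bounds[OF assms(1), of "Suc i"] by auto
qed

lemma step_endpoints_tendsto:
  assumes "fine_partitions t m p" "0 < r" "r \<le> t"
  shows "(\<lambda>n. step (m n) (p n) (p n) r) \<longlonglongrightarrow> r"
    and "(\<lambda>n. step (m n) (p n) (\<lambda>i. p n (Suc i)) r) \<longlonglongrightarrow> r"
proof -
  obtain h where h: "h \<longlonglongrightarrow> 0" "\<And>n i. i < m n \<Longrightarrow> p n (Suc i) - p n i \<le> h n"
    and p: "\<And>n. partition t (m n) (p n)"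
    using assms(1) by (auto simp: fine_partitions_def)
  have b: "step (m n) (p n) (\<lambda>i. p n (Suc i)) r - step (m n) (p n) (p n) r \<le> h n" for n
  proof -
    obtain i where i: "i < m n" "p n i < r" "r \<le> p n (Suc i)" using partition_cell[OF p assms(2,3)] .
    then show ?thesis using step_cell[OF p i] h(2)[OF i(1)] by simp
  qed
  note s = step_left_endpoint[OF p assms(2,3)]
  have "norm (step (m n) (p n) (p n) r - r) \<le> h n" for n using b[of n] s[of n] by auto
  then have "(\<lambda>n. step (m n) (p n) (p n) r - r) \<longlonglongrightarrow> 0"
    by (intro Lim_null_comparison[OF _ h(1)]) auto
  then show "(\<lambda>n. step (m n) (p n) (p n) r) \<longlonglongrightarrow> r" by (simp add: LIM_zero_iff)
  have "norm (step (m n) (p n) (\<lambda>i. p n (Suc i)) r - r) \<le> h n" for n using b[of n] s[of n] by auto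
  then have "(\<lambda>n. step (m n) (p n) (\<lambda>i. p n (Suc i)) r - r) \<longlonglongrightarrow> 0"
    by (intro Lim_null_comparison[OF _ h(1)]) auto
  then show "(\<lambda>n. step (m n) (p n) (\<lambda>i. p n (Suc i)) r) \<longlonglongrightarrow> r" by (simp add: LIM_zero_iff)
qed

lemma partition_sum_lengths:
  assumes "partition t m p"
  shows "(\<Sum>j<m. p (Suc j) - p j) = t"
  using assms sum_lessThan_telescope[of p m] by (simp add: partition_def)

lemma riemann_sum_tendsto:
  fixes f :: "real \<Rightarrow> real"
  assumes fine: "fine_partitions t m p" and f: "continuous_on {0..t} f"
  shows "(\<lambda>n. \<Sum>i<m n. f (p n i) * (p n (Suc i) - p n i)) \<longlonglongrightarrow> (LINT r:{0..t}|lborel. f r)"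
proof -
  note p = fine_partitionsD[OF fine]
  obtain C where C: "0 \<le> C" "\<And>r. r \<in> {0..t} \<Longrightarrow> \<bar>f r\<bar> \<le> C" using continuous_on_Icc_bound[OF f] by auto
  have "(\<lambda>n. LINT r:{0<..t}|lborel. step (m n) (p n) (\<lambda>i. f (p n i)) r) \<longlonglongrightarrow> (LINT r:{0<..t}|lborel. f r)"
    unfolding set_lebesgue_integral_def
  proof (rule integral_dominated_convergence[where w="\<lambda>r. C * indicator {0<..t} r"])
    have "set_integrable lborel {0..t} f" by (rule borel_integrable_atLeastAtMost'[OF f])
    then have "set_integrable lborel {0<..t} f" by (rule set_integrable_subset) auto
    then show "(\<lambda>r. indicator {0<..t} r *\<^sub>R f r) \<in> borel_measurable lborel"
      unfolding set_integrable_def by auto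
    show "integrable lborel (\<lambda>r. C * indicator {0<..t} r)"
      by (rule integrable_indicator_Ioc)
    show "AE r in lborel. (\<lambda>n. indicator {0<..t} r *\<^sub>R step (m n) (p n) (\<lambda>i. f (p n i)) r) \<longlonglongrightarrow> indicator {0<..t} r *\<^sub>R f r"
    proof (rule AE_I2)
      fix r
      show "(\<lambda>n. indicator {0<..t} r *\<^sub>R step (m n) (p n) (\<lambda>i. f (p n i)) r) \<longlonglongrightarrow> indicator {0<..t} r *\<^sub>R f r"
      proof (cases "r \<in> {0<..t}")
        case True
        then have r: "0 < r" "r \<le> t" by auto
        have mem: "step (m n) (p n) (p n) r \<in> {0..t}" for n using step_left_endpoint[OF p r, of n] r by auto
        have "(\<lambda>n. f (step (m n) (p n) (p n) r)) \<longlonglongrightarrow> f r"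
          using mem r
          by (intro continuous_on_tendsto_compose[OF f step_endpoints_tendsto(1)[OF fine r]])
            (auto intro!: always_eventually)
        then show ?thesis using True step_compose[OF p r, of _ f] by simp
      qed simp
    qed
    show "AE r in lborel. norm (indicator {0<..t} r *\<^sub>R step (m n) (p n) (\<lambda>i. f (p n i)) r) \<le> C * indicator {0<..t} r" for n
    proof (rule AE_I2)
      fix r
      show "norm (indicator {0<..t} r *\<^sub>R step (m n) (p n) (\<lambda>i. f (p n i)) r) \<le> C * indicator {0<..t} r"
      proof (cases "r \<in> {0<..t}")
        case True
        then have r: "0 < r" "r \<le> t" by auto
        have "step (m n) (p n) (p n) r \<in> {0..t}" using step_left_endpoint[OF p r, of n] r by auto
        then show ?thesis using True step_compose[OF p r, of n f "p n"] C(2) by simp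
      qed simp
    qed
  qed measurable
  moreover have "(LINT r:{0<..t}|lborel. step (m n) (p n) (\<lambda>i. f (p n i)) r) =
      (\<Sum>i<m n. f (p n i) * (p n (Suc i) - p n i))" for n
    unfolding step_integral(2)[OF p, symmetric]
    by (rule set_integral_Ioc_Icc) (use step_measurable in \<open>simp add: set_borel_measurable_def\<close>)
  moreover have "(LINT r:{0<..t}|lborel. f r) = (LINT r:{0..t}|lborel. f r)"
    using borel_integrable_atLeastAtMost'[OF f]
    by (intro set_integral_Ioc_Icc) (auto simp: set_borel_measurable_def set_integrable_def)
  ultimately show ?thesis by simp
qed

text \<open>
  Merge the given points with an equidistant grid: the next point after \<open>p i\<close> is at most the next
  grid point.
\<close>

lemma ex_fine_partition:
  assumes t: "0 \<le> t" and A: "finite A" "A \<subseteq> {0..t}"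
  obtains m p where "partition t m p" "\<And>i. i < m \<Longrightarrow> p (Suc i) - p i \<le> t / real (Suc n)" "A \<subseteq> p ` {..m}"
proof -
  define A' where "A' = A \<union> {0, t} \<union> (\<lambda>i. t * real i / real (Suc n)) ` {..Suc n}"
  have fin: "finite A'" using A by (simp add: A'_def)
  have sub: "A' \<subseteq> {0..t}" using A t by (auto simp: A'_def divide_le_eq mult_left_mono intro!: mult_left_mono)
  define xs where "xs = sorted_list_of_set A'"
  have xs: "set xs = A'" "sorted xs" "distinct xs" using fin by (auto simp: xs_def)
  have ne: "xs \<noteq> []" using xs(1) by (auto simp: A'_def)
  define m where "m = length xs - 1"
  have len: "length xs = Suc m" using ne by (simp add: m_def)
  define p where "p i = xs ! i" for i
  have img: "p ` {..m} = A'"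
    using xs(1) len by (auto simp: p_def in_set_conv_nth image_iff less_Suc_eq_le)
  have mono: "p i \<le> p j" if "i \<le> j" "j \<le> m" for i j
    using sorted_nth_mono[OF xs(2)] that len by (auto simp: p_def)
  have bd: "p i \<in> {0..t}" if "i \<le> m" for i using img sub that by auto
  show thesis
  proof
    have "0 \<in> p ` {..m}" "t \<in> p ` {..m}" unfolding img by (auto simp: A'_def)
    then obtain i j where ij: "i \<le> m" "p i = 0" "j \<le> m" "p j = t" by auto
    have "p 0 = 0" using mono[of 0 i] ij bd[of 0] by auto
    moreover have "p m = t" using mono[of j m] ij bd[of m] by auto
    ultimately show "partition t m p" using mono by (auto simp: partition_def)
    show "A \<subseteq> p ` {..m}" unfolding img by (auto simp: A'_def)
    fix i assume i: "i < m"
    have lt: "p i < p (Suc i)"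
      using mono[of i "Suc i"] i xs(3) len nth_eq_iff_index_eq[OF xs(3), of i "Suc i"] by (auto simp: p_def)
    then have pit: "0 \<le> p i" "p i < t" using bd[of i] bd[of "Suc i"] i by auto
    define g where "g = nat \<lfloor>p i * real (Suc n) / t\<rfloor>"
    have g0: "0 \<le> p i * real (Suc n) / t" using pit by (intro divide_nonneg_nonneg mult_nonneg_nonneg) auto
    have g: "real g \<le> p i * real (Suc n) / t" "p i * real (Suc n) / t < real g + 1"
      unfolding g_def using g0 by linarith+
    have "real g < real (Suc n)"
    proof (rule le_less_trans[OF g(1)])
      show "p i * real (Suc n) / t < real (Suc n)" using pit by (simp add: divide_less_eq)
    qed
    then have "Suc g \<le> Suc n" by linarith
    then have "t * real (Suc g) / real (Suc n) \<in> A'"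
      unfolding A'_def by (intro UnI2 image_eqI[of _ _ "Suc g"]) auto
    then obtain k where k: "k \<le> m" "p k = t * real (Suc g) / real (Suc n)" unfolding img[symmetric] by auto
    have "p i < p k" using g(2) pit unfolding k(2) by (simp add: field_simps)
    then have "Suc i \<le> k" using mono[of k i] i by (metis Suc_leI leD less_imp_le not_le)
    then have "p (Suc i) \<le> p k" by (rule mono[OF _ k(1)])
    also have "p k \<le> p i + t / real (Suc n)"
    proof -
      have "t * real g \<le> p i * real (Suc n)" using g(1) pit by (simp add: field_simps)
      then have "t * real g / real (Suc n) \<le> p i" by (simp add: divide_le_eq)
      moreover have "t * real (Suc g) / real (Suc n) = t * real g / real (Suc n) + t / real (Suc n)"
        by (simp add: add_divide_distrib ring_distribs)
      ultimately show ?thesis unfolding k(2) by simp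
    qed
    finally show "p (Suc i) - p i \<le> t / real (Suc n)" by simp
  qed
qed

lemma ex_fine_partitions:
  assumes s: "0 \<le> s" and A: "\<And>n. finite (A n)" "\<And>n. A n \<subseteq> {0..s}"
  obtains m p where "fine_partitions s m p" "\<And>n. A n \<subseteq> p n ` {..m n}"
proof -
  have "\<exists>mp. partition s (fst mp) (snd mp) \<and> (\<forall>i<fst mp. snd mp (Suc i) - snd mp i \<le> s / real (Suc n)) \<and>
      A n \<subseteq> snd mp ` {..fst mp}" for n
  proof -
    obtain m p where "partition s m p" "\<And>i. i < m \<Longrightarrow> p (Suc i) - p i \<le> s / real (Suc n)" "A n \<subseteq> p ` {..m}"
      using ex_fine_partition[OF s A] by blast
    then show ?thesis by (intro exI[of _ "(m, p)"]) auto
  qed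
  then obtain mp where mp: "\<And>n. partition s (fst (mp n)) (snd (mp n))"
    "\<And>n i. i < fst (mp n) \<Longrightarrow> snd (mp n) (Suc i) - snd (mp n) i \<le> s / real (Suc n)"
    "\<And>n. A n \<subseteq> snd (mp n) ` {..fst (mp n)}" by metis
  have "(\<lambda>n. s * (1 / real (Suc n))) \<longlonglongrightarrow> s * 0"
    by (intro tendsto_intros LIMSEQ_Suc[OF lim_1_over_n])
  then have "(\<lambda>n. s / real (Suc n)) \<longlonglongrightarrow> 0" by simp
  then have "fine_partitions s (\<lambda>n. fst (mp n)) (\<lambda>n. snd (mp n))"
    unfolding fine_partitions_def using mp(1,2) by (intro conjI allI exI[of _ "\<lambda>n. s / real (Suc n)"]) auto
  then show thesis using mp(3) by (rule that)
qed

section \<open>Stochastic integrals as limits of Riemann sums\<close>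

lemma telescope_between:
  fixes f :: "real \<Rightarrow> real"
  assumes p: "partition t m p" and kl: "k \<le> m" "l \<le> m" "p k \<le> p l"
  shows "f (p l) - f (p k) =
    (\<Sum>j<m. indicator {p k<..p l} (p (Suc j)) * (f (p (Suc j)) - f (p j)))"
proof (cases "p k = p l")
  case False
  then have lt: "p k < p l" using kl by simp
  then have "k < l" using partition_mono[OF p, of l k] kl by (meson not_le)
  \<comment> \<open>A cell of positive length lies between \<open>p k\<close> and \<open>p l\<close> exactly when its index does; empty cells contribute nothing.\<close>
  have eq: "indicator {p k<..p l} (p (Suc j)) * (f (p (Suc j)) - f (p j)) =
      (if j \<in> {k..<l} then f (p (Suc j)) - f (p j) else 0)" if j: "j < m" for j
  proof (cases "p j = p (Suc j)")
    case False
    then have pj: "p j < p (Suc j)" using p j by (metis order_le_less partition_def)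
    have "p k < p (Suc j) \<longleftrightarrow> k \<le> j"
      using partition_mono[OF p, of "Suc j" k] partition_mono[OF p, of k j] kl pj j
      by (metis le_less_trans less_imp_le_nat not_less not_less_eq_eq)
    moreover have "p (Suc j) \<le> p l \<longleftrightarrow> j < l"
      using partition_mono[OF p, of "Suc j" l] partition_mono[OF p, of l j] kl pj j
      by (metis Suc_leI le_less_trans less_imp_le_nat not_less)
    ultimately show ?thesis by (auto simp: indicator_def)
  qed simp
  have "(\<Sum>j<m. indicator {p k<..p l} (p (Suc j)) * (f (p (Suc j)) - f (p j))) =
      (\<Sum>j<m. if j \<in> {k..<l} then f (p (Suc j)) - f (p j) else 0)"
    using eq by (intro sum.cong) auto
  also have "\<dots> = (\<Sum>j\<in>{..<m} \<inter> {k..<l}. f (p (Suc j)) - f (p j))"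
    by (subst sum.inter_restrict) auto
  also have "{..<m} \<inter> {k..<l} = {k..<l}" using kl by auto
  also have "(\<Sum>j\<in>{k..<l}. f (p (Suc j)) - f (p j)) = f (p l) - f (p k)"
    using sum_Suc_diff'[of k l "\<lambda>j. f (p j)"] \<open>k < l\<close> by simp
  finally show ?thesis by simp
qed simp

text \<open>
  A simple process whose jump times, cut at \<open>t\<close>, are points of a partition is constant on each cell.
  Its value on a cell is then known at the left end, and its integral up to \<open>t\<close> is a sum over the cells.
  In this form two simple processes with different jump times can be subtracted.
\<close>

context
  fixes N :: nat and \<tau> :: "nat \<Rightarrow> real" and \<eta> :: "nat \<Rightarrow> 'a \<Rightarrow> real" and t :: real and m :: nat
    and p :: "nat \<Rightarrow> real"
  assumes p: "partition t m p" and \<tau>0: "0 \<le> \<tau> 0" and \<tau>_mono: "\<And>i. i < N \<Longrightarrow> \<tau> i \<le> \<tau> (Suc i)"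
    and merged: "\<And>i. i \<le> N \<Longrightarrow> min t (\<tau> i) \<in> p ` {..m}"
begin

lemma merged_indicator:
  assumes "i < N" "r \<le> t"
  shows "indicator {\<tau> i<..\<tau> (Suc i)} r = (indicator {min t (\<tau> i)<..min t (\<tau> (Suc i))} r :: real)"
  using assms by (auto simp: indicator_def)

lemma merged_index: "i \<le> N \<Longrightarrow> \<exists>k\<le>m. min t (\<tau> i) = p k"
  using merged[of i] by auto

lemma merged_simple_integral:
  "simple_integral_wrt B (N, \<tau>, \<eta>) t \<omega> =
    (\<Sum>j<m. simple_value (N, \<tau>, \<eta>) (p (Suc j)) \<omega> * (B (p (Suc j)) \<omega> - B (p j) \<omega>))"
proof -
  have "B (min t (\<tau> (Suc i))) \<omega> - B (min t (\<tau> i)) \<omega> =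
      (\<Sum>j<m. indicator {\<tau> i<..\<tau> (Suc i)} (p (Suc j)) * (B (p (Suc j)) \<omega> - B (p j) \<omega>))" if i: "i < N" for i
  proof -
    obtain k l where k: "k \<le> m" "min t (\<tau> i) = p k" and l: "l \<le> m" "min t (\<tau> (Suc i)) = p l"
      using merged_index[of i] merged_index[of "Suc i"] i by auto
    have "p k \<le> p l" unfolding k(2)[symmetric] l(2)[symmetric] using \<tau>_mono[OF i] by auto
    from telescope_between[OF p k(1) l(1) this, of "\<lambda>s. B s \<omega>"]
    have "B (p l) \<omega> - B (p k) \<omega> = (\<Sum>j<m. indicator {p k<..p l} (p (Suc j)) * (B (p (Suc j)) \<omega> - B (p j) \<omega>))" .
    also have "\<dots> = (\<Sum>j<m. indicator {\<tau> i<..\<tau> (Suc i)} (p (Suc j)) * (B (p (Suc j)) \<omega> - B (p j) \<omega>))"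
      using merged_indicator[OF i] partition_bounds[OF p]
      by (intro sum.cong) (auto simp: k(2)[symmetric] l(2)[symmetric] simp del: of_bool_eq_iff)
    finally show ?thesis by (simp add: k l)
  qed
  then have "simple_integral_wrt B (N, \<tau>, \<eta>) t \<omega> =
      (\<Sum>i<N. \<Sum>j<m. \<eta> i \<omega> * indicator {\<tau> i<..\<tau> (Suc i)} (p (Suc j)) * (B (p (Suc j)) \<omega> - B (p j) \<omega>))"
    unfolding simple_integral_wrt_def prod.case mult.assoc sum_distrib_left[symmetric]
    by (intro sum.cong refl arg_cong2[where f="(*)"]) (simp only: lessThan_iff)
  also have "\<dots> = (\<Sum>j<m. \<Sum>i<N. \<eta> i \<omega> * indicator {\<tau> i<..\<tau> (Suc i)} (p (Suc j)) * (B (p (Suc j)) \<omega> - B (p j) \<omega>))"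
    by (rule sum.swap)
  finally show ?thesis unfolding simple_value_def prod.case sum_distrib_right .
qed

lemma merged_simple_value:
  assumes j: "j < m" and r: "p j < r" "r \<le> p (Suc j)"
  shows "simple_value (N, \<tau>, \<eta>) r \<omega> = simple_value (N, \<tau>, \<eta>) (p (Suc j)) \<omega>"
proof -
  have cut: "min t (\<tau> i) < r \<longleftrightarrow> min t (\<tau> i) < p (Suc j)" if i: "i \<le> N" for i
  proof -
    obtain k where k: "k \<le> m" "min t (\<tau> i) = p k" using merged_index[OF i] by auto
    show ?thesis unfolding k(2)
      using partition_mono[OF p, of k j] partition_mono[OF p, of "Suc j" k] j r k(1)
      by (metis le_less_trans less_le_trans not_less not_less_eq_eq less_imp_le_nat)
  qed
  have rt: "r \<le> t" "p (Suc j) \<le> t" using r partition_bounds[OF p, of "Suc j"] j by auto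
  have "indicator {\<tau> i<..\<tau> (Suc i)} r = (indicator {\<tau> i<..\<tau> (Suc i)} (p (Suc j)) :: real)" if i: "i < N" for i
    unfolding merged_indicator[OF i rt(1)] merged_indicator[OF i rt(2)]
    using cut[of i] cut[of "Suc i"] i unfolding indicator_def by (simp add: not_less[symmetric])
  then show ?thesis
    unfolding simple_value_def prod.case
    by (intro sum.cong refl arg_cong2[where f="(*)"]) (simp only: lessThan_iff)
qed

lemma merged_simple_value_measurable:
  assumes j: "j < m" and meas: "\<And>i. i < N \<Longrightarrow> \<tau> i \<le> p j \<Longrightarrow> \<eta> i \<in> borel_measurable G"
  shows "(\<lambda>\<omega>. simple_value (N, \<tau>, \<eta>) (p (Suc j)) \<omega>) \<in> borel_measurable G"
  unfolding simple_value_def prod.case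
proof (rule borel_measurable_sum)
  fix i assume "i \<in> {..<N}"
  then have i: "i < N" by simp
  show "(\<lambda>\<omega>. \<eta> i \<omega> * indicator {\<tau> i<..\<tau> (Suc i)} (p (Suc j))) \<in> borel_measurable G"
  proof (cases "p (Suc j) \<in> {\<tau> i<..\<tau> (Suc i)}")
    case True
    obtain k where k: "k \<le> m" "min t (\<tau> i) = p k" using merged_index[of i] i by auto
    have lt: "\<tau> i < p (Suc j)" "p (Suc j) \<le> t" using True partition_bounds[OF p, of "Suc j"] j by auto
    then have pk: "p k = \<tau> i" using k(2) by simp
    have "k \<le> j" using partition_mono[OF p, of "Suc j" k] lt pk k(1) by (metis not_less not_less_eq_eq)
    then have "\<tau> i \<le> p j" using partition_mono[OF p, of k j] j pk by simp
    then show ?thesis using meas[OF i] by simp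
  qed simp
qed

end

context brownian_basis
begin

text \<open>
  The coefficients are cut off as soon as the running quadratic sum would exceed \<open>\<kappa>\<close>; this is a
  decision that can be taken at the left end of each interval. The cut sums have second moment at
  most \<open>\<kappa>\<close>, and they coincide with the original ones unless the total quadratic sum exceeds \<open>\<kappa>\<close>.
\<close>

lemma increment_sum_tail:
  fixes p :: "nat \<Rightarrow> real" and a :: "nat \<Rightarrow> 'a \<Rightarrow> real"
  assumes p: "\<And>i. i < n \<Longrightarrow> 0 \<le> p i" "\<And>i. i < n \<Longrightarrow> p i \<le> p (Suc i)"
    and a: "\<And>i. i < n \<Longrightarrow> a i \<in> borel_measurable (F (p i))"
    and pos: "0 < \<epsilon>" "0 < \<kappa>"
  shows "prob {\<omega> \<in> space M. \<epsilon> < \<bar>\<Sum>i<n. a i \<omega> * (B (p (Suc i)) \<omega> - B (p i) \<omega>)\<bar>}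
    \<le> \<kappa> / \<epsilon>\<^sup>2 + prob {\<omega> \<in> space M. \<kappa> < (\<Sum>i<n. (a i \<omega>)\<^sup>2 * (p (Suc i) - p i))}"
proof -
  define Q where "Q k \<omega> = (\<Sum>i<k. (a i \<omega>)\<^sup>2 * (p (Suc i) - p i))" for k \<omega>
  define b where "b i \<omega> = (if p i < p (Suc i) \<and> Q (Suc i) \<omega> \<le> \<kappa> then a i \<omega> else 0)" for i \<omega>
  define dB where "dB i \<omega> = B (p (Suc i)) \<omega> - B (p i) \<omega>" for i \<omega>
  have mono: "p i \<le> p j" if "i \<le> j" "j \<le> n" for i j
    using steps_mono[of n p] p(2) that by auto
  have aM[measurable]: "i < n \<Longrightarrow> a i \<in> borel_measurable M" for i
    using a p by (auto intro: measurable_F_M)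
  have aF: "a i \<in> borel_measurable (F (p j))" if "i \<le> j" "j < n" for i j
    using measurable_F_mono[OF a[of i] p(1)[of i] mono[of i j]] that by auto
  have bF: "b i \<in> borel_measurable (F (p i))" if i: "i < n" for i
  proof -
    have [measurable]: "Q (Suc i) \<in> borel_measurable (F (p i))"
      unfolding Q_def[abs_def] using i
      by (intro borel_measurable_sum borel_measurable_times borel_measurable_power borel_measurable_const aF)
        (simp_all add: less_Suc_eq_le)
    note [measurable] = a[OF i]
    show ?thesis unfolding b_def[abs_def] by measurable
  qed
  have Qmono: "Q k \<omega> \<le> Q l \<omega>" if "k \<le> l" "l \<le> n" for k l \<omega>
    unfolding Q_def using that p(2) by (intro sum_mono2) auto
  have bsum: "(\<Sum>i<k. (b i \<omega>)\<^sup>2 * (p (Suc i) - p i)) \<le> \<kappa>" if "k \<le> n" for k \<omega>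
    using that
  proof (induction k)
    case 0 then show ?case using pos by simp
  next
    case (Suc k)
    show ?case
    proof (cases "Q (Suc k) \<omega> \<le> \<kappa>")
      case True
      have "(\<Sum>i<Suc k. (b i \<omega>)\<^sup>2 * (p (Suc i) - p i)) \<le> Q (Suc k) \<omega>"
        unfolding Q_def b_def using Suc.prems p(2) by (intro sum_mono mult_right_mono) auto
      then show ?thesis using True by simp
    next
      case False
      then have "b k \<omega> = 0" by (simp add: b_def)
      then show ?thesis using Suc by simp
    qed
  qed
  have int_b: "integrable M (\<lambda>\<omega>. (b i \<omega>)\<^sup>2)" if i: "i < n" for i
  proof (cases "p i < p (Suc i)")
    case True
    have "(b i \<omega>)\<^sup>2 * (p (Suc i) - p i) \<le> \<kappa>" for \<omega>
    proof -
      have "(b i \<omega>)\<^sup>2 * (p (Suc i) - p i) \<le> (\<Sum>i<n. (b i \<omega>)\<^sup>2 * (p (Suc i) - p i))"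
        using i p(2) by (intro member_le_sum) auto
      then show ?thesis using bsum[of n \<omega>] by simp
    qed
    then have "(b i \<omega>)\<^sup>2 \<le> \<kappa> / (p (Suc i) - p i)" for \<omega>
      using True by (simp add: pos_le_divide_eq)
    moreover have "b i \<in> borel_measurable M" using bF[OF i] p(1)[OF i] by (rule measurable_F_M)
    ultimately show ?thesis by (intro integrable_const_bound[where B="\<kappa> / (p (Suc i) - p i)"]) auto
  next
    case False then show ?thesis by (simp add: b_def)
  qed
  have bM[measurable]: "i < n \<Longrightarrow> b i \<in> borel_measurable M" for i
    using bF p by (auto intro: measurable_F_M)
  have dBM[measurable]: "i < n \<Longrightarrow> dB i \<in> borel_measurable M" for i
    unfolding dB_def[abs_def] using B_measurable[of "p i"] B_measurable[of "p (Suc i)"] p[of i] by auto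
  have dB: "integrable M (dB i)" "expectation (dB i) = 0" "integrable M (\<lambda>\<omega>. (dB i \<omega>)\<^sup>2)"
    "expectation (\<lambda>\<omega>. (dB i \<omega>)\<^sup>2) = p (Suc i) - p i" if "i < n" for i
    using increment_moments[OF p(1)[OF that] p(2)[OF that]] by (auto simp: dB_def[abs_def])
  have orth: "integrable M (\<lambda>\<omega>. (\<Sum>i<n. b i \<omega> * dB i \<omega>)\<^sup>2)"
    "expectation (\<lambda>\<omega>. (\<Sum>i<n. b i \<omega> * dB i \<omega>)\<^sup>2) = (\<Sum>i<n. expectation (\<lambda>\<omega>. (b i \<omega>)\<^sup>2) * expectation (\<lambda>\<omega>. (dB i \<omega>)\<^sup>2))"
    using orthogonal_increments[of n p b "\<lambda>_ x. x"] p bF int_b dB unfolding dB_def by auto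
  have "expectation (\<lambda>\<omega>. (\<Sum>i<n. b i \<omega> * dB i \<omega>)\<^sup>2) = expectation (\<lambda>\<omega>. \<Sum>i<n. (b i \<omega>)\<^sup>2 * (p (Suc i) - p i))"
    unfolding orth(2) using int_b dB by (subst Bochner_Integration.integral_sum) auto
  also have "\<dots> \<le> expectation (\<lambda>\<omega>. \<kappa>)"
    using int_b bsum by (intro integral_mono) auto
  finally have E: "expectation (\<lambda>\<omega>. (\<Sum>i<n. b i \<omega> * dB i \<omega>)\<^sup>2) \<le> \<kappa>" by (simp add: prob_space)
  have same: "(\<Sum>i<n. a i \<omega> * dB i \<omega>) = (\<Sum>i<n. b i \<omega> * dB i \<omega>)" if "Q n \<omega> \<le> \<kappa>" for \<omega>
  proof (rule sum.cong[OF refl])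
    fix i assume "i \<in> {..<n}"
    then have i: "i < n" by simp
    have "Q (Suc i) \<omega> \<le> \<kappa>" using Qmono[of "Suc i" n \<omega>] i that by simp
    then show "a i \<omega> * dB i \<omega> = b i \<omega> * dB i \<omega>"
      using p(2)[OF i] by (cases "p i = p (Suc i)") (auto simp: b_def dB_def)
  qed
  have SM: "(\<lambda>\<omega>. \<Sum>i<n. b i \<omega> * dB i \<omega>) \<in> borel_measurable M" "(\<lambda>\<omega>. \<Sum>i<n. a i \<omega> * dB i \<omega>) \<in> borel_measurable M"
    "Q n \<in> borel_measurable M"
    unfolding Q_def[abs_def] by (auto intro!: borel_measurable_sum)
  have "prob {\<omega> \<in> space M. \<epsilon> < \<bar>\<Sum>i<n. a i \<omega> * dB i \<omega>\<bar>}
      \<le> prob ({\<omega> \<in> space M. \<epsilon>\<^sup>2 \<le> (\<Sum>i<n. b i \<omega> * dB i \<omega>)\<^sup>2} \<union> {\<omega> \<in> space M. \<kappa> < Q n \<omega>})"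
  proof (rule finite_measure_mono)
    show "{\<omega> \<in> space M. \<epsilon> < \<bar>\<Sum>i<n. a i \<omega> * dB i \<omega>\<bar>}
      \<subseteq> {\<omega> \<in> space M. \<epsilon>\<^sup>2 \<le> (\<Sum>i<n. b i \<omega> * dB i \<omega>)\<^sup>2} \<union> {\<omega> \<in> space M. \<kappa> < Q n \<omega>}"
      using same pos by (auto simp: abs_le_square_iff[symmetric] not_less)
  qed (use SM in measurable)
  also have "\<dots> \<le> prob {\<omega> \<in> space M. \<epsilon>\<^sup>2 \<le> (\<Sum>i<n. b i \<omega> * dB i \<omega>)\<^sup>2} + prob {\<omega> \<in> space M. \<kappa> < Q n \<omega>}"
    using SM by (intro measure_Un_le) measurable
  also have "prob {\<omega> \<in> space M. \<epsilon>\<^sup>2 \<le> (\<Sum>i<n. b i \<omega> * dB i \<omega>)\<^sup>2} \<le> expectation (\<lambda>\<omega>. (\<Sum>i<n. b i \<omega> * dB i \<omega>)\<^sup>2) / \<epsilon>\<^sup>2"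
    using pos orth(1) by (intro integral_Markov_inequality_measure[where A="{}"]) auto
  also have "\<dots> \<le> \<kappa> / \<epsilon>\<^sup>2" using E by (intro divide_right_mono) auto
  finally show ?thesis unfolding Q_def dB_def by simp
qed

lemma increment_sums_null:
  fixes p :: "nat \<Rightarrow> nat \<Rightarrow> real" and a :: "nat \<Rightarrow> nat \<Rightarrow> 'a \<Rightarrow> real" and m :: "nat \<Rightarrow> nat"
  assumes p: "\<And>n i. i < m n \<Longrightarrow> 0 \<le> p n i" "\<And>n i. i < m n \<Longrightarrow> p n i \<le> p n (Suc i)"
    and a: "\<And>n i. i < m n \<Longrightarrow> a n i \<in> borel_measurable (F (p n i))"
    and null: "null_in_prob (\<lambda>n \<omega>. \<Sum>i<m n. (a n i \<omega>)\<^sup>2 * (p n (Suc i) - p n i))"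
  shows "null_in_prob (\<lambda>n \<omega>. \<Sum>i<m n. a n i \<omega> * (B (p n (Suc i)) \<omega> - B (p n i) \<omega>))"
proof (rule null_in_probI_prob)
  show "(\<lambda>\<omega>. \<Sum>i<m n. a n i \<omega> * (B (p n (Suc i)) \<omega> - B (p n i) \<omega>)) \<in> borel_measurable M" for n
  proof (intro borel_measurable_sum borel_measurable_times borel_measurable_diff)
    fix i assume "i \<in> {..<m n}"
    then have i: "i < m n" by simp
    show "a n i \<in> borel_measurable M" by (rule measurable_F_M[OF a[OF i] p(1)[OF i]])
    show "B (p n (Suc i)) \<in> borel_measurable M" "B (p n i) \<in> borel_measurable M"
      using B_measurable p[OF i] by auto
  qed
  fix \<epsilon> :: real assume \<epsilon>: "0 < \<epsilon>"
  let ?P = "\<lambda>n. prob {\<omega> \<in> space M. \<epsilon> < \<bar>\<Sum>i<m n. a n i \<omega> * (B (p n (Suc i)) \<omega> - B (p n i) \<omega>)\<bar>}"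
  let ?Q = "\<lambda>n \<omega>. \<Sum>i<m n. (a n i \<omega>)\<^sup>2 * (p n (Suc i) - p n i)"
  show "?P \<longlonglongrightarrow> 0"
  proof (rule LIMSEQ_I)
    fix r :: real assume r: "0 < r"
    define \<kappa> where "\<kappa> = \<epsilon>\<^sup>2 * r / 2"
    have \<kappa>: "0 < \<kappa>" "\<kappa> / \<epsilon>\<^sup>2 = r / 2" using r \<epsilon> by (auto simp: \<kappa>_def)
    obtain no where no: "\<And>n. n \<ge> no \<Longrightarrow> norm (prob {\<omega> \<in> space M. \<kappa> < \<bar>?Q n \<omega>\<bar>} - 0) < r / 2"
      using LIMSEQ_D[OF null_in_prob_prob[OF null \<kappa>(1)], of "r/2"] r by auto
    have "?Q n \<omega> \<ge> 0" for n \<omega> using p(2) by (intro sum_nonneg mult_nonneg_nonneg) auto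
    then have abs: "\<bar>?Q n \<omega>\<bar> = ?Q n \<omega>" for n \<omega> by simp
    show "\<exists>no. \<forall>n\<ge>no. norm (?P n - 0) < r"
    proof (intro exI[of _ no] allI impI)
      fix n assume "n \<ge> no"
      have "?P n \<le> \<kappa> / \<epsilon>\<^sup>2 + prob {\<omega> \<in> space M. \<kappa> < ?Q n \<omega>}"
        by (rule increment_sum_tail) (use p a \<epsilon> \<kappa> in auto)
      then show "norm (?P n - 0) < r" using no[OF \<open>n \<ge> no\<close>] \<kappa> unfolding abs by simp
    qed
  qed
qed

text \<open>
  On a partition refining the jump times of \<open>S n\<close>, the integral of \<open>S n\<close> and the Riemann sum of \<open>X\<close>
  differ by a sum of increments with coefficients \<open>S n - X\<close> evaluated cell by cell. Their quadratic
  sum is at most twice the squared distance of \<open>S n\<close> and \<open>X\<close> plus twice that of \<open>X\<close> from its own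
  discretization; the first vanishes by assumption, the second by continuity of the paths.
\<close>

lemma riemann_sums_null:
  fixes X :: "real \<Rightarrow> 'a \<Rightarrow> real" and S :: "nat \<Rightarrow> 'a simple_process"
  assumes t: "0 \<le> t"
    and X: "\<And>s. 0 \<le> s \<Longrightarrow> s \<le> t \<Longrightarrow> X s \<in> borel_measurable (F s)"
      "\<And>\<omega>. \<omega> \<in> space M \<Longrightarrow> continuous_on {0..t} (\<lambda>s. X s \<omega>)"
    and S: "\<And>n. simple_process M F (S n)"
    and approx: "vanishes_in_probability M
       (\<lambda>n \<omega>. \<integral>\<^sup>+s\<in>{0..t}. ennreal ((simple_value (S n) s \<omega> - X s \<omega>)\<^sup>2) \<partial>lborel)"
    and limit: "vanishes_in_probability M
       (\<lambda>n \<omega>. ennreal \<bar>simple_integral_wrt B (S n) t \<omega> - I \<omega>\<bar>)"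
    and I: "I \<in> borel_measurable M"
    and fine: "fine_partitions t m p"
    and merged: "\<And>n i. i \<le> fst (S n) \<Longrightarrow> min t (fst (snd (S n)) i) \<in> p n ` {..m n}"
  shows "null_in_prob (\<lambda>n \<omega>. (\<Sum>j<m n. X (p n j) \<omega> * (B (p n (Suc j)) \<omega> - B (p n j) \<omega>)) - I \<omega>)"
proof -
  note p = fine_partitionsD[OF fine]
  have pb: "0 \<le> p n j" "p n j \<le> t" if "j \<le> m n" for n j
    using partition_bounds[OF p that] by auto
  have pm: "p n j \<le> p n (Suc j)" if "j < m n" for n j using p[of n] that by (auto simp: partition_def)
  define V where "V n = simple_value (S n)" for n
  define a where "a n j \<omega> = V n (p n (Suc j)) \<omega> - X (p n j) \<omega>" for n j \<omega>
  define Q where "Q n \<omega> = (\<Sum>j<m n. (a n j \<omega>)\<^sup>2 * (p n (Suc j) - p n j))" for n \<omega>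
  define U where "U n \<omega> = (\<integral>\<^sup>+s\<in>{0..t}. ennreal ((V n s \<omega> - X s \<omega>)\<^sup>2) \<partial>lborel)" for n \<omega>
  define E where "E n \<omega> r = (X (max 0 (min t r)) \<omega> - step (m n) (p n) (\<lambda>j. X (p n j) \<omega>) r)\<^sup>2" for n \<omega> r
  define W where "W n \<omega> = (LINT r:{0..t}|lborel. E n \<omega> r)" for n \<omega>
  have XM[measurable]: "X s \<in> borel_measurable M" if "0 \<le> s" "s \<le> t" for s
    using X(1)[OF that] that by (auto intro: measurable_F_M)
  have Sform: "\<exists>N \<tau> \<eta>. S n = (N, \<tau>, \<eta>)" for n by (metis prod.exhaust)
  have VF: "V n (p n (Suc j)) \<in> borel_measurable (F (p n j))" if j: "j < m n" for n j
  proof -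
    obtain N \<tau> \<eta> where Sn: "S n = (N, \<tau>, \<eta>)" using Sform by blast
    have sp: "0 \<le> \<tau> 0" "\<And>i. i < N \<Longrightarrow> \<tau> i \<le> \<tau> (Suc i)" "\<And>i. i < N \<Longrightarrow> \<eta> i \<in> borel_measurable (F (\<tau> i))"
      using S[of n] unfolding Sn simple_process_def by auto
    have \<tau>0: "0 \<le> \<tau> i" if "i \<le> N" for i
      using steps_mono[of N \<tau> 0 i] sp(1,2) that by force
    show ?thesis unfolding V_def Sn
    proof (rule merged_simple_value_measurable[OF p[of n] sp(1,2) _ j])
      fix i assume "i \<le> N" then show "min t (\<tau> i) \<in> p n ` {..m n}" using merged[of i n] by (simp add: Sn)
    next
      fix i assume i: "i < N" "\<tau> i \<le> p n j"
      then show "\<eta> i \<in> borel_measurable (F (p n j))"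
        using measurable_F_mono[OF sp(3)[OF i(1)], of "p n j"] \<tau>0[of i] by simp
    qed
  qed
  have aF: "a n j \<in> borel_measurable (F (p n j))" if j: "j < m n" for n j
    using VF[OF j] X(1)[of "p n j"] pb[of j n] j unfolding a_def[abs_def] by auto
  have aM: "a n j \<in> borel_measurable M" if j: "j < m n" for n j
    using aF[OF j] pb[of j n] j by (auto intro: measurable_F_M)
  have BM: "B (p n j) \<in> borel_measurable M" if "j \<le> m n" for n j using B_measurable pb(1)[OF that] by auto
  have QM: "Q n \<in> borel_measurable M" for n
    unfolding Q_def[abs_def] using aM by (intro borel_measurable_sum) auto
  have integral: "simple_integral_wrt B (S n) t \<omega> =
      (\<Sum>j<m n. V n (p n (Suc j)) \<omega> * (B (p n (Suc j)) \<omega> - B (p n j) \<omega>))" for n \<omega>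
  proof -
    obtain N \<tau> \<eta> where Sn: "S n = (N, \<tau>, \<eta>)" using Sform by blast
    show ?thesis unfolding V_def Sn
    proof (rule merged_simple_integral[OF p[of n]])
      show "0 \<le> \<tau> 0" "\<And>i. i < N \<Longrightarrow> \<tau> i \<le> \<tau> (Suc i)" using S[of n] unfolding Sn simple_process_def by auto
      fix i assume "i \<le> N" then show "min t (\<tau> i) \<in> p n ` {..m n}" using merged[of i n] by (simp add: Sn)
    qed
  qed
  \<comment> \<open>On each cell the simple process equals its value at the right end.\<close>
  have Vstep: "V n r \<omega> = step (m n) (p n) (\<lambda>j. V n (p n (Suc j)) \<omega>) r" if r: "0 < r" "r \<le> t" for n r \<omega>
  proof -
    obtain N \<tau> \<eta> where Sn: "S n = (N, \<tau>, \<eta>)" using Sform by blast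
    obtain j where j: "j < m n" "p n j < r" "r \<le> p n (Suc j)" using partition_cell[OF p r] .
    have "V n r \<omega> = V n (p n (Suc j)) \<omega>" unfolding V_def Sn
    proof (rule merged_simple_value[OF p[of n] _ _ _ j])
      show "0 \<le> \<tau> 0" "\<And>i. i < N \<Longrightarrow> \<tau> i \<le> \<tau> (Suc i)" using S[of n] unfolding Sn simple_process_def by auto
      fix i assume "i \<le> N" then show "min t (\<tau> i) \<in> p n ` {..m n}" using merged[of i n] by (simp add: Sn)
    qed
    then show ?thesis using step_cell[OF p j] by simp
  qed
  have Vmeas[measurable]: "(\<lambda>r. V n r \<omega>) \<in> borel_measurable borel" for n \<omega>
  proof -
    obtain N \<tau> \<eta> where Sn: "S n = (N, \<tau>, \<eta>)" using Sform by blast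
    show ?thesis unfolding V_def Sn simple_value_def prod.case by measurable
  qed
  have X'[measurable]: "(\<lambda>(\<omega>, s). X (max 0 (min t s)) \<omega>) \<in> borel_measurable (M \<Otimes>\<^sub>M borel)"
    by (rule continuous_process_measurable[OF t XM X(2)])
  have X'path: "(\<lambda>s. X (max 0 (min t s)) \<omega>) \<in> borel_measurable borel" if "\<omega> \<in> space M" for \<omega>
    using measurable_Pair2[OF X' that] by simp
  have EM: "(\<lambda>(\<omega>, r). E n \<omega> r) \<in> borel_measurable (M \<Otimes>\<^sub>M borel)" for n
  proof -
    have "(\<lambda>z. step (m n) (p n) (\<lambda>j. X (p n j) (fst z)) (snd z)) \<in> borel_measurable (M \<Otimes>\<^sub>M borel)"
      unfolding step_def
    proof (rule borel_measurable_sum)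
      fix j assume "j \<in> {..<m n}"
      then have [measurable]: "X (p n j) \<in> borel_measurable M" using pb[of j n] by auto
      show "(\<lambda>z. X (p n j) (fst z) * indicator {p n j<..p n (Suc j)} (snd z)) \<in> borel_measurable (M \<Otimes>\<^sub>M borel)"
        by measurable
    qed
    then show ?thesis using X' unfolding E_def case_prod_beta by simp
  qed
  have WM: "W n \<in> borel_measurable M" for n
  proof -
    have "(\<lambda>z. indicator {0..t} (snd z) *\<^sub>R E n (fst z) (snd z)) \<in> borel_measurable (M \<Otimes>\<^sub>M lborel)"
      using EM[of n] by (simp add: case_prod_beta)
    then show ?thesis unfolding W_def[abs_def] set_lebesgue_integral_def
      by (intro sigma_finite_measure.borel_measurable_lebesgue_integral[OF sigma_finite_lborel])
        (simp add: case_prod_beta)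
  qed
  have Epath: "(\<lambda>r. E n \<omega> r) \<in> borel_measurable borel" if "\<omega> \<in> space M" for n \<omega>
    using measurable_Pair2[OF EM that] by simp
  have E_bound: "\<exists>C\<ge>0. \<forall>n. \<forall>r\<in>{0..t}. E n \<omega> r \<le> C" if \<omega>: "\<omega> \<in> space M" for \<omega>
  proof -
    obtain C where C: "0 \<le> C" "\<And>r. r \<in> {0..t} \<Longrightarrow> \<bar>X r \<omega>\<bar> \<le> C" using continuous_on_Icc_bound[OF X(2)[OF \<omega>]] by auto
    have "E n \<omega> r \<le> (2 * C)\<^sup>2" if r: "r \<in> {0..t}" for n r
    proof -
      have "\<bar>step (m n) (p n) (\<lambda>j. X (p n j) \<omega>) r\<bar> \<le> C"
      proof (cases "r = 0")
        case True
        then have "step (m n) (p n) (\<lambda>j. X (p n j) \<omega>) r = 0"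
          unfolding step_def
        proof (intro sum.neutral ballI)
          fix j assume "j \<in> {..<m n}"
          then have "0 \<le> p n j" using pb(1)[of j n] by simp
          then show "X (p n j) \<omega> * indicator {p n j<..p n (Suc j)} r = 0"
            using True by (simp add: indicator_def)
        qed
        then show ?thesis using C by simp
      next
        case False
        then have r': "0 < r" "r \<le> t" using r by auto
        have "step (m n) (p n) (p n) r \<in> {0..t}" using step_left_endpoint[OF p r', of n] r by auto
        then show ?thesis using step_compose[OF p r', of n "\<lambda>s. X s \<omega>" "p n"] C(2) by simp
      qed
      moreover have "\<bar>X (max 0 (min t r)) \<omega>\<bar> \<le> C" using C(2)[of r] r by simp
      ultimately have "\<bar>X (max 0 (min t r)) \<omega> - step (m n) (p n) (\<lambda>j. X (p n j) \<omega>) r\<bar> \<le> \<bar>2 * C\<bar>" by linarith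
      then show ?thesis unfolding E_def by (simp only: abs_le_square_iff)
    qed
    then show ?thesis by (intro exI[of _ "(2 * C)\<^sup>2"]) auto
  qed
  have E_int: "set_integrable lborel {0..t} (E n \<omega>)" if \<omega>: "\<omega> \<in> space M" for n \<omega>
  proof -
    obtain C where C: "C \<ge> 0" "\<forall>n. \<forall>r\<in>{0..t}. E n \<omega> r \<le> C" using E_bound[OF \<omega>] by auto
    have "E n \<omega> r \<ge> 0" for r by (simp add: E_def)
    then show ?thesis
      using C by (intro set_integrable_bound[OF borel_integrable_atLeastAtMost'[of 0 t "\<lambda>_. C"]])
        (use Epath[OF \<omega>, of n] in \<open>simp_all add: set_borel_measurable_def\<close>)
  qed
  have Wlim: "(\<lambda>n. W n \<omega>) \<longlonglongrightarrow> 0" if \<omega>: "\<omega> \<in> space M" for \<omega>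
  proof -
    obtain C where C: "C \<ge> 0" "\<And>n r. r \<in> {0..t} \<Longrightarrow> E n \<omega> r \<le> C" using E_bound[OF \<omega>] by auto
    have "W n \<omega> = (LINT r:{0<..t}|lborel. E n \<omega> r)" for n
      unfolding W_def
      by (rule set_integral_Ioc_Icc[symmetric]) (use Epath[OF \<omega>, of n] in \<open>simp add: set_borel_measurable_def\<close>)
    moreover have "(\<lambda>n. LINT r:{0<..t}|lborel. E n \<omega> r) \<longlonglongrightarrow> (LINT r:{0<..t}|lborel. 0)"
      unfolding set_lebesgue_integral_def
    proof (rule integral_dominated_convergence[where w="\<lambda>r. C * indicator {0<..t} r"])
      show "integrable lborel (\<lambda>r. C * indicator {0<..t} r)"
        by (rule integrable_indicator_Ioc)
      show "AE r in lborel. (\<lambda>n. indicator {0<..t} r *\<^sub>R E n \<omega> r) \<longlonglongrightarrow> indicator {0<..t} r *\<^sub>R 0"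
      proof (rule AE_I2)
        fix r
        show "(\<lambda>n. indicator {0<..t} r *\<^sub>R E n \<omega> r) \<longlonglongrightarrow> indicator {0<..t} r *\<^sub>R 0"
        proof (cases "r \<in> {0<..t}")
          case True
          then have r: "0 < r" "r \<le> t" by auto
          have mem: "step (m n) (p n) (p n) r \<in> {0..t}" for n using step_left_endpoint[OF p r, of n] r by auto
          have "(\<lambda>n. X (step (m n) (p n) (p n) r) \<omega>) \<longlonglongrightarrow> X r \<omega>"
            using mem r
            by (intro continuous_on_tendsto_compose[OF X(2)[OF \<omega>] step_endpoints_tendsto(1)[OF fine r]])
              (auto intro!: always_eventually)
          then have "(\<lambda>n. (X r \<omega> - X (step (m n) (p n) (p n) r) \<omega>)\<^sup>2) \<longlonglongrightarrow> (X r \<omega> - X r \<omega>)\<^sup>2"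
            by (intro tendsto_intros)
          then show ?thesis using True r step_compose[OF p r, of _ "\<lambda>s. X s \<omega>"] by (simp add: E_def)
        qed simp
      qed
      show "AE r in lborel. norm (indicator {0<..t} r *\<^sub>R E n \<omega> r) \<le> C * indicator {0<..t} r" for n
      proof (rule AE_I2)
        fix r
        have "0 \<le> E n \<omega> r" by (simp add: E_def)
        then show "norm (indicator {0<..t} r *\<^sub>R E n \<omega> r) \<le> C * indicator {0<..t} r"
          using C(2)[of r n] by (auto simp: indicator_def)
      qed
    qed (use Epath[OF \<omega>] in measurable)
    ultimately show ?thesis by (simp add: set_lebesgue_integral_def)
  qed
  \<comment> \<open>The two parts of the quadratic sum \<open>Q\<close>: the approximation error \<open>U\<close> and the discretization error \<open>W\<close>.\<close>
  have key: "ennreal (Q n \<omega>) \<le> 2 * U n \<omega> + 2 * ennreal (W n \<omega>)" if \<omega>: "\<omega> \<in> space M" for n \<omega>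
  proof -
    note [measurable] = X'path[OF \<omega>] Epath[OF \<omega>]
    let ?a = "step (m n) (p n) (\<lambda>j. (a n j \<omega>)\<^sup>2)"
    have Uform: "U n \<omega> = (\<integral>\<^sup>+s. ennreal (indicator {0..t} s * (V n s \<omega> - X (max 0 (min t s)) \<omega>)\<^sup>2) \<partial>lborel)"
      unfolding U_def by (intro nn_integral_cong) (auto simp: indicator_def)
    have Wform: "ennreal (W n \<omega>) = (\<integral>\<^sup>+s. ennreal (indicator {0..t} s * E n \<omega> s) \<partial>lborel)"
      using E_int[OF \<omega>, of n] unfolding W_def set_lebesgue_integral_def set_integrable_def real_scaleR_def
      by (subst nn_integral_eq_integral) (auto simp: E_def)
    have "Q n \<omega> = (LINT r:{0..t}|lborel. ?a r)"
      unfolding step_integral(2)[OF p] Q_def ..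
    moreover have "0 \<le> ?a r" for r unfolding step_def by (intro sum_nonneg) auto
    ultimately have "ennreal (Q n \<omega>) = (\<integral>\<^sup>+r. ennreal (indicator {0..t} r * ?a r) \<partial>lborel)"
      using step_integral(1)[OF p, of n "\<lambda>j. (a n j \<omega>)\<^sup>2"]
      unfolding set_lebesgue_integral_def set_integrable_def real_scaleR_def
      by (subst nn_integral_eq_integral) auto
    also have "\<dots> \<le> (\<integral>\<^sup>+r. 2 * ennreal (indicator {0..t} r * (V n r \<omega> - X (max 0 (min t r)) \<omega>)\<^sup>2) + 2 * ennreal (indicator {0..t} r * E n \<omega> r) \<partial>lborel)"
    proof (rule nn_integral_mono_AE, rule AE_I[of _ _ "{0}"])
      show "{r \<in> space lborel. \<not> ennreal (indicator {0..t} r * ?a r) \<le>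
         2 * ennreal (indicator {0..t} r * (V n r \<omega> - X (max 0 (min t r)) \<omega>)\<^sup>2) + 2 * ennreal (indicator {0..t} r * E n \<omega> r)} \<subseteq> {0}"
      proof (rule subsetI, rule ccontr, unfold singleton_iff)
        fix r assume r: "r \<in> {r \<in> space lborel. \<not> ennreal (indicator {0..t} r * ?a r) \<le>
         2 * ennreal (indicator {0..t} r * (V n r \<omega> - X (max 0 (min t r)) \<omega>)\<^sup>2) + 2 * ennreal (indicator {0..t} r * E n \<omega> r)}"
          and "r \<noteq> 0"
        have r': "0 < r" "r \<le> t"
        proof -
          have "r \<in> {0..t}" using r by (cases "r \<in> {0..t}") simp_all
          then show "0 < r" "r \<le> t" using \<open>r \<noteq> 0\<close> by auto
        qed
        have 1: "?a r = (V n r \<omega> - step (m n) (p n) (\<lambda>j. X (p n j) \<omega>) r)\<^sup>2"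
        proof -
          obtain j where j: "j < m n" "p n j < r" "r \<le> p n (Suc j)" using partition_cell[OF p r'] .
          show ?thesis unfolding Vstep[OF r'] step_cell[OF p j] a_def ..
        qed
        have "(x - z)\<^sup>2 \<le> 2 * (x - y)\<^sup>2 + 2 * (y - z)\<^sup>2" for x y z :: real
        proof -
          have "0 \<le> ((x - y) - (y - z))\<^sup>2" by simp
          then show ?thesis by (simp add: power2_eq_square algebra_simps)
        qed
        then have "?a r \<le> 2 * (V n r \<omega> - X (max 0 (min t r)) \<omega>)\<^sup>2 + 2 * E n \<omega> r"
          unfolding 1 E_def .
        then have "ennreal (?a r) \<le> ennreal (2 * (V n r \<omega> - X (max 0 (min t r)) \<omega>)\<^sup>2 + 2 * E n \<omega> r)"
          by (rule ennreal_leI)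
        also have "\<dots> = 2 * ennreal ((V n r \<omega> - X (max 0 (min t r)) \<omega>)\<^sup>2) + 2 * ennreal (E n \<omega> r)"
          by (subst ennreal_plus) (auto simp: E_def ennreal_mult)
        finally show False using r r' by simp
      qed
    qed auto
    also have "\<dots> = 2 * U n \<omega> + 2 * ennreal (W n \<omega>)"
      unfolding Uform Wform
      by (simp add: nn_integral_add nn_integral_cmult)
    finally show ?thesis .
  qed
  have "null_in_prob Q"
  proof (rule null_in_prob_min_1[OF QM])
    have 1: "null_in_prob (\<lambda>n \<omega>. enn2real (min 1 (U n \<omega>)))"
      using vanishes_in_probability_enn2real[OF approx] unfolding U_def V_def .
    have 2: "null_in_prob W" by (rule null_in_prob_AE[OF WM]) (use Wlim in auto)
    show "null_in_prob (\<lambda>n \<omega>. (enn2real (min 1 (U n \<omega>)) + enn2real (min 1 (U n \<omega>))) + (W n \<omega> + W n \<omega>))"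
      by (intro null_in_prob_add 1 2)
    fix n \<omega> assume \<omega>: "\<omega> \<in> space M"
    have Q0: "0 \<le> Q n \<omega>" unfolding Q_def using pm by (intro sum_nonneg mult_nonneg_nonneg) auto
    have W0: "0 \<le> W n \<omega>" unfolding W_def set_lebesgue_integral_def
      by (intro Bochner_Integration.integral_nonneg) (auto simp: E_def)
    have "min 1 (Q n \<omega>) \<le> 2 * enn2real (min 1 (U n \<omega>)) + 2 * W n \<omega>"
    proof (cases "1 \<le> U n \<omega>")
      case True
      then show ?thesis using W0 by (simp add: min_absorb1)
    next
      case False
      then obtain u where u: "U n \<omega> = ennreal u" "0 \<le> u" "u < 1"
        by (cases "U n \<omega>") (auto simp: not_le ennreal_less_iff)
      have UW: "2 * U n \<omega> + 2 * ennreal (W n \<omega>) = ennreal (2 * u + 2 * W n \<omega>)"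
        using u W0 by (simp add: ennreal_mult' ennreal_plus)
      then have "Q n \<omega> \<le> 2 * u + 2 * W n \<omega>"
        using key[OF \<omega>, of n] u(2) W0 unfolding UW by (subst (asm) ennreal_le_iff) simp_all
      moreover have "enn2real (min 1 (U n \<omega>)) = u" using u False by (simp add: min_def)
      ultimately show ?thesis by simp
    qed
    then show "min 1 \<bar>Q n \<omega>\<bar> \<le> \<bar>(enn2real (min 1 (U n \<omega>)) + enn2real (min 1 (U n \<omega>))) + (W n \<omega> + W n \<omega>)\<bar>"
      using Q0 W0 by simp
  qed
  then have A: "null_in_prob (\<lambda>n \<omega>. \<Sum>j<m n. a n j \<omega> * (B (p n (Suc j)) \<omega> - B (p n j) \<omega>))"
    unfolding Q_def[abs_def] using pb pm aF by (intro increment_sums_null) auto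
  have "null_in_prob (\<lambda>n \<omega>. \<bar>simple_integral_wrt B (S n) t \<omega> - I \<omega>\<bar>)"
    using limit unfolding vanishes_in_probability_iff by auto
  then have "null_in_prob (\<lambda>n \<omega>. simple_integral_wrt B (S n) t \<omega> - I \<omega>)"
  proof (rule null_in_prob_dominated)
    have "V n (p n (Suc j)) \<in> borel_measurable M" if "j < m n" for n j
      using VF[OF that] pb[of j n] that by (auto intro: measurable_F_M)
    then show "(\<lambda>\<omega>. simple_integral_wrt B (S n) t \<omega> - I \<omega>) \<in> borel_measurable M" for n
      unfolding integral using I BM
      by (intro borel_measurable_diff borel_measurable_sum borel_measurable_times) auto
  qed auto
  from null_in_prob_diff[OF this A]
  show ?thesis
    unfolding integral a_def by (simp add: left_diff_distrib sum_subtractf)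
qed

end

section \<open>Uniqueness of solutions\<close>

lemma weighted_sum_square_le:
  fixes x w :: "nat \<Rightarrow> real"
  assumes "\<And>j. j < m \<Longrightarrow> 0 \<le> w j"
  shows "(\<Sum>j<m. x j * w j)\<^sup>2 \<le> (\<Sum>j<m. w j) * (\<Sum>j<m. (x j)\<^sup>2 * w j)"
proof -
  have "(\<Sum>j<m. x j * w j) = (\<Sum>j<m. sqrt (w j) * (x j * sqrt (w j)))"
    using assms by (intro sum.cong) (auto simp: mult_ac)
  also have "(\<dots>)\<^sup>2 \<le> (\<Sum>j<m. (sqrt (w j))\<^sup>2) * (\<Sum>j<m. (x j * sqrt (w j))\<^sup>2)"
    by (rule Cauchy_Schwarz_ineq_sum)
  also have "\<dots> = (\<Sum>j<m. w j) * (\<Sum>j<m. (x j)\<^sup>2 * w j)"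
    using assms by (intro arg_cong2[where f="(*)"] sum.cong) (auto simp: power_mult_distrib)
  finally show ?thesis .
qed

text \<open>Picard iteration of the bound gains a factor \<open>1/2\<close> each time against the weight \<open>exp (2 C s)\<close>.\<close>

lemma gronwall_zero:
  fixes \<phi> :: "real \<Rightarrow> real"
  assumes C: "0 < C" and t: "0 \<le> t"
    and int: "\<And>s. 0 \<le> s \<Longrightarrow> s \<le> t \<Longrightarrow> set_integrable lborel {0<..s} \<phi>"
    and bd: "\<And>s. 0 \<le> s \<Longrightarrow> s \<le> t \<Longrightarrow> \<phi> s \<le> A"
    and le: "\<And>s. 0 \<le> s \<Longrightarrow> s \<le> t \<Longrightarrow> \<phi> s \<le> C * (LINT r:{0<..s}|lborel. \<phi> r)"
  shows "\<phi> t \<le> 0"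
proof -
  let ?A = "max A 0"
  have exp_int: "set_integrable lborel {0<..s} (\<lambda>r. k * exp (2 * C * r))"
    "(LINT r:{0<..s}|lborel. k * exp (2 * C * r)) = k * (exp (2 * C * s) - 1) / (2 * C)" if "0 \<le> s" for k s
  proof -
    have c: "continuous_on {0..s} (\<lambda>r. k * exp (2 * C * r))" by (intro continuous_intros)
    have i: "set_integrable lborel {0..s} (\<lambda>r. k * exp (2 * C * r))" by (rule borel_integrable_atLeastAtMost'[OF c])
    then show "set_integrable lborel {0<..s} (\<lambda>r. k * exp (2 * C * r))" by (rule set_integrable_subset) auto
    have "(LINT r:{0<..s}|lborel. k * exp (2 * C * r)) = (LINT r:{0..s}|lborel. k * exp (2 * C * r))"
      using i by (intro set_integral_Ioc_Icc) (auto simp: set_borel_measurable_def set_integrable_def)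
    also have "\<dots> = k * exp (2 * C * s) / (2 * C) - k * exp (2 * C * 0) / (2 * C)"
      unfolding set_lebesgue_integral_def real_scaleR_def
    proof (subst mult.commute, rule integral_FTC_Icc_real[OF that])
      fix r
      show "((\<lambda>r. k * exp (2 * C * r) / (2 * C)) has_real_derivative k * exp (2 * C * r)) (at r)"
        using C by (auto intro!: derivative_eq_intros)
      show "isCont (\<lambda>r. k * exp (2 * C * r)) r" by (intro continuous_intros)
    qed
    finally show "(LINT r:{0<..s}|lborel. k * exp (2 * C * r)) = k * (exp (2 * C * s) - 1) / (2 * C)"
      by (simp add: diff_divide_distrib right_diff_distrib)
  qed
  have "\<phi> s \<le> ?A * (1/2)^n * exp (2 * C * s)" if "0 \<le> s" "s \<le> t" for s n
    using that
  proof (induction n arbitrary: s)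
    case 0
    have "\<phi> s \<le> ?A" using bd[OF 0] by simp
    also have "\<dots> \<le> ?A * exp (2 * C * s)"
    proof -
      have "1 \<le> exp (2 * C * s)" using C 0 by simp
      then show ?thesis using mult_left_mono[of 1 "exp (2 * C * s)" ?A] by simp
    qed
    finally show ?case by simp
  next
    case (Suc n)
    let ?k = "?A * (1/2)^n"
    have k: "0 \<le> ?k" by simp
    have "\<phi> s \<le> C * (LINT r:{0<..s}|lborel. \<phi> r)" by (rule le[OF Suc.prems])
    also have "\<dots> \<le> C * (LINT r:{0<..s}|lborel. ?k * exp (2 * C * r))"
    proof (intro mult_left_mono set_integral_mono)
      show "set_integrable lborel {0<..s} \<phi>" by (rule int[OF Suc.prems])
      show "set_integrable lborel {0<..s} (\<lambda>r. ?k * exp (2 * C * r))" by (rule exp_int(1)[OF Suc.prems(1)])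
      fix r assume "r \<in> {0<..s}"
      then show "\<phi> r \<le> ?k * exp (2 * C * r)" using Suc.IH[of r] Suc.prems by auto
    qed (use C in simp)
    also have "\<dots> = ?k * (exp (2 * C * s) - 1) / 2"
      unfolding exp_int(2)[OF Suc.prems(1)] using C by simp
    also have "\<dots> \<le> ?A * (1/2)^Suc n * exp (2 * C * s)"
      using k by (simp add: algebra_simps)
    finally show ?case .
  qed
  then have ub: "\<phi> t \<le> ?A * (1/2)^n * exp (2 * C * t)" for n using t by blast
  have "(\<lambda>n. ?A * (1/2)^n * exp (2 * C * t)) \<longlonglongrightarrow> ?A * 0 * exp (2 * C * t)"
    by (intro tendsto_intros LIMSEQ_realpow_zero) auto
  then have "\<phi> t \<le> ?A * 0 * exp (2 * C * t)"
    by (rule LIMSEQ_le_const) (use ub in blast)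
  then show ?thesis by simp
qed

context brownian_basis
begin

text \<open>
  The difference of two solutions has no moments a priori, so it is localized: \<open>g N s\<close> indicates that
  \<open>D\<close> stayed within \<open>[- N, N]\<close> up to time \<open>s\<close>. This indicator decreases in time; hence on the event
  \<open>g N s = 1\<close> it may be inserted into every coefficient of the Euler sum without changing it. The
  localized sums have second moments controlled by Riemann sums of \<open>\<phi> s = E (g N s D s)\<^sup>2\<close>, and
  Fatou's lemma gives \<open>\<phi> s \<le> C \<integral>\<^sub>0\<^sup>s \<phi>\<close>.
\<close>

lemma homogeneous_sde_zero:
  fixes D :: "real \<Rightarrow> 'a \<Rightarrow> real"
  assumes t: "0 \<le> t"
    and D: "\<And>s. 0 \<le> s \<Longrightarrow> s \<le> t \<Longrightarrow> D s \<in> borel_measurable (F s)"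
      "\<And>\<omega>. \<omega> \<in> space M \<Longrightarrow> continuous_on {0..t} (\<lambda>s. D s \<omega>)"
    and euler: "\<And>s. 0 \<le> s \<Longrightarrow> s \<le> t \<Longrightarrow> \<exists>m p. fine_partitions s m p \<and>
      null_in_prob (\<lambda>n \<omega>. (\<Sum>j<m n. D (p n j) \<omega> * (- \<delta> * (p n (Suc j) - p n j) +
         \<sigma> * (B (p n (Suc j)) \<omega> - B (p n j) \<omega>))) - D s \<omega>)"
  shows "AE \<omega> in M. D t \<omega> = 0"
proof -
  define g :: "nat \<Rightarrow> real \<Rightarrow> 'a \<Rightarrow> real" where "g N s \<omega> =
    (if \<forall>n i. i \<le> Suc n \<longrightarrow> \<bar>D (real i / real (Suc n) * s) \<omega>\<bar> \<le> real N then 1 else 0)" for N s \<omega>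
  \<comment> \<open>By continuity the countably many times \<open>(i / (n + 1)) s\<close> decide the event, which makes it measurable.\<close>
  have grid: "0 \<le> real i / real (Suc n) * s \<and> real i / real (Suc n) * s \<le> s" if "i \<le> Suc n" "0 \<le> s" for i n s
    using that mult_right_mono[of "real i / real (Suc n)" 1 s] by (auto simp: divide_le_eq)
  have g_iff: "g N s \<omega> = (if \<forall>r\<in>{0..s}. \<bar>D r \<omega>\<bar> \<le> real N then 1 else 0)"
    if \<omega>: "\<omega> \<in> space M" and s: "0 \<le> s" "s \<le> t" for N s \<omega>
  proof -
    have "\<bar>D r \<omega>\<bar> \<le> real N" if all: "\<And>n i. i \<le> Suc n \<Longrightarrow> \<bar>D (real i / real (Suc n) * s) \<omega>\<bar> \<le> real N" and r: "r \<in> {0..s}" for r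
    proof (cases "s = 0")
      case True
      then show ?thesis using all[of 0 0] r by simp
    next
      case False
      define x where "x = r / s"
      have x: "0 \<le> x" "x \<le> 1" "x * s = r" using r False by (auto simp: x_def)
      let ?i = "\<lambda>n. nat \<lfloor>x * real (Suc n)\<rfloor>"
      have i: "?i n \<le> Suc n" for n
      proof -
        have "x * real (Suc n) \<le> real (Suc n)" using x mult_right_mono[of x 1 "real (Suc n)"] by simp
        then show ?thesis by linarith
      qed
      have "(\<lambda>n. real (?i n) / real (Suc n) * s) \<longlonglongrightarrow> x * s"
        by (intro tendsto_intros floor_grid(3)[OF x(1)])
      then have "(\<lambda>n. D (real (?i n) / real (Suc n) * s) \<omega>) \<longlonglongrightarrow> D r \<omega>"
        using grid[OF i s(1)] s r unfolding x(3)
        by (intro continuous_on_tendsto_compose[OF D(2)[OF \<omega>]]) (auto intro!: always_eventually intro: order_trans)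
      then have "(\<lambda>n. \<bar>D (real (?i n) / real (Suc n) * s) \<omega>\<bar>) \<longlonglongrightarrow> \<bar>D r \<omega>\<bar>"
        by (rule tendsto_rabs)
      then show ?thesis using all[OF i] by (intro LIMSEQ_le_const2) auto
    qed
    moreover have "\<bar>D (real i / real (Suc n) * s) \<omega>\<bar> \<le> real N"
      if "\<forall>r\<in>{0..s}. \<bar>D r \<omega>\<bar> \<le> real N" "i \<le> Suc n" for i n
      using that grid[OF that(2) s(1)] by auto
    ultimately show ?thesis unfolding g_def by (intro if_cong refl iffI) blast+
  qed
  have gF: "g N s \<in> borel_measurable (F s)" if s: "0 \<le> s" "s \<le> t" for N s
  proof -
    have [measurable]: "(\<lambda>\<omega>. if i \<le> Suc n then D (real i / real (Suc n) * s) \<omega> else 0) \<in> borel_measurable (F s)" for n i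
    proof (cases "i \<le> Suc n")
      case True
      then show ?thesis
        using measurable_F_mono[OF D(1), of "real i / real (Suc n) * s" s] grid[OF True s(1)] s by auto
    qed simp
    have "g N s = (\<lambda>\<omega>. if \<forall>n i. \<bar>if i \<le> Suc n then D (real i / real (Suc n) * s) \<omega> else 0\<bar> \<le> real N then 1 else 0)"
      unfolding g_def by (intro ext if_cong refl) (auto split: if_splits)
    then show ?thesis by (simp only:) measurable
  qed
  have g01: "g N s \<omega> = 0 \<or> g N s \<omega> = 1" for N s \<omega> by (simp add: g_def)
  have gD: "\<bar>g N s \<omega> * D s \<omega>\<bar> \<le> real N" if "\<omega> \<in> space M" "0 \<le> s" "s \<le> t" for N s \<omega>
    using g_iff[OF that, of N] that by auto
  have g_anti: "g N s \<omega> = 1 \<Longrightarrow> g N r \<omega> = 1" if "\<omega> \<in> space M" "0 \<le> r" "r \<le> s" "s \<le> t" for N r s \<omega>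
    using g_iff[of \<omega> s N] g_iff[of \<omega> r N] that by (auto split: if_splits)
  have DM: "D s \<in> borel_measurable M" "g N s \<in> borel_measurable M" if "0 \<le> s" "s \<le> t" for s N
    using D(1)[OF that] gF[OF that, of N] that by (auto intro: measurable_F_M)
  define \<phi> where "\<phi> N s = expectation (\<lambda>\<omega>. (g N s \<omega> * D s \<omega>)\<^sup>2)" for N s
  have gD2: "(g N s \<omega> * D s \<omega>)\<^sup>2 \<le> (real N)\<^sup>2" if "\<omega> \<in> space M" "0 \<le> s" "s \<le> t" for N s \<omega>
    using gD[OF that, of N] by (simp add: abs_le_square_iff[symmetric])
  have gD_int: "integrable M (\<lambda>\<omega>. (g N s \<omega> * D s \<omega>)\<^sup>2)" if "0 \<le> s" "s \<le> t" for N s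
    using gD2[of _ s N] that DM[OF that] by (intro integrable_const_bound[where B="(real N)\<^sup>2"]) auto
  have \<phi>_bd: "0 \<le> \<phi> N s" "\<phi> N s \<le> (real N)\<^sup>2" if "0 \<le> s" "s \<le> t" for N s
  proof -
    show "0 \<le> \<phi> N s" unfolding \<phi>_def by (intro Bochner_Integration.integral_nonneg) auto
    have "\<phi> N s \<le> expectation (\<lambda>\<omega>. (real N)\<^sup>2)"
      unfolding \<phi>_def using gD2 that by (intro integral_mono gD_int) auto
    then show "\<phi> N s \<le> (real N)\<^sup>2" by (simp add: prob_space)
  qed
  \<comment> \<open>Left continuity suffices: Riemann sums evaluate \<open>\<phi>\<close> at left ends of cells.\<close>
  have \<phi>_left: "(\<lambda>n. \<phi> N (\<rho> n)) \<longlonglongrightarrow> \<phi> N r"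
    if \<rho>: "\<rho> \<longlonglongrightarrow> r" "\<And>n. 0 \<le> \<rho> n" "\<And>n. \<rho> n \<le> r" and r: "r \<le> t" for N \<rho> r
    unfolding \<phi>_def
  proof (rule integral_dominated_convergence[where w="\<lambda>_. (real N)\<^sup>2"])
    have r0: "0 \<le> r" using \<rho>(2,3)[of 0] by simp
    have \<rho>t: "\<rho> n \<le> t" for n using \<rho>(3)[of n] r by simp
    show "(\<lambda>\<omega>. (g N r \<omega> * D r \<omega>)\<^sup>2) \<in> borel_measurable M" using DM[OF r0 r] by auto
    show "(\<lambda>\<omega>. (g N (\<rho> n) \<omega> * D (\<rho> n) \<omega>)\<^sup>2) \<in> borel_measurable M" for n using DM[OF \<rho>(2) \<rho>t] by auto
    show "AE \<omega> in M. norm ((g N (\<rho> n) \<omega> * D (\<rho> n) \<omega>)\<^sup>2) \<le> (real N)\<^sup>2" for n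
      using gD2[OF _ \<rho>(2) \<rho>t] by auto
    show "AE \<omega> in M. (\<lambda>n. (g N (\<rho> n) \<omega> * D (\<rho> n) \<omega>)\<^sup>2) \<longlonglongrightarrow> (g N r \<omega> * D r \<omega>)\<^sup>2"
    proof (rule AE_I2)
      fix \<omega> assume \<omega>: "\<omega> \<in> space M"
      have Dlim: "(\<lambda>n. D (\<rho> n) \<omega>) \<longlonglongrightarrow> D r \<omega>"
        using \<rho> \<rho>t r r0 by (intro continuous_on_tendsto_compose[OF D(2)[OF \<omega>]]) auto
      have "(\<lambda>n. g N (\<rho> n) \<omega>) \<longlonglongrightarrow> g N r \<omega>"
      proof (cases "g N r \<omega> = 1")
        case True
        then have "g N (\<rho> n) \<omega> = 1" for n using g_anti[OF \<omega> \<rho>(2,3) r] by blast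
        then show ?thesis using True by simp
      next
        case False
        then obtain r' where r': "r' \<in> {0..r}" "real N < \<bar>D r' \<omega>\<bar>"
          using g_iff[OF \<omega> r0 r, of N] by (auto split: if_splits simp: not_le)
        have "\<forall>\<^sub>F n in sequentially. g N (\<rho> n) \<omega> = 0"
        proof (cases "r' = r")
          case True
          have "(\<lambda>n. \<bar>D (\<rho> n) \<omega>\<bar>) \<longlonglongrightarrow> \<bar>D r \<omega>\<bar>" by (intro tendsto_rabs Dlim)
          then have "\<forall>\<^sub>F n in sequentially. real N < \<bar>D (\<rho> n) \<omega>\<bar>"
            using r' True by (intro order_tendstoD) auto
          then show ?thesis
          proof eventually_elim
            case (elim n)
            then show ?case using g_iff[OF \<omega> \<rho>(2) \<rho>t, of N n] \<rho>(2)[of n] by force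
          qed
        next
          case False
          then have "r' < r" using r' by auto
          then have "\<forall>\<^sub>F n in sequentially. r' < \<rho> n" using order_tendstoD(1)[OF \<rho>(1)] by auto
          then show ?thesis
          proof eventually_elim
            case (elim n)
            then have "r' \<in> {0..\<rho> n}" using r' by auto
            then show ?case using g_iff[OF \<omega> \<rho>(2) \<rho>t, of N n] r'(2) by (auto simp: not_le)
          qed
        qed
        then show ?thesis using False g01[of N r \<omega>] by (intro tendsto_eventually) auto
      qed
      then show "(\<lambda>n. (g N (\<rho> n) \<omega> * D (\<rho> n) \<omega>)\<^sup>2) \<longlonglongrightarrow> (g N r \<omega> * D r \<omega>)\<^sup>2"
        by (intro tendsto_intros Dlim)
    qed
  qed auto
  have \<phi>_step: "(\<lambda>n. indicator {0<..s} r *\<^sub>R step (m n) (p n) (\<lambda>j. \<phi> N (p n j)) r) \<longlonglongrightarrow> indicator {0<..s} r *\<^sub>R \<phi> N r"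
    if fine: "fine_partitions s m p" and s: "s \<le> t" for N s m p r
  proof (cases "r \<in> {0<..s}")
    case True
    then have r: "0 < r" "r \<le> s" by auto
    note q = step_left_endpoint[OF fine_partitionsD[OF fine] r]
    have "(\<lambda>n. \<phi> N (step (m n) (p n) (p n) r)) \<longlonglongrightarrow> \<phi> N r"
      using q r s by (intro \<phi>_left[OF step_endpoints_tendsto(1)[OF fine r]]) (auto simp: less_imp_le)
    then show ?thesis using True step_compose[OF fine_partitionsD[OF fine] r, of _ "\<phi> N"] by simp
  qed simp
  have \<phi>_stepbd: "norm (indicator {0<..s} r *\<^sub>R step m p (\<lambda>j. \<phi> N (p j)) r) \<le> (real N)\<^sup>2 * indicator {0<..s} r"
    if p: "partition s m p" and s: "s \<le> t" for N s m p r
  proof (cases "r \<in> {0<..s}")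
    case True
    then have r: "0 < r" "r \<le> s" by auto
    have "0 \<le> step m p p r" "step m p p r \<le> t" using step_left_endpoint[OF p r] r s by auto
    then show ?thesis using True step_compose[OF p r, of "\<phi> N" p] \<phi>_bd[of "step m p p r" N] by simp
  qed simp
  have \<phi>_int: "set_integrable lborel {0<..s} (\<phi> N)" if s: "0 \<le> s" "s \<le> t" for N s
  proof -
    obtain m p where fine: "fine_partitions s m p" using euler[OF s] by blast
    have "(\<lambda>r. indicator {0<..s} r *\<^sub>R \<phi> N r) \<in> borel_measurable lborel"
    proof (rule borel_measurable_LIMSEQ_real)
      show "(\<lambda>r. indicator {0<..s} r *\<^sub>R step (m n) (p n) (\<lambda>j. \<phi> N (p n j)) r) \<in> borel_measurable lborel" for n
        by measurable
    qed (use \<phi>_step[OF fine s(2)] in auto)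
    then show ?thesis
      unfolding set_integrable_def
      by (rule Bochner_Integration.integrable_bound[OF integrable_indicator_Ioc[of "(real N)\<^sup>2" 0 s]])
        (use \<phi>_bd s in \<open>auto simp: indicator_def intro!: AE_I2\<close>)
  qed
  have \<phi>_sum: "(\<lambda>n. \<Sum>j<m n. \<phi> N (p n j) * (p n (Suc j) - p n j)) \<longlonglongrightarrow> (LINT r:{0<..s}|lborel. \<phi> N r)"
    if fine: "fine_partitions s m p" and s: "0 \<le> s" "s \<le> t" for N s m p
  proof -
    note p = fine_partitionsD[OF fine]
    have "(\<Sum>j<m n. \<phi> N (p n j) * (p n (Suc j) - p n j)) = (LINT r:{0<..s}|lborel. step (m n) (p n) (\<lambda>j. \<phi> N (p n j)) r)" for n
      unfolding step_integral(2)[OF p, symmetric]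
      by (rule set_integral_Ioc_Icc[symmetric]) (use step_measurable in \<open>simp add: set_borel_measurable_def\<close>)
    moreover have "(\<lambda>n. LINT r:{0<..s}|lborel. step (m n) (p n) (\<lambda>j. \<phi> N (p n j)) r) \<longlonglongrightarrow> (LINT r:{0<..s}|lborel. \<phi> N r)"
      unfolding set_lebesgue_integral_def
    proof (rule integral_dominated_convergence[where w="\<lambda>r. (real N)\<^sup>2 * indicator {0<..s} r"])
      show "(\<lambda>r. indicator {0<..s} r *\<^sub>R \<phi> N r) \<in> borel_measurable lborel"
        using \<phi>_int[OF s, of N] unfolding set_integrable_def by auto
      show "integrable lborel (\<lambda>r. (real N)\<^sup>2 * indicator {0<..s} r)" by (rule integrable_indicator_Ioc)
      show "AE r in lborel. (\<lambda>n. indicator {0<..s} r *\<^sub>R step (m n) (p n) (\<lambda>j. \<phi> N (p n j)) r) \<longlonglongrightarrow> indicator {0<..s} r *\<^sub>R \<phi> N r"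
        using \<phi>_step[OF fine s(2)] by auto
      show "AE r in lborel. norm (indicator {0<..s} r *\<^sub>R step (m n) (p n) (\<lambda>j. \<phi> N (p n j)) r) \<le> (real N)\<^sup>2 * indicator {0<..s} r" for n
        using \<phi>_stepbd[OF p s(2)] by auto
    qed measurable
    ultimately show ?thesis by simp
  qed
  \<comment> \<open>The summand \<open>1\<close> serves only to make the constant positive.\<close>
  define C where "C = 2 * \<delta>\<^sup>2 * t + 2 * \<sigma>\<^sup>2 + 1"
  have C: "0 < C" using t by (auto simp: C_def add_nonneg_pos)
  have key: "\<phi> N s \<le> C * (LINT r:{0<..s}|lborel. \<phi> N r)" if s: "0 \<le> s" "s \<le> t" for N s
  proof -
    obtain m p where fine: "fine_partitions s m p" and null: "null_in_prob (\<lambda>n \<omega>. (\<Sum>j<m n. D (p n j) \<omega> * (- \<delta> * (p n (Suc j) - p n j) +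
         \<sigma> * (B (p n (Suc j)) \<omega> - B (p n j) \<omega>))) - D s \<omega>)" using euler[OF s] by blast
    note p = fine_partitionsD[OF fine]
    have pb: "0 \<le> p n j" "p n j \<le> s" if "j \<le> m n" for n j using partition_bounds[OF p that] by auto
    have pm: "p n j \<le> p n (Suc j)" if "j < m n" for n j using p[of n] that by (auto simp: partition_def)
    define dp where "dp n j = p n (Suc j) - p n j" for n j
    define dB where "dB n j \<omega> = B (p n (Suc j)) \<omega> - B (p n j) \<omega>" for n j \<omega>
    \<comment> \<open>\<open>R\<close> is the Euler sum of \<open>D\<close>, \<open>G\<close> the Euler sum of the localized process.\<close>
    define a where "a n j \<omega> = g N (p n j) \<omega> * D (p n j) \<omega>" for n j \<omega>
    define R where "R n \<omega> = (\<Sum>j<m n. D (p n j) \<omega> * (- \<delta> * dp n j + \<sigma> * dB n j \<omega>))" for n \<omega>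
    define G where "G n \<omega> = (\<Sum>j<m n. a n j \<omega> * (- \<delta> * dp n j + \<sigma> * dB n j \<omega>))" for n \<omega>
    have dp: "0 \<le> dp n j" if "j < m n" for n j using pm[OF that] by (simp add: dp_def)
    have aF: "a n j \<in> borel_measurable (F (p n j))" if "j < m n" for n j
      using gF[of "p n j" N] D(1)[of "p n j"] pb[of j n] that s unfolding a_def[abs_def] by auto
    have aM: "a n j \<in> borel_measurable M" if "j < m n" for n j
      using aF[OF that] pb[of j n] that by (auto intro: measurable_F_M)
    have a_int: "integrable M (\<lambda>\<omega>. (a n j \<omega>)\<^sup>2)" "expectation (\<lambda>\<omega>. (a n j \<omega>)\<^sup>2) = \<phi> N (p n j)" if "j < m n" for n j
      using gD_int[of "p n j" N] pb[of j n] that s by (auto simp: a_def \<phi>_def)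
    have dBM: "dB n j \<in> borel_measurable M" if "j < m n" for n j
      unfolding dB_def[abs_def] using B_measurable pb[of j n] pb[of "Suc j" n] that by auto
    have GM: "G n \<in> borel_measurable M" for n
      unfolding G_def[abs_def] using aM dBM by (intro borel_measurable_sum borel_measurable_times) auto
    have mom: "integrable M (dB n j)" "expectation (dB n j) = 0" "integrable M (\<lambda>\<omega>. (dB n j \<omega>)\<^sup>2)"
      "expectation (\<lambda>\<omega>. (dB n j \<omega>)\<^sup>2) = dp n j" if "j < m n" for n j
      using increment_moments[OF pb(1)[of j n] pm[OF that]] that by (auto simp: dB_def[abs_def] dp_def)
    have orth: "integrable M (\<lambda>\<omega>. (\<Sum>j<m n. a n j \<omega> * dB n j \<omega>)\<^sup>2)"
      "expectation (\<lambda>\<omega>. (\<Sum>j<m n. a n j \<omega> * dB n j \<omega>)\<^sup>2) =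
        (\<Sum>j<m n. expectation (\<lambda>\<omega>. (a n j \<omega>)\<^sup>2) * expectation (\<lambda>\<omega>. (dB n j \<omega>)\<^sup>2))" for n
      using orthogonal_increments[of "m n" "p n" "a n" "\<lambda>_ x. x"] pb pm aF a_int mom unfolding dB_def by auto
    have G_le: "(G n \<omega>)\<^sup>2 \<le> 2 * \<delta>\<^sup>2 * s * (\<Sum>j<m n. (a n j \<omega>)\<^sup>2 * dp n j) + 2 * \<sigma>\<^sup>2 * (\<Sum>j<m n. a n j \<omega> * dB n j \<omega>)\<^sup>2" for n \<omega>
    proof -
      have sumdp: "(\<Sum>j<m n. dp n j) = s" unfolding dp_def by (rule partition_sum_lengths[OF p])
      have "G n \<omega> = - \<delta> * (\<Sum>j<m n. a n j \<omega> * dp n j) + \<sigma> * (\<Sum>j<m n. a n j \<omega> * dB n j \<omega>)"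
        unfolding G_def sum_distrib_left sum.distrib[symmetric] by (intro sum.cong) (auto simp: algebra_simps)
      moreover have "(x + y)\<^sup>2 \<le> 2 * x\<^sup>2 + 2 * y\<^sup>2" for x y :: real
      proof -
        have "0 \<le> (x - y)\<^sup>2" by simp
        then show ?thesis by (simp add: power2_eq_square algebra_simps)
      qed
      ultimately have "(G n \<omega>)\<^sup>2 \<le> 2 * (- \<delta> * (\<Sum>j<m n. a n j \<omega> * dp n j))\<^sup>2 + 2 * (\<sigma> * (\<Sum>j<m n. a n j \<omega> * dB n j \<omega>))\<^sup>2"
        by metis
      also have "\<dots> = 2 * \<delta>\<^sup>2 * (\<Sum>j<m n. a n j \<omega> * dp n j)\<^sup>2 + 2 * \<sigma>\<^sup>2 * (\<Sum>j<m n. a n j \<omega> * dB n j \<omega>)\<^sup>2"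
        by (simp add: power_mult_distrib)
      also have "(\<Sum>j<m n. a n j \<omega> * dp n j)\<^sup>2 \<le> s * (\<Sum>j<m n. (a n j \<omega>)\<^sup>2 * dp n j)"
        using weighted_sum_square_le[of "m n" "dp n" "\<lambda>j. a n j \<omega>"] dp unfolding sumdp by auto
      finally show ?thesis by (simp add: mult.assoc mult_left_mono)
    qed
    have sum_int: "integrable M (\<lambda>\<omega>. \<Sum>j<m n. (a n j \<omega>)\<^sup>2 * dp n j)"
      "expectation (\<lambda>\<omega>. \<Sum>j<m n. (a n j \<omega>)\<^sup>2 * dp n j) = (\<Sum>j<m n. \<phi> N (p n j) * dp n j)" for n
      using a_int by (auto intro!: Bochner_Integration.integrable_sum simp: Bochner_Integration.integral_sum)
    have \<phi>p: "0 \<le> \<phi> N (p n j)" if "j < m n" for n j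
      using \<phi>_bd(1)[of "p n j" N] pb[of j n] that s by auto
    define c where "c n = C * (\<Sum>j<m n. \<phi> N (p n j) * dp n j)" for n
    have EG: "(\<integral>\<^sup>+\<omega>. ennreal ((G n \<omega>)\<^sup>2) \<partial>M) \<le> ennreal (c n)" for n
    proof -
      let ?H = "\<lambda>\<omega>. 2 * \<delta>\<^sup>2 * s * (\<Sum>j<m n. (a n j \<omega>)\<^sup>2 * dp n j) + 2 * \<sigma>\<^sup>2 * (\<Sum>j<m n. a n j \<omega> * dB n j \<omega>)\<^sup>2"
      have H: "integrable M ?H" using sum_int(1) orth(1) by auto
      have H0: "0 \<le> ?H \<omega>" for \<omega> using order_trans[OF zero_le_power2 G_le] .
      have S0: "0 \<le> (\<Sum>j<m n. \<phi> N (p n j) * dp n j)"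
        using \<phi>p dp by (intro sum_nonneg mult_nonneg_nonneg) auto
      have "(\<integral>\<^sup>+\<omega>. ennreal ((G n \<omega>)\<^sup>2) \<partial>M) \<le> (\<integral>\<^sup>+\<omega>. ennreal (?H \<omega>) \<partial>M)"
        using G_le by (intro nn_integral_mono ennreal_leI)
      also have "\<dots> = ennreal (expectation ?H)" using H H0 by (intro nn_integral_eq_integral) auto
      also have "expectation ?H = 2 * \<delta>\<^sup>2 * s * (\<Sum>j<m n. \<phi> N (p n j) * dp n j) + 2 * \<sigma>\<^sup>2 * (\<Sum>j<m n. \<phi> N (p n j) * dp n j)"
        using sum_int orth a_int(2) mom(4) by simp
      also have "\<dots> = (2 * \<delta>\<^sup>2 * s + 2 * \<sigma>\<^sup>2) * (\<Sum>j<m n. \<phi> N (p n j) * dp n j)"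
        by (simp add: distrib_right)
      also have "\<dots> \<le> c n"
      proof -
        have "2 * \<delta>\<^sup>2 * s \<le> 2 * \<delta>\<^sup>2 * t" using s by (intro mult_left_mono) auto
        then show ?thesis unfolding c_def C_def using S0 by (intro mult_right_mono) auto
      qed
      finally show ?thesis by (simp add: ennreal_leI)
    qed
    obtain k where k: "strict_mono k" "AE \<omega> in M. (\<lambda>n. R (k n) \<omega> - D s \<omega>) \<longlonglongrightarrow> 0"
      using null_in_prob_AE_subseq[OF null] unfolding R_def dp_def dB_def by auto
    have lim_c: "(\<lambda>n. ennreal (c (k n))) \<longlonglongrightarrow> ennreal (C * (LINT r:{0<..s}|lborel. \<phi> N r))"
    proof -
      have "c \<longlonglongrightarrow> C * (LINT r:{0<..s}|lborel. \<phi> N r)"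
        unfolding c_def dp_def by (intro tendsto_intros \<phi>_sum[OF fine s])
      then show ?thesis using LIMSEQ_subseq_LIMSEQ[OF _ k(1)] by (auto simp: comp_def)
    qed
    \<comment> \<open>Along the almost surely convergent subsequence, \<open>G\<close> tends to \<open>D s\<close> wherever \<open>g N s = 1\<close>.\<close>
    have "AE \<omega> in M. ennreal ((g N s \<omega> * D s \<omega>)\<^sup>2) \<le> liminf (\<lambda>n. ennreal ((G (k n) \<omega>)\<^sup>2))"
      using k(2) AE_space
    proof eventually_elim
      case (elim \<omega>)
      show ?case
      proof (cases "g N s \<omega> = 1")
        case True
        have "G n \<omega> = R n \<omega>" for n
          unfolding G_def R_def a_def using g_anti[OF elim(2) pb(1) pb(2) s(2) True]
          by (intro sum.cong) auto
        moreover have "(\<lambda>n. R (k n) \<omega>) \<longlonglongrightarrow> D s \<omega>" using elim(1) by (simp add: LIM_zero_iff)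
        ultimately have "(\<lambda>n. (G (k n) \<omega>)\<^sup>2) \<longlonglongrightarrow> (g N s \<omega> * D s \<omega>)\<^sup>2"
          using True by (auto intro!: tendsto_intros)
        then have "(\<lambda>n. ennreal ((G (k n) \<omega>)\<^sup>2)) \<longlonglongrightarrow> ennreal ((g N s \<omega> * D s \<omega>)\<^sup>2)"
          by (rule tendsto_ennrealI)
        from lim_imp_Liminf[OF _ this] show ?thesis by simp
      next
        case False
        then have "g N s \<omega> = 0" using g01 by blast
        then show ?thesis by simp
      qed
    qed
    then have "(\<integral>\<^sup>+\<omega>. ennreal ((g N s \<omega> * D s \<omega>)\<^sup>2) \<partial>M) \<le> (\<integral>\<^sup>+\<omega>. liminf (\<lambda>n. ennreal ((G (k n) \<omega>)\<^sup>2)) \<partial>M)"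
      by (rule nn_integral_mono_AE)
    also have "\<dots> \<le> liminf (\<lambda>n. \<integral>\<^sup>+\<omega>. ennreal ((G (k n) \<omega>)\<^sup>2) \<partial>M)"
      using GM by (intro nn_integral_liminf) auto
    also have "\<dots> \<le> liminf (\<lambda>n. ennreal (c (k n)))"
      using EG by (intro Liminf_mono) auto
    also have "\<dots> = ennreal (C * (LINT r:{0<..s}|lborel. \<phi> N r))"
      using lim_imp_Liminf[OF _ lim_c] by simp
    finally have "ennreal (\<phi> N s) \<le> ennreal (C * (LINT r:{0<..s}|lborel. \<phi> N r))"
      unfolding \<phi>_def using nn_integral_eq_integral[OF gD_int[OF s, of N]] by simp
    moreover have "0 \<le> C * (LINT r:{0<..s}|lborel. \<phi> N r)"
    proof (rule LIMSEQ_le_const)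
      show "c \<longlonglongrightarrow> C * (LINT r:{0<..s}|lborel. \<phi> N r)"
        unfolding c_def dp_def by (intro tendsto_intros \<phi>_sum[OF fine s])
      show "\<exists>N. \<forall>n\<ge>N. 0 \<le> c n"
        unfolding c_def using C \<phi>p dp
        by (intro exI allI impI mult_nonneg_nonneg sum_nonneg) auto
    qed
    ultimately show ?thesis by simp
  qed
  have "AE \<omega> in M. g N t \<omega> * D t \<omega> = 0" for N
  proof -
    have "\<phi> N t \<le> 0"
      by (rule gronwall_zero[OF C t \<phi>_int \<phi>_bd(2) key])
    then have "expectation (\<lambda>\<omega>. (g N t \<omega> * D t \<omega>)\<^sup>2) = 0"
      using \<phi>_bd(1)[OF t order_refl, of N] unfolding \<phi>_def by linarith
    then show ?thesis
      using integral_nonneg_eq_0_iff_AE[OF gD_int[of t N]] t by simp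
  qed
  then have "AE \<omega> in M. \<forall>N. g N t \<omega> * D t \<omega> = 0"
    unfolding AE_all_countable by blast
  then show ?thesis
    using AE_space
  proof eventually_elim
    case (elim \<omega>)
    obtain c where c: "\<And>r. r \<in> {0..t} \<Longrightarrow> \<bar>D r \<omega>\<bar> \<le> c" using continuous_on_Icc_bound[OF D(2)[OF elim(2)]] by auto
    obtain N where "c \<le> real N" using real_arch_simple by blast
    then have "\<forall>r\<in>{0..t}. \<bar>D r \<omega>\<bar> \<le> real N" using c order_trans by blast
    then have "g N t \<omega> = 1" using g_iff[OF elim(2) t order_refl, of N] by simp
    then show ?case using elim(1)[rule_format, of N] by simp
  qed
qed

text \<open>
  One partition sequence refines the jump times of the simple processes belonging to both solutions,
  so both stochastic integrals are limits of Riemann sums along the same partitions and can be subtracted.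
\<close>

lemma strong_solution_unique:
  assumes X: "strong_solution M F B \<delta> \<sigma> T \<xi> u X" and Y: "strong_solution M F B \<delta> \<sigma> T \<xi> u Y"
    and t: "t \<in> horizon T"
  shows "AE \<omega> in M. X t \<omega> = Y t \<omega>"
proof -
  obtain I where Xc: "continuous_adapted M F T X" and I: "ito_integral M F B T (\<lambda>s \<omega>. \<sigma> * X s \<omega>) I"
    and Xeq: "AE \<omega> in M. \<forall>t\<in>horizon T. set_integrable lborel {0..t} (\<lambda>s. - \<delta> * X s \<omega> + u s \<omega>) \<and>
           X t \<omega> = \<xi> \<omega> + (LINT s:{0..t}|lborel. - \<delta> * X s \<omega> + u s \<omega>) + I t \<omega>"
    using X unfolding strong_solution_def by blast
  obtain J where Yc: "continuous_adapted M F T Y" and J: "ito_integral M F B T (\<lambda>s \<omega>. \<sigma> * Y s \<omega>) J"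
    and Yeq: "AE \<omega> in M. \<forall>t\<in>horizon T. set_integrable lborel {0..t} (\<lambda>s. - \<delta> * Y s \<omega> + u s \<omega>) \<and>
           Y t \<omega> = \<xi> \<omega> + (LINT s:{0..t}|lborel. - \<delta> * Y s \<omega> + u s \<omega>) + J t \<omega>"
    using Y unfolding strong_solution_def by blast
  obtain S where S: "\<And>n. simple_process M F (S n)" "\<And>t. t\<in>horizon T \<Longrightarrow>
           vanishes_in_probability M
             (\<lambda>n \<omega>. \<integral>\<^sup>+s\<in>{0..t}. ennreal ((simple_value (S n) s \<omega> - \<sigma> * X s \<omega>)\<^sup>2) \<partial>lborel) \<and>
           vanishes_in_probability M
             (\<lambda>n \<omega>. ennreal \<bar>simple_integral_wrt B (S n) t \<omega> - I t \<omega>\<bar>)" and Ic: "continuous_adapted M F T I"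
    using I unfolding ito_integral_def by blast
  obtain S' where S': "\<And>n. simple_process M F (S' n)" "\<And>t. t\<in>horizon T \<Longrightarrow>
           vanishes_in_probability M
             (\<lambda>n \<omega>. \<integral>\<^sup>+s\<in>{0..t}. ennreal ((simple_value (S' n) s \<omega> - \<sigma> * Y s \<omega>)\<^sup>2) \<partial>lborel) \<and>
           vanishes_in_probability M
             (\<lambda>n \<omega>. ennreal \<bar>simple_integral_wrt B (S' n) t \<omega> - J t \<omega>\<bar>)" and Jc: "continuous_adapted M F T J"
    using J unfolding ito_integral_def by blast
  define D where "D s \<omega> = X s \<omega> - Y s \<omega>" for s \<omega>
  have hor: "s \<in> horizon T" if "0 \<le> s" "s \<le> t" for s using horizon_down[OF t that] .
  have adapted: "X s \<in> borel_measurable (F s)" "Y s \<in> borel_measurable (F s)"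
      "I s \<in> borel_measurable (F s)" "J s \<in> borel_measurable (F s)" if "0 \<le> s" "s \<le> t" for s
    using Xc Yc Ic Jc hor[OF that] by (auto simp: continuous_adapted_def)
  have adaptedM: "X s \<in> borel_measurable M" "Y s \<in> borel_measurable M" if "0 \<le> s" "s \<le> t" for s
    by (rule measurable_F_M[OF adapted(1)[OF that] that(1)], rule measurable_F_M[OF adapted(2)[OF that] that(1)])
  have cont: "continuous_on {0..s} (\<lambda>s. X s \<omega>)" "continuous_on {0..s} (\<lambda>s. Y s \<omega>)" if "\<omega> \<in> space M" "0 \<le> s" "s \<le> t" for \<omega> s
    using Xc Yc that hor by (auto simp: continuous_adapted_def intro!: continuous_on_horizonD[OF _ hor])
  have times_nonneg: "0 \<le> fst (snd S) i" if "simple_process M F S" "i \<le> fst S" for S :: "'a simple_process" and i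
  proof -
    obtain N \<tau> \<eta> where Sn: "S = (N, \<tau>, \<eta>)" by (metis prod.exhaust)
    show ?thesis using that steps_mono[of N \<tau> 0 i] unfolding Sn simple_process_def by force
  qed
  have "AE \<omega> in M. D t \<omega> = 0"
  proof (rule homogeneous_sde_zero)
    show "0 \<le> t" using t by (rule horizonD)
    show "D s \<in> borel_measurable (F s)" if "0 \<le> s" "s \<le> t" for s
      using adapted[OF that] unfolding D_def[abs_def] by auto
    show "continuous_on {0..t} (\<lambda>s. D s \<omega>)" if "\<omega> \<in> space M" for \<omega>
      using cont[OF that] t unfolding D_def by (intro continuous_intros) (auto dest: horizonD)
    fix s assume s: "0 \<le> s" "s \<le> t"
    define A where "A n = (\<lambda>i. min s (fst (snd (S n)) i)) ` {..fst (S n)} \<union>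
        (\<lambda>i. min s (fst (snd (S' n)) i)) ` {..fst (S' n)}" for n
    have "finite (A n)" "A n \<subseteq> {0..s}" for n
      using s times_nonneg[OF S(1)] times_nonneg[OF S'(1)] by (auto simp: A_def)
    then obtain m p where fine: "fine_partitions s m p" and Ap: "\<And>n. A n \<subseteq> p n ` {..m n}"
      using ex_fine_partitions[OF s(1)] by metis
    note p = fine_partitionsD[OF fine]
    have pb: "0 \<le> p n j" "p n j \<le> s" if "j \<le> m n" for n j using partition_bounds[OF p that] by auto
    have RX: "null_in_prob (\<lambda>n \<omega>. (\<Sum>j<m n. \<sigma> * X (p n j) \<omega> * (B (p n (Suc j)) \<omega> - B (p n j) \<omega>)) - I s \<omega>)"
    proof (rule riemann_sums_null[OF s(1) _ _ S(1) _ _ _ fine])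
      show "(\<lambda>\<omega>. \<sigma> * X r \<omega>) \<in> borel_measurable (F r)" if "0 \<le> r" "r \<le> s" for r
        using adapted(1)[of r] that s by auto
      show "continuous_on {0..s} (\<lambda>r. \<sigma> * X r \<omega>)" if "\<omega> \<in> space M" for \<omega>
        using cont(1)[OF that s] by (intro continuous_intros)
      show "I s \<in> borel_measurable M" using adapted(3)[OF s] s(1) by (rule measurable_F_M)
      show "min s (fst (snd (S n)) i) \<in> p n ` {..m n}" if "i \<le> fst (S n)" for n i
        using Ap[of n] that unfolding A_def by auto
    qed (use S(2)[OF hor[OF s]] in auto)
    have RY: "null_in_prob (\<lambda>n \<omega>. (\<Sum>j<m n. \<sigma> * Y (p n j) \<omega> * (B (p n (Suc j)) \<omega> - B (p n j) \<omega>)) - J s \<omega>)"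
    proof (rule riemann_sums_null[OF s(1) _ _ S'(1) _ _ _ fine])
      show "(\<lambda>\<omega>. \<sigma> * Y r \<omega>) \<in> borel_measurable (F r)" if "0 \<le> r" "r \<le> s" for r
        using adapted(2)[of r] that s by auto
      show "continuous_on {0..s} (\<lambda>r. \<sigma> * Y r \<omega>)" if "\<omega> \<in> space M" for \<omega>
        using cont(2)[OF that s] by (intro continuous_intros)
      show "J s \<in> borel_measurable M" using adapted(4)[OF s] s(1) by (rule measurable_F_M)
      show "min s (fst (snd (S' n)) i) \<in> p n ` {..m n}" if "i \<le> fst (S' n)" for n i
        using Ap[of n] that unfolding A_def by auto
    qed (use S'(2)[OF hor[OF s]] in auto)
    have DM: "D (p n j) \<in> borel_measurable M" if "j \<le> m n" for n j
      using adaptedM[of "p n j"] pb[OF that] s unfolding D_def[abs_def] by auto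
    have DsM: "D s \<in> borel_measurable M"
      using adaptedM[OF s] unfolding D_def[abs_def] by auto
    have BM: "B (p n j) \<in> borel_measurable M" if "j \<le> m n" for n j using B_measurable pb(1)[OF that] by auto
    have Dlim: "(\<lambda>n. \<Sum>j<m n. D (p n j) \<omega> * (p n (Suc j) - p n j)) \<longlonglongrightarrow> (LINT r:{0..s}|lborel. D r \<omega>)"
      if "\<omega> \<in> space M" for \<omega>
      using cont[OF that s] unfolding D_def by (intro riemann_sum_tendsto[OF fine] continuous_intros)
    have SM: "(\<lambda>\<omega>. \<Sum>j<m n. D (p n j) \<omega> * (p n (Suc j) - p n j)) \<in> borel_measurable M" for n
      using DM by (intro borel_measurable_sum) auto
    have RD: "null_in_prob (\<lambda>n \<omega>. - \<delta> * ((\<Sum>j<m n. D (p n j) \<omega> * (p n (Suc j) - p n j)) - (LINT r:{0..s}|lborel. D r \<omega>)))"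
    proof (rule null_in_prob_AE)
      have "(\<lambda>\<omega>. LINT r:{0..s}|lborel. D r \<omega>) \<in> borel_measurable M"
        by (rule borel_measurable_LIMSEQ_real[OF Dlim SM])
      then show "(\<lambda>\<omega>. - \<delta> * ((\<Sum>j<m n. D (p n j) \<omega> * (p n (Suc j) - p n j)) - (LINT r:{0..s}|lborel. D r \<omega>))) \<in> borel_measurable M" for n
        using SM by auto
      show "AE \<omega> in M. (\<lambda>n. - \<delta> * ((\<Sum>j<m n. D (p n j) \<omega> * (p n (Suc j) - p n j)) - (LINT r:{0..s}|lborel. D r \<omega>))) \<longlonglongrightarrow> 0"
        using Dlim by (intro AE_I2 tendsto_mult_right_zero) (simp add: LIM_zero_iff)
    qed
    have "null_in_prob (\<lambda>n \<omega>. (\<Sum>j<m n. D (p n j) \<omega> * (- \<delta> * (p n (Suc j) - p n j) +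
         \<sigma> * (B (p n (Suc j)) \<omega> - B (p n j) \<omega>))) - D s \<omega>)"
    proof (rule null_in_prob_cong_AE[OF null_in_prob_add[OF RD null_in_prob_diff[OF RX RY]]])
      show "(\<lambda>\<omega>. (\<Sum>j<m n. D (p n j) \<omega> * (- \<delta> * (p n (Suc j) - p n j) +
         \<sigma> * (B (p n (Suc j)) \<omega> - B (p n j) \<omega>))) - D s \<omega>) \<in> borel_measurable M" for n
        using DM BM DsM by (intro borel_measurable_diff borel_measurable_sum borel_measurable_times borel_measurable_add) auto
      fix n
      show "AE \<omega> in M. (\<Sum>j<m n. D (p n j) \<omega> * (- \<delta> * (p n (Suc j) - p n j) + \<sigma> * (B (p n (Suc j)) \<omega> - B (p n j) \<omega>))) - D s \<omega> =
        - \<delta> * ((\<Sum>j<m n. D (p n j) \<omega> * (p n (Suc j) - p n j)) - (LINT r:{0..s}|lborel. D r \<omega>)) +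
        (((\<Sum>j<m n. \<sigma> * X (p n j) \<omega> * (B (p n (Suc j)) \<omega> - B (p n j) \<omega>)) - I s \<omega>) -
         ((\<Sum>j<m n. \<sigma> * Y (p n j) \<omega> * (B (p n (Suc j)) \<omega> - B (p n j) \<omega>)) - J s \<omega>))"
        using Xeq Yeq
      proof eventually_elim
        case (elim \<omega>)
        note iX = elim(1)[rule_format, OF hor[OF s]] and iY = elim(2)[rule_format, OF hor[OF s]]
        have "(LINT s:{0..s}|lborel. - \<delta> * X s \<omega> + u s \<omega>) - (LINT s:{0..s}|lborel. - \<delta> * Y s \<omega> + u s \<omega>) =
            (LINT s:{0..s}|lborel. (- \<delta> * X s \<omega> + u s \<omega>) - (- \<delta> * Y s \<omega> + u s \<omega>))"
          using iX iY by (subst set_integral_diff) auto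
        also have "\<dots> = (LINT s:{0..s}|lborel. - \<delta> * D s \<omega>)"
          unfolding D_def by (simp add: algebra_simps)
        also have "\<dots> = - \<delta> * (LINT s:{0..s}|lborel. D s \<omega>)" by (rule set_integral_mult_right)
        finally have Ds: "D s \<omega> = - \<delta> * (LINT s:{0..s}|lborel. D s \<omega>) + I s \<omega> - J s \<omega>"
          using iX iY unfolding D_def by linarith
        have "(\<Sum>j<m n. D (p n j) \<omega> * (- \<delta> * (p n (Suc j) - p n j) + \<sigma> * (B (p n (Suc j)) \<omega> - B (p n j) \<omega>))) =
           - \<delta> * (\<Sum>j<m n. D (p n j) \<omega> * (p n (Suc j) - p n j)) +
           ((\<Sum>j<m n. \<sigma> * X (p n j) \<omega> * (B (p n (Suc j)) \<omega> - B (p n j) \<omega>)) -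
            (\<Sum>j<m n. \<sigma> * Y (p n j) \<omega> * (B (p n (Suc j)) \<omega> - B (p n j) \<omega>)))"
          unfolding sum_subtractf[symmetric] sum_distrib_left sum.distrib[symmetric]
          by (intro sum.cong) (auto simp: D_def algebra_simps)
        then show ?case using Ds by (simp add: algebra_simps)
      qed
    qed
    then show "\<exists>m p. fine_partitions s m p \<and> null_in_prob (\<lambda>n \<omega>. (\<Sum>j<m n. D (p n j) \<omega> * (- \<delta> * (p n (Suc j) - p n j) +
         \<sigma> * (B (p n (Suc j)) \<omega> - B (p n j) \<omega>))) - D s \<omega>)"
      using fine by blast
  qed
  then show ?thesis by (simp add: D_def)
qed

end

section \<open>Existence of solutions\<close>

lemma set_integrable_times_continuous:
  fixes f g :: "real \<Rightarrow> real"
  assumes f: "set_integrable lborel {a..b} f" and g: "continuous_on {a..b} g"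
  shows "set_integrable lborel {a..b} (\<lambda>s. f s * g s)"
proof -
  obtain C where C: "0 \<le> C" "\<And>r. r \<in> {a..b} \<Longrightarrow> \<bar>g r\<bar> \<le> C" using continuous_on_Icc_bound[OF g] by auto
  have gi: "set_integrable lborel {a..b} g" by (rule borel_integrable_atLeastAtMost'[OF g])
  have fg: "indicator {a..b} s *\<^sub>R (f s * g s) = (indicator {a..b} s *\<^sub>R f s) * (indicator {a..b} s *\<^sub>R g s)" for s
    by (auto simp: indicator_def)
  have Ci: "set_integrable lborel {a..b} (\<lambda>s. C * f s)" using f by (rule set_integrable_mult_right)
  show ?thesis
  proof (rule set_integrable_bound[OF Ci])
    show "set_borel_measurable lborel {a..b} (\<lambda>s. f s * g s)"
      unfolding set_borel_measurable_def fg using f gi unfolding set_integrable_def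
      by (intro borel_measurable_times) auto
    show "AE x in lborel. x \<in> {a..b} \<longrightarrow> norm (f x * g x) \<le> norm (C * f x)"
    proof (intro AE_I2 impI)
      fix x assume "x \<in> {a..b}"
      then have "\<bar>g x\<bar> * \<bar>f x\<bar> \<le> C * \<bar>f x\<bar>" using C(2) by (intro mult_right_mono) auto
      then show "norm (f x * g x) \<le> norm (C * f x)" using C(1) by (simp add: abs_mult mult.commute)
    qed
  qed
qed

lemma set_integral_Icc_split:
  fixes f :: "real \<Rightarrow> real"
  assumes "set_integrable lborel {0..c} f" "0 \<le> b" "b \<le> c"
  shows "(LINT r:{0..c}|lborel. f r) = (LINT r:{0..b}|lborel. f r) + (LINT r:{b<..c}|lborel. f r)"
proof -
  have "{0..c} = {0..b} \<union> {b<..c}" using assms by auto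
  moreover have "(LINT r:{0..b} \<union> {b<..c}|lborel. f r) = (LINT r:{0..b}|lborel. f r) + (LINT r:{b<..c}|lborel. f r)"
    by (rule set_integral_Un) (use assms in \<open>auto intro: set_integrable_subset\<close>)
  ultimately show ?thesis by simp
qed

lemma exp_minus_le: "exp (- x) \<le> 1 - x + x\<^sup>2" if "0 \<le> x" for x :: real
proof -
  have "1 \<le> (1 - x + x\<^sup>2) * (1 + x)" using that by (simp add: algebra_simps power2_eq_square)
  also have "\<dots> \<le> (1 - x + x\<^sup>2) * exp x"
  proof (rule mult_left_mono)
    have "0 \<le> (1 - x/2)\<^sup>2 + 3 / 4 * x\<^sup>2" by simp
    then show "0 \<le> 1 - x + x\<^sup>2" by (simp add: power2_eq_square algebra_simps)
  qed (rule exp_ge_add_one_self)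
  finally show ?thesis by (simp add: exp_minus field_simps)
qed

lemma exp_le_quadratic: "exp x \<le> 1 + x + x\<^sup>2 * exp x" if "0 \<le> x" for x :: real
proof -
  have "(1 + x) * exp (- x) \<ge> (1 + x) * (1 - x)"
    using exp_ge_add_one_self[of "- x"] that by (intro mult_left_mono) auto
  then have "1 - (1 + x) * exp (- x) \<le> x\<^sup>2" by (simp add: algebra_simps power2_eq_square)
  then have "(1 - (1 + x) * exp (- x)) * exp x \<le> x\<^sup>2 * exp x" by (intro mult_right_mono) auto
  moreover have "(1 - (1 + x) * exp (- x)) * exp x = exp x - (1 + x)"
    by (simp add: left_diff_distrib mult.assoc exp_minus)
  ultimately show ?thesis by simp
qed

text \<open>
  Simple processes must have bounded coefficients; truncation at levels tending to infinity achieves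
  this and is eventually invisible on every bounded path.
\<close>

definition clip :: "real \<Rightarrow> real \<Rightarrow> real" where
  "clip K x = max (- K) (min K x)"

lemma clip_le: "0 \<le> K \<Longrightarrow> \<bar>clip K x\<bar> \<le> K" "0 \<le> K \<Longrightarrow> \<bar>clip K x\<bar> \<le> \<bar>x\<bar>" "\<bar>x\<bar> \<le> K \<Longrightarrow> clip K x = x"
  by (auto simp: clip_def)

lemma clip_measurable [measurable]: "clip K \<in> borel_measurable borel"
  unfolding clip_def[abs_def] by measurable

lemma LIMSEQ_clip:
  assumes "f \<longlonglongrightarrow> l" "filterlim K at_top sequentially" "\<And>n. \<bar>f n\<bar> \<le> C"
  shows "(\<lambda>n. clip (K n) (f n)) \<longlonglongrightarrow> l"
proof -
  have "\<forall>\<^sub>F n in sequentially. C \<le> K n" using assms(2) by (simp add: filterlim_at_top)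
  then have "\<forall>\<^sub>F n in sequentially. clip (K n) (f n) = f n"
    by eventually_elim (use assms(3) in \<open>auto intro!: clip_le(3) intro: order_trans\<close>)
  then show ?thesis using assms(1) by (simp add: tendsto_cong)
qed

text \<open>
  Brownian motion and the control are well behaved almost surely only. Replacing them by zero off a good event
  makes all paths continuous and integrable.
\<close>

definition masked :: "'a set \<Rightarrow> (real \<Rightarrow> 'a \<Rightarrow> real) \<Rightarrow> real \<Rightarrow> 'a \<Rightarrow> real" where
  "masked G f s \<omega> = (if \<omega> \<in> G then f s \<omega> else 0)"

text \<open>
  For \<open>Z\<^sub>s = exp (\<sigma> B\<^sub>s - (\<delta> + \<sigma>\<^sup>2 / 2) s)\<close> and an increment \<open>x\<close> of \<open>B\<close> over a time step \<open>d\<close>, this is the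
  growth factor \<open>Z\<^bsub>s+d\<^esub> / Z\<^sub>s\<close> minus its mean \<open>exp (- \<delta> d)\<close> and minus its linear part \<open>\<sigma> x\<close>.
\<close>

definition noise :: "real \<Rightarrow> real \<Rightarrow> real \<Rightarrow> real \<Rightarrow> real" where
  "noise \<delta> \<sigma> d x = exp (\<sigma> * x - (\<delta> + \<sigma>\<^sup>2 / 2) * d) - exp (- \<delta> * d) - \<sigma> * x"

lemma noise_measurable [measurable]: "noise \<delta> \<sigma> d \<in> borel_measurable borel"
  unfolding noise_def[abs_def] by measurable

context brownian_basis
begin

text \<open>
  The exact variance is \<open>exp ((\<sigma>\<^sup>2 - 2 \<delta>) d) - exp (- 2 \<delta> d) + \<sigma>\<^sup>2 d - 2 \<sigma>\<^sup>2 d exp (- \<delta> d)\<close>. Its first order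
  terms in \<open>d\<close> cancel: this cancellation replaces Ito's formula.
\<close>

lemma noise_moments:
  assumes st: "0 \<le> s" "s \<le> t" and tk: "t - s \<le> k" and \<delta>: "0 \<le> \<delta>"
  shows "integrable M (\<lambda>\<omega>. (noise \<delta> \<sigma> (t - s) (B t \<omega> - B s \<omega>))\<^sup>2)"
    and "expectation (\<lambda>\<omega>. noise \<delta> \<sigma> (t - s) (B t \<omega> - B s \<omega>)) = 0"
    and "expectation (\<lambda>\<omega>. (noise \<delta> \<sigma> (t - s) (B t \<omega> - B s \<omega>))\<^sup>2) \<le> (\<sigma>^4 * exp (\<sigma>\<^sup>2 * k) + 2 * \<sigma>\<^sup>2 * \<delta>) * (t - s)\<^sup>2"
proof -
  define d where "d = t - s"
  have d: "0 \<le> d" "d \<le> k" using st tk by (auto simp: d_def)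
  define W where "W \<omega> = B t \<omega> - B s \<omega>" for \<omega>
  define c where "c = exp (- (\<delta> + \<sigma>\<^sup>2 / 2) * d)"
  define e where "e = exp (- \<delta> * d)"
  have X: "integrable M (\<lambda>\<omega>. exp (a * W \<omega>))" "expectation (\<lambda>\<omega>. exp (a * W \<omega>)) = exp (a\<^sup>2 * d / 2)"
    "integrable M (\<lambda>\<omega>. W \<omega> * exp (a * W \<omega>))"
    "expectation (\<lambda>\<omega>. W \<omega> * exp (a * W \<omega>)) = a * d * exp (a\<^sup>2 * d / 2)" for a
    unfolding W_def d_def by (rule increment_exp[OF st])+
  have Mo: "integrable M W" "expectation W = 0" "integrable M (\<lambda>\<omega>. (W \<omega>)\<^sup>2)" "expectation (\<lambda>\<omega>. (W \<omega>)\<^sup>2) = d"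
    unfolding W_def[abs_def] d_def by (rule increment_moments[OF st])+
  have ce: "c * exp (\<sigma>\<^sup>2 * d / 2) = e"
  proof -
    have "- (\<delta> + \<sigma>\<^sup>2 / 2) * d + \<sigma>\<^sup>2 * d / 2 = - \<delta> * d" by (simp add: left_diff_distrib)
    then show ?thesis unfolding c_def e_def by (simp only: exp_add[symmetric])
  qed
  have nz: "noise \<delta> \<sigma> d x = c * exp (\<sigma> * x) - e - \<sigma> * x" for x
  proof -
    have "\<sigma> * x - (\<delta> + \<sigma>\<^sup>2 / 2) * d = - (\<delta> + \<sigma>\<^sup>2 / 2) * d + \<sigma> * x"
      by (simp only: mult_minus_left)
    then show ?thesis unfolding noise_def c_def e_def by (simp only: exp_add)
  qed
  have sq: "(noise \<delta> \<sigma> d (W \<omega>))\<^sup>2 = c\<^sup>2 * exp ((2 * \<sigma>) * W \<omega>) + e\<^sup>2 + \<sigma>\<^sup>2 * (W \<omega>)\<^sup>2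
      - 2 * c * e * exp (\<sigma> * W \<omega>) - 2 * c * \<sigma> * (W \<omega> * exp (\<sigma> * W \<omega>)) + 2 * e * \<sigma> * W \<omega>" for \<omega>
  proof -
    have "exp ((2 * \<sigma>) * W \<omega>) = exp (\<sigma> * W \<omega>) * exp (\<sigma> * W \<omega>)" by (simp add: exp_add[symmetric])
    then show ?thesis unfolding nz by (simp add: power2_eq_square algebra_simps)
  qed
  show "integrable M (\<lambda>\<omega>. (noise \<delta> \<sigma> (t - s) (B t \<omega> - B s \<omega>))\<^sup>2)"
    unfolding d_def[symmetric] W_def[symmetric] sq using X Mo by auto
  show "expectation (\<lambda>\<omega>. noise \<delta> \<sigma> (t - s) (B t \<omega> - B s \<omega>)) = 0"
    unfolding d_def[symmetric] W_def[symmetric] nz using X(1,2)[of \<sigma>] Mo ce by (simp add: prob_space)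
  have "expectation (\<lambda>\<omega>. (noise \<delta> \<sigma> d (W \<omega>))\<^sup>2) = c\<^sup>2 * exp ((2 * \<sigma>)\<^sup>2 * d / 2) + e\<^sup>2 + \<sigma>\<^sup>2 * d
      - 2 * c * e * exp (\<sigma>\<^sup>2 * d / 2) - 2 * c * \<sigma> * (\<sigma> * d * exp (\<sigma>\<^sup>2 * d / 2))"
    unfolding sq using X Mo by (simp add: prob_space)
  also have "\<dots> = (e\<^sup>2 * exp (\<sigma>\<^sup>2 * d)) - e\<^sup>2 + \<sigma>\<^sup>2 * d - 2 * \<sigma>\<^sup>2 * d * e"
  proof -
    have 1: "c\<^sup>2 * exp ((2 * \<sigma>)\<^sup>2 * d / 2) = e\<^sup>2 * exp (\<sigma>\<^sup>2 * d)"
    proof -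
      have "exp ((2 * \<sigma>)\<^sup>2 * d / 2) = (exp (\<sigma>\<^sup>2 * d / 2))\<^sup>2 * exp (\<sigma>\<^sup>2 * d)"
        unfolding exp_double[symmetric] exp_add[symmetric] by (simp add: power2_eq_square)
      then show ?thesis unfolding ce[symmetric] by (simp add: power_mult_distrib)
    qed
    have 2: "2 * c * e * exp (\<sigma>\<^sup>2 * d / 2) = 2 * e\<^sup>2"
      using ce by (simp add: power2_eq_square mult_ac)
    have 3: "2 * c * \<sigma> * (\<sigma> * d * exp (\<sigma>\<^sup>2 * d / 2)) = 2 * \<sigma>\<^sup>2 * d * e"
      unfolding ce[symmetric] by (simp add: power2_eq_square mult_ac)
    show ?thesis unfolding 1 2 3 by simp
  qed
  also have "\<dots> \<le> (\<sigma>^4 * exp (\<sigma>\<^sup>2 * k) + 2 * \<sigma>\<^sup>2 * \<delta>) * d\<^sup>2"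
  proof -
    have e1: "e \<le> 1" "0 \<le> e" unfolding e_def using \<delta> d by (auto simp: mult_nonneg_nonneg)
    have "1 - \<delta> * d \<le> e" unfolding e_def using exp_ge_add_one_self[of "- \<delta> * d"] by simp
    then have "2 * \<sigma>\<^sup>2 * d * (1 - \<delta> * d) \<le> 2 * \<sigma>\<^sup>2 * d * e" using d by (intro mult_left_mono) auto
    moreover have "e\<^sup>2 * exp (\<sigma>\<^sup>2 * d) - e\<^sup>2 \<le> \<sigma>\<^sup>2 * d + (\<sigma>\<^sup>2 * d)\<^sup>2 * exp (\<sigma>\<^sup>2 * k)"
    proof -
      have p0: "0 \<le> \<sigma>\<^sup>2 * d" using d by simp
      have "e\<^sup>2 * exp (\<sigma>\<^sup>2 * d) - e\<^sup>2 = e\<^sup>2 * (exp (\<sigma>\<^sup>2 * d) - 1)" by (simp add: algebra_simps)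
      also have "\<dots> \<le> 1 * (exp (\<sigma>\<^sup>2 * d) - 1)"
        using e1 p0 by (intro mult_right_mono) (auto simp: power_le_one)
      also have "\<dots> \<le> \<sigma>\<^sup>2 * d + (\<sigma>\<^sup>2 * d)\<^sup>2 * exp (\<sigma>\<^sup>2 * d)" using exp_le_quadratic[OF p0] by simp
      also have "(\<sigma>\<^sup>2 * d)\<^sup>2 * exp (\<sigma>\<^sup>2 * d) \<le> (\<sigma>\<^sup>2 * d)\<^sup>2 * exp (\<sigma>\<^sup>2 * k)"
        using d by (intro mult_left_mono) (auto intro: mult_left_mono)
      finally show ?thesis by simp
    qed
    moreover have "(\<sigma>\<^sup>2 * d)\<^sup>2 * exp (\<sigma>\<^sup>2 * k) = \<sigma>^4 * exp (\<sigma>\<^sup>2 * k) * d\<^sup>2" by (simp add: power_mult_distrib)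
    moreover have "2 * \<sigma>\<^sup>2 * d * (1 - \<delta> * d) = 2 * (\<sigma>\<^sup>2 * d) - 2 * \<sigma>\<^sup>2 * \<delta> * d\<^sup>2"
      by (simp add: algebra_simps power2_eq_square)
    ultimately show ?thesis unfolding distrib_right by linarith
  qed
  finally show "expectation (\<lambda>\<omega>. (noise \<delta> \<sigma> (t - s) (B t \<omega> - B s \<omega>))\<^sup>2) \<le> (\<sigma>^4 * exp (\<sigma>\<^sup>2 * k) + 2 * \<sigma>\<^sup>2 * \<delta>) * (t - s)\<^sup>2"
    unfolding d_def W_def .
qed

definition good_event :: "ereal \<Rightarrow> (real \<Rightarrow> 'a \<Rightarrow> real) \<Rightarrow> 'a set \<Rightarrow> bool" where
  "good_event T u G \<longleftrightarrow> G \<in> sets (F 0) \<and> (AE \<omega> in M. \<omega> \<in> G) \<and>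
     (\<forall>\<omega>\<in>G. \<omega> \<in> space M \<and> B 0 \<omega> = 0 \<and> continuous_on {0..} (\<lambda>s. B s \<omega>) \<and>
        (\<forall>t\<in>horizon T. set_integrable lborel {0..t} (\<lambda>s. u s \<omega>)))"

lemma ex_good_event:
  assumes "AE \<omega> in M. \<forall>t\<in>horizon T. set_integrable lborel {0..t} (\<lambda>s. u s \<omega>)"
  shows "\<exists>G. good_event T u G"
proof -
  have "AE \<omega> in M. \<omega> \<in> space M \<and> B 0 \<omega> = 0 \<and> continuous_on {0..} (\<lambda>s. B s \<omega>) \<and>
        (\<forall>t\<in>horizon T. set_integrable lborel {0..t} (\<lambda>s. u s \<omega>))"
    using assms brownian AE_space unfolding brownian_motion_def by (auto elim!: eventually_elim2)
  from AE_good_event[OF this] show ?thesis unfolding good_event_def by metis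
qed

text \<open>
  The solution with initial value \<open>1\<close> and no control, and the variation of constants formula built on it.
\<close>

definition geo :: "real \<Rightarrow> real \<Rightarrow> 'a set \<Rightarrow> real \<Rightarrow> 'a \<Rightarrow> real" where
  "geo \<delta> \<sigma> G s \<omega> = exp (\<sigma> * masked G B s \<omega> - (\<delta> + \<sigma>\<^sup>2 / 2) * s)"

definition explicit :: "real \<Rightarrow> real \<Rightarrow> 'a set \<Rightarrow> ('a \<Rightarrow> real) \<Rightarrow> (real \<Rightarrow> 'a \<Rightarrow> real) \<Rightarrow> real \<Rightarrow> 'a \<Rightarrow> real" where
  "explicit \<delta> \<sigma> G \<xi> u s \<omega> = geo \<delta> \<sigma> G s \<omega> *
     (\<xi> \<omega> + (LINT r:{0..s}|lborel. masked G u r \<omega> * inverse (geo \<delta> \<sigma> G r \<omega>)))"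

lemma geo_pos: "0 < geo \<delta> \<sigma> G s \<omega>"
  by (simp add: geo_def)

context
  fixes T :: ereal and u :: "real \<Rightarrow> 'a \<Rightarrow> real" and G :: "'a set" and \<xi> :: "'a \<Rightarrow> real" and \<delta> \<sigma> :: real
  assumes \<delta>: "0 \<le> \<delta>" and \<xi>: "\<xi> \<in> borel_measurable (F 0)"
    and u: "progressively_measurable F T u" and good: "good_event T u G"
begin

private abbreviation "z \<equiv> geo \<delta> \<sigma> G"
private abbreviation "v \<equiv> masked G u"
private abbreviation "Y \<equiv> explicit \<delta> \<sigma> G \<xi> u"

lemma G_sets: "0 \<le> s \<Longrightarrow> G \<in> sets (F s)"
  using good sets_F_mono[of 0 s] by (auto simp: good_event_def)

lemma geo_adapted: "0 \<le> s \<Longrightarrow> z s \<in> borel_measurable (F s)"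
  using B_adapted[of s] G_sets[of s] unfolding geo_def[abs_def] masked_def by measurable

lemma geo_continuous: "continuous_on {0..} (\<lambda>s. z s \<omega>)"
proof (cases "\<omega> \<in> G")
  case True
  then have "continuous_on {0..} (\<lambda>s. B s \<omega>)" using good by (auto simp: good_event_def)
  then show ?thesis using True unfolding geo_def masked_def by (auto intro!: continuous_intros)
next
  case False
  then show ?thesis unfolding geo_def masked_def by (auto intro!: continuous_intros)
qed

lemma geo_continuous_Icc: "continuous_on {0..t} (\<lambda>s. z s \<omega>)"
  by (rule continuous_on_subset[OF geo_continuous]) auto

lemma inverse_geo_continuous_Icc: "continuous_on {0..t} (\<lambda>s. inverse (z s \<omega>))"
  using geo_pos by (intro continuous_on_inverse geo_continuous_Icc) (auto simp: less_imp_neq[THEN not_sym])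

lemma masked_progressive:
  assumes "t \<in> horizon T"
  shows "(\<lambda>(\<omega>, s). v s \<omega>) \<in> borel_measurable (F t \<Otimes>\<^sub>M restrict_space borel {0..t})"
proof -
  have [measurable]: "(\<lambda>(\<omega>, s). u s \<omega>) \<in> borel_measurable (F t \<Otimes>\<^sub>M restrict_space borel {0..t})"
    using u assms by (auto simp: progressively_measurable_def)
  have [measurable]: "G \<in> sets (F t)" using G_sets assms horizonD by auto
  have "(\<lambda>p. if fst p \<in> G then (\<lambda>(\<omega>, s). u s \<omega>) p else 0) \<in> borel_measurable (F t \<Otimes>\<^sub>M restrict_space borel {0..t})"
    by measurable
  then show ?thesis by (simp add: masked_def case_prod_beta)
qed

lemma masked_integrable: "t \<in> horizon T \<Longrightarrow> set_integrable lborel {0..t} (\<lambda>s. v s \<omega>)"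
  using good by (cases "\<omega> \<in> G") (auto simp: good_event_def masked_def set_integrable_def)

lemma quotient_integrable: "t \<in> horizon T \<Longrightarrow> set_integrable lborel {0..t} (\<lambda>s. v s \<omega> * inverse (z s \<omega>))"
  by (intro set_integrable_times_continuous masked_integrable inverse_geo_continuous_Icc)

lemma explicit_continuous: "continuous_on (horizon T) (\<lambda>s. Y s \<omega>)"
  unfolding explicit_def
  by (intro continuous_on_mult continuous_on_add continuous_on_const continuous_on_indefinite_integral quotient_integrable
      continuous_on_subset[OF geo_continuous]) (auto dest: horizonD)

lemma explicit_adapted:
  assumes t: "t \<in> horizon T"
  shows "Y t \<in> borel_measurable (F t)"
proof -
  have t0: "0 \<le> t" using t by (rule horizonD)
  have "(\<lambda>(\<omega>, s). z s \<omega>) \<in> borel_measurable (F t \<Otimes>\<^sub>M restrict_space borel {0..t})"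
    using t0 by (intro continuous_process_measurable_restrict geo_continuous_Icc)
      (auto intro: measurable_F_mono[OF geo_adapted])
  with masked_progressive[OF t]
  have "(\<lambda>(\<omega>, s). v s \<omega> * inverse (z s \<omega>)) \<in> borel_measurable (F t \<Otimes>\<^sub>M restrict_space borel {0..t})"
    unfolding case_prod_beta by (intro borel_measurable_times borel_measurable_inverse)
  note [measurable] = progressive_integral_measurable[OF this] geo_adapted[OF t0] measurable_F_mono[OF \<xi> order_refl t0]
  show ?thesis unfolding explicit_def[abs_def] by measurable
qed

text \<open>
  What the state equation leaves for the stochastic integral of \<open>\<sigma> Y\<close>.
\<close>

definition martingale_part :: "real \<Rightarrow> 'a \<Rightarrow> real" where
  "martingale_part s \<omega> = Y s \<omega> - \<xi> \<omega> - (LINT r:{0..s}|lborel. - \<delta> * Y r \<omega> + v r \<omega>)"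

lemma explicit_integrable: "t \<in> horizon T \<Longrightarrow> set_integrable lborel {0..t} (\<lambda>s. Y s \<omega>)"
  by (intro borel_integrable_atLeastAtMost' continuous_on_horizonD[OF explicit_continuous])

lemma drift_integrable: "t \<in> horizon T \<Longrightarrow> set_integrable lborel {0..t} (\<lambda>s. - \<delta> * Y s \<omega> + v s \<omega>)"
  by (intro set_integral_add set_integrable_mult_right explicit_integrable masked_integrable)

lemma explicit_progressive:
  assumes t: "t \<in> horizon T"
  shows "(\<lambda>(\<omega>, s). Y s \<omega>) \<in> borel_measurable (F t \<Otimes>\<^sub>M restrict_space borel {0..t})"
  using horizonD[OF t] horizon_down[OF t]
  by (intro continuous_process_measurable_restrict continuous_on_horizonD[OF explicit_continuous t])
    (auto intro: measurable_F_mono[OF explicit_adapted])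

lemma martingale_part_continuous_adapted: "continuous_adapted M F T martingale_part"
  unfolding continuous_adapted_def
proof (intro conjI ballI)
  fix t assume t: "t \<in> horizon T"
  have t0: "0 \<le> t" using t by (rule horizonD)
  have "(\<lambda>(\<omega>, s). - \<delta> * Y s \<omega> + v s \<omega>) \<in> borel_measurable (F t \<Otimes>\<^sub>M restrict_space borel {0..t})"
    using explicit_progressive[OF t] masked_progressive[OF t] unfolding case_prod_beta
    by (intro borel_measurable_add borel_measurable_times) auto
  note [measurable] = progressive_integral_measurable[OF this] explicit_adapted[OF t] measurable_F_mono[OF \<xi> order_refl t0]
  show "martingale_part t \<in> borel_measurable (F t)"
    unfolding martingale_part_def[abs_def] by measurable
next
  fix \<omega> show "continuous_on (horizon T) (\<lambda>s. martingale_part s \<omega>)"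
    unfolding martingale_part_def
    by (intro continuous_on_diff explicit_continuous continuous_on_const continuous_on_indefinite_integral drift_integrable)
qed

text \<open>
  Over one step, the old value is multiplied by the growth factor of \<open>z\<close>, which is split into noise, a linear
  Brownian term and decay; the control received during the step is added.
\<close>

lemma explicit_increment:
  assumes \<omega>: "\<omega> \<in> G" and t: "t \<in> horizon T" and s: "0 \<le> s" "s \<le> t"
  shows "Y t \<omega> - Y s \<omega> = Y s \<omega> * noise \<delta> \<sigma> (t - s) (B t \<omega> - B s \<omega>) + \<sigma> * Y s \<omega> * (B t \<omega> - B s \<omega>)
    - Y s \<omega> * (1 - exp (- \<delta> * (t - s))) + z t \<omega> * (LINT r:{s<..t}|lborel. v r \<omega> * inverse (z r \<omega>))"
proof -
  let ?A = "\<lambda>t. \<xi> \<omega> + (LINT r:{0..t}|lborel. v r \<omega> * inverse (z r \<omega>))"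
  have zt: "z t \<omega> = z s \<omega> * exp (\<sigma> * (B t \<omega> - B s \<omega>) - (\<delta> + \<sigma>\<^sup>2 / 2) * (t - s))"
    using \<omega> unfolding geo_def masked_def exp_add[symmetric] by (simp add: algebra_simps diff_divide_distrib)
  have At: "?A t = ?A s + (LINT r:{s<..t}|lborel. v r \<omega> * inverse (z r \<omega>))"
    using set_integral_Icc_split[OF quotient_integrable[OF t] s] by simp
  have "Y t \<omega> = z t \<omega> * ?A s + z t \<omega> * (LINT r:{s<..t}|lborel. v r \<omega> * inverse (z r \<omega>))"
    unfolding explicit_def At by (simp add: distrib_left)
  moreover have "z t \<omega> * ?A s = Y s \<omega> * exp (\<sigma> * (B t \<omega> - B s \<omega>) - (\<delta> + \<sigma>\<^sup>2 / 2) * (t - s))"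
    unfolding explicit_def zt by simp
  ultimately show ?thesis unfolding noise_def by (simp add: algebra_simps)
qed

lemma explicit_remainder:
  assumes \<omega>: "\<omega> \<in> G" and t: "t \<in> horizon T" and fine: "fine_partitions t m p"
  shows "(\<lambda>n. (\<Sum>i<m n. \<sigma> * Y (p n i) \<omega> * (B (p n (Suc i)) \<omega> - B (p n i) \<omega>)) - martingale_part t \<omega> +
     (\<Sum>i<m n. Y (p n i) \<omega> * noise \<delta> \<sigma> (p n (Suc i) - p n i) (B (p n (Suc i)) \<omega> - B (p n i) \<omega>))) \<longlonglongrightarrow> 0"
proof -
  note p = fine_partitionsD[OF fine]
  have t0: "0 \<le> t" using t by (rule horizonD)
  have pb: "0 \<le> p n j" "p n j \<le> t" if "j \<le> m n" for n j using partition_bounds[OF p that] by auto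
  have pm: "p n j \<le> p n (Suc j)" if "j < m n" for n j using p[of n] that by (auto simp: partition_def)
  have ph: "p n j \<in> horizon T" if "j \<le> m n" for n j using horizon_down[OF t] pb[OF that] by auto
  define dp where "dp n i = p n (Suc i) - p n i" for n i
  \<comment> \<open>\<open>R1\<close> is the error of the discretized decay, \<open>R2\<close> that of the discretized control.\<close>
  define R1 where "R1 n = (\<Sum>i<m n. Y (p n i) \<omega> * (1 - exp (- \<delta> * dp n i))) - \<delta> * (LINT r:{0..t}|lborel. Y r \<omega>)" for n
  define R2 where "R2 n = (LINT r:{0..t}|lborel. v r \<omega>) -
     (\<Sum>i<m n. z (p n (Suc i)) \<omega> * (LINT r:{p n i<..p n (Suc i)}|lborel. v r \<omega> * inverse (z r \<omega>)))" for n
  have Yc: "continuous_on {0..t} (\<lambda>s. Y s \<omega>)" by (rule continuous_on_horizonD[OF explicit_continuous t])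
  have eq: "(\<Sum>i<m n. \<sigma> * Y (p n i) \<omega> * (B (p n (Suc i)) \<omega> - B (p n i) \<omega>)) - martingale_part t \<omega> +
     (\<Sum>i<m n. Y (p n i) \<omega> * noise \<delta> \<sigma> (p n (Suc i) - p n i) (B (p n (Suc i)) \<omega> - B (p n i) \<omega>)) = R1 n + R2 n" for n
  proof -
    have "z 0 \<omega> = 1" using \<omega> good by (simp add: geo_def masked_def good_event_def)
    moreover have "(LINT r:{0..0}|lborel. v r \<omega> * inverse (z r \<omega>)) = 0"
      using set_integral_Ioc_Icc[of 0 0 "\<lambda>r. v r \<omega> * inverse (z r \<omega>)"] quotient_integrable[OF horizon_down[OF t order_refl t0]]
      by (simp add: set_borel_measurable_def set_integrable_def set_lebesgue_integral_def)
    ultimately have Y0: "Y 0 \<omega> = \<xi> \<omega>" by (simp add: explicit_def)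
    have "Y t \<omega> - \<xi> \<omega> = (\<Sum>i<m n. Y (p n (Suc i)) \<omega> - Y (p n i) \<omega>)"
      using sum_lessThan_telescope[of "\<lambda>i. Y (p n i) \<omega>" "m n"] p[of n] Y0 by (simp add: partition_def)
    also have "\<dots> = (\<Sum>i<m n. Y (p n i) \<omega> * noise \<delta> \<sigma> (p n (Suc i) - p n i) (B (p n (Suc i)) \<omega> - B (p n i) \<omega>)
        + \<sigma> * Y (p n i) \<omega> * (B (p n (Suc i)) \<omega> - B (p n i) \<omega>) - Y (p n i) \<omega> * (1 - exp (- \<delta> * dp n i))
        + z (p n (Suc i)) \<omega> * (LINT r:{p n i<..p n (Suc i)}|lborel. v r \<omega> * inverse (z r \<omega>)))"
      using pb pm ph by (intro sum.cong refl) (auto simp: explicit_increment[OF \<omega>] dp_def)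
    finally have "Y t \<omega> - \<xi> \<omega> = \<dots>" .
    moreover have "(LINT r:{0..t}|lborel. - \<delta> * Y r \<omega> + v r \<omega>) = - \<delta> * (LINT r:{0..t}|lborel. Y r \<omega>) + (LINT r:{0..t}|lborel. v r \<omega>)"
      using set_integral_add(2)[OF set_integrable_mult_right[OF explicit_integrable[OF t, of \<omega>], of "- \<delta>"] masked_integrable[OF t, of \<omega>]]
        set_integral_mult_right[of lborel "{0..t}" "- \<delta>" "\<lambda>r. Y r \<omega>"] by (simp only:)
    ultimately show ?thesis
      unfolding martingale_part_def R1_def R2_def by (simp add: sum.distrib sum_subtractf)
  qed
  have "R1 \<longlonglongrightarrow> 0"
  proof -
    obtain h where h: "h \<longlonglongrightarrow> 0" "\<And>n i. i < m n \<Longrightarrow> dp n i \<le> h n"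
      using fine by (auto simp: fine_partitions_def dp_def)
    obtain C where C: "0 \<le> C" "\<And>r. r \<in> {0..t} \<Longrightarrow> \<bar>Y r \<omega>\<bar> \<le> C" using continuous_on_Icc_bound[OF Yc] by auto
    have dp0: "0 \<le> dp n i" if "i < m n" for n i using pm[OF that] by (simp add: dp_def)
    have R1_bound: "norm (R1 n - \<delta> * ((\<Sum>i<m n. Y (p n i) \<omega> * dp n i) - (LINT r:{0..t}|lborel. Y r \<omega>))) \<le> C * \<delta>\<^sup>2 * h n * t" for n
    proof -
      have "R1 n - \<delta> * ((\<Sum>i<m n. Y (p n i) \<omega> * dp n i) - (LINT r:{0..t}|lborel. Y r \<omega>))
          = (\<Sum>i<m n. Y (p n i) \<omega> * (1 - exp (- \<delta> * dp n i) - \<delta> * dp n i))"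
        unfolding R1_def by (simp add: right_diff_distrib sum_subtractf sum_distrib_left mult_ac)
      also have "norm \<dots> \<le> (\<Sum>i<m n. C * \<delta>\<^sup>2 * h n * dp n i)"
      proof (rule sum_norm_le)
        fix i assume "i \<in> {..<m n}"
        then have i: "i < m n" by simp
        have x: "0 \<le> \<delta> * dp n i" using \<delta> dp0[OF i] by simp
        have "\<bar>1 - exp (- \<delta> * dp n i) - \<delta> * dp n i\<bar> \<le> (\<delta> * dp n i)\<^sup>2"
          using exp_minus_le[OF x] exp_ge_add_one_self[of "- (\<delta> * dp n i)"] by auto
        also have "\<dots> = \<delta>\<^sup>2 * (dp n i * dp n i)" by (simp add: power2_eq_square mult_ac)
        also have "\<dots> \<le> \<delta>\<^sup>2 * (h n * dp n i)" using h(2)[OF i] dp0[OF i] by (intro mult_left_mono mult_right_mono) auto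
        finally have "\<bar>Y (p n i) \<omega>\<bar> * \<bar>1 - exp (- \<delta> * dp n i) - \<delta> * dp n i\<bar> \<le> C * (\<delta>\<^sup>2 * (h n * dp n i))"
          using C pb[of i n] i by (intro mult_mono) auto
        then show "norm (Y (p n i) \<omega> * (1 - exp (- \<delta> * dp n i) - \<delta> * dp n i)) \<le> C * \<delta>\<^sup>2 * h n * dp n i"
          by (simp add: abs_mult mult_ac)
      qed
      also have "\<dots> = C * \<delta>\<^sup>2 * h n * t"
        using partition_sum_lengths[OF p, of n] by (simp add: sum_distrib_left[symmetric] dp_def)
      finally show ?thesis .
    qed
    have "(\<lambda>n. C * \<delta>\<^sup>2 * h n * t) \<longlonglongrightarrow> C * \<delta>\<^sup>2 * 0 * t"
      by (intro tendsto_intros h)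
    then have h_lim: "(\<lambda>n. C * \<delta>\<^sup>2 * h n * t) \<longlonglongrightarrow> 0" by simp
    have "(\<lambda>n. R1 n - \<delta> * ((\<Sum>i<m n. Y (p n i) \<omega> * dp n i) - (LINT r:{0..t}|lborel. Y r \<omega>))) \<longlonglongrightarrow> 0"
      by (rule Lim_null_comparison[OF always_eventually[OF allI[OF R1_bound]] h_lim])
    moreover have "(\<lambda>n. \<delta> * ((\<Sum>i<m n. Y (p n i) \<omega> * dp n i) - (LINT r:{0..t}|lborel. Y r \<omega>))) \<longlonglongrightarrow> 0"
      using riemann_sum_tendsto[OF fine Yc] unfolding dp_def by (intro tendsto_mult_right_zero) (simp add: LIM_zero_iff)
    ultimately show ?thesis using tendsto_add by fastforce
  qed
  moreover have "R2 \<longlonglongrightarrow> 0"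
  proof -
    have qi: "set_integrable lborel {0..t} (\<lambda>r. v r \<omega> * inverse (z r \<omega>))" by (rule quotient_integrable[OF t])
    have Ioc: "set_integrable lborel {0<..t} f" if "set_integrable lborel {0..t} f" for f :: "real \<Rightarrow> real"
      using that by (rule set_integrable_subset) auto
    obtain C where C: "0 \<le> C" "\<And>r. r \<in> {0..t} \<Longrightarrow> \<bar>z r \<omega>\<bar> \<le> C" using continuous_on_Icc_bound[OF geo_continuous_Icc] by auto
    let ?s = "\<lambda>n. step (m n) (p n) (\<lambda>i. z (p n (Suc i)) \<omega>)"
    have "(\<lambda>n. LINT r:{0<..t}|lborel. ?s n r * (v r \<omega> * inverse (z r \<omega>))) \<longlonglongrightarrow> (LINT r:{0<..t}|lborel. v r \<omega>)"
      unfolding set_lebesgue_integral_def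
    proof (rule integral_dominated_convergence[where w="\<lambda>r. C * \<bar>indicator {0<..t} r *\<^sub>R (v r \<omega> * inverse (z r \<omega>))\<bar>"])
      show "(\<lambda>r. indicator {0<..t} r *\<^sub>R v r \<omega>) \<in> borel_measurable lborel"
        using Ioc[OF masked_integrable[OF t, of \<omega>]] unfolding set_integrable_def by auto
      show "(\<lambda>r. indicator {0<..t} r *\<^sub>R (?s n r * (v r \<omega> * inverse (z r \<omega>)))) \<in> borel_measurable lborel" for n
        using Ioc[OF step_times_integral(1)[OF p[of n] qi]] unfolding set_integrable_def by auto
      show "integrable lborel (\<lambda>r. C * \<bar>indicator {0<..t} r *\<^sub>R (v r \<omega> * inverse (z r \<omega>))\<bar>)"
        using Ioc[OF qi] unfolding set_integrable_def by (intro integrable_mult_right integrable_abs)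
      show "AE r in lborel. (\<lambda>n. indicator {0<..t} r *\<^sub>R (?s n r * (v r \<omega> * inverse (z r \<omega>)))) \<longlonglongrightarrow> indicator {0<..t} r *\<^sub>R v r \<omega>"
      proof (rule AE_I2)
        fix r
        show "(\<lambda>n. indicator {0<..t} r *\<^sub>R (?s n r * (v r \<omega> * inverse (z r \<omega>)))) \<longlonglongrightarrow> indicator {0<..t} r *\<^sub>R v r \<omega>"
        proof (cases "r \<in> {0<..t}")
          case True
          then have r: "0 < r" "r \<le> t" by auto
          have mem: "step (m n) (p n) (\<lambda>i. p n (Suc i)) r \<in> {0..t}" for n using step_left_endpoint[OF p r, of n] r by auto
          have "(\<lambda>n. z (step (m n) (p n) (\<lambda>i. p n (Suc i)) r) \<omega>) \<longlonglongrightarrow> z r \<omega>"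
            using mem r by (intro continuous_on_tendsto_compose[OF geo_continuous_Icc step_endpoints_tendsto(2)[OF fine r]]) auto
          then have "(\<lambda>n. ?s n r) \<longlonglongrightarrow> z r \<omega>"
            using step_compose[OF p r, of _ "\<lambda>s. z s \<omega>"] by simp
          then have "(\<lambda>n. ?s n r * (v r \<omega> * inverse (z r \<omega>))) \<longlonglongrightarrow> z r \<omega> * (v r \<omega> * inverse (z r \<omega>))"
            by (intro tendsto_intros)
          moreover have "z r \<omega> * (v r \<omega> * inverse (z r \<omega>)) = v r \<omega>"
            using geo_pos[of \<delta> \<sigma> G r \<omega>] by (simp add: mult.left_commute)
          ultimately show ?thesis using True by simp
        qed simp
      qed
      show "AE r in lborel. norm (indicator {0<..t} r *\<^sub>R (?s n r * (v r \<omega> * inverse (z r \<omega>))))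
          \<le> C * \<bar>indicator {0<..t} r *\<^sub>R (v r \<omega> * inverse (z r \<omega>))\<bar>" for n
      proof (rule AE_I2)
        fix r
        show "norm (indicator {0<..t} r *\<^sub>R (?s n r * (v r \<omega> * inverse (z r \<omega>))))
          \<le> C * \<bar>indicator {0<..t} r *\<^sub>R (v r \<omega> * inverse (z r \<omega>))\<bar>"
        proof (cases "r \<in> {0<..t}")
          case True
          then have r: "0 < r" "r \<le> t" by auto
          have "step (m n) (p n) (\<lambda>i. p n (Suc i)) r \<in> {0..t}" using step_left_endpoint[OF p r, of n] r by auto
          then have "\<bar>?s n r\<bar> \<le> C" using step_compose[OF p r, of n "\<lambda>s. z s \<omega>"] C(2) by simp
          then have "\<bar>?s n r\<bar> * \<bar>v r \<omega> * inverse (z r \<omega>)\<bar> \<le> C * \<bar>v r \<omega> * inverse (z r \<omega>)\<bar>"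
            by (rule mult_right_mono) simp
          then show ?thesis using True by (simp add: abs_mult)
        qed simp
      qed
    qed
    moreover have "(LINT r:{0<..t}|lborel. f r) = (LINT r:{0..t}|lborel. f r)" if "set_integrable lborel {0..t} f" for f :: "real \<Rightarrow> real"
      using that by (intro set_integral_Ioc_Icc) (auto simp: set_integrable_def set_borel_measurable_def)
    ultimately have "(\<lambda>n. LINT r:{0..t}|lborel. ?s n r * (v r \<omega> * inverse (z r \<omega>))) \<longlonglongrightarrow> (LINT r:{0..t}|lborel. v r \<omega>)"
      using step_times_integral(1)[OF p qi] masked_integrable[OF t, of \<omega>] by simp
    then have "(\<lambda>n. (LINT r:{0..t}|lborel. v r \<omega>) - (LINT r:{0..t}|lborel. ?s n r * (v r \<omega> * inverse (z r \<omega>))))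
        \<longlonglongrightarrow> (LINT r:{0..t}|lborel. v r \<omega>) - (LINT r:{0..t}|lborel. v r \<omega>)"
      by (intro tendsto_intros)
    then show ?thesis unfolding R2_def[abs_def] step_times_integral(2)[OF p qi] by simp
  qed
  ultimately show ?thesis unfolding eq using tendsto_add[of R1 0 sequentially R2 0] by simp
qed

text \<open>
  The sum of the variances of the noise terms is of the order of the mesh \<open>1 / (n + 1)\<close>. Clipping at
  the fourth root of \<open>n + 1\<close> multiplies it by a square root at most, so the second moment of
  the sum still vanishes, although the clipping level tends to infinity.
\<close>

lemma clipped_noise_null:
  assumes t: "t \<in> horizon T" and p: "\<And>n. partition t (m n) (p n)"
    and mesh: "\<And>n i. i < m n \<Longrightarrow> p n (Suc i) - p n i \<le> 1 / real (Suc n)"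
  shows "null_in_prob (\<lambda>n \<omega>. \<Sum>i<m n. clip (sqrt (sqrt (real (Suc n)))) (Y (p n i) \<omega>) *
      noise \<delta> \<sigma> (p n (Suc i) - p n i) (B (p n (Suc i)) \<omega> - B (p n i) \<omega>))"
proof -
  define K where "K n = sqrt (sqrt (real (Suc n)))" for n
  define C where "C = \<sigma>^4 * exp (\<sigma>\<^sup>2 * t) + 2 * \<sigma>\<^sup>2 * \<delta>"
  have C: "0 \<le> C" using \<delta> by (simp add: C_def)
  have t0: "0 \<le> t" using t by (rule horizonD)
  have pb: "0 \<le> p n j" "p n j \<le> t" if "j \<le> m n" for n j using partition_bounds[OF p that] by auto
  have pm: "p n j \<le> p n (Suc j)" if "j < m n" for n j using p[of n] that by (auto simp: partition_def)
  define d where "d n i = p n (Suc i) - p n i" for n i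
  define N where "N n i \<omega> = noise \<delta> \<sigma> (d n i) (B (p n (Suc i)) \<omega> - B (p n i) \<omega>)" for n i \<omega>
  define a where "a n i \<omega> = clip (K n) (Y (p n i) \<omega>)" for n i \<omega>
  have d0: "0 \<le> d n i" "d n i \<le> t" "d n i \<le> 1 / real (Suc n)" if "i < m n" for n i
    using pm[OF that] pb(1)[of i n] pb(2)[of "Suc i" n] mesh[OF that] that by (auto simp: d_def)
  have K0: "0 \<le> K n" for n by (simp add: K_def)
  have aF: "a n i \<in> borel_measurable (F (p n i))" if "i < m n" for n i
  proof -
    have [measurable]: "Y (p n i) \<in> borel_measurable (F (p n i))"
      using that by (intro explicit_adapted horizon_down[OF t] pb) auto
    show ?thesis unfolding a_def by measurable
  qed
  have aM: "a n i \<in> borel_measurable M" if "i < m n" for n i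
    using aF[OF that] pb(1)[of i n] that by (auto intro: measurable_F_M)
  have a2: "(a n i \<omega>)\<^sup>2 \<le> (K n)\<^sup>2" for n i \<omega>
    using clip_le(1)[OF K0] K0 unfolding a_def by (simp add: abs_le_square_iff[symmetric])
  have a_int: "integrable M (\<lambda>\<omega>. (a n i \<omega>)\<^sup>2)" if "i < m n" for n i
    using a2 aM[OF that] by (intro integrable_const_bound[where B="(K n)\<^sup>2"]) auto
  have NM: "N n i \<in> borel_measurable M" if "i < m n" for n i
  proof -
    have [measurable]: "B (p n i) \<in> borel_measurable M" "B (p n (Suc i)) \<in> borel_measurable M"
      using that by (auto intro!: B_measurable pb)
    show ?thesis unfolding N_def by measurable
  qed
  have Nm: "integrable M (\<lambda>\<omega>. (N n i \<omega>)\<^sup>2)" "expectation (N n i) = 0" "expectation (\<lambda>\<omega>. (N n i \<omega>)\<^sup>2) \<le> C * (d n i)\<^sup>2"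
    if i: "i < m n" for n i
  proof -
    have "p n (Suc i) - p n i \<le> t" using d0(2)[OF i] by (simp add: d_def)
    from noise_moments[OF pb(1)[of i n] pm[OF i] this \<delta>, of \<sigma>] i
    show "integrable M (\<lambda>\<omega>. (N n i \<omega>)\<^sup>2)" "expectation (N n i) = 0" "expectation (\<lambda>\<omega>. (N n i \<omega>)\<^sup>2) \<le> C * (d n i)\<^sup>2"
      by (auto simp: N_def[abs_def] d_def C_def)
  qed
  have orth: "integrable M (\<lambda>\<omega>. (\<Sum>i<m n. a n i \<omega> * N n i \<omega>)\<^sup>2)"
    "expectation (\<lambda>\<omega>. (\<Sum>i<m n. a n i \<omega> * N n i \<omega>)\<^sup>2) =
        (\<Sum>i<m n. expectation (\<lambda>\<omega>. (a n i \<omega>)\<^sup>2) * expectation (\<lambda>\<omega>. (N n i \<omega>)\<^sup>2))" for n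
    using orthogonal_increments[of "m n" "p n" "a n" "\<lambda>i. noise \<delta> \<sigma> (d n i)"] pb pm aF a_int Nm unfolding N_def by auto
  have "null_in_prob (\<lambda>n \<omega>. \<Sum>i<m n. a n i \<omega> * N n i \<omega>)"
  proof (rule null_in_prob_L2)
    show "(\<lambda>\<omega>. \<Sum>i<m n. a n i \<omega> * N n i \<omega>) \<in> borel_measurable M" for n
      using aM NM by (intro borel_measurable_sum borel_measurable_times) auto
    show "integrable M (\<lambda>\<omega>. (\<Sum>i<m n. a n i \<omega> * N n i \<omega>)\<^sup>2)" for n by (rule orth)
    show "(\<lambda>n. expectation (\<lambda>\<omega>. (\<Sum>i<m n. a n i \<omega> * N n i \<omega>)\<^sup>2)) \<longlonglongrightarrow> 0"
    proof (rule tendsto_sandwich[OF _ _ tendsto_const])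
      show "\<forall>\<^sub>F n in sequentially. 0 \<le> expectation (\<lambda>\<omega>. (\<Sum>i<m n. a n i \<omega> * N n i \<omega>)\<^sup>2)"
        by (auto intro!: always_eventually Bochner_Integration.integral_nonneg)
      have "expectation (\<lambda>\<omega>. (\<Sum>i<m n. a n i \<omega> * N n i \<omega>)\<^sup>2) \<le> (K n)\<^sup>2 * (C * (1 / real (Suc n)) * t)" for n
      proof -
        have "expectation (\<lambda>\<omega>. (\<Sum>i<m n. a n i \<omega> * N n i \<omega>)\<^sup>2) \<le> (\<Sum>i<m n. (K n)\<^sup>2 * (C * (1 / real (Suc n)) * d n i))"
          unfolding orth(2)
        proof (rule sum_mono)
          fix i assume "i \<in> {..<m n}"
          then have i: "i < m n" by simp
          have "expectation (\<lambda>\<omega>. (a n i \<omega>)\<^sup>2) \<le> expectation (\<lambda>\<omega>. (K n)\<^sup>2)"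
            using a2 a_int[OF i] by (intro integral_mono) auto
          then have 1: "expectation (\<lambda>\<omega>. (a n i \<omega>)\<^sup>2) \<le> (K n)\<^sup>2" by (simp add: prob_space)
          have "(d n i)\<^sup>2 \<le> 1 / real (Suc n) * d n i"
            unfolding power2_eq_square using d0[OF i] by (intro mult_right_mono) auto
          then have "C * (d n i)\<^sup>2 \<le> C * (1 / real (Suc n) * d n i)" using C by (rule mult_left_mono)
          then have 2: "expectation (\<lambda>\<omega>. (N n i \<omega>)\<^sup>2) \<le> C * (1 / real (Suc n)) * d n i"
            using Nm(3)[OF i] by (simp add: mult.assoc)
          show "expectation (\<lambda>\<omega>. (a n i \<omega>)\<^sup>2) * expectation (\<lambda>\<omega>. (N n i \<omega>)\<^sup>2) \<le> (K n)\<^sup>2 * (C * (1 / real (Suc n)) * d n i)"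
            by (intro mult_mono 1 2) (auto intro: Bochner_Integration.integral_nonneg)
        qed
        also have "\<dots> = (K n)\<^sup>2 * (C * (1 / real (Suc n)) * t)"
          using partition_sum_lengths[OF p, of n] by (simp only: sum_distrib_left[symmetric] d_def)
        finally show ?thesis .
      qed
      then show "\<forall>\<^sub>F n in sequentially. expectation (\<lambda>\<omega>. (\<Sum>i<m n. a n i \<omega> * N n i \<omega>)\<^sup>2) \<le> (K n)\<^sup>2 * (C * (1 / real (Suc n)) * t)"
        by simp
      have "(K n)\<^sup>2 * (C * (1 / real (Suc n)) * t) = (C * t) * inverse (sqrt (real (Suc n)))" for n
      proof -
        have "(K n)\<^sup>2 * (1 / real (Suc n)) = sqrt (real (Suc n)) / (sqrt (real (Suc n)) * sqrt (real (Suc n)))"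
          by (simp add: K_def)
        also have "\<dots> = inverse (sqrt (real (Suc n)))"
          by (simp add: inverse_eq_divide del: real_sqrt_mult_self)
        finally show ?thesis by (simp only: mult_ac)
      qed
      moreover have "(\<lambda>n. (C * t) * inverse (sqrt (real (Suc n)))) \<longlonglongrightarrow> 0"
        by (intro tendsto_mult_right_zero tendsto_inverse_0_at_top filterlim_compose[OF sqrt_at_top]
            filterlim_compose[OF filterlim_real_sequentially filterlim_Suc])
      ultimately show "(\<lambda>n. (K n)\<^sup>2 * (C * (1 / real (Suc n)) * t)) \<longlonglongrightarrow> 0" by simp
    qed
  qed
  then show ?thesis unfolding a_def K_def N_def d_def .
qed

text \<open>
  Mesh \<open>1 / (n + 1)\<close> on \<open>[0, n + 1]\<close>, so that every time is eventually covered. Grid points beyond a finite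
  horizon get the coefficient zero: adaptedness of the state is known on the horizon alone.
\<close>

definition approximant :: "nat \<Rightarrow> 'a simple_process" where
  "approximant n = (Suc n * Suc n, \<lambda>i. real i / real (Suc n),
     \<lambda>i \<omega>. if real i / real (Suc n) \<in> horizon T then clip (real n) (\<sigma> * Y (real i / real (Suc n)) \<omega>) else 0)"

lemma approximant_simple: "simple_process M F (approximant n)"
  unfolding simple_process_def approximant_def prod.case
proof (intro conjI allI impI)
  fix i
  show "(\<lambda>\<omega>. if real i / real (Suc n) \<in> horizon T then clip (real n) (\<sigma> * Y (real i / real (Suc n)) \<omega>) else 0)
      \<in> borel_measurable (F (real i / real (Suc n)))"
  proof (cases "real i / real (Suc n) \<in> horizon T")
    case True
    note [measurable] = explicit_adapted[OF True]
    show ?thesis unfolding if_P[OF True] by measurable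
  qed simp
  show "\<exists>C. \<forall>i<Suc n * Suc n. \<forall>\<omega>\<in>space M. \<bar>if real i / real (Suc n) \<in> horizon T
       then clip (real n) (\<sigma> * Y (real i / real (Suc n)) \<omega>) else 0\<bar> \<le> C"
    by (intro exI[of _ "real n"]) (auto intro: clip_le(1))
qed (auto intro: divide_right_mono)

definition grid :: "real \<Rightarrow> nat \<Rightarrow> nat \<Rightarrow> real" where
  "grid t n i = min t (real i / real (Suc n))"

lemma grid_partition:
  assumes "0 \<le> t" "t \<le> real (Suc n)"
  shows "partition t (Suc n * Suc n) (grid t n)"
    and "grid t n (Suc i) - grid t n i \<le> 1 / real (Suc n)"
proof -
  have "real (Suc n * Suc n) / real (Suc n) = real (Suc n)" by (simp only: of_nat_mult) simp
  moreover have "real i / real (Suc n) \<le> real (Suc i) / real (Suc n)" for i by (intro divide_right_mono) auto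
  ultimately show "partition t (Suc n * Suc n) (grid t n)"
    using assms unfolding partition_def grid_def by (intro conjI allI impI min.mono order_refl) simp_all
  have "real (Suc i) / real (Suc n) = real i / real (Suc n) + 1 / real (Suc n)"
    by (simp add: add_divide_distrib)
  moreover have "0 \<le> 1 / real (Suc n)" by simp
  ultimately show "grid t n (Suc i) - grid t n i \<le> 1 / real (Suc n)"
    unfolding grid_def by linarith
qed

lemma approximant_value:
  assumes t: "t \<in> horizon T" "t \<le> real (Suc n)" and r: "0 < r" "r \<le> t"
  shows "simple_value (approximant n) r \<omega> =
    clip (real n) (\<sigma> * Y (step (Suc n * Suc n) (grid t n) (grid t n) r) \<omega>)"
proof -
  have p: "partition t (Suc n * Suc n) (grid t n)" using t horizonD by (intro grid_partition) auto
  have "simple_value (approximant n) r \<omega> = step (Suc n * Suc n) (grid t n) (\<lambda>i. clip (real n) (\<sigma> * Y (grid t n i) \<omega>)) r"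
    unfolding simple_value_def approximant_def prod.case step_def
  proof (intro sum.cong refl)
    fix i
    let ?\<tau> = "real i / real (Suc n)"
    have 1: "indicator {?\<tau><..real (Suc i) / real (Suc n)} r = (indicator {grid t n i<..grid t n (Suc i)} r :: real)"
      using r by (auto simp: indicator_def grid_def)
    show "(if ?\<tau> \<in> horizon T then clip (real n) (\<sigma> * Y ?\<tau> \<omega>) else 0) * indicator {?\<tau><..real (Suc i) / real (Suc n)} r =
         clip (real n) (\<sigma> * Y (grid t n i) \<omega>) * indicator {grid t n i<..grid t n (Suc i)} r"
    proof (cases "?\<tau> < r")
      case True
      then have "?\<tau> \<in> horizon T" using horizon_down[OF t(1), of ?\<tau>] r by simp
      moreover have "grid t n i = ?\<tau>" using True r by (simp add: grid_def)
      ultimately show ?thesis unfolding 1 by simp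
    next
      case False
      then have "indicator {?\<tau><..real (Suc i) / real (Suc n)} r = (0::real)" by (simp add: indicator_def)
      then show ?thesis unfolding 1 by simp
    qed
  qed
  also have "\<dots> = clip (real n) (\<sigma> * Y (step (Suc n * Suc n) (grid t n) (grid t n) r) \<omega>)"
    by (rule step_compose[OF p r, of "\<lambda>s. clip (real n) (\<sigma> * Y s \<omega>)"])
  finally show ?thesis .
qed

lemma approximant_integral:
  assumes t: "t \<in> horizon T"
  shows "simple_integral_wrt B (approximant n) t \<omega> =
    (\<Sum>i<Suc n * Suc n. clip (real n) (\<sigma> * Y (grid t n i) \<omega>) * (B (grid t n (Suc i)) \<omega> - B (grid t n i) \<omega>))"
  unfolding simple_integral_wrt_def approximant_def prod.case grid_def
proof (intro sum.cong refl)
  fix i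
  let ?\<tau> = "real i / real (Suc n)"
  have le: "?\<tau> \<le> real (Suc i) / real (Suc n)" by (intro divide_right_mono) auto
  show "(if ?\<tau> \<in> horizon T then clip (real n) (\<sigma> * Y ?\<tau> \<omega>) else 0) *
         (B (min t (real (Suc i) / real (Suc n))) \<omega> - B (min t ?\<tau>) \<omega>) =
         clip (real n) (\<sigma> * Y (min t ?\<tau>) \<omega>) *
         (B (min t (real (Suc i) / real (Suc n))) \<omega> - B (min t ?\<tau>) \<omega>)"
  proof (cases "?\<tau> \<le> t")
    case True
    then have "?\<tau> \<in> horizon T" using horizon_down[OF t, of ?\<tau>] by simp
    then show ?thesis using True by simp
  next
    case False
    then have "min t ?\<tau> = t" "min t (real (Suc i) / real (Suc n)) = t" using le by auto
    then show ?thesis by simp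
  qed
qed

lemma approximants_converge:
  assumes t: "t \<in> horizon T"
  shows "vanishes_in_probability M
      (\<lambda>n \<omega>. \<integral>\<^sup>+s\<in>{0..t}. ennreal ((simple_value (approximant n) s \<omega> - \<sigma> * Y s \<omega>)\<^sup>2) \<partial>lborel)"
proof (rule vanishes_in_probability_AE)
  have t0: "0 \<le> t" using t by (rule horizonD)
  note Yc = continuous_on_horizonD[OF explicit_continuous t]
  have YM: "Y s \<in> borel_measurable M" if "0 \<le> s" "s \<le> t" for s
    by (rule measurable_F_M[OF explicit_adapted[OF horizon_down[OF t that]] that(1)])
  have Yj: "(\<lambda>(\<omega>, s). Y s \<omega>) \<in> borel_measurable (M \<Otimes>\<^sub>M restrict_space borel {0..t})"
    by (rule continuous_process_measurable_restrict[OF t0 YM Yc])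
  show "(\<lambda>\<omega>. \<integral>\<^sup>+s\<in>{0..t}. ennreal ((simple_value (approximant n) s \<omega> - \<sigma> * Y s \<omega>)\<^sup>2) \<partial>lborel) \<in> borel_measurable M" for n
  proof (rule progressive_nn_integral_measurable)
    have [measurable]: "(\<lambda>\<omega>. if real i / real (Suc n) \<in> horizon T then clip (real n) (\<sigma> * Y (real i / real (Suc n)) \<omega>) else 0) \<in> borel_measurable M" for i
    proof (cases "real i / real (Suc n) \<in> horizon T")
      case True
      have "Y (real i / real (Suc n)) \<in> borel_measurable M"
        by (rule measurable_F_M[OF explicit_adapted[OF True]]) simp
      then show ?thesis using True by simp
    qed simp
    have snd_meas: "snd \<in> borel_measurable (M \<Otimes>\<^sub>M restrict_space borel {0..t})"
      by (rule measurable_compose[OF measurable_snd]) (rule measurable_restrict_space1, simp)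
    have "(\<lambda>z. simple_value (approximant n) (snd z) (fst z)) \<in> borel_measurable (M \<Otimes>\<^sub>M restrict_space borel {0..t})"
      unfolding simple_value_def approximant_def prod.case
    proof (rule borel_measurable_sum, rule borel_measurable_times)
      fix i
      show "(\<lambda>z. if real i / real (Suc n) \<in> horizon T then clip (real n) (\<sigma> * Y (real i / real (Suc n)) (fst z)) else 0)
          \<in> borel_measurable (M \<Otimes>\<^sub>M restrict_space borel {0..t})"
        by (rule measurable_compose[OF measurable_fst, of "\<lambda>\<omega>. if real i / real (Suc n) \<in> horizon T then clip (real n) (\<sigma> * Y (real i / real (Suc n)) \<omega>) else 0"]) measurable
      show "(\<lambda>z. indicator {real i / real (Suc n)<..real (Suc i) / real (Suc n)} (snd z) :: real)
          \<in> borel_measurable (M \<Otimes>\<^sub>M restrict_space borel {0..t})"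
        by (rule measurable_compose[OF snd_meas]) measurable
    qed
    then show "(\<lambda>(\<omega>, s). (simple_value (approximant n) s \<omega> - \<sigma> * Y s \<omega>)\<^sup>2) \<in> borel_measurable (M \<Otimes>\<^sub>M restrict_space borel {0..t})"
      using Yj unfolding case_prod_beta by (intro borel_measurable_power borel_measurable_diff borel_measurable_times) auto
  qed
  obtain n0 :: nat where n0: "t \<le> real n0" using real_arch_simple by blast
  have fine: "fine_partitions t (\<lambda>n. Suc (n + n0) * Suc (n + n0)) (\<lambda>n. grid t (n + n0))"
    unfolding fine_partitions_def
  proof (intro conjI allI impI exI[of _ "\<lambda>n. 1 / real (Suc (n + n0))"])
    show "partition t (Suc (n + n0) * Suc (n + n0)) (grid t (n + n0))" for n
      using n0 t0 by (intro grid_partition) auto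
    show "(\<lambda>n. 1 / real (Suc (n + n0))) \<longlonglongrightarrow> 0"
      using LIMSEQ_ignore_initial_segment[OF LIMSEQ_Suc[OF lim_1_over_n], of n0] by simp
    show "grid t (n + n0) (Suc i) - grid t (n + n0) i \<le> 1 / real (Suc (n + n0))"
      for n i
      using n0 t0 by (intro grid_partition) auto
  qed
  note p = fine_partitionsD[OF fine]
  show "AE \<omega> in M. (\<lambda>n. \<integral>\<^sup>+s\<in>{0..t}. ennreal ((simple_value (approximant n) s \<omega> - \<sigma> * Y s \<omega>)\<^sup>2) \<partial>lborel) \<longlonglongrightarrow> 0"
  proof (rule AE_I2, rule LIMSEQ_offset[where k=n0])
    fix \<omega>
    have \<sigma>Yc: "continuous_on {0..t} (\<lambda>s. \<sigma> * Y s \<omega>)" by (intro continuous_intros Yc)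
    obtain C where C: "0 \<le> C" "\<And>r. r \<in> {0..t} \<Longrightarrow> \<bar>\<sigma> * Y r \<omega>\<bar> \<le> C" using continuous_on_Icc_bound[OF \<sigma>Yc] by auto
    let ?S = "\<lambda>n r. simple_value (approximant (n + n0)) r \<omega>"
    have S: "?S n r = clip (real (n + n0)) (\<sigma> * Y (step (Suc (n + n0) * Suc (n + n0)) (grid t (n + n0)) (grid t (n + n0)) r) \<omega>)"
      if "0 < r" "r \<le> t" for n r
      by (rule approximant_value[OF t _ that]) (use n0 in simp)
    have mem: "step (Suc (n + n0) * Suc (n + n0)) (grid t (n + n0)) (grid t (n + n0)) r \<in> {0..t}" if r: "0 < r" "r \<le> t" for n r
      using step_left_endpoint[OF p r, of n] r by auto
    have "(\<lambda>n. \<integral>\<^sup>+s. ennreal (indicator {0<..t} s * (?S n s - \<sigma> * Y s \<omega>)\<^sup>2) \<partial>lborel) \<longlonglongrightarrow> (\<integral>\<^sup>+s. 0 \<partial>(lborel :: real measure))"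
    proof (rule nn_integral_dominated_convergence[where w="\<lambda>s. ennreal ((2 * C)\<^sup>2 * indicator {0<..t} s)"])
      have Ym: "(\<lambda>s. indicator {0<..t} s *\<^sub>R (\<sigma> * Y s \<omega>)) \<in> borel_measurable lborel"
      proof -
        have "set_integrable lborel {0<..t} (\<lambda>s. \<sigma> * Y s \<omega>)"
          by (rule set_integrable_subset[OF borel_integrable_atLeastAtMost'[OF \<sigma>Yc]]) auto
        then show ?thesis unfolding set_integrable_def by (rule borel_measurable_integrable)
      qed
      have Sm: "(\<lambda>s. ?S n s) \<in> borel_measurable lborel" for n
        unfolding simple_value_def approximant_def prod.case by measurable
      have "(\<lambda>s. ennreal (indicator {0<..t} s * (?S n s - indicator {0<..t} s *\<^sub>R (\<sigma> * Y s \<omega>))\<^sup>2)) \<in> borel_measurable lborel" for n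
        using Ym Sm[of n] by measurable
      moreover have "indicator {0<..t} s * (?S n s - indicator {0<..t} s *\<^sub>R (\<sigma> * Y s \<omega>))\<^sup>2 =
          indicator {0<..t} s * (?S n s - \<sigma> * Y s \<omega>)\<^sup>2" for n s
        by (simp add: indicator_def)
      ultimately show "(\<lambda>s. ennreal (indicator {0<..t} s * (?S n s - \<sigma> * Y s \<omega>)\<^sup>2)) \<in> borel_measurable lborel" for n
        by (simp only:)
      show "(\<integral>\<^sup>+s. ennreal ((2 * C)\<^sup>2 * indicator {0<..t} s) \<partial>lborel) < \<infinity>"
        by (subst nn_integral_eq_integral[OF integrable_indicator_Ioc]) auto
      show "AE s in lborel. ennreal (indicator {0<..t} s * (?S n s - \<sigma> * Y s \<omega>)\<^sup>2) \<le> ennreal ((2 * C)\<^sup>2 * indicator {0<..t} s)" for n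
      proof (rule AE_I2, rule ennreal_leI)
        fix s
        show "indicator {0<..t} s * (?S n s - \<sigma> * Y s \<omega>)\<^sup>2 \<le> (2 * C)\<^sup>2 * indicator {0<..t} s"
        proof (cases "s \<in> {0<..t}")
          case True
          then have s: "0 < s" "s \<le> t" by auto
          have "\<bar>?S n s\<bar> \<le> C" unfolding S[OF s]
            by (rule order_trans[OF clip_le(2) C(2)[OF mem[OF s]]]) simp
          moreover have "\<bar>\<sigma> * Y s \<omega>\<bar> \<le> C" using C(2)[of s] s by simp
          ultimately have "\<bar>?S n s - \<sigma> * Y s \<omega>\<bar> \<le> \<bar>2 * C\<bar>" by linarith
          then have "(?S n s - \<sigma> * Y s \<omega>)\<^sup>2 \<le> (2 * C)\<^sup>2" by (simp only: abs_le_square_iff)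
          then show ?thesis using True by simp
        qed simp
      qed
      show "AE s in lborel. (\<lambda>n. ennreal (indicator {0<..t} s * (?S n s - \<sigma> * Y s \<omega>)\<^sup>2)) \<longlonglongrightarrow> 0"
      proof (rule AE_I2)
        fix s
        show "(\<lambda>n. ennreal (indicator {0<..t} s * (?S n s - \<sigma> * Y s \<omega>)\<^sup>2)) \<longlonglongrightarrow> 0"
        proof (cases "s \<in> {0<..t}")
          case True
          then have s: "0 < s" "s \<le> t" by auto
          have 1: "(\<lambda>n. \<sigma> * Y (step (Suc (n + n0) * Suc (n + n0)) (grid t (n + n0)) (grid t (n + n0)) s) \<omega>) \<longlonglongrightarrow> \<sigma> * Y s \<omega>"
            using mem[OF s] s
            by (intro continuous_on_tendsto_compose[OF \<sigma>Yc step_endpoints_tendsto(1)[OF fine s]]) auto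
          have 2: "filterlim (\<lambda>n. real (n + n0)) at_top sequentially"
            by (rule filterlim_compose[OF filterlim_real_sequentially filterlim_add_const_nat_at_top])
          have "(\<lambda>n. ?S n s) \<longlonglongrightarrow> \<sigma> * Y s \<omega>"
            unfolding S[OF s] by (rule LIMSEQ_clip[OF 1 2 C(2)[OF mem[OF s]]])
          then have "(\<lambda>n. (?S n s - \<sigma> * Y s \<omega>)\<^sup>2) \<longlonglongrightarrow> (\<sigma> * Y s \<omega> - \<sigma> * Y s \<omega>)\<^sup>2"
            by (intro tendsto_intros)
          then have "(\<lambda>n. ennreal ((?S n s - \<sigma> * Y s \<omega>)\<^sup>2)) \<longlonglongrightarrow> ennreal ((\<sigma> * Y s \<omega> - \<sigma> * Y s \<omega>)\<^sup>2)"
            by (rule tendsto_ennrealI)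
          then show ?thesis using True by simp
        qed simp
      qed
    qed measurable
    moreover have "(\<integral>\<^sup>+s\<in>{0..t}. ennreal ((?S n s - \<sigma> * Y s \<omega>)\<^sup>2) \<partial>lborel) =
        (\<integral>\<^sup>+s. ennreal (indicator {0<..t} s * (?S n s - \<sigma> * Y s \<omega>)\<^sup>2) \<partial>lborel)" for n
      by (rule nn_integral_cong_AE, rule AE_I[of _ _ "{0}"]) (auto simp: indicator_def)
    ultimately show "(\<lambda>n. \<integral>\<^sup>+s\<in>{0..t}. ennreal ((?S n s - \<sigma> * Y s \<omega>)\<^sup>2) \<partial>lborel) \<longlonglongrightarrow> 0" by simp
  qed
qed

text \<open>
  Adding the clipped noise to the error leaves a quantity which, path by path, equals the
  unclipped one for large \<open>n\<close> and therefore tends to zero; the noise itself is null in probability.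
\<close>

lemma approximant_integrals_converge:
  assumes t: "t \<in> horizon T"
  shows "vanishes_in_probability M (\<lambda>n \<omega>. ennreal \<bar>simple_integral_wrt B (approximant n) t \<omega> - martingale_part t \<omega>\<bar>)"
proof -
  have t0: "0 \<le> t" using t by (rule horizonD)
  note Yc = continuous_on_horizonD[OF explicit_continuous t]
  \<comment> \<open>The grid of index \<open>n\<close> covers \<open>[0, t]\<close> from \<open>n0\<close> on, so all indices are shifted by \<open>n0\<close>.\<close>
  obtain n0 :: nat where n0: "t \<le> real n0" using real_arch_simple by blast
  define m where "m n = Suc (n + n0) * Suc (n + n0)" for n
  define p where "p n = grid t (n + n0)" for n
  define K where "K n = sqrt (sqrt (real (Suc n)))" for n
  have part: "partition t (m n) (p n)" for n
    using n0 t0 unfolding m_def p_def by (intro grid_partition) auto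
  have mesh: "p n (Suc i) - p n i \<le> 1 / real (Suc (n + n0))" for n i
    using n0 t0 unfolding p_def by (intro grid_partition) auto
  have fine: "fine_partitions t m p"
    unfolding fine_partitions_def
  proof (intro conjI allI exI impI)
    show "(\<lambda>n. 1 / real (Suc (n + n0))) \<longlonglongrightarrow> 0"
      using LIMSEQ_ignore_initial_segment[OF LIMSEQ_Suc[OF lim_1_over_n], of n0] by simp
  qed (use part mesh in auto)
  have pb: "0 \<le> p n j" "p n j \<le> t" if "j \<le> m n" for n j using partition_bounds[OF part that] by auto
  have YM: "Y (p n j) \<in> borel_measurable M" if "j \<le> m n" for n j
    by (rule measurable_F_M[OF explicit_adapted[OF horizon_down[OF t pb[OF that]]] pb(1)[OF that]])
  have BM: "B (p n j) \<in> borel_measurable M" if "j \<le> m n" for n j using B_measurable pb(1)[OF that] by auto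
  have IM: "martingale_part t \<in> borel_measurable M"
    using martingale_part_continuous_adapted t t0 by (auto simp: continuous_adapted_def intro: measurable_F_M)
  let ?SI = "\<lambda>n \<omega>. simple_integral_wrt B (approximant n) t \<omega>"
  have SIM: "?SI n \<in> borel_measurable M" for n
    unfolding approximant_integral[OF t]
  proof (intro borel_measurable_sum borel_measurable_times borel_measurable_diff)
    fix i
    have g: "0 \<le> grid t n i" "grid t n i \<le> t" for i using t0 by (auto simp: grid_def)
    have [measurable]: "Y (grid t n i) \<in> borel_measurable M"
      by (rule measurable_F_M[OF explicit_adapted[OF horizon_down[OF t g]] g(1)])
    show "(\<lambda>\<omega>. clip (real n) (\<sigma> * Y (grid t n i) \<omega>)) \<in> borel_measurable M" by measurable
    show "B (grid t n (Suc i)) \<in> borel_measurable M" "B (grid t n i) \<in> borel_measurable M" using B_measurable g by auto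
  qed
  define N where "N n \<omega> = (\<Sum>i<m n. clip (K n) (Y (p n i) \<omega>) *
      noise \<delta> \<sigma> (p n (Suc i) - p n i) (B (p n (Suc i)) \<omega> - B (p n i) \<omega>))" for n \<omega>
  have Nnull: "null_in_prob N"
    unfolding N_def[abs_def] K_def
  proof (rule clipped_noise_null[OF t part])
    fix n i
    have "1 / real (Suc (n + n0)) \<le> 1 / real (Suc n)" by (intro divide_left_mono) auto
    then show "p n (Suc i) - p n i \<le> 1 / real (Suc n)" using mesh[of n i] by linarith
  qed
  have "null_in_prob (\<lambda>n \<omega>. (?SI (n + n0) \<omega> - martingale_part t \<omega>) + N n \<omega>)"
  proof (rule null_in_prob_AE)
    show "(\<lambda>\<omega>. (?SI (n + n0) \<omega> - martingale_part t \<omega>) + N n \<omega>) \<in> borel_measurable M" for n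
      using SIM IM null_in_prob_measurable[OF Nnull] by auto
    have "AE \<omega> in M. \<omega> \<in> G" using good by (simp add: good_event_def)
    then show "AE \<omega> in M. (\<lambda>n. (?SI (n + n0) \<omega> - martingale_part t \<omega>) + N n \<omega>) \<longlonglongrightarrow> 0"
    proof eventually_elim
      case (elim \<omega>)
      obtain C where C: "0 \<le> C" "\<And>r. r \<in> {0..t} \<Longrightarrow> \<bar>Y r \<omega>\<bar> \<le> C" using continuous_on_Icc_bound[OF Yc] by auto
      have Ktop: "filterlim K at_top sequentially"
        unfolding K_def by (intro filterlim_compose[OF sqrt_at_top] filterlim_compose[OF filterlim_real_sequentially filterlim_Suc])
      have 1: "\<forall>\<^sub>F n in sequentially. C \<le> K n" using Ktop by (simp add: filterlim_at_top)
      have "filterlim (\<lambda>n. real (n + n0)) at_top sequentially"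
        by (rule filterlim_compose[OF filterlim_real_sequentially filterlim_add_const_nat_at_top])
      then have 2: "\<forall>\<^sub>F n in sequentially. \<bar>\<sigma>\<bar> * C \<le> real (n + n0)" by (simp add: filterlim_at_top)
      have "\<forall>\<^sub>F n in sequentially. (?SI (n + n0) \<omega> - martingale_part t \<omega>) + N n \<omega> =
        (\<Sum>i<m n. \<sigma> * Y (p n i) \<omega> * (B (p n (Suc i)) \<omega> - B (p n i) \<omega>)) - martingale_part t \<omega> +
        (\<Sum>i<m n. Y (p n i) \<omega> * noise \<delta> \<sigma> (p n (Suc i) - p n i) (B (p n (Suc i)) \<omega> - B (p n i) \<omega>))"
        using 1 2
      proof eventually_elim
        case (elim n)
        have Yp: "\<bar>Y (p n i) \<omega>\<bar> \<le> C" if "i < m n" for i using C(2) pb[of i n] that by simp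
        have "clip (K n) (Y (p n i) \<omega>) = Y (p n i) \<omega>" if "i < m n" for i
          using Yp[OF that] elim(1) by (intro clip_le(3)) simp
        moreover have "clip (real (n + n0)) (\<sigma> * Y (p n i) \<omega>) = \<sigma> * Y (p n i) \<omega>" if "i < m n" for i
        proof (rule clip_le(3))
          have "\<bar>\<sigma> * Y (p n i) \<omega>\<bar> \<le> \<bar>\<sigma>\<bar> * C" using Yp[OF that] by (simp add: abs_mult mult_left_mono)
          then show "\<bar>\<sigma> * Y (p n i) \<omega>\<bar> \<le> real (n + n0)" using elim(2) by linarith
        qed
        ultimately show ?case
          unfolding approximant_integral[OF t] N_def m_def[symmetric] p_def[symmetric] by simp
      qed
      then show ?case by (rule tendsto_cong[THEN iffD2]) (rule explicit_remainder[OF elim t fine])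
    qed
  qed
  from null_in_prob_diff[OF this Nnull]
  have "null_in_prob (\<lambda>n \<omega>. ?SI (n + n0) \<omega> - martingale_part t \<omega>)" by simp
  then have "null_in_prob (\<lambda>n \<omega>. ?SI n \<omega> - martingale_part t \<omega>)"
    using SIM IM LIMSEQ_offset[of "\<lambda>n. expectation (\<lambda>\<omega>. min 1 \<bar>?SI n \<omega> - martingale_part t \<omega>\<bar>)" n0 0]
    by (auto simp: null_in_prob_def)
  then have "null_in_prob (\<lambda>n \<omega>. \<bar>?SI n \<omega> - martingale_part t \<omega>\<bar>)"
    by (rule null_in_prob_dominated) (use SIM IM in auto)
  then show ?thesis
    unfolding vanishes_in_probability_iff by (auto dest: null_in_prob_measurable)
qed

lemma explicit_strong_solution: "strong_solution M F B \<delta> \<sigma> T \<xi> u Y"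
  unfolding strong_solution_def
proof (intro conjI exI)
  show "continuous_adapted M F T Y"
    using explicit_adapted explicit_continuous by (auto simp: continuous_adapted_def)
  show "ito_integral M F B T (\<lambda>s \<omega>. \<sigma> * Y s \<omega>) martingale_part"
    unfolding ito_integral_def
  proof (intro conjI ballI exI allI)
    show "progressively_measurable F T (\<lambda>s \<omega>. \<sigma> * Y s \<omega>)"
      using explicit_progressive unfolding progressively_measurable_def case_prod_beta by auto
    fix t assume t: "t \<in> horizon T"
    show "AE \<omega> in M. (\<integral>\<^sup>+s\<in>{0..t}. ennreal ((\<sigma> * Y s \<omega>)\<^sup>2) \<partial>lborel) < \<infinity>"
    proof (rule AE_I2)
      fix \<omega>
      have "set_integrable lborel {0..t} (\<lambda>s. (\<sigma> * Y s \<omega>)\<^sup>2)"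
        by (intro borel_integrable_atLeastAtMost' continuous_intros continuous_on_horizonD[OF explicit_continuous t])
      then have "(\<integral>\<^sup>+s. ennreal (norm (indicator {0..t} s *\<^sub>R (\<sigma> * Y s \<omega>)\<^sup>2)) \<partial>lborel) < \<infinity>"
        unfolding set_integrable_def by (simp add: integrable_iff_bounded)
      also have "(\<integral>\<^sup>+s. ennreal (norm (indicator {0..t} s *\<^sub>R (\<sigma> * Y s \<omega>)\<^sup>2)) \<partial>lborel) = (\<integral>\<^sup>+s\<in>{0..t}. ennreal ((\<sigma> * Y s \<omega>)\<^sup>2) \<partial>lborel)"
        by (intro nn_integral_cong) (auto simp: indicator_def)
      finally show "(\<integral>\<^sup>+s\<in>{0..t}. ennreal ((\<sigma> * Y s \<omega>)\<^sup>2) \<partial>lborel) < \<infinity>" .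
    qed
  qed (use martingale_part_continuous_adapted approximant_simple approximants_converge approximant_integrals_converge in auto)
  have "AE \<omega> in M. \<omega> \<in> G" using good by (simp add: good_event_def)
  then show "AE \<omega> in M. \<forall>t\<in>horizon T. set_integrable lborel {0..t} (\<lambda>s. - \<delta> * Y s \<omega> + u s \<omega>) \<and>
      Y t \<omega> = \<xi> \<omega> + (LINT s:{0..t}|lborel. - \<delta> * Y s \<omega> + u s \<omega>) + martingale_part t \<omega>"
  proof eventually_elim
    case (elim \<omega>)
    then have "v s \<omega> = u s \<omega>" for s by (simp add: masked_def)
    then show ?case using drift_integrable[of _ \<omega>] unfolding martingale_part_def by simp
  qed
qed

end

end

section \<open>Admissible controls and the mean of the state\<close>

lemma nn_set_integral_finite_integrable:
  fixes f :: "real \<Rightarrow> real"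
  assumes "set_borel_measurable lborel A f" "\<And>s. s \<in> A \<Longrightarrow> 0 \<le> f s"
    and "(\<integral>\<^sup>+s\<in>A. ennreal (f s) \<partial>lborel) < \<infinity>"
  shows "set_integrable lborel A f"
  unfolding set_integrable_def
proof (rule integrableI_nonneg)
  show "(\<lambda>x. indicator A x *\<^sub>R f x) \<in> borel_measurable lborel"
    using assms(1) by (simp add: set_borel_measurable_def)
  show "AE x in lborel. 0 \<le> indicator A x *\<^sub>R f x" using assms(2) by (auto simp: indicator_def)
  have "(\<integral>\<^sup>+x. ennreal (indicator A x *\<^sub>R f x) \<partial>lborel) = (\<integral>\<^sup>+s\<in>A. ennreal (f s) \<partial>lborel)"
    by (intro nn_integral_cong) (auto simp: indicator_def)
  then show "(\<integral>\<^sup>+x. ennreal (indicator A x *\<^sub>R f x) \<partial>lborel) < \<infinity>" using assms(3) by simp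
qed

lemma progressive_section_measurable:
  assumes "(\<lambda>(\<omega>, s). f s \<omega>) \<in> borel_measurable (N \<Otimes>\<^sub>M restrict_space borel {0..t::real})" "\<omega> \<in> space N"
  shows "set_borel_measurable lborel {0..t} (\<lambda>s. f s \<omega> :: real)"
proof -
  have "(\<lambda>s. f s \<omega>) \<in> borel_measurable (restrict_space borel {0..t})"
    using measurable_Pair2[OF assms] by simp
  then show ?thesis
    by (simp add: borel_measurable_restrict_space_iff set_borel_measurable_def mult.commute)
qed

lemma progressive_time_measurable:
  assumes "(\<lambda>(\<omega>, s). f s \<omega>) \<in> borel_measurable (N \<Otimes>\<^sub>M restrict_space borel {0..t::real})" "s \<in> {0..t}"
  shows "(f s :: 'a \<Rightarrow> real) \<in> borel_measurable N"
  using measurable_Pair1[OF assms(1), of s] assms(2) by (simp add: space_restrict_space)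

context brownian_basis
begin

lemma progressive_measurable_M:
  assumes "f \<in> borel_measurable (F t \<Otimes>\<^sub>M N)" "0 \<le> t"
  shows "f \<in> borel_measurable (M \<Otimes>\<^sub>M N)"
proof -
  have "(\<lambda>z. (fst z, snd z)) \<in> measurable (M \<Otimes>\<^sub>M N) (F t \<Otimes>\<^sub>M N)"
    using measurable_F_M[of "\<lambda>\<omega>. \<omega>" t "F t"] assms(2)
    by (intro measurable_Pair measurable_compose[OF measurable_fst]) auto
  from measurable_compose[OF this assms(1)] show ?thesis by simp
qed

lemma controls_progressive:
  "u \<in> controls M F \<rho> T \<Longrightarrow> t \<in> horizon T \<Longrightarrow>
    (\<lambda>(\<omega>, s). u s \<omega>) \<in> borel_measurable (F t \<Otimes>\<^sub>M restrict_space borel {0..t})"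
  by (simp add: controls_def progressively_measurable_def)

lemma controls_nonneg: "u \<in> controls M F \<rho> T \<Longrightarrow> s \<in> horizon T \<Longrightarrow> \<omega> \<in> space M \<Longrightarrow> 0 \<le> u s \<omega>"
  by (simp add: controls_def)

lemma controls_adapted:
  "u \<in> controls M F \<rho> T \<Longrightarrow> t \<in> horizon T \<Longrightarrow> u t \<in> borel_measurable (F t)"
  using progressive_time_measurable[OF controls_progressive, of u \<rho> T t t] horizonD[of t T] by simp

lemma controls_expected_integral_finite:
  assumes u: "u \<in> controls M F \<rho> T" and t: "t \<in> horizon T"
  shows "(\<integral>\<^sup>+\<omega>. (\<integral>\<^sup>+s\<in>{0..t}. ennreal (u s \<omega>) \<partial>lborel) \<partial>M) < \<infinity>"
proof (cases "T = \<infinity>")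
  case True
  then show ?thesis using u horizonD[OF t] by (auto simp: controls_def)
next
  case False
  have t0: "0 \<le> t" using t by (rule horizonD)
  have fin: "(\<integral>\<^sup>+\<omega>. (\<integral>\<^sup>+s\<in>horizon T. ennreal ((u s \<omega>)\<^sup>2) \<partial>lborel) \<partial>M) < \<infinity>"
    using u False by (simp add: controls_def)
  have "(\<integral>\<^sup>+\<omega>. (\<integral>\<^sup>+s\<in>{0..t}. ennreal (u s \<omega>) \<partial>lborel) \<partial>M) \<le>
      (\<integral>\<^sup>+\<omega>. ennreal t + (\<integral>\<^sup>+s\<in>{0..t}. ennreal ((u s \<omega>)\<^sup>2) \<partial>lborel) \<partial>M)"
  proof (rule nn_integral_mono)
    fix \<omega> assume \<omega>: "\<omega> \<in> space M"
    have um: "set_borel_measurable lborel {0..t} (\<lambda>s. (u s \<omega>)\<^sup>2)"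
    proof -
      have "(\<lambda>(\<omega>, s). (u s \<omega>)\<^sup>2) \<in> borel_measurable (F t \<Otimes>\<^sub>M restrict_space borel {0..t})"
        using controls_progressive[OF u t] unfolding case_prod_beta by (rule borel_measurable_power)
      from progressive_section_measurable[OF this, of \<omega>] \<omega> space_F[OF t0] show ?thesis by simp
    qed
    have "(\<integral>\<^sup>+s\<in>{0..t}. ennreal (u s \<omega>) \<partial>lborel) \<le>
        (\<integral>\<^sup>+s. ennreal (indicator {0..t} s) + ennreal (indicator {0..t} s *\<^sub>R (u s \<omega>)\<^sup>2) \<partial>lborel)"
    proof (rule nn_integral_mono)
      fix s
      have "x \<le> 1 + x\<^sup>2" for x :: real
      proof -
        have "0 \<le> (x - 1/2)\<^sup>2" by simp
        then show ?thesis by (simp add: power2_eq_square algebra_simps)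
      qed
      then have "ennreal (u s \<omega>) \<le> ennreal (1 + (u s \<omega>)\<^sup>2)"
        by (rule ennreal_leI)
      also have "\<dots> = ennreal 1 + ennreal ((u s \<omega>)\<^sup>2)" by (rule ennreal_plus) auto
      finally have "ennreal (u s \<omega>) \<le> ennreal 1 + ennreal ((u s \<omega>)\<^sup>2)" .
      then show "ennreal (u s \<omega>) * indicator {0..t} s \<le> ennreal (indicator {0..t} s) + ennreal (indicator {0..t} s *\<^sub>R (u s \<omega>)\<^sup>2)"
        by (auto simp: indicator_def)
    qed
    also have "\<dots> = (\<integral>\<^sup>+s. ennreal (indicator {0..t} s) \<partial>lborel) + (\<integral>\<^sup>+s. ennreal (indicator {0..t} s *\<^sub>R (u s \<omega>)\<^sup>2) \<partial>lborel)"
      using um by (intro nn_integral_add) (auto simp: set_borel_measurable_def)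
    also have "(\<integral>\<^sup>+s. ennreal (indicator {0..t} s) \<partial>lborel) = ennreal t"
      using t0 by (simp add: ennreal_indicator)
    also have "(\<integral>\<^sup>+s. ennreal (indicator {0..t} s *\<^sub>R (u s \<omega>)\<^sup>2) \<partial>lborel) = (\<integral>\<^sup>+s\<in>{0..t}. ennreal ((u s \<omega>)\<^sup>2) \<partial>lborel)"
      by (intro nn_integral_cong) (auto simp: indicator_def)
    finally show "(\<integral>\<^sup>+s\<in>{0..t}. ennreal (u s \<omega>) \<partial>lborel) \<le> ennreal t + (\<integral>\<^sup>+s\<in>{0..t}. ennreal ((u s \<omega>)\<^sup>2) \<partial>lborel)" .
  qed
  also have "\<dots> \<le> (\<integral>\<^sup>+\<omega>. ennreal t + (\<integral>\<^sup>+s\<in>horizon T. ennreal ((u s \<omega>)\<^sup>2) \<partial>lborel) \<partial>M)"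
    using horizon_down[OF t]
    by (intro nn_integral_mono add_left_mono) (auto simp: indicator_def)
  also have "\<dots> < \<infinity>"
  proof -
    obtain a where a: "T = ereal a" "horizon T = {0..a}" using t False by (cases rule: horizon_cases) auto
    then have aT: "a \<in> horizon T" using t horizonD[OF t] by auto
    have "(\<lambda>(\<omega>, s). (u s \<omega>)\<^sup>2) \<in> borel_measurable (F a \<Otimes>\<^sub>M restrict_space borel {0..a})"
      using controls_progressive[OF u aT] unfolding case_prod_beta by (rule borel_measurable_power)
    from progressive_nn_integral_measurable[OF progressive_measurable_M[OF this horizonD[OF aT]]]
    have "(\<lambda>\<omega>. \<integral>\<^sup>+s\<in>horizon T. ennreal ((u s \<omega>)\<^sup>2) \<partial>lborel) \<in> borel_measurable M" by (simp add: a)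
    then show ?thesis using fin by (subst nn_integral_add) (auto simp: emeasure_space_1)
  qed
  finally show ?thesis .
qed

lemma controls_integrable_paths:
  assumes u: "u \<in> controls M F \<rho> T"
  shows "AE \<omega> in M. \<forall>t\<in>horizon T. set_integrable lborel {0..t} (\<lambda>s. u s \<omega>)"
proof -
  have 1: "AE \<omega> in M. set_integrable lborel {0..t} (\<lambda>s. u s \<omega>)" if t: "t \<in> horizon T" for t
  proof -
    have t0: "0 \<le> t" using t by (rule horizonD)
    note meas = progressive_measurable_M[OF controls_progressive[OF u t] t0]
    have "AE \<omega> in M. (\<integral>\<^sup>+s\<in>{0..t}. ennreal (u s \<omega>) \<partial>lborel) \<noteq> \<infinity>"
      using controls_expected_integral_finite[OF u t] progressive_nn_integral_measurable[OF meas]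
      by (intro nn_integral_PInf_AE) (auto simp: less_top)
    then show ?thesis
      using AE_space
    proof eventually_elim
      case (elim \<omega>)
      show ?case
      proof (rule nn_set_integral_finite_integrable)
        show "set_borel_measurable lborel {0..t} (\<lambda>s. u s \<omega>)"
          by (rule progressive_section_measurable[OF meas elim(2)])
        show "0 \<le> u s \<omega>" if "s \<in> {0..t}" for s
          using that controls_nonneg[OF u horizon_down[OF t] elim(2)] by auto
      qed (use elim(1) in \<open>simp add: less_top\<close>)
    qed
  qed
  show ?thesis
  proof (cases "0 \<le> T")
    case True
    obtain c where c: "\<And>n. c n \<in> horizon T" "\<And>t. t \<in> horizon T \<Longrightarrow> \<forall>\<^sub>F n in sequentially. t \<le> c n"
      using ex_cofinal_in_horizon[OF True] by blast
    have "AE \<omega> in M. \<forall>n. set_integrable lborel {0..c n} (\<lambda>s. u s \<omega>)"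
      unfolding AE_all_countable using 1 c(1) by blast
    then show ?thesis
    proof eventually_elim
      case (elim \<omega>)
      show ?case
      proof
        fix t assume "t \<in> horizon T"
        then obtain n where n: "t \<le> c n" using c(2) eventually_happens'[OF sequentially_bot] by blast
        show "set_integrable lborel {0..t} (\<lambda>s. u s \<omega>)"
          by (rule set_integrable_subset[OF elim[rule_format, of n]]) (use n in auto)
      qed
    qed
  next
    case False
    then have "horizon T = {}" by (auto simp: horizon_def not_le intro: less_le_trans)
    then show ?thesis by simp
  qed
qed

text \<open>
  The ratio \<open>Z\<^sub>t / Z\<^sub>r\<close> depends on the increment of \<open>B\<close> after time \<open>r\<close> alone, hence is independent of \<open>u\<^sub>r\<close>, and has mean
  \<open>exp (- \<delta> (t - r))\<close>. All integrands are nonnegative, so Tonelli's theorem exchanges the integrals over \<open>r\<close> and the sample space.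
\<close>

lemma explicit_mean:
  assumes \<delta>: "0 \<le> \<delta>" and \<xi>: "\<xi> \<in> borel_measurable (F 0)" "AE \<omega> in M. 0 < \<xi> \<omega>"
    and u: "u \<in> controls M F \<rho> T" and good: "good_event T u G" and t: "t \<in> horizon T"
  shows "AE \<omega> in M. 0 \<le> explicit \<delta> \<sigma> G \<xi> u t \<omega>"
    and "(\<integral>\<^sup>+\<omega>. ennreal (explicit \<delta> \<sigma> G \<xi> u t \<omega>) \<partial>M) = ennreal (exp (- \<delta> * t)) * (\<integral>\<^sup>+\<omega>. ennreal (\<xi> \<omega>) \<partial>M) +
      (\<integral>\<^sup>+r\<in>{0..t}. ennreal (exp (- \<delta> * (t - r))) * (\<integral>\<^sup>+\<omega>. ennreal (u r \<omega>) \<partial>M) \<partial>lborel)"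
proof -
  have t0: "0 \<le> t" using t by (rule horizonD)
  have up: "progressively_measurable F T u" using u by (simp add: controls_def)
  have AEG: "AE \<omega> in M. \<omega> \<in> G" using good by (simp add: good_event_def)
  define z where "z = geo \<delta> \<sigma> G"
  define c where "c = \<delta> + \<sigma>\<^sup>2 / 2"
  have zpos: "0 < z s \<omega>" for s \<omega> unfolding z_def by (rule geo_pos)
  have ratio: "z t \<omega> * inverse (z r \<omega>) = exp (\<sigma> * (B t \<omega> - B r \<omega>) - c * (t - r))" if "\<omega> \<in> G" for r \<omega>
    using that unfolding z_def geo_def masked_def c_def exp_minus[symmetric] exp_add[symmetric]
    by (simp add: algebra_simps diff_divide_distrib)
  have E_exp: "(\<integral>\<^sup>+\<omega>. ennreal (exp (\<sigma> * (B t \<omega> - B r \<omega>) - c * (t - r))) \<partial>M) = ennreal (exp (- \<delta> * (t - r)))"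
    if r: "0 \<le> r" "r \<le> t" for r
  proof -
    have eq: "exp (\<sigma> * (B t \<omega> - B r \<omega>) - c * (t - r)) = exp (- c * (t - r)) * exp (\<sigma> * (B t \<omega> - B r \<omega>))" for \<omega>
      unfolding exp_add[symmetric] by simp
    have "(\<integral>\<^sup>+\<omega>. ennreal (exp (\<sigma> * (B t \<omega> - B r \<omega>) - c * (t - r))) \<partial>M) =
        ennreal (expectation (\<lambda>\<omega>. exp (- c * (t - r)) * exp (\<sigma> * (B t \<omega> - B r \<omega>))))"
      unfolding eq using increment_exp(1)[OF r, of \<sigma>] by (intro nn_integral_eq_integral) auto
    also have "expectation (\<lambda>\<omega>. exp (- c * (t - r)) * exp (\<sigma> * (B t \<omega> - B r \<omega>))) = exp (- c * (t - r)) * exp (\<sigma>\<^sup>2 * (t - r) / 2)"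
      using increment_exp(2)[OF r, of \<sigma>] by simp
    also have "\<dots> = exp (- \<delta> * (t - r))"
    proof -
      have "- c * (t - r) + \<sigma>\<^sup>2 * (t - r) / 2 = - \<delta> * (t - r)" by (simp add: c_def algebra_simps diff_divide_distrib)
      then show ?thesis by (simp only: exp_add[symmetric])
    qed
    finally show ?thesis .
  qed
  have mult: "(\<integral>\<^sup>+\<omega>. ennreal (f \<omega>) * ennreal (exp (\<sigma> * (B t \<omega> - B r \<omega>) - c * (t - r))) \<partial>M) =
      (\<integral>\<^sup>+\<omega>. ennreal (f \<omega>) \<partial>M) * ennreal (exp (- \<delta> * (t - r)))"
    if r: "0 \<le> r" "r \<le> t" and f: "f \<in> borel_measurable (F r)" for r f
    unfolding E_exp[OF r, symmetric]
    by (rule nn_integral_mult_increment[OF r, of "\<lambda>\<omega>. ennreal (f \<omega>)" "\<lambda>x. ennreal (exp (\<sigma> * x - c * (t - r)))"])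
      (use f in auto)
  define h where "h \<omega> r = masked G u r \<omega> * inverse (z r \<omega>)" for \<omega> r
  have h0: "0 \<le> h \<omega> r" if "\<omega> \<in> G" "r \<in> {0..t}" for \<omega> r
    using controls_nonneg[OF u horizon_down[OF t], of r \<omega>] that good zpos[of r \<omega>]
    by (auto simp: h_def masked_def good_event_def intro!: mult_nonneg_nonneg)
  have hi: "set_integrable lborel {0..t} (h \<omega>)" for \<omega>
    unfolding h_def[abs_def] z_def by (rule quotient_integrable[OF \<delta> \<xi>(1) up good t])
  have hint: "0 \<le> (LINT r:{0..t}|lborel. h \<omega> r)" if "\<omega> \<in> G" for \<omega>
    unfolding set_lebesgue_integral_def using h0[OF that]
    by (intro Bochner_Integration.integral_nonneg) (auto simp: indicator_def)
  have Yform: "explicit \<delta> \<sigma> G \<xi> u t \<omega> = z t \<omega> * (\<xi> \<omega> + (LINT r:{0..t}|lborel. h \<omega> r))" for \<omega>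
    unfolding explicit_def h_def z_def ..
  show "AE \<omega> in M. 0 \<le> explicit \<delta> \<sigma> G \<xi> u t \<omega>"
    using AEG \<xi>(2)
  proof eventually_elim
    case (elim \<omega>)
    then show ?case unfolding Yform using hint[of \<omega>] zpos[of t \<omega>] by (intro mult_nonneg_nonneg) auto
  qed
  have up': "(\<lambda>(\<omega>, s). u s \<omega>) \<in> borel_measurable (M \<Otimes>\<^sub>M restrict_space borel {0..t})"
    by (rule progressive_measurable_M[OF controls_progressive[OF u t] t0])
  have joint: "(\<lambda>(\<omega>, r). ennreal (indicator {0..t} r * (z t \<omega> * h \<omega> r))) \<in> borel_measurable (M \<Otimes>\<^sub>M lborel)"
  proof -
    have zt: "z t \<in> borel_measurable M" unfolding z_def
      by (rule measurable_F_M[OF geo_adapted[OF \<delta> \<xi>(1) up good t0] t0])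
    have "(\<lambda>(\<omega>, s). z s \<omega>) \<in> borel_measurable (M \<Otimes>\<^sub>M restrict_space borel {0..t})"
      unfolding z_def
      by (intro continuous_process_measurable_restrict[OF t0] geo_continuous_Icc[OF \<delta> \<xi>(1) up good])
        (auto intro: measurable_F_M[OF geo_adapted[OF \<delta> \<xi>(1) up good]])
    moreover have "(\<lambda>(\<omega>, s). masked G u s \<omega>) \<in> borel_measurable (M \<Otimes>\<^sub>M restrict_space borel {0..t})"
      by (rule progressive_measurable_M[OF masked_progressive[OF \<delta> \<xi>(1) up good t] t0])
    ultimately have hm: "(\<lambda>(\<omega>, r). z t \<omega> * h \<omega> r) \<in> borel_measurable (M \<Otimes>\<^sub>M restrict_space borel {0..t})"
      unfolding h_def case_prod_beta using measurable_compose[OF measurable_fst zt]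
      by (intro borel_measurable_times borel_measurable_inverse)
    from measurable_indicator_times_restrict[OF this]
    show "(\<lambda>(\<omega>, r). ennreal (indicator {0..t} r * (z t \<omega> * h \<omega> r))) \<in> borel_measurable (M \<Otimes>\<^sub>M lborel)"
      by (simp add: case_prod_beta mult.commute[of _ "indicator _ _"])
  qed
  have "(\<integral>\<^sup>+\<omega>. ennreal (explicit \<delta> \<sigma> G \<xi> u t \<omega>) \<partial>M) =
      (\<integral>\<^sup>+\<omega>. ennreal (\<xi> \<omega>) * ennreal (exp (\<sigma> * (B t \<omega> - B 0 \<omega>) - c * (t - 0))) +
        (\<integral>\<^sup>+r. ennreal (indicator {0..t} r * (z t \<omega> * h \<omega> r)) \<partial>lborel) \<partial>M)"
  proof (rule nn_integral_cong_AE)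
    show "AE \<omega> in M. ennreal (explicit \<delta> \<sigma> G \<xi> u t \<omega>) =
      ennreal (\<xi> \<omega>) * ennreal (exp (\<sigma> * (B t \<omega> - B 0 \<omega>) - c * (t - 0))) +
        (\<integral>\<^sup>+r. ennreal (indicator {0..t} r * (z t \<omega> * h \<omega> r)) \<partial>lborel)"
      using AEG \<xi>(2)
    proof eventually_elim
      case (elim \<omega>)
      have "z 0 \<omega> = 1" using elim good by (simp add: z_def geo_def masked_def good_event_def)
      then have zt: "z t \<omega> = exp (\<sigma> * (B t \<omega> - B 0 \<omega>) - c * (t - 0))"
        using ratio[OF elim(1), of 0] by simp
      have i2: "(\<integral>\<^sup>+r. ennreal (indicator {0..t} r * (z t \<omega> * h \<omega> r)) \<partial>lborel) = ennreal (z t \<omega> * (LINT r:{0..t}|lborel. h \<omega> r))"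
      proof -
        have "(\<integral>\<^sup>+r. ennreal (indicator {0..t} r *\<^sub>R (z t \<omega> * h \<omega> r)) \<partial>lborel) = ennreal (LINT r:{0..t}|lborel. z t \<omega> * h \<omega> r)"
          unfolding set_lebesgue_integral_def
        proof (rule nn_integral_eq_integral)
          have "set_integrable lborel {0..t} (\<lambda>r. z t \<omega> * h \<omega> r)" by (rule set_integrable_mult_right) (rule hi)
          then show "integrable lborel (\<lambda>r. indicator {0..t} r *\<^sub>R (z t \<omega> * h \<omega> r))" unfolding set_integrable_def .
          show "AE r in lborel. 0 \<le> indicator {0..t} r *\<^sub>R (z t \<omega> * h \<omega> r)"
            using h0[OF elim(1)] zpos[of t \<omega>] by (auto simp: indicator_def)
        qed
        also have "(LINT r:{0..t}|lborel. z t \<omega> * h \<omega> r) = z t \<omega> * (LINT r:{0..t}|lborel. h \<omega> r)"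
          by (rule set_integral_mult_right)
        finally show ?thesis by simp
      qed
      have "explicit \<delta> \<sigma> G \<xi> u t \<omega> = \<xi> \<omega> * z t \<omega> + z t \<omega> * (LINT r:{0..t}|lborel. h \<omega> r)"
        unfolding Yform by (simp add: algebra_simps)
      then have "ennreal (explicit \<delta> \<sigma> G \<xi> u t \<omega>) = ennreal (\<xi> \<omega> * z t \<omega>) + ennreal (z t \<omega> * (LINT r:{0..t}|lborel. h \<omega> r))"
        using elim(2) zpos[of t \<omega>] hint[OF elim(1)] by simp
      also have "ennreal (\<xi> \<omega> * z t \<omega>) = ennreal (\<xi> \<omega>) * ennreal (z t \<omega>)"
        using elim(2) zpos[of t \<omega>] by (simp add: ennreal_mult)
      finally show ?case unfolding i2 unfolding zt .
    qed
  qed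
  also have "\<dots> = (\<integral>\<^sup>+\<omega>. ennreal (\<xi> \<omega>) * ennreal (exp (\<sigma> * (B t \<omega> - B 0 \<omega>) - c * (t - 0))) \<partial>M) +
        (\<integral>\<^sup>+\<omega>. (\<integral>\<^sup>+r. ennreal (indicator {0..t} r * (z t \<omega> * h \<omega> r)) \<partial>lborel) \<partial>M)"
  proof (rule nn_integral_add)
    note [measurable] = measurable_F_M[OF \<xi>(1) order_refl] B_measurable[OF t0] B_measurable[OF order_refl]
    show "(\<lambda>\<omega>. ennreal (\<xi> \<omega>) * ennreal (exp (\<sigma> * (B t \<omega> - B 0 \<omega>) - c * (t - 0)))) \<in> borel_measurable M" by measurable
    show "(\<lambda>\<omega>. \<integral>\<^sup>+r. ennreal (indicator {0..t} r * (z t \<omega> * h \<omega> r)) \<partial>lborel) \<in> borel_measurable M"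
      by (rule sigma_finite_measure.borel_measurable_nn_integral[OF sigma_finite_lborel joint])
  qed
  also have "(\<integral>\<^sup>+\<omega>. ennreal (\<xi> \<omega>) * ennreal (exp (\<sigma> * (B t \<omega> - B 0 \<omega>) - c * (t - 0))) \<partial>M) =
      ennreal (exp (- \<delta> * t)) * (\<integral>\<^sup>+\<omega>. ennreal (\<xi> \<omega>) \<partial>M)"
    using mult[OF order_refl t0 \<xi>(1)] by (simp add: mult.commute)
  also have "(\<integral>\<^sup>+\<omega>. (\<integral>\<^sup>+r. ennreal (indicator {0..t} r * (z t \<omega> * h \<omega> r)) \<partial>lborel) \<partial>M) =
      (\<integral>\<^sup>+r. (\<integral>\<^sup>+\<omega>. ennreal (indicator {0..t} r * (z t \<omega> * h \<omega> r)) \<partial>M) \<partial>lborel)"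
  proof -
    interpret P: pair_sigma_finite M lborel ..
    show ?thesis using P.Fubini[OF joint] by simp
  qed
  also have "\<dots> = (\<integral>\<^sup>+r\<in>{0..t}. ennreal (exp (- \<delta> * (t - r))) * (\<integral>\<^sup>+\<omega>. ennreal (u r \<omega>) \<partial>M) \<partial>lborel)"
  proof (rule nn_integral_cong)
    fix r
    show "(\<integral>\<^sup>+\<omega>. ennreal (indicator {0..t} r * (z t \<omega> * h \<omega> r)) \<partial>M) =
      ennreal (exp (- \<delta> * (t - r))) * (\<integral>\<^sup>+\<omega>. ennreal (u r \<omega>) \<partial>M) * indicator {0..t} r"
    proof (cases "r \<in> {0..t}")
      case True
      then have r: "0 \<le> r" "r \<le> t" by auto
      have rT: "r \<in> horizon T" by (rule horizon_down[OF t r])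
      have "(\<integral>\<^sup>+\<omega>. ennreal (z t \<omega> * h \<omega> r) \<partial>M) = (\<integral>\<^sup>+\<omega>. ennreal (u r \<omega>) * ennreal (exp (\<sigma> * (B t \<omega> - B r \<omega>) - c * (t - r))) \<partial>M)"
      proof (rule nn_integral_cong_AE)
        show "AE \<omega> in M. ennreal (z t \<omega> * h \<omega> r) = ennreal (u r \<omega>) * ennreal (exp (\<sigma> * (B t \<omega> - B r \<omega>) - c * (t - r)))"
          using AEG AE_space
        proof eventually_elim
          case (elim \<omega>)
          have "z t \<omega> * h \<omega> r = u r \<omega> * (z t \<omega> * inverse (z r \<omega>))"
            using elim(1) by (simp add: h_def masked_def)
          then show ?case unfolding ratio[OF elim(1)]
            using controls_nonneg[OF u rT elim(2)] by (simp add: ennreal_mult)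
        qed
      qed
      then show ?thesis using True mult[OF r controls_adapted[OF u rT]] by (simp add: mult.commute)
    qed simp
  qed
  finally show "(\<integral>\<^sup>+\<omega>. ennreal (explicit \<delta> \<sigma> G \<xi> u t \<omega>) \<partial>M) = ennreal (exp (- \<delta> * t)) * (\<integral>\<^sup>+\<omega>. ennreal (\<xi> \<omega>) \<partial>M) +
      (\<integral>\<^sup>+r\<in>{0..t}. ennreal (exp (- \<delta> * (t - r))) * (\<integral>\<^sup>+\<omega>. ennreal (u r \<omega>) \<partial>M) \<partial>lborel)" .
qed

text \<open>
  The state is a choice among solutions, but every solution agrees almost surely with the explicit one.
\<close>

lemma state_properties:
  assumes \<delta>: "0 \<le> \<delta>" and \<xi>: "\<xi> \<in> borel_measurable (F 0)" "AE \<omega> in M. 0 < \<xi> \<omega>"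
    and u: "u \<in> controls M F \<rho> T"
  shows "continuous_adapted M F T (state M F B \<delta> \<sigma> T \<xi> u)"
    and "t \<in> horizon T \<Longrightarrow> AE \<omega> in M. 0 \<le> state M F B \<delta> \<sigma> T \<xi> u t \<omega>"
    and "t \<in> horizon T \<Longrightarrow> (\<integral>\<^sup>+\<omega>. ennreal (state M F B \<delta> \<sigma> T \<xi> u t \<omega>) \<partial>M) =
      ennreal (exp (- \<delta> * t)) * (\<integral>\<^sup>+\<omega>. ennreal (\<xi> \<omega>) \<partial>M) +
      (\<integral>\<^sup>+r\<in>{0..t}. ennreal (exp (- \<delta> * (t - r))) * (\<integral>\<^sup>+\<omega>. ennreal (u r \<omega>) \<partial>M) \<partial>lborel)"
proof -
  obtain G where G: "good_event T u G"
    using ex_good_event[OF controls_integrable_paths[OF u]] by blast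
  have up: "progressively_measurable F T u" using u by (simp add: controls_def)
  note ex = explicit_strong_solution[OF \<delta> \<xi>(1) up G, of \<sigma>]
  then have sol: "strong_solution M F B \<delta> \<sigma> T \<xi> u (state M F B \<delta> \<sigma> T \<xi> u)"
    unfolding state_def by (rule someI[where P="strong_solution M F B \<delta> \<sigma> T \<xi> u"])
  then show "continuous_adapted M F T (state M F B \<delta> \<sigma> T \<xi> u)" by (simp add: strong_solution_def)
  assume t: "t \<in> horizon T"
  have eq: "AE \<omega> in M. state M F B \<delta> \<sigma> T \<xi> u t \<omega> = explicit \<delta> \<sigma> G \<xi> u t \<omega>"
    by (rule strong_solution_unique[OF sol ex t])
  then show "AE \<omega> in M. 0 \<le> state M F B \<delta> \<sigma> T \<xi> u t \<omega>"
    using explicit_mean(1)[OF \<delta> \<xi> u G t, of \<sigma>] by eventually_elim simp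
  have "(\<integral>\<^sup>+\<omega>. ennreal (state M F B \<delta> \<sigma> T \<xi> u t \<omega>) \<partial>M) = (\<integral>\<^sup>+\<omega>. ennreal (explicit \<delta> \<sigma> G \<xi> u t \<omega>) \<partial>M)"
    using eq by (intro nn_integral_cong_AE) (auto elim: eventually_mono)
  then show "(\<integral>\<^sup>+\<omega>. ennreal (state M F B \<delta> \<sigma> T \<xi> u t \<omega>) \<partial>M) =
      ennreal (exp (- \<delta> * t)) * (\<integral>\<^sup>+\<omega>. ennreal (\<xi> \<omega>) \<partial>M) +
      (\<integral>\<^sup>+r\<in>{0..t}. ennreal (exp (- \<delta> * (t - r))) * (\<integral>\<^sup>+\<omega>. ennreal (u r \<omega>) \<partial>M) \<partial>lborel)"
    unfolding explicit_mean(2)[OF \<delta> \<xi> u G t, of \<sigma>] .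
qed

end

section \<open>The payoff as a quadratic functional of the control\<close>

lemma ext_integral_ereal:
  assumes "integrable N f"
  shows "ext_integral N (\<lambda>x. ereal (f x)) = ereal (integral\<^sup>L N f)"
proof -
  have fin: "(\<integral>\<^sup>+x. ennreal (f x) \<partial>N) \<noteq> \<infinity>" "(\<integral>\<^sup>+x. ennreal (- f x) \<partial>N) \<noteq> \<infinity>"
    using assms by (auto simp: real_integrable_def)
  have e: "enn2ereal x = ereal (enn2real x)" if "x \<noteq> \<infinity>" for x
    using that by (cases x) auto
  show ?thesis
    unfolding ext_integral_def real_lebesgue_integral_def[OF assms]
    using e[OF fin(1)] e[OF fin(2)] by simp
qed

lemma ext_integral_cong_AE:
  assumes "AE x in N. f x = g x"
  shows "ext_integral N f = ext_integral N g"
proof -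
  have "(\<integral>\<^sup>+x. e2ennreal (f x) \<partial>N) = (\<integral>\<^sup>+x. e2ennreal (g x) \<partial>N)"
    "(\<integral>\<^sup>+x. e2ennreal (- f x) \<partial>N) = (\<integral>\<^sup>+x. e2ennreal (- g x) \<partial>N)"
    using assms by (auto intro!: nn_integral_cong_AE)
  then show ?thesis by (simp add: ext_integral_def)
qed

lemma sigma_finite_horizon: "sigma_finite_measure (restrict_space lborel (horizon T))"
  by (rule sigma_finite_measure_restrict_space[OF sigma_finite_lborel]) simp

lemma measurable_pair_lborel: "measurable (N \<Otimes>\<^sub>M lborel) K = measurable (N \<Otimes>\<^sub>M borel) K"
  by (intro measurable_cong_sets sets_pair_measure_cong) auto

context brownian_basis
begin

text \<open>
  On the infinite horizon progressive measurability yields joint measurability up to each finite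
  time; the limit along a cofinal sequence of times extends it to the whole horizon.
\<close>

lemma progressive_horizon_measurable:
  fixes f :: "real \<Rightarrow> 'a \<Rightarrow> real"
  assumes T: "0 \<le> T" and f: "progressively_measurable F T f"
  shows "(\<lambda>(\<omega>, s). indicator (horizon T) s * f s \<omega>) \<in> borel_measurable (M \<Otimes>\<^sub>M borel)"
    and "(\<lambda>(\<omega>, s). f s \<omega>) \<in> borel_measurable (M \<Otimes>\<^sub>M restrict_space lborel (horizon T))"
proof -
  obtain c where c: "\<And>n. c n \<in> horizon T" "\<And>t. t \<in> horizon T \<Longrightarrow> \<forall>\<^sub>F n in sequentially. t \<le> c n"
    using ex_cofinal_in_horizon[OF T] by blast
  show 1: "(\<lambda>(\<omega>, s). indicator (horizon T) s * f s \<omega>) \<in> borel_measurable (M \<Otimes>\<^sub>M borel)"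
  proof (rule borel_measurable_LIMSEQ_real)
    fix n
    have "(\<lambda>(\<omega>, s). f s \<omega>) \<in> borel_measurable (M \<Otimes>\<^sub>M restrict_space borel {0..c n})"
      using f c(1)[of n] horizonD[OF c(1)[of n]]
      by (intro progressive_measurable_M) (auto simp: progressively_measurable_def)
    from measurable_indicator_times_restrict[OF this]
    show "(\<lambda>z. f (snd z) (fst z) * indicator {0..c n} (snd z)) \<in> borel_measurable (M \<Otimes>\<^sub>M borel)"
      by (simp add: case_prod_beta)
  next
    fix z :: "'a \<times> real"
    have "\<forall>\<^sub>F n in sequentially. f (snd z) (fst z) * indicator {0..c n} (snd z) = (case z of (\<omega>, s) \<Rightarrow> indicator (horizon T) s * f s \<omega>)"
    proof (cases "snd z \<in> horizon T")
      case True
      from c(2)[OF this] show ?thesis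
        by eventually_elim (use True horizonD[OF True] in \<open>auto simp: case_prod_beta indicator_def\<close>)
    next
      case False
      then have "snd z \<notin> {0..c n}" for n using horizon_down[OF c(1)] by auto
      then show ?thesis using False by (simp add: case_prod_beta indicator_def)
    qed
    then show "(\<lambda>n. f (snd z) (fst z) * indicator {0..c n} (snd z)) \<longlonglongrightarrow> (case z of (\<omega>, s) \<Rightarrow> indicator (horizon T) s * f s \<omega>)"
      by (rule tendsto_eventually)
  qed
  have "(\<lambda>z. (fst z, snd z)) \<in> measurable (M \<Otimes>\<^sub>M restrict_space lborel (horizon T)) (M \<Otimes>\<^sub>M borel)"
    by (intro measurable_Pair measurable_fst measurable_compose[OF measurable_snd] measurable_restrict_space1) auto
  from measurable_compose[OF this 1]
  have "(\<lambda>z. indicator (horizon T) (snd z) * f (snd z) (fst z)) \<in> borel_measurable (M \<Otimes>\<^sub>M restrict_space lborel (horizon T))"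
    by simp
  then show "(\<lambda>(\<omega>, s). f s \<omega>) \<in> borel_measurable (M \<Otimes>\<^sub>M restrict_space lborel (horizon T))"
    by (rule measurable_cong[THEN iffD1, rotated]) (auto simp: space_pair_measure space_restrict_space)
qed

lemma continuous_adapted_progressive:
  assumes "continuous_adapted M F T X"
  shows "progressively_measurable F T X"
  unfolding progressively_measurable_def
proof
  fix t assume t: "t \<in> horizon T"
  show "(\<lambda>(\<omega>, s). X s \<omega>) \<in> borel_measurable (F t \<Otimes>\<^sub>M restrict_space borel {0..t})"
  proof (rule continuous_process_measurable_restrict[OF horizonD[OF t]])
    show "X s \<in> borel_measurable (F t)" if "0 \<le> s" "s \<le> t" for s
      using assms horizon_down[OF t that] that
      by (auto simp: continuous_adapted_def intro: measurable_F_mono)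
    show "continuous_on {0..t} (\<lambda>s. X s \<omega>)" if "\<omega> \<in> space (F t)" for \<omega>
      using assms that space_F[OF horizonD[OF t]]
      by (intro continuous_on_horizonD[OF _ t]) (auto simp: continuous_adapted_def)
  qed
qed

context
  fixes T :: ereal and \<xi> :: "'a \<Rightarrow> real" and \<delta> \<sigma> \<rho> \<beta> :: real and q :: "real \<Rightarrow> real"
  assumes T: "0 \<le> T" and \<delta>: "0 < \<delta>" and \<rho>: "0 < \<rho>"
    and \<xi>: "\<xi> \<in> borel_measurable (F 0)" "AE \<omega> in M. 0 < \<xi> \<omega>" "integrable M \<xi>"
    and q: "q \<in> Qclass \<delta> \<rho> \<beta> T"
begin

private abbreviation "R \<equiv> restrict_space lborel (horizon T)"
private abbreviation "\<zeta> \<equiv> zfun \<delta> \<rho> \<beta> T q"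
private abbreviation "X \<equiv> state M F B \<delta> \<sigma> T \<xi>"

definition weight :: "real \<Rightarrow> real" where
  "weight r = indicator (horizon T) r * q r powr (- \<beta>)"

lemma weight_nonneg: "0 \<le> weight r"
  by (simp add: weight_def)

lemma weight_measurable [measurable]: "weight \<in> borel_measurable borel"
proof -
  have "q \<in> borel_measurable (restrict_space borel (horizon T))"
    using q by (simp add: Qclass_def positive_measurable_def)
  then have "(\<lambda>r. q r * indicator (horizon T) r) \<in> borel_measurable borel"
    by (subst (asm) borel_measurable_restrict_space_iff) (auto simp: mult.commute)
  then have "(\<lambda>r. indicator (horizon T) r * (q r * indicator (horizon T) r) powr (- \<beta>)) \<in> borel_measurable borel"
    by measurable
  moreover have "indicator (horizon T) r * (q r * indicator (horizon T) r) powr (- \<beta>) = weight r" for r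
    by (simp add: weight_def indicator_def)
  ultimately show ?thesis by simp
qed

lemma weight_integrable: "integrable lborel weight"
proof -
  have "set_integrable lborel (horizon T \<inter> {0<..}) (\<lambda>s. q s powr (- \<beta>))"
    using q by (simp add: Qclass_def)
  then have 1: "integrable lborel (\<lambda>r. indicator (horizon T \<inter> {0<..}) r *\<^sub>R q r powr (- \<beta>))"
    by (simp add: set_integrable_def)
  have "AE r in lborel. r \<noteq> (0::real)" by (rule AE_lborel_singleton)
  then have "AE r in lborel. indicator (horizon T \<inter> {0<..}) r *\<^sub>R q r powr (- \<beta>) = weight r"
    by eventually_elim (auto simp: weight_def indicator_def horizon_def)
  from integrable_cong_AE_imp[OF 1 _ this] show ?thesis by simp
qed

definition kernel :: "real \<Rightarrow> real \<Rightarrow> real" where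
  "kernel s r = indicator {s<..} r * exp (- (\<rho> + \<delta>) * (r - s)) * weight r"

lemma kernel_measurable: "(\<lambda>(s, r). kernel s r) \<in> borel_measurable (borel \<Otimes>\<^sub>M borel)"
proof -
  have "(\<lambda>p. (if fst p < snd p then 1 else 0) * exp (- (\<rho> + \<delta>) * (snd p - fst p)) * weight (snd p)) \<in> borel_measurable (borel \<Otimes>\<^sub>M borel)"
    by measurable
  then show ?thesis by (simp add: kernel_def case_prod_beta indicator_def)
qed

lemma kernel_bounds: "0 \<le> kernel s r" "kernel s r \<le> weight r"
proof -
  show "0 \<le> kernel s r" by (simp add: kernel_def weight_nonneg)
  have "exp (- (\<rho> + \<delta>) * (r - s)) \<le> 1" if "s < r"
    unfolding exp_le_one_iff mult_minus_left neg_le_0_iff_le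
    using that \<delta> \<rho> by (intro mult_nonneg_nonneg) auto
  then have "exp (- (\<rho> + \<delta>) * (r - s)) * weight r \<le> 1 * weight r" if "s < r"
    using that weight_nonneg by (intro mult_right_mono) auto
  then show "kernel s r \<le> weight r" using weight_nonneg[of r] by (auto simp: kernel_def indicator_def)
qed

lemma kernel_integrable: "integrable lborel (kernel s)"
proof (rule Bochner_Integration.integrable_bound[OF weight_integrable])
  show "kernel s \<in> borel_measurable lborel" using measurable_Pair2[OF kernel_measurable, of s] by simp
  show "AE r in lborel. norm (kernel s r) \<le> norm (weight r)"
    using kernel_bounds[of s] weight_nonneg by (intro AE_I2) simp
qed

lemma zfun_eq_kernel: "\<zeta> s = (\<integral>r. kernel s r \<partial>lborel)"
  unfolding zfun_def set_lebesgue_integral_def kernel_def weight_def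
  by (intro Bochner_Integration.integral_cong) (auto simp: indicator_def)

lemma zfun_bounds: "0 \<le> \<zeta> s" "\<zeta> s \<le> (\<integral>r. weight r \<partial>lborel)"
  unfolding zfun_eq_kernel using kernel_bounds
  by (auto intro!: Bochner_Integration.integral_nonneg integral_mono kernel_integrable weight_integrable)

lemma zfun_measurable [measurable]: "\<zeta> \<in> borel_measurable borel"
proof -
  have "(\<lambda>s. \<integral>r. kernel s r \<partial>lborel) \<in> borel_measurable borel"
    using kernel_measurable
    by (intro sigma_finite_measure.borel_measurable_lebesgue_integral[OF sigma_finite_lborel])
      (simp add: measurable_pair_lborel)
  then show ?thesis by (simp add: zfun_eq_kernel[abs_def])
qed

lemma nn_integral_kernel: "(\<integral>\<^sup>+r. ennreal (kernel s r) \<partial>lborel) = ennreal (\<zeta> s)"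
  unfolding zfun_eq_kernel using kernel_integrable kernel_bounds by (intro nn_integral_eq_integral) auto

lemma nn_integral_discount: "(\<integral>\<^sup>+s. ennreal (exp (- \<rho> * s)) * indicator {0..} s \<partial>lborel) = ennreal (1 / \<rho>)"
proof -
  have "(\<integral>\<^sup>+s. ennreal (exp (- \<rho> * s)) * indicator {0..} s \<partial>lborel) = ennreal (0 - (- exp (- \<rho> * 0) / \<rho>))"
  proof (rule nn_integral_FTC_atLeast)
    show "((\<lambda>s. - exp (- \<rho> * s) / \<rho>) has_real_derivative exp (- \<rho> * s)) (at s)" for s
      using \<rho> by (auto intro!: derivative_eq_intros)
    have "filterlim (\<lambda>s. \<rho> * s) at_top at_top"
      using \<rho> by (intro filterlim_tendsto_pos_mult_at_top[OF tendsto_const] filterlim_ident) auto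
    then have "filterlim (\<lambda>s. - \<rho> * s) at_bot at_top" by (simp add: filterlim_uminus_at_bot)
    then have "((\<lambda>s. exp (- \<rho> * s)) \<longlongrightarrow> 0) at_top" by (rule filterlim_compose[OF exp_at_bot])
    then have "((\<lambda>s. - exp (- \<rho> * s) / \<rho>) \<longlongrightarrow> - 0 / \<rho>) at_top" by (intro tendsto_intros) (use \<rho> in auto)
    then show "((\<lambda>s. - exp (- \<rho> * s) / \<rho>) \<longlongrightarrow> 0) at_top" by simp
  qed auto
  then show ?thesis by simp
qed

lemma zfun_control: "(\<lambda>s \<omega>. \<zeta> s) \<in> controls M F \<rho> T"
proof -
  define Z where "Z = (\<integral>r. weight r \<partial>lborel)"
  have Z: "0 \<le> \<zeta> s" "\<zeta> s \<le> Z" for s using zfun_bounds[of s] by (auto simp: Z_def)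
  have Z2: "(\<zeta> s)\<^sup>2 \<le> Z\<^sup>2" for s using Z[of s] by (intro power_mono) auto
  have fin: "(\<integral>\<^sup>+s\<in>{0..t}. ennreal (c s) \<partial>lborel) < \<infinity>" if "\<And>s. c s \<le> K" for c :: "real \<Rightarrow> real" and K t
  proof -
    have "(\<integral>\<^sup>+s\<in>{0..t}. ennreal (c s) \<partial>lborel) \<le> (\<integral>\<^sup>+s\<in>{0..t}. ennreal K \<partial>lborel)"
      using that by (intro nn_integral_mono mult_right_mono ennreal_leI) auto
    also have "\<dots> < \<infinity>"
      by (subst nn_integral_cmult_indicator) (auto simp: ennreal_mult_less_top emeasure_lborel_Icc_eq)
    finally show ?thesis .
  qed
  have prog: "progressively_measurable F T (\<lambda>s \<omega>. \<zeta> s)"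
    unfolding progressively_measurable_def
  proof
    fix t assume "t \<in> horizon T"
    have "snd \<in> measurable (F t \<Otimes>\<^sub>M restrict_space borel {0..t}) borel"
      by (rule measurable_compose[OF measurable_snd]) (rule measurable_restrict_space1, simp)
    from measurable_compose[OF this zfun_measurable]
    show "(\<lambda>(\<omega>, s). \<zeta> s) \<in> borel_measurable (F t \<Otimes>\<^sub>M restrict_space borel {0..t})"
      by (simp add: case_prod_beta)
  qed
  show ?thesis
  proof (cases T)
    case (real a)
    then have "(\<integral>\<^sup>+s\<in>horizon T. ennreal ((\<zeta> s)\<^sup>2) \<partial>lborel) < \<infinity>" using fin[of "\<lambda>s. (\<zeta> s)\<^sup>2", OF Z2] by simp
    then show ?thesis unfolding controls_def using prog Z real by (auto simp: emeasure_space_1)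
  next
    case PInf
    have "(\<integral>\<^sup>+s\<in>{0..}. ennreal (exp (- \<rho> * s) * (\<zeta> s)\<^sup>2) \<partial>lborel) \<le> (\<integral>\<^sup>+s. ennreal (Z\<^sup>2) * (ennreal (exp (- \<rho> * s)) * indicator {0..} s) \<partial>lborel)"
    proof (rule nn_integral_mono)
      fix s
      have "exp (- \<rho> * s) * (\<zeta> s)\<^sup>2 \<le> exp (- \<rho> * s) * Z\<^sup>2" using Z2 by (intro mult_left_mono) auto
      then have "ennreal (exp (- \<rho> * s) * (\<zeta> s)\<^sup>2) \<le> ennreal (exp (- \<rho> * s) * Z\<^sup>2)" by (rule ennreal_leI)
      then show "ennreal (exp (- \<rho> * s) * (\<zeta> s)\<^sup>2) * indicator {0..} s \<le> ennreal (Z\<^sup>2) * (ennreal (exp (- \<rho> * s)) * indicator {0..} s)"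
        by (auto simp: indicator_def ennreal_mult mult.commute)
    qed
    also have "\<dots> = ennreal (Z\<^sup>2) * ennreal (1 / \<rho>)"
      using nn_integral_discount by (subst nn_integral_cmult) auto
    also have "\<dots> < \<infinity>" by (simp add: ennreal_mult_less_top)
    finally have "(\<integral>\<^sup>+s\<in>{0..}. ennreal (exp (- \<rho> * s) * (\<zeta> s)\<^sup>2) \<partial>lborel) < \<infinity>" .
    then show ?thesis unfolding controls_def using prog Z PInf fin[of \<zeta>, OF Z(2)] by (auto simp: emeasure_space_1)
  qed (use T in auto)
qed

lemma control_measurable:
  assumes v: "v \<in> controls M F \<rho> T"
  shows "(\<lambda>(\<omega>, s). v s \<omega>) \<in> borel_measurable (M \<Otimes>\<^sub>M R)"
    "(\<lambda>(\<omega>, s). indicator (horizon T) s * v s \<omega>) \<in> borel_measurable (M \<Otimes>\<^sub>M borel)"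
  using v progressive_horizon_measurable[OF T] by (auto simp: controls_def)

lemma snd_measurable: "snd \<in> borel_measurable (M \<Otimes>\<^sub>M R)"
  by (rule measurable_compose[OF measurable_snd]) (rule measurable_restrict_space1, simp)

lemma control_square_integrable:
  assumes v: "v \<in> controls M F \<rho> T"
  shows "integrable (M \<Otimes>\<^sub>M R) (\<lambda>(\<omega>, s). exp (- \<rho> * s) * (v s \<omega>)\<^sup>2)"
proof (rule integrableI_nonneg)
  interpret R: sigma_finite_measure R by (rule sigma_finite_horizon)
  have m: "(\<lambda>(\<omega>, s). exp (- \<rho> * s) * (v s \<omega>)\<^sup>2) \<in> borel_measurable (M \<Otimes>\<^sub>M R)"
    using control_measurable(1)[OF v] snd_measurable unfolding case_prod_beta by measurable
  then show "(\<lambda>(\<omega>, s). exp (- \<rho> * s) * (v s \<omega>)\<^sup>2) \<in> borel_measurable (M \<Otimes>\<^sub>M R)" .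
  show "AE x in M \<Otimes>\<^sub>M R. 0 \<le> (case x of (\<omega>, s) \<Rightarrow> exp (- \<rho> * s) * (v s \<omega>)\<^sup>2)" by (auto simp: case_prod_beta)
  have "(\<integral>\<^sup>+x. ennreal (case x of (\<omega>, s) \<Rightarrow> exp (- \<rho> * s) * (v s \<omega>)\<^sup>2) \<partial>(M \<Otimes>\<^sub>M R)) =
      (\<integral>\<^sup>+\<omega>. \<integral>\<^sup>+s. ennreal (exp (- \<rho> * s) * (v s \<omega>)\<^sup>2) \<partial>R \<partial>M)"
    using R.nn_integral_fst[of "\<lambda>x. ennreal (case x of (\<omega>, s) \<Rightarrow> exp (- \<rho> * s) * (v s \<omega>)\<^sup>2)" M] m by simp
  also have "\<dots> = (\<integral>\<^sup>+\<omega>. (\<integral>\<^sup>+s\<in>horizon T. ennreal (exp (- \<rho> * s) * (v s \<omega>)\<^sup>2) \<partial>lborel) \<partial>M)"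
    by (intro nn_integral_cong) (simp add: nn_integral_restrict_space)
  also have "\<dots> < \<infinity>"
  proof (cases T)
    case (real a)
    have "(\<integral>\<^sup>+\<omega>. (\<integral>\<^sup>+s\<in>horizon T. ennreal (exp (- \<rho> * s) * (v s \<omega>)\<^sup>2) \<partial>lborel) \<partial>M) \<le>
        (\<integral>\<^sup>+\<omega>. (\<integral>\<^sup>+s\<in>horizon T. ennreal ((v s \<omega>)\<^sup>2) \<partial>lborel) \<partial>M)"
    proof (intro nn_integral_mono)
      fix s \<omega>
      have "exp (- \<rho> * s) * (v s \<omega>)\<^sup>2 \<le> 1 * (v s \<omega>)\<^sup>2" if "s \<in> horizon T"
        using \<rho> horizonD[OF that] by (intro mult_right_mono) auto
      then show "ennreal (exp (- \<rho> * s) * (v s \<omega>)\<^sup>2) * indicator (horizon T) s \<le> ennreal ((v s \<omega>)\<^sup>2) * indicator (horizon T) s"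
        by (auto simp: indicator_def intro!: ennreal_leI)
    qed
    also have "\<dots> < \<infinity>" using v real by (simp add: controls_def)
    finally show ?thesis .
  next
    case PInf
    then show ?thesis using v by (simp add: controls_def)
  qed (use T in auto)
  finally show "(\<integral>\<^sup>+x. ennreal (case x of (\<omega>, s) \<Rightarrow> exp (- \<rho> * s) * (v s \<omega>)\<^sup>2) \<partial>(M \<Otimes>\<^sub>M R)) < \<infinity>" .
qed

lemma control_cross_integrable:
  assumes v: "v \<in> controls M F \<rho> T"
  shows "integrable (M \<Otimes>\<^sub>M R) (\<lambda>(\<omega>, s). exp (- \<rho> * s) * (\<zeta> s * v s \<omega>))"
proof (rule Bochner_Integration.integrable_bound)
  show "integrable (M \<Otimes>\<^sub>M R) (\<lambda>x. (case x of (\<omega>, s) \<Rightarrow> exp (- \<rho> * s) * (\<zeta> s)\<^sup>2) + (case x of (\<omega>, s) \<Rightarrow> exp (- \<rho> * s) * (v s \<omega>)\<^sup>2))"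
    by (intro Bochner_Integration.integrable_add control_square_integrable[OF v] control_square_integrable[OF zfun_control])
  have "(\<lambda>x. \<zeta> (snd x)) \<in> borel_measurable (M \<Otimes>\<^sub>M R)"
    by (rule measurable_compose[OF snd_measurable zfun_measurable])
  then show "(\<lambda>(\<omega>, s). exp (- \<rho> * s) * (\<zeta> s * v s \<omega>)) \<in> borel_measurable (M \<Otimes>\<^sub>M R)"
    using control_measurable(1)[OF v] snd_measurable unfolding case_prod_beta by measurable
  show "AE x in M \<Otimes>\<^sub>M R. norm (case x of (\<omega>, s) \<Rightarrow> exp (- \<rho> * s) * (\<zeta> s * v s \<omega>)) \<le>
      norm ((case x of (\<omega>, s) \<Rightarrow> exp (- \<rho> * s) * (\<zeta> s)\<^sup>2) + (case x of (\<omega>, s) \<Rightarrow> exp (- \<rho> * s) * (v s \<omega>)\<^sup>2))"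
  proof (rule AE_I2, clarify)
    fix \<omega> s
    have "norm (exp (- \<rho> * s) * (\<zeta> s * v s \<omega>)) = exp (- \<rho> * s) * (\<bar>\<zeta> s\<bar> * \<bar>v s \<omega>\<bar>)" by (simp add: abs_mult)
    also have "\<dots> \<le> exp (- \<rho> * s) * ((\<zeta> s)\<^sup>2 + (v s \<omega>)\<^sup>2)" by (intro mult_left_mono abs_mult_le_sum_squares) simp
    also have "\<dots> \<le> norm (exp (- \<rho> * s) * (\<zeta> s)\<^sup>2 + exp (- \<rho> * s) * (v s \<omega>)\<^sup>2)"
      by (simp add: distrib_left)
    finally show "norm (exp (- \<rho> * s) * (\<zeta> s * v s \<omega>)) \<le> norm (exp (- \<rho> * s) * (\<zeta> s)\<^sup>2 + exp (- \<rho> * s) * (v s \<omega>)\<^sup>2)" .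
  qed
qed

definition baseline :: ennreal where
  "baseline = (\<integral>\<^sup>+\<omega>. ennreal (\<xi> \<omega>) \<partial>M) * (\<integral>\<^sup>+s. ennreal (exp (- (\<rho> + \<delta>) * s) * weight s) \<partial>lborel)"

lemma baseline_finite: "baseline < \<infinity>"
proof -
  have "(\<integral>\<^sup>+\<omega>. ennreal (\<xi> \<omega>) \<partial>M) < \<infinity>"
    using \<xi>(3) by (auto simp: real_integrable_def less_top)
  moreover have "(\<integral>\<^sup>+s. ennreal (exp (- (\<rho> + \<delta>) * s) * weight s) \<partial>lborel) \<le> (\<integral>\<^sup>+s. ennreal (weight s) \<partial>lborel)"
  proof (intro nn_integral_mono ennreal_leI)
    fix s
    show "exp (- (\<rho> + \<delta>) * s) * weight s \<le> weight s"
    proof (cases "s \<in> horizon T")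
      case True
      then have "exp (- (\<rho> + \<delta>) * s) \<le> 1"
        unfolding exp_le_one_iff mult_minus_left neg_le_0_iff_le
        using \<delta> \<rho> horizonD[OF True] by (intro mult_nonneg_nonneg) auto
      then show ?thesis using mult_right_mono[of "exp (- (\<rho> + \<delta>) * s)" 1 "weight s"] weight_nonneg by simp
    qed (simp add: weight_def)
  qed
  moreover have "(\<integral>\<^sup>+s. ennreal (weight s) \<partial>lborel) < \<infinity>"
    using weight_integrable by (auto simp: real_integrable_def less_top)
  ultimately show ?thesis unfolding baseline_def by (auto simp: ennreal_mult_less_top)
qed

text \<open>
  Insert the mean of the state and exchange the integrals over \<open>r \<le> s\<close>: the time \<open>r\<close> at which the
  control acts then carries the discounted future weight
  \<open>exp (- \<rho> r) \<integral>\<^sub>r exp (- (\<rho> + \<delta>) (s - r)) q\<^sub>s powr (- \<beta>) ds = exp (- \<rho> r) z\<^sub>r\<close>.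
  The initial value contributes \<open>baseline\<close>, which is the same for all controls.
\<close>

lemma nn_integral_benefit:
  assumes v: "v \<in> controls M F \<rho> T"
  shows "(\<integral>\<^sup>+x. ennreal (case x of (\<omega>, s) \<Rightarrow> exp (- \<rho> * s) * (X v s \<omega> * q s powr (- \<beta>))) \<partial>(M \<Otimes>\<^sub>M R)) =
    baseline + (\<integral>\<^sup>+x. ennreal (case x of (\<omega>, s) \<Rightarrow> exp (- \<rho> * s) * (\<zeta> s * v s \<omega>)) \<partial>(M \<Otimes>\<^sub>M R))"
proof -
  interpret R: sigma_finite_measure R by (rule sigma_finite_horizon)
  interpret P: pair_sigma_finite M R ..
  have \<delta>0: "0 \<le> \<delta>" using \<delta> by simp
  note Xp = state_properties[OF \<delta>0 \<xi>(1,2) v, where \<sigma>=\<sigma>]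
  have XR: "(\<lambda>(\<omega>, s). X v s \<omega>) \<in> borel_measurable (M \<Otimes>\<^sub>M R)"
    by (rule progressive_horizon_measurable(2)[OF T continuous_adapted_progressive[OF Xp(1)]])
  have wR: "(\<lambda>x. weight (snd x)) \<in> borel_measurable (M \<Otimes>\<^sub>M R)"
    by (rule measurable_compose[OF snd_measurable weight_measurable])
  define U where "U r = (\<integral>\<^sup>+\<omega>. ennreal (indicator (horizon T) r * v r \<omega>) \<partial>M)" for r
  have UM[measurable]: "U \<in> borel_measurable borel"
  proof -
    have "(\<lambda>(r, \<omega>). ennreal (indicator (horizon T) r * v r \<omega>)) \<in> borel_measurable (borel \<Otimes>\<^sub>M M)"
      using measurable_compose[OF measurable_pair_swap' control_measurable(2)[OF v]] by (simp add: case_prod_beta)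
    then show ?thesis unfolding U_def[abs_def] by (rule borel_measurable_nn_integral)
  qed
  have U: "U r = (\<integral>\<^sup>+\<omega>. ennreal (v r \<omega>) \<partial>M)" if "r \<in> horizon T" for r using that by (simp add: U_def)
  have U_out: "U r = 0" if "r \<notin> horizon T" for r using that by (simp add: U_def)
  define \<Xi> where "\<Xi> = (\<integral>\<^sup>+\<omega>. ennreal (\<xi> \<omega>) \<partial>M)"
  have 1: "(\<integral>\<^sup>+x. ennreal (case x of (\<omega>, s) \<Rightarrow> exp (- \<rho> * s) * (X v s \<omega> * q s powr (- \<beta>))) \<partial>(M \<Otimes>\<^sub>M R)) =
      (\<integral>\<^sup>+s. \<integral>\<^sup>+\<omega>. ennreal (exp (- \<rho> * s) * (X v s \<omega> * weight s)) \<partial>M \<partial>R)"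
  proof -
    have m: "(\<lambda>(\<omega>, s). ennreal (exp (- \<rho> * s) * (X v s \<omega> * weight s))) \<in> borel_measurable (M \<Otimes>\<^sub>M R)"
      using XR wR snd_measurable unfolding case_prod_beta by measurable
    have "(\<integral>\<^sup>+x. ennreal (case x of (\<omega>, s) \<Rightarrow> exp (- \<rho> * s) * (X v s \<omega> * q s powr (- \<beta>))) \<partial>(M \<Otimes>\<^sub>M R)) =
        (\<integral>\<^sup>+x. (case x of (\<omega>, s) \<Rightarrow> ennreal (exp (- \<rho> * s) * (X v s \<omega> * weight s))) \<partial>(M \<Otimes>\<^sub>M R))"
      by (intro nn_integral_cong) (auto simp: space_pair_measure space_restrict_space weight_def)
    also have "\<dots> = (\<integral>\<^sup>+s. \<integral>\<^sup>+\<omega>. ennreal (exp (- \<rho> * s) * (X v s \<omega> * weight s)) \<partial>M \<partial>R)"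
      using P.nn_integral_snd[OF m] by simp
    finally show ?thesis .
  qed
  have 2: "(\<integral>\<^sup>+\<omega>. ennreal (exp (- \<rho> * s) * (X v s \<omega> * weight s)) \<partial>M) =
      ennreal (exp (- \<rho> * s) * weight s) * (ennreal (exp (- \<delta> * s)) * \<Xi> + (\<integral>\<^sup>+r\<in>{0..s}. ennreal (exp (- \<delta> * (s - r))) * U r \<partial>lborel))"
    if s: "s \<in> horizon T" for s
  proof -
    have XsM: "X v s \<in> borel_measurable M"
      using Xp(1) s by (auto simp: continuous_adapted_def intro: measurable_F_M[OF _ horizonD])
    have "(\<integral>\<^sup>+\<omega>. ennreal (exp (- \<rho> * s) * (X v s \<omega> * weight s)) \<partial>M) = (\<integral>\<^sup>+\<omega>. ennreal (exp (- \<rho> * s) * weight s) * ennreal (X v s \<omega>) \<partial>M)"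
    proof (rule nn_integral_cong_AE)
      show "AE \<omega> in M. ennreal (exp (- \<rho> * s) * (X v s \<omega> * weight s)) = ennreal (exp (- \<rho> * s) * weight s) * ennreal (X v s \<omega>)"
        using Xp(2)[OF s] by eventually_elim (simp add: ennreal_mult[symmetric] weight_nonneg mult_ac)
    qed
    also have "\<dots> = ennreal (exp (- \<rho> * s) * weight s) * (\<integral>\<^sup>+\<omega>. ennreal (X v s \<omega>) \<partial>M)"
      using XsM by (intro nn_integral_cmult) auto
    also have "(\<integral>\<^sup>+\<omega>. ennreal (X v s \<omega>) \<partial>M) = ennreal (exp (- \<delta> * s)) * \<Xi> +
        (\<integral>\<^sup>+r\<in>{0..s}. ennreal (exp (- \<delta> * (s - r))) * U r \<partial>lborel)"
      unfolding Xp(3)[OF s] \<Xi>_def using U horizon_down[OF s]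
      by (intro arg_cong2[where f="(+)"] refl nn_integral_cong) (auto simp: indicator_def)
    finally show ?thesis .
  qed
  have "(\<integral>\<^sup>+s. \<integral>\<^sup>+\<omega>. ennreal (exp (- \<rho> * s) * (X v s \<omega> * weight s)) \<partial>M \<partial>R) =
      (\<integral>\<^sup>+s. ennreal (exp (- \<rho> * s) * weight s) * (ennreal (exp (- \<delta> * s)) * \<Xi> + (\<integral>\<^sup>+r\<in>{0..s}. ennreal (exp (- \<delta> * (s - r))) * U r \<partial>lborel)) * indicator (horizon T) s \<partial>lborel)"
    using 2 by (subst nn_integral_restrict_space) (auto intro!: nn_integral_cong simp: indicator_def)
  also have "\<dots> = (\<integral>\<^sup>+s. \<Xi> * ennreal (exp (- (\<rho> + \<delta>) * s) * weight s) +
      (\<integral>\<^sup>+r. ennreal (exp (- \<rho> * r)) * U r * ennreal (indicator {..s} r * exp (- (\<rho> + \<delta>) * (s - r)) * weight s) \<partial>lborel) \<partial>lborel)"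
  proof (rule nn_integral_cong)
    fix s
    show "ennreal (exp (- \<rho> * s) * weight s) * (ennreal (exp (- \<delta> * s)) * \<Xi> + (\<integral>\<^sup>+r\<in>{0..s}. ennreal (exp (- \<delta> * (s - r))) * U r \<partial>lborel)) * indicator (horizon T) s =
      \<Xi> * ennreal (exp (- (\<rho> + \<delta>) * s) * weight s) +
      (\<integral>\<^sup>+r. ennreal (exp (- \<rho> * r)) * U r * ennreal (indicator {..s} r * exp (- (\<rho> + \<delta>) * (s - r)) * weight s) \<partial>lborel)"
    proof (cases "s \<in> horizon T")
      case True
      have e1: "ennreal (exp (- \<rho> * s) * weight s) * (ennreal (exp (- \<delta> * s)) * \<Xi>) = \<Xi> * ennreal (exp (- (\<rho> + \<delta>) * s) * weight s)"
      proof -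
        have "exp (- \<rho> * s) * weight s * exp (- \<delta> * s) = exp (- (\<rho> + \<delta>) * s) * weight s"
          by (simp add: mult_exp_exp algebra_simps)
        then show ?thesis
          by (metis ennreal_mult' exp_ge_zero mult.assoc mult.commute mult_nonneg_nonneg weight_nonneg)
      qed
      have "ennreal (exp (- \<rho> * s) * weight s) * (\<integral>\<^sup>+r\<in>{0..s}. ennreal (exp (- \<delta> * (s - r))) * U r \<partial>lborel) =
          (\<integral>\<^sup>+r. ennreal (exp (- \<rho> * s) * weight s) * (ennreal (exp (- \<delta> * (s - r))) * U r * indicator {0..s} r) \<partial>lborel)"
        by (rule nn_integral_cmult[symmetric]) measurable
      also have "\<dots> = (\<integral>\<^sup>+r. ennreal (exp (- \<rho> * r)) * U r * ennreal (indicator {..s} r * exp (- (\<rho> + \<delta>) * (s - r)) * weight s) \<partial>lborel)"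
      proof (rule nn_integral_cong)
        fix r
        show "ennreal (exp (- \<rho> * s) * weight s) * (ennreal (exp (- \<delta> * (s - r))) * U r * indicator {0..s} r) =
           ennreal (exp (- \<rho> * r)) * U r * ennreal (indicator {..s} r * exp (- (\<rho> + \<delta>) * (s - r)) * weight s)"
        proof (cases "r \<in> horizon T \<and> r \<le> s")
          case True
          have "exp (- \<rho> * s) * weight s * exp (- \<delta> * (s - r)) = exp (- \<rho> * r) * (exp (- (\<rho> + \<delta>) * (s - r)) * weight s)"
            by (simp add: mult_exp_exp algebra_simps)
          then have "ennreal (exp (- \<rho> * s) * weight s) * ennreal (exp (- \<delta> * (s - r))) = ennreal (exp (- \<rho> * r)) * ennreal (exp (- (\<rho> + \<delta>) * (s - r)) * weight s)"
            using weight_nonneg[of s] by (subst (1 2) ennreal_mult[symmetric]) auto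
          then show ?thesis using True horizonD[of r T] by (simp add: mult_ac)
        next
          case False
          then show ?thesis using U_out[of r] by (auto simp: indicator_def)
        qed
      qed
      finally show ?thesis using True e1 by (simp add: distrib_left)
    qed (simp add: weight_def)
  qed
  also have "\<dots> = (\<integral>\<^sup>+s. \<Xi> * ennreal (exp (- (\<rho> + \<delta>) * s) * weight s) \<partial>lborel) +
      (\<integral>\<^sup>+s. (\<integral>\<^sup>+r. ennreal (exp (- \<rho> * r)) * U r * ennreal (indicator {..s} r * exp (- (\<rho> + \<delta>) * (s - r)) * weight s) \<partial>lborel) \<partial>lborel)"
  proof (rule nn_integral_add)
    have "(\<lambda>(s, r). ennreal (exp (- \<rho> * r)) * U r * ennreal ((if r \<le> s then 1 else 0) * exp (- (\<rho> + \<delta>) * (s - r)) * weight s)) \<in> borel_measurable (borel \<Otimes>\<^sub>M borel)"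
      by measurable
    then have "(\<lambda>(s, r). ennreal (exp (- \<rho> * r)) * U r * ennreal (indicator {..s} r * exp (- (\<rho> + \<delta>) * (s - r)) * weight s)) \<in> borel_measurable (borel \<Otimes>\<^sub>M lborel)"
      by (simp add: measurable_pair_lborel indicator_def)
    from sigma_finite_measure.borel_measurable_nn_integral[OF sigma_finite_lborel this]
    show "(\<lambda>s. \<integral>\<^sup>+r. ennreal (exp (- \<rho> * r)) * U r * ennreal (indicator {..s} r * exp (- (\<rho> + \<delta>) * (s - r)) * weight s) \<partial>lborel) \<in> borel_measurable lborel"
      by simp
  qed measurable
  also have "(\<integral>\<^sup>+s. \<Xi> * ennreal (exp (- (\<rho> + \<delta>) * s) * weight s) \<partial>lborel) = baseline"
    unfolding baseline_def \<Xi>_def by (rule nn_integral_cmult) measurable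
  also have "(\<integral>\<^sup>+s. (\<integral>\<^sup>+r. ennreal (exp (- \<rho> * r)) * U r * ennreal (indicator {..s} r * exp (- (\<rho> + \<delta>) * (s - r)) * weight s) \<partial>lborel) \<partial>lborel) =
      (\<integral>\<^sup>+r. (\<integral>\<^sup>+s. ennreal (exp (- \<rho> * r)) * U r * ennreal (indicator {..s} r * exp (- (\<rho> + \<delta>) * (s - r)) * weight s) \<partial>lborel) \<partial>lborel)"
  proof -
    have "(\<lambda>(r, s). ennreal (exp (- \<rho> * r)) * U r * ennreal ((if r \<le> s then 1 else 0) * exp (- (\<rho> + \<delta>) * (s - r)) * weight s)) \<in> borel_measurable (lborel \<Otimes>\<^sub>M lborel)"
      by measurable
    then have "(\<lambda>(r, s). ennreal (exp (- \<rho> * r)) * U r * ennreal (indicator {..s} r * exp (- (\<rho> + \<delta>) * (s - r)) * weight s)) \<in> borel_measurable (lborel \<Otimes>\<^sub>M lborel)"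
      by (simp add: indicator_def)
    from lborel_pair.Fubini[OF this] show ?thesis unfolding prod.case .
  qed
  also have "\<dots> = (\<integral>\<^sup>+r. ennreal (exp (- \<rho> * r)) * U r * ennreal (\<zeta> r) \<partial>lborel)"
  proof (rule nn_integral_cong)
    fix r
    have "(\<integral>\<^sup>+s. ennreal (exp (- \<rho> * r)) * U r * ennreal (indicator {..s} r * exp (- (\<rho> + \<delta>) * (s - r)) * weight s) \<partial>lborel) =
        ennreal (exp (- \<rho> * r)) * U r * (\<integral>\<^sup>+s. ennreal (indicator {r..} s * exp (- (\<rho> + \<delta>) * (s - r)) * weight s) \<partial>lborel)"
    proof -
      have "indicator {..s} r = (indicator {r..} s :: real)" for s by (simp add: indicator_def)
      then show ?thesis by (subst nn_integral_cmult[symmetric]) auto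
    qed
    also have "(\<integral>\<^sup>+s. ennreal (indicator {r..} s * exp (- (\<rho> + \<delta>) * (s - r)) * weight s) \<partial>lborel) = (\<integral>\<^sup>+s. ennreal (kernel r s) \<partial>lborel)"
    proof (rule nn_integral_cong_AE)
      have "AE s in lborel. s \<noteq> r" by (rule AE_lborel_singleton)
      then show "AE s in lborel. ennreal (indicator {r..} s * exp (- (\<rho> + \<delta>) * (s - r)) * weight s) = ennreal (kernel r s)"
        by eventually_elim (auto simp: kernel_def indicator_def)
    qed
    finally show "(\<integral>\<^sup>+s. ennreal (exp (- \<rho> * r)) * U r * ennreal (indicator {..s} r * exp (- (\<rho> + \<delta>) * (s - r)) * weight s) \<partial>lborel) =
        ennreal (exp (- \<rho> * r)) * U r * ennreal (\<zeta> r)"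
      unfolding nn_integral_kernel .
  qed
  also have "\<dots> = (\<integral>\<^sup>+r. (\<integral>\<^sup>+\<omega>. ennreal (exp (- \<rho> * r) * (\<zeta> r * v r \<omega>)) \<partial>M) \<partial>R)"
  proof -
    have "(\<integral>\<^sup>+r. (\<integral>\<^sup>+\<omega>. ennreal (exp (- \<rho> * r) * (\<zeta> r * v r \<omega>)) \<partial>M) \<partial>R) =
        (\<integral>\<^sup>+r. (\<integral>\<^sup>+\<omega>. ennreal (exp (- \<rho> * r) * (\<zeta> r * v r \<omega>)) \<partial>M) * indicator (horizon T) r \<partial>lborel)"
      by (rule nn_integral_restrict_space) simp
    also have "\<dots> = (\<integral>\<^sup>+r. ennreal (exp (- \<rho> * r)) * U r * ennreal (\<zeta> r) \<partial>lborel)"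
    proof (rule nn_integral_cong)
      fix r
      show "(\<integral>\<^sup>+\<omega>. ennreal (exp (- \<rho> * r) * (\<zeta> r * v r \<omega>)) \<partial>M) * indicator (horizon T) r = ennreal (exp (- \<rho> * r)) * U r * ennreal (\<zeta> r)"
      proof (cases "r \<in> horizon T")
        case True
        have vM: "v r \<in> borel_measurable M" by (rule measurable_F_M[OF controls_adapted[OF v True] horizonD[OF True]])
        have "(\<integral>\<^sup>+\<omega>. ennreal (exp (- \<rho> * r) * (\<zeta> r * v r \<omega>)) \<partial>M) = (\<integral>\<^sup>+\<omega>. ennreal (exp (- \<rho> * r) * \<zeta> r) * ennreal (v r \<omega>) \<partial>M)"
          using controls_nonneg[OF v True] zfun_bounds(1)[of r]
          by (intro nn_integral_cong) (simp add: ennreal_mult[symmetric] mult.assoc)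
        also have "\<dots> = ennreal (exp (- \<rho> * r) * \<zeta> r) * U r"
          using vM by (simp add: nn_integral_cmult U[OF True])
        finally show ?thesis using True zfun_bounds(1)[of r] by (simp add: ennreal_mult mult_ac)
      qed (simp add: U_out)
    qed
    finally show ?thesis by simp
  qed
  also have "\<dots> = (\<integral>\<^sup>+x. ennreal (case x of (\<omega>, s) \<Rightarrow> exp (- \<rho> * s) * (\<zeta> s * v s \<omega>)) \<partial>(M \<Otimes>\<^sub>M R))"
  proof -
    have m: "(\<lambda>(\<omega>, s). ennreal (exp (- \<rho> * s) * (\<zeta> s * v s \<omega>))) \<in> borel_measurable (M \<Otimes>\<^sub>M R)"
      using borel_measurable_integrable[OF control_cross_integrable[OF v]] by (simp add: case_prod_beta)
    show ?thesis using P.nn_integral_snd[OF m] by (simp add: case_prod_unfold)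
  qed
  finally show ?thesis unfolding 1 .
qed

lemma benefit_integrable:
  assumes v: "v \<in> controls M F \<rho> T"
  shows "integrable (M \<Otimes>\<^sub>M R) (\<lambda>(\<omega>, s). exp (- \<rho> * s) * (X v s \<omega> * q s powr (- \<beta>)))"
    and "(\<integral>x. (case x of (\<omega>, s) \<Rightarrow> exp (- \<rho> * s) * (X v s \<omega> * q s powr (- \<beta>))) \<partial>(M \<Otimes>\<^sub>M R)) =
      enn2real baseline + (\<integral>x. (case x of (\<omega>, s) \<Rightarrow> exp (- \<rho> * s) * (\<zeta> s * v s \<omega>)) \<partial>(M \<Otimes>\<^sub>M R))"
proof -
  let ?b = "\<lambda>x. case x of (\<omega>, s) \<Rightarrow> exp (- \<rho> * s) * (X v s \<omega> * q s powr (- \<beta>))"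
  let ?c = "\<lambda>x. case x of (\<omega>, s) \<Rightarrow> exp (- \<rho> * s) * (\<zeta> s * v s \<omega>)"
  interpret R: sigma_finite_measure R by (rule sigma_finite_horizon)
  interpret P: pair_sigma_finite M R ..
  interpret Q: pair_sigma_finite R M ..
  have \<delta>0: "0 \<le> \<delta>" using \<delta> by simp
  note Xp = state_properties[OF \<delta>0 \<xi>(1,2) v, where \<sigma>=\<sigma>]
  have XR: "(\<lambda>(\<omega>, s). X v s \<omega>) \<in> borel_measurable (M \<Otimes>\<^sub>M R)"
    by (rule progressive_horizon_measurable(2)[OF T continuous_adapted_progressive[OF Xp(1)]])
  have qR: "(\<lambda>x. q (snd x) powr (- \<beta>)) \<in> borel_measurable (M \<Otimes>\<^sub>M R)"
  proof -
    have "(\<lambda>x. weight (snd x)) \<in> borel_measurable (M \<Otimes>\<^sub>M R)"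
      by (rule measurable_compose[OF snd_measurable weight_measurable])
    then show ?thesis
      by (rule measurable_cong[THEN iffD1, rotated]) (auto simp: space_pair_measure space_restrict_space weight_def)
  qed
  have bM: "?b \<in> borel_measurable (M \<Otimes>\<^sub>M R)"
    using XR qR snd_measurable unfolding case_prod_beta by measurable
  have nonneg: "AE x in M \<Otimes>\<^sub>M R. 0 \<le> ?b x"
  proof -
    have set: "{x \<in> space (M \<Otimes>\<^sub>M R). 0 \<le> X v (snd x) (fst x)} \<in> sets (M \<Otimes>\<^sub>M R)"
      using XR unfolding case_prod_beta by measurable
    have "AE s in R. AE \<omega> in M. 0 \<le> X v s \<omega>"
    proof (rule AE_I2)
      fix s assume "s \<in> space R"
      then show "AE \<omega> in M. 0 \<le> X v s \<omega>" using Xp(2)[of s] by (simp add: space_restrict_space)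
    qed
    then have "AE \<omega> in M. AE s in R. 0 \<le> X v s \<omega>"
      using P.AE_commute[of "\<lambda>\<omega> s. 0 \<le> X v s \<omega>", OF set] by simp
    then have "AE x in M \<Otimes>\<^sub>M R. 0 \<le> X v (snd x) (fst x)"
      by (intro P.AE_pair_measure set) simp
    then show ?thesis by eventually_elim (auto simp: case_prod_beta intro!: mult_nonneg_nonneg)
  qed
  have c_nonneg: "AE x in M \<Otimes>\<^sub>M R. 0 \<le> ?c x"
    using controls_nonneg[OF v] zfun_bounds(1)
    by (intro AE_I2) (auto simp: space_pair_measure space_restrict_space intro!: mult_nonneg_nonneg)
  note ci = control_cross_integrable[OF v]
  have c_nn: "(\<integral>\<^sup>+x. ennreal (?c x) \<partial>(M \<Otimes>\<^sub>M R)) = ennreal (\<integral>x. ?c x \<partial>(M \<Otimes>\<^sub>M R))"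
    by (rule nn_integral_eq_integral[OF ci c_nonneg])
  have b_nn: "(\<integral>\<^sup>+x. ennreal (?b x) \<partial>(M \<Otimes>\<^sub>M R)) = baseline + ennreal (\<integral>x. ?c x \<partial>(M \<Otimes>\<^sub>M R))"
    using nn_integral_benefit[OF v] unfolding c_nn .
  show "integrable (M \<Otimes>\<^sub>M R) ?b"
  proof (rule integrableI_nonneg[OF bM nonneg])
    show "(\<integral>\<^sup>+x. ennreal (?b x) \<partial>(M \<Otimes>\<^sub>M R)) < \<infinity>"
      unfolding b_nn using baseline_finite by simp
  qed
  have "(\<integral>x. ?b x \<partial>(M \<Otimes>\<^sub>M R)) = enn2real (baseline + ennreal (\<integral>x. ?c x \<partial>(M \<Otimes>\<^sub>M R)))"
    unfolding b_nn[symmetric] by (rule integral_eq_nn_integral[OF bM nonneg])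
  also have "\<dots> = enn2real baseline + (\<integral>x. ?c x \<partial>(M \<Otimes>\<^sub>M R))"
    using baseline_finite Bochner_Integration.integral_nonneg_AE[OF c_nonneg] by (simp add: enn2real_plus)
  finally show "(\<integral>x. ?b x \<partial>(M \<Otimes>\<^sub>M R)) = enn2real baseline + (\<integral>x. ?c x \<partial>(M \<Otimes>\<^sub>M R))" .
qed

definition gain :: "(real \<Rightarrow> 'a \<Rightarrow> real) \<Rightarrow> real" where
  "gain v = (\<integral>x. (case x of (\<omega>, s) \<Rightarrow> exp (- \<rho> * s) * (\<zeta> s * v s \<omega>)) \<partial>(M \<Otimes>\<^sub>M R)) -
    1 / 2 * (\<integral>x. (case x of (\<omega>, s) \<Rightarrow> exp (- \<rho> * s) * (v s \<omega>)\<^sup>2) \<partial>(M \<Otimes>\<^sub>M R))"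

text \<open>
  All integrals are finite, so the extended-valued iterated integral is an ordinary integral
  over the product space.
\<close>

lemma payoff_eq_gain:
  assumes v: "v \<in> controls M F \<rho> T"
  shows "payoff M F B \<delta> \<sigma> \<rho> \<beta> T q \<xi> v = ereal (enn2real baseline + gain v)"
proof -
  interpret R: sigma_finite_measure R by (rule sigma_finite_horizon)
  interpret P: pair_sigma_finite M R ..
  let ?f = "\<lambda>\<omega> s. exp (- \<rho> * s) * (X v s \<omega> * q s powr (- \<beta>) - 1 / 2 * (v s \<omega>)\<^sup>2)"
  let ?b = "\<lambda>x. case x of (\<omega>, s) \<Rightarrow> exp (- \<rho> * s) * (X v s \<omega> * q s powr (- \<beta>))"
  let ?d = "\<lambda>x. case x of (\<omega>, s) \<Rightarrow> exp (- \<rho> * s) * (v s \<omega>)\<^sup>2"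
  have f_eq: "(\<lambda>(\<omega>, s). ?f \<omega> s) = (\<lambda>x. ?b x - 1 / 2 * ?d x)"
    by (auto simp: fun_eq_iff algebra_simps)
  note bi = benefit_integrable[OF v] and di = control_square_integrable[OF v]
  have fi: "integrable (M \<Otimes>\<^sub>M R) (\<lambda>(\<omega>, s). ?f \<omega> s)"
    unfolding f_eq using bi(1) di by (intro Bochner_Integration.integrable_diff integrable_mult_right)
  have "payoff M F B \<delta> \<sigma> \<rho> \<beta> T q \<xi> v = ext_integral M (\<lambda>\<omega>. ereal (\<integral>s. ?f \<omega> s \<partial>R))"
    unfolding payoff_def
  proof (rule ext_integral_cong_AE)
    show "AE \<omega> in M. ext_integral R (\<lambda>s. ereal (?f \<omega> s)) = ereal (\<integral>s. ?f \<omega> s \<partial>R)"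
      using P.AE_integrable_fst[OF fi] by eventually_elim (rule ext_integral_ereal)
  qed
  also have "\<dots> = ereal (\<integral>\<omega>. (\<integral>s. ?f \<omega> s \<partial>R) \<partial>M)"
    by (rule ext_integral_ereal[OF P.integrable_fst[OF fi]])
  also have "(\<integral>\<omega>. (\<integral>s. ?f \<omega> s \<partial>R) \<partial>M) = (\<integral>x. (case x of (\<omega>, s) \<Rightarrow> ?f \<omega> s) \<partial>(M \<Otimes>\<^sub>M R))"
    by (rule P.integral_fst[OF fi])
  also have "\<dots> = (\<integral>x. ?b x \<partial>(M \<Otimes>\<^sub>M R)) - 1 / 2 * (\<integral>x. ?d x \<partial>(M \<Otimes>\<^sub>M R))"
    unfolding f_eq using bi(1) di
    by (subst Bochner_Integration.integral_diff) (auto intro: integrable_mult_right)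
  also have "\<dots> = enn2real baseline + gain v"
    unfolding bi(2) gain_def by simp
  finally show ?thesis .
qed

text \<open>
  Completing the square in \<open>z v - v\<^sup>2 / 2\<close>.
\<close>

lemma gain_gap:
  assumes v: "v \<in> controls M F \<rho> T"
  shows "integrable (M \<Otimes>\<^sub>M R) (\<lambda>(\<omega>, s). exp (- \<rho> * s) * (v s \<omega> - \<zeta> s)\<^sup>2)"
    and "gain (\<lambda>s \<omega>. \<zeta> s) - gain v = 1 / 2 * (\<integral>x. (case x of (\<omega>, s) \<Rightarrow> exp (- \<rho> * s) * (v s \<omega> - \<zeta> s)\<^sup>2) \<partial>(M \<Otimes>\<^sub>M R))"
proof -
  let ?c = "\<lambda>x. case x of (\<omega>, s) \<Rightarrow> exp (- \<rho> * s) * (\<zeta> s * v s \<omega>)"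
  let ?d = "\<lambda>x. case x of (\<omega>, s) \<Rightarrow> exp (- \<rho> * s) * (v s \<omega>)\<^sup>2"
  let ?z = "\<lambda>x::'a \<times> real. case x of (\<omega>, s) \<Rightarrow> exp (- \<rho> * s) * (\<zeta> s)\<^sup>2"
  have eq: "(\<lambda>(\<omega>, s). exp (- \<rho> * s) * (v s \<omega> - \<zeta> s)\<^sup>2) = (\<lambda>x. ?d x - 2 * ?c x + ?z x)"
    by (auto simp: fun_eq_iff power2_eq_square algebra_simps)
  note c = control_cross_integrable[OF v] and d = control_square_integrable[OF v]
    and z = control_square_integrable[OF zfun_control]
  show "integrable (M \<Otimes>\<^sub>M R) (\<lambda>(\<omega>, s). exp (- \<rho> * s) * (v s \<omega> - \<zeta> s)\<^sup>2)"
    unfolding eq using c d z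
    by (intro Bochner_Integration.integrable_add Bochner_Integration.integrable_diff integrable_mult_right)
  have "(\<integral>x. ?d x - 2 * ?c x + ?z x \<partial>(M \<Otimes>\<^sub>M R)) =
      (\<integral>x. ?d x \<partial>(M \<Otimes>\<^sub>M R)) - 2 * (\<integral>x. ?c x \<partial>(M \<Otimes>\<^sub>M R)) + (\<integral>x. ?z x \<partial>(M \<Otimes>\<^sub>M R))"
  proof -
    have c2: "integrable (M \<Otimes>\<^sub>M R) (\<lambda>x. 2 * ?c x)" using c by (rule integrable_mult_right)
    show ?thesis
      using Bochner_Integration.integral_add[OF Bochner_Integration.integrable_diff[OF d c2] z]
        Bochner_Integration.integral_diff[OF d c2] by simp
  qed
  moreover have "(\<integral>x. (case x of (\<omega>, s) \<Rightarrow> exp (- \<rho> * s) * (\<zeta> s * \<zeta> s)) \<partial>(M \<Otimes>\<^sub>M R)) = (\<integral>x. ?z x \<partial>(M \<Otimes>\<^sub>M R))"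
    by (simp add: power2_eq_square)
  ultimately show "gain (\<lambda>s \<omega>. \<zeta> s) - gain v = 1 / 2 * (\<integral>x. (case x of (\<omega>, s) \<Rightarrow> exp (- \<rho> * s) * (v s \<omega> - \<zeta> s)\<^sup>2) \<partial>(M \<Otimes>\<^sub>M R))"
    unfolding eq gain_def by simp
qed

lemma zfun_optimal:
  assumes v: "v \<in> controls M F \<rho> T"
  shows "payoff M F B \<delta> \<sigma> \<rho> \<beta> T q \<xi> v \<le> payoff M F B \<delta> \<sigma> \<rho> \<beta> T q \<xi> (\<lambda>s \<omega>. \<zeta> s)"
    and "payoff M F B \<delta> \<sigma> \<rho> \<beta> T q \<xi> (\<lambda>s \<omega>. \<zeta> s) \<le> payoff M F B \<delta> \<sigma> \<rho> \<beta> T q \<xi> v \<Longrightarrow> same_control M T v (\<lambda>s \<omega>. \<zeta> s)"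
proof -
  let ?g = "\<lambda>x. case x of (\<omega>, s) \<Rightarrow> exp (- \<rho> * s) * (v s \<omega> - \<zeta> s)\<^sup>2"
  note gi = gain_gap(1)[OF v]
  have g0: "AE x in M \<Otimes>\<^sub>M R. 0 \<le> ?g x" by (auto simp: case_prod_beta)
  have I0: "0 \<le> (\<integral>x. ?g x \<partial>(M \<Otimes>\<^sub>M R))" by (rule Bochner_Integration.integral_nonneg_AE[OF g0])
  show "payoff M F B \<delta> \<sigma> \<rho> \<beta> T q \<xi> v \<le> payoff M F B \<delta> \<sigma> \<rho> \<beta> T q \<xi> (\<lambda>s \<omega>. \<zeta> s)"
    unfolding payoff_eq_gain[OF v] payoff_eq_gain[OF zfun_control] using gain_gap(2)[OF v] I0 by simp
  assume "payoff M F B \<delta> \<sigma> \<rho> \<beta> T q \<xi> (\<lambda>s \<omega>. \<zeta> s) \<le> payoff M F B \<delta> \<sigma> \<rho> \<beta> T q \<xi> v"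
  then have "(\<integral>x. ?g x \<partial>(M \<Otimes>\<^sub>M R)) = 0"
    unfolding payoff_eq_gain[OF v] payoff_eq_gain[OF zfun_control] using gain_gap(2)[OF v] I0 by simp
  then have "AE x in M \<Otimes>\<^sub>M R. ?g x = 0"
    using integral_nonneg_eq_0_iff_AE[OF gi g0] by simp
  then show "same_control M T v (\<lambda>s \<omega>. \<zeta> s)"
    unfolding same_control_def by eventually_elim auto
qed

text \<open>
  Controls that agree almost everywhere give the same mean, because for almost every \<open>r\<close> they have the
  same expectation at time \<open>r\<close>.
\<close>

lemma mean_of_state:
  assumes v: "v \<in> controls M F \<rho> T" and same: "same_control M T v (\<lambda>s \<omega>. \<zeta> s)" and t: "t \<in> horizon T"
  shows "expectation (X v t) = exp (- \<delta> * t) * expectation \<xi> +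
    (LINT r:{0..t}|lborel. exp (- \<delta> * (t - r)) * \<zeta> r)"
proof -
  interpret R: sigma_finite_measure R by (rule sigma_finite_horizon)
  interpret P: pair_sigma_finite M R ..
  have \<delta>0: "0 \<le> \<delta>" using \<delta> by simp
  have t0: "0 \<le> t" using t by (rule horizonD)
  note Xp = state_properties[OF \<delta>0 \<xi>(1,2) v, where \<sigma>=\<sigma>]
  have XM: "X v t \<in> borel_measurable M"
    using Xp(1) t t0 by (auto simp: continuous_adapted_def intro: measurable_F_M)
  have zR: "(\<lambda>x. \<zeta> (snd x)) \<in> borel_measurable (M \<Otimes>\<^sub>M R)"
    by (rule measurable_compose[OF snd_measurable zfun_measurable])
  have set: "{x \<in> space (M \<Otimes>\<^sub>M R). v (snd x) (fst x) = \<zeta> (snd x)} \<in> sets (M \<Otimes>\<^sub>M R)"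
    using control_measurable(1)[OF v] zR unfolding case_prod_beta by measurable
  have "AE \<omega> in M. AE s in R. v s \<omega> = \<zeta> s"
    using P.AE_pair[of "\<lambda>x. v (snd x) (fst x) = \<zeta> (snd x)"] same by (simp add: same_control_def case_prod_beta)
  then have "AE s in R. AE \<omega> in M. v s \<omega> = \<zeta> s"
    using P.AE_commute[of "\<lambda>\<omega> s. v s \<omega> = \<zeta> s", OF set] by simp
  then have AEs: "AE s in lborel. s \<in> horizon T \<longrightarrow> (AE \<omega> in M. v s \<omega> = \<zeta> s)"
    by (subst (asm) AE_restrict_space_iff) auto
  have c: "continuous_on {0..t} (\<lambda>r. exp (- \<delta> * (t - r)))" by (intro continuous_intros)
  have zi: "set_integrable lborel {0..t} \<zeta>"
  proof (rule set_integrable_bound[OF borel_integrable_atLeastAtMost'[of 0 t "\<lambda>_. \<integral>r. weight r \<partial>lborel"]])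
    show "set_borel_measurable lborel {0..t} \<zeta>" by (simp add: set_borel_measurable_def)
    show "AE x in lborel. x \<in> {0..t} \<longrightarrow> norm (\<zeta> x) \<le> norm (\<integral>r. weight r \<partial>lborel)"
    proof (intro AE_I2 impI)
      fix x show "norm (\<zeta> x) \<le> norm (\<integral>r. weight r \<partial>lborel)" using zfun_bounds[of x] by simp
    qed
  qed simp
  have ei: "set_integrable lborel {0..t} (\<lambda>r. exp (- \<delta> * (t - r)) * \<zeta> r)"
    using set_integrable_times_continuous[OF zi c] by (simp add: mult.commute)
  have I0: "0 \<le> (LINT r:{0..t}|lborel. exp (- \<delta> * (t - r)) * \<zeta> r)"
    unfolding set_lebesgue_integral_def using zfun_bounds(1)
    by (intro Bochner_Integration.integral_nonneg) auto
  have "(\<integral>\<^sup>+r\<in>{0..t}. ennreal (exp (- \<delta> * (t - r))) * (\<integral>\<^sup>+\<omega>. ennreal (v r \<omega>) \<partial>M) \<partial>lborel) =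
      (\<integral>\<^sup>+r. ennreal (indicator {0..t} r *\<^sub>R (exp (- \<delta> * (t - r)) * \<zeta> r)) \<partial>lborel)"
  proof (rule nn_integral_cong_AE)
    show "AE r in lborel. ennreal (exp (- \<delta> * (t - r))) * (\<integral>\<^sup>+\<omega>. ennreal (v r \<omega>) \<partial>M) * indicator {0..t} r =
        ennreal (indicator {0..t} r *\<^sub>R (exp (- \<delta> * (t - r)) * \<zeta> r))"
      using AEs
    proof eventually_elim
      case (elim r)
      show ?case
      proof (cases "r \<in> {0..t}")
        case True
        then have "AE \<omega> in M. v r \<omega> = \<zeta> r" using elim horizon_down[OF t] by auto
        then have "(\<integral>\<^sup>+\<omega>. ennreal (v r \<omega>) \<partial>M) = (\<integral>\<^sup>+\<omega>. ennreal (\<zeta> r) \<partial>M)"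
          by (intro nn_integral_cong_AE) (auto elim: eventually_mono)
        then show ?thesis using True zfun_bounds(1)[of r] by (simp add: emeasure_space_1 ennreal_mult)
      qed simp
    qed
  qed
  also have "\<dots> = ennreal (LINT r:{0..t}|lborel. exp (- \<delta> * (t - r)) * \<zeta> r)"
    unfolding set_lebesgue_integral_def using ei zfun_bounds(1)
    by (intro nn_integral_eq_integral) (auto simp: set_integrable_def)
  finally have 1: "(\<integral>\<^sup>+r\<in>{0..t}. ennreal (exp (- \<delta> * (t - r))) * (\<integral>\<^sup>+\<omega>. ennreal (v r \<omega>) \<partial>M) \<partial>lborel) =
      ennreal (LINT r:{0..t}|lborel. exp (- \<delta> * (t - r)) * \<zeta> r)" .
  have 2: "(\<integral>\<^sup>+\<omega>. ennreal (\<xi> \<omega>) \<partial>M) = ennreal (expectation \<xi>)" "0 \<le> expectation \<xi>"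
  proof -
    have "AE \<omega> in M. 0 \<le> \<xi> \<omega>" using \<xi>(2) by eventually_elim simp
    then show "(\<integral>\<^sup>+\<omega>. ennreal (\<xi> \<omega>) \<partial>M) = ennreal (expectation \<xi>)" "0 \<le> expectation \<xi>"
      by (rule nn_integral_eq_integral[OF \<xi>(3)], rule Bochner_Integration.integral_nonneg_AE)
  qed
  have "expectation (X v t) = enn2real (\<integral>\<^sup>+\<omega>. ennreal (X v t \<omega>) \<partial>M)"
    by (rule integral_eq_nn_integral[OF XM Xp(2)[OF t]])
  also have "(\<integral>\<^sup>+\<omega>. ennreal (X v t \<omega>) \<partial>M) = ennreal (exp (- \<delta> * t) * expectation \<xi> +
      (LINT r:{0..t}|lborel. exp (- \<delta> * (t - r)) * \<zeta> r))"
    unfolding Xp(3)[OF t] 1 2(1) using 2(2) I0 by (simp add: ennreal_mult ennreal_plus)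
  finally show ?thesis using 2(2) I0 by (subst (asm) enn2real_ennreal) auto
qed

section \<open>Equilibria and the integral equation\<close>

lemma solves_integral_eq_zfun:
  "solves_integral_eq \<delta> \<rho> \<beta> T m q \<longleftrightarrow>
    (\<forall>s\<in>horizon T. q s = exp (- \<delta> * s) * m + (LINT r:{0..s}|lborel. exp (- \<delta> * (s - r)) * \<zeta> r))"
  by (simp add: solves_integral_eq_def zfun_def)

lemma equilibrium_solves:
  assumes eq: "equilibrium M F B \<delta> \<sigma> \<rho> \<beta> T \<xi> u q"
  shows "same_control M T u (\<lambda>s \<omega>. \<zeta> s)" and "solves_integral_eq \<delta> \<rho> \<beta> T (expectation \<xi>) q"
proof -
  have u: "u \<in> controls M F \<rho> T" using eq by (simp add: equilibrium_def)
  have "payoff M F B \<delta> \<sigma> \<rho> \<beta> T q \<xi> (\<lambda>s \<omega>. \<zeta> s) \<le> payoff M F B \<delta> \<sigma> \<rho> \<beta> T q \<xi> u"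
    using eq zfun_control by (simp add: equilibrium_def)
  then show same: "same_control M T u (\<lambda>s \<omega>. \<zeta> s)" by (rule zfun_optimal(2)[OF u])
  show "solves_integral_eq \<delta> \<rho> \<beta> T (expectation \<xi>) q"
    unfolding solves_integral_eq_zfun using eq mean_of_state[OF u same] by (simp add: equilibrium_def)
qed

lemma solution_equilibrium:
  assumes "solves_integral_eq \<delta> \<rho> \<beta> T (expectation \<xi>) q"
  shows "equilibrium M F B \<delta> \<sigma> \<rho> \<beta> T \<xi> (\<lambda>s \<omega>. \<zeta> s) q"
  unfolding equilibrium_def
proof (intro conjI ballI)
  show "q \<in> positive_measurable T" using q by (simp add: Qclass_def)
  fix s assume s: "s \<in> horizon T"
  have "same_control M T (\<lambda>s \<omega>. \<zeta> s) (\<lambda>s \<omega>. \<zeta> s)" by (simp add: same_control_def case_prod_beta)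
  from mean_of_state[OF zfun_control this s]
  show "q s = expectation (X (\<lambda>s \<omega>. \<zeta> s) s)"
    using assms s unfolding solves_integral_eq_zfun by simp
qed (auto intro: zfun_control zfun_optimal(1))

end

lemma zfun_cong: "(\<And>s. s \<in> horizon T \<Longrightarrow> y s = q s) \<Longrightarrow> zfun \<delta> \<rho> \<beta> T y = zfun \<delta> \<rho> \<beta> T q"
  unfolding zfun_def set_lebesgue_integral_def
  by (intro ext Bochner_Integration.integral_cong) (auto simp: indicator_def)

text \<open>
  Every equilibrium with \<open>y\<close> in the class yields a solution \<open>y\<close>, which must be \<open>q\<close>; its control is then
  the optimal one for \<open>q\<close>.
\<close>

lemma unique_solution_unique_equilibrium:
  assumes T: "0 \<le> T" and \<delta>: "0 < \<delta>" and \<rho>: "0 < \<rho>"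
    and \<xi>: "\<xi> \<in> borel_measurable (F 0)" "AE \<omega> in M. 0 < \<xi> \<omega>" "integrable M \<xi>"
    and q: "unique_Q_solution \<delta> \<rho> \<beta> T (expectation \<xi>) q"
  shows "unique_Q_equilibrium M F B \<delta> \<sigma> \<rho> \<beta> T \<xi> (\<lambda>s \<omega>. zfun \<delta> \<rho> \<beta> T q s) q"
proof -
  have qQ: "q \<in> Qclass \<delta> \<rho> \<beta> T" and sol: "solves_integral_eq \<delta> \<rho> \<beta> T (expectation \<xi>) q"
    and uniq: "\<And>y. y \<in> Qclass \<delta> \<rho> \<beta> T \<Longrightarrow> solves_integral_eq \<delta> \<rho> \<beta> T (expectation \<xi>) y \<Longrightarrow> \<forall>s\<in>horizon T. y s = q s"
    using q by (auto simp: unique_Q_solution_def)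
  show ?thesis
    unfolding unique_Q_equilibrium_def
  proof (intro conjI ballI impI)
    show "equilibrium M F B \<delta> \<sigma> \<rho> \<beta> T \<xi> (\<lambda>s \<omega>. zfun \<delta> \<rho> \<beta> T q s) q"
      by (rule solution_equilibrium[OF T \<delta> \<rho> \<xi> qQ sol])
    show "q \<in> Qclass \<delta> \<rho> \<beta> T" by (rule qQ)
    fix v y assume y: "y \<in> Qclass \<delta> \<rho> \<beta> T" and eq: "equilibrium M F B \<delta> \<sigma> \<rho> \<beta> T \<xi> v y"
    note es = equilibrium_solves[OF T \<delta> \<rho> \<xi> y eq]
    have yq: "\<forall>s\<in>horizon T. y s = q s" by (rule uniq[OF y es(2)])
    have zq: "zfun \<delta> \<rho> \<beta> T y = zfun \<delta> \<rho> \<beta> T q" by (rule zfun_cong) (use yq in simp)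
    show "same_control M T v (\<lambda>s \<omega>. zfun \<delta> \<rho> \<beta> T q s)" using es(1) unfolding zq .
    show "y s = q s" if "s \<in> horizon T" for s using yq that by blast
  qed
qed

end

theorem theorem4p1:
  fixes M :: "'a measure" and F :: "real \<Rightarrow> 'a measure" and B :: "real \<Rightarrow> 'a \<Rightarrow> real"
    and \<xi> :: "'a \<Rightarrow> real" and \<delta> \<sigma> \<rho> \<beta> :: real
  assumes "0 < \<delta>" "0 < \<sigma>" "0 < \<rho>" "0 < \<beta>"
    and "usual_conditions M F"
    and "brownian_motion M F B"
    and "\<xi> \<in> borel_measurable (F 0)"
    and "independent_of_process M \<xi> B"
    and "AE \<omega> in M. 0 < \<xi> \<omega>"
    and "integrable M \<xi>" "0 < prob_space.expectation M \<xi>"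
  shows
    "(\<forall>T::real. 0 < T \<longrightarrow>
        (\<forall>u. \<forall>q\<in>Qclass \<delta> \<rho> \<beta> (ereal T). equilibrium M F B \<delta> \<sigma> \<rho> \<beta> (ereal T) \<xi> u q \<longrightarrow>
           solves_integral_eq \<delta> \<rho> \<beta> (ereal T) (prob_space.expectation M \<xi>) q) \<and>
        (\<forall>q. unique_Q_solution \<delta> \<rho> \<beta> (ereal T) (prob_space.expectation M \<xi>) q \<longrightarrow>
           unique_Q_equilibrium M F B \<delta> \<sigma> \<rho> \<beta> (ereal T) \<xi> (\<lambda>s \<omega>. zfun \<delta> \<rho> \<beta> (ereal T) q s) q)) \<and>
     (\<forall>u. \<forall>q\<in>Qclass \<delta> \<rho> \<beta> \<infinity>. equilibrium M F B \<delta> \<sigma> \<rho> \<beta> \<infinity> \<xi> u q \<longrightarrow>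
        solves_integral_eq \<delta> \<rho> \<beta> \<infinity> (prob_space.expectation M \<xi>) q) \<and>
     (\<forall>q. unique_Q_solution \<delta> \<rho> \<beta> \<infinity> (prob_space.expectation M \<xi>) q \<longrightarrow>
        unique_Q_equilibrium M F B \<delta> \<sigma> \<rho> \<beta> \<infinity> \<xi> (\<lambda>s \<omega>. zfun \<delta> \<rho> \<beta> \<infinity> q s) q)"
proof -
  interpret prob_space M using assms(5) by (simp add: usual_conditions_def)
  interpret brownian_basis M F B by unfold_locales (rule assms)+
  note solves = equilibrium_solves(2)[OF _ assms(1,3,7,9,10)]
    and unique = unique_solution_unique_equilibrium[OF _ assms(1,3,7,9,10)]
  have "0 \<le> ereal T" if "0 < T" for T using that by simp
  moreover have "0 \<le> (\<infinity> :: ereal)" by simp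
  ultimately show ?thesis using solves unique by blast
qed

end
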